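(* Let $K$ be an arbitrary commutative unital ring. The cyclic homology $A\mapsto HC(A)$ of $A_\infty$-algebras over $K$ determines a functor $HC:A_\infty(K)\to GrM(K)$ from the category $A_\infty(K)$ of $A_\infty$-algebras over $K$ to the category $GrM(K)$ of graded $K$-modules. This functor sends homotopy equivalences of $A_\infty$-algebras to isomorphisms of graded modules.
   Context: All modules are $K$-modules, all maps are $K$-linear, $\otimes=\otimes_K$. Tensor products of graded maps follow the Koszul rule $(\varphi\otimes\psi)(a\otimes b)=(-1)^{|\psi||a|}\varphi(a)\otimes\psi(b)$, and $A^{\otimes n}$ carries the usual tensor differential. $A_\infty$-algebras. An $A_\infty$-algebra $(A,d,\pi_n)$ is a differential module $A=\{A_n\}_{n\ge 0}$, $d:A_\bullet\to A_{\bullet-1}$, with maps $\pi_n:(A^{\otimes(n+2)})_\bullet\to A_{\bullet+n}$, $n\ge 0$, satisfying for all integers $n\ge -1$ $$d(\pi_{n+1})=\sum_{m=0}^n\sum_{t=1}^{m+2}(-1)^{t(n-m+1)+n+1}\pi_m(1^{\otimes(t-1)}\otimes\pi_{n-m}\otimes 1^{\otimes(m-t+2)}),$$ where $d(\pi_{n+1})=d\pi_{n+1}+(-1)^n\pi_{n+1}d$. A morphism $f:(A,d,\pi_n)\to(A',d,\pi_n)$ is a family $f_n:(A^{\otimes(n+1)})_\bullet\to A'_{\bullet+n}$, $n\ge 0$, with, for all $n\ge -1$, $$d(f_{n+1})=\sum_{m=0}^n\sum_{t=1}^{m+1}(-1)^{t(n-m+1)+n+1}f_m(1^{\otimes(t-1)}\otimes\pi_{n-m}\otimes1^{\otimes(m-t+1)})-\sum_{m=0}^n\sum_{J_{n-m}}(-1)^{\varepsilon}\pi_m(f_{n_1}\otimes\dots\otimes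 f_{n_{m+2}}),$$ where $d(f_{n+1})=df_{n+1}+(-1)^nf_{n+1}d$, $J_{n-m}=\{n_1\ge 0,\dots,n_{m+2}\ge 0\mid n_1+\dots+n_{m+2}=n-m\}$, $\varepsilon=\sum_{i=1}^{m+1}(n_i+1)(n_{i+1}+\dots+n_{m+2})$. The composition of morphisms is $(gf)_{n+1}=\sum_{m=-1}^n\sum_{J_{n-m}}(-1)^\varepsilon g_{m+1}(f_{n_1}\otimes\dots\otimes f_{n_{m+2}})$, $n\ge -1$; the identity $1_A$ has $(1_A)_0=\mathrm{id}_A$ and $(1_A)_n=0$ for $n\ge 1$. This gives the category $A_\infty(K)$. A homotopy between morphisms $f,g:(A,d,\pi_n)\to(A',d,\pi_n)$ is a family $h_n:(A^{\otimes(n+1)})_\bullet\to A'_{\bullet+n+1}$, $n\ge 0$, with, for all $n\ge -1$, $$d(h_{n+1})=f_{n+1}-g_{n+1}+\sum_{m=0}^n\sum_{t=1}^{m+1}(-1)^{t(n-m+1)+n}h_m(1^{\otimes(t-1)}\otimes\pi_{n-m}\otimes1^{\otimes(m-t+1)})+\sum_{m=0}^n\sum_{J_{n-m}}\sum_{i=1}^{m+2}(-1)^{\varrho}\pi_m(g_{n_1}\otimes\dots\otimes g_{n_{i-1}}\otimes h_{n_i}\otimes f_{n_{i+1}}\otimes\dots\otimes f_{n_{m+2}}),$$ where $d(h_{n+1})=dh_{n+1}+(-1)^{n+1}h_{n+1}d$ and $\varrho=m+\sum_{k=1}^{m+1}(n_k+1)(n_{k+1}+\dots+n_{m+2})+\sum_{k=1}^{i-1}n_k$.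 Being homotopic is an equivalence relation; a morphism $f:A\to A'$ is a homotopy equivalence of $A_\infty$-algebras if there is a morphism $g:A'\to A$ with $gf$ homotopic to $1_A$ and $fg$ homotopic to $1_{A'}$. $CF_\infty$-modules (cyclic differential modules with $\infty$-simplicial faces). A differential bigraded module $(X,d)$ is $X=\{X_{n,m}\}_{n,m\ge 0}$ with a differential $d$ of bidegree $(0,-1)$; for a map $\varphi$ of bidegree $(a,b)$ put $d(\varphi)=d\varphi-(-1)^{a+b}\varphi d$. For integers $0\le i_1<\dots<i_k$ and $\sigma\in\Sigma_k$ let $(\sigma(i_1),\dots,\sigma(i_k))$ be the permuted tuple, let $\widehat{\sigma(i_s)}=\sigma(i_s)-\alpha(\sigma(i_s))$ with $\alpha(\sigma(i_s))$ the number of entries to the right of $\sigma(i_s)$ smaller than it, let $\mathrm{sign}(\sigma)\in\{0,1\}$ be the parity of $\sigma$, and let $I_\sigma$ be the set of splittings of $(\widehat{\sigma(i_1)},\dots,\widehat{\sigma(i_k)})$ into $(\widehat{\sigma(i_1)},\dots,\widehat{\sigma(i_m)})$ and $(\widehat{\sigma(i_{m+1})},\dots,\widehat{\sigma(i_k)})$, $1\le m\le k-1$, both strictly increasing. A $CF_\infty$-module $(X,d,\partial,t)$ is a differential bigraded module with maps $\partial_{(i_1,\dots,i_k)}:X_{n,\bullet}\to X_{n-k,\bullet+k-1}$, $1\le k\le n$, $0\le i_1<\dots<i_k\le n$, and $t_n:X_{n,\bullet}\to X_{n,\bullet}$, $n\ge 0$, such that $$d(\partial_{(i_1,\dots,i_k)})=\sum_{\sigma\in\Sigma_k}\sum_{I_\sigma}(-1)^{\mathrm{sign}(\sigma)+1}\partial_{(\widehat{\sigma(i_1)},\dots,\widehat{\sigma(i_m)})}\partial_{(\widehat{\sigma(i_{m+1})},\dots,\widehat{\sigma(i_k)})},$$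 $dt_n=t_nd$, $t_n^{n+1}=1$, and $\partial_{(i_1,\dots,i_k)}t_n$ equals $t_{n-k}\partial_{(i_1-1,\dots,i_k-1)}$ if $i_1>0$ and $(-1)^{k-1}\partial_{(i_2-1,\dots,i_k-1,n)}$ if $i_1=0$. Cyclic homology of a $CF_\infty$-module $X$. For $q\in\{0,1\}$ put $d_q^0=d$ and $d_q^k=\sum_{0\le i_1<\dots<i_k\le n-q}(-1)^{i_1+\dots+i_k}\partial_{(i_1,\dots,i_k)}:X_{n,\bullet}\to X_{n-k,\bullet+k-1}$ for $k\ge 1$; put $T_n=(-1)^nt_n$, $N_n=1+T_n+\dots+T_n^n$; $\overline X_n=\bigoplus_{k=0}^nX_{k,n-k}$, $b=\sum_{i}d_0^i$ and $b'=\sum_{i}d_1^i:\overline X_n\to\overline X_{n-1}$; $\overline T_n,\overline N_n$ act on $X_{k,n-k}\subset\overline X_n$ by $T_k,N_k$. The chain bicomplex $C(\overline X)$ has $C(\overline X)_{n,m}=\overline X_n$ ($n,m\ge 0$), $D_1:C(\overline X)_{n,m}\to C(\overline X)_{n,m-1}$ equal to $1-\overline T_n$ for $m$ odd and $\overline N_n$ for $m$ even (zero for $m=0$), and $D_2:C(\overline X)_{n,m}\to C(\overline X)_{n-1,m}$ equal to $b$ for $m$ even and $-b'$ for $m$ odd. $HC(X)$ is the graded homology of the associated total chain complex with differential $D=D_1+D_2$. Cyclic homology of an $A_\infty$-algebra. An $A_\infty$-algebra $(A,d,\pi_n)$ defines the $CF_\infty$-module $(\mathcal L(A),d,\partial,t)$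 with $\mathcal L(A)_{n,m}=(A^{\otimes(n+1)})_m$, $d(a_0\otimes\dots\otimes a_n)=\sum_{i=0}^n(-1)^{|a_0|+\dots+|a_{i-1}|}a_0\otimes\dots\otimes d(a_i)\otimes\dots\otimes a_n$, $t_n(a_0\otimes\dots\otimes a_n)=(-1)^{|a_n|(|a_0|+\dots+|a_{n-1}|)}a_n\otimes a_0\otimes\dots\otimes a_{n-1}$, and $\partial_{(i_1,\dots,i_k)}:\mathcal L(A)_{n,p}\to\mathcal L(A)_{n-k,p+k-1}$ equal to: $(-1)^{k(p-1)}1^{\otimes j}\otimes\pi_{k-1}\otimes1^{\otimes(n-k-j)}$ if $(i_1,\dots,i_k)=(j,j+1,\dots,j+k-1)$ with $0\le j\le n-k$; $(-1)^{q(k-1)}\partial_{(0,1,\dots,k-1)}t_n^q$ if $(i_1,\dots,i_k)=(0,1,\dots,k-q-1,n-q+1,n-q+2,\dots,n)$ with $1\le q\le k$; and $0$ otherwise. The cyclic homology of $A$, which is the value of the functor on the object $A$, is $HC(A)=HC(\mathcal L(A))$. *)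

theory Defs
  imports "HOL-Algebra.Module" "HOL-Algebra.AbelCoset"
begin

text \<open>
  \<open>K\<close> is a commutative unital ring and modules are those of
  \<^theory>\<open>HOL-Algebra.Module\<close>; the \<open>mult\<close> and \<open>one\<close> fields of a module record are never used.
  Every map is extensional (\<open>undefined\<close> off its domain), so that HOL equality of maps is
  equality of maps on their domain.
\<close>


section \<open>Linear maps, quotients, finite direct sums\<close>

definition lin_maps ::
  "('k, 'r) ring_scheme \<Rightarrow> ('k, 'a) module \<Rightarrow> ('k, 'b) module \<Rightarrow> ('a \<Rightarrow> 'b) set" where
  "lin_maps K M N = {\<phi> \<in> carrier M \<rightarrow>\<^sub>E carrier N.
     (\<forall>x\<in>carrier M. \<forall>y\<in>carrier M. \<phi> (x \<oplus>\<^bsub>M\<^esub> y) = \<phi> x \<oplus>\<^bsub>N\<^esub> \<phi> y) \<and>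
     (\<forall>c\<in>carrier K. \<forall>x\<in>carrier M. \<phi> (c \<odot>\<^bsub>M\<^esub> x) = c \<odot>\<^bsub>N\<^esub> \<phi> x)}"

text \<open>\<open>sgn_mult M e x\<close> is \<open>(-1)\<^sup>e x\<close>.\<close>

definition sgn_mult :: "('k, 'a) module \<Rightarrow> int \<Rightarrow> 'a \<Rightarrow> 'a" where
  "sgn_mult M e x = (if even e then x else \<ominus>\<^bsub>M\<^esub> x)"

definition quot_module :: "('k, 'a) module \<Rightarrow> 'a set \<Rightarrow> ('k, 'a set) module" where
  "quot_module M H = \<lparr>carrier = a_rcosets\<^bsub>M\<^esub> H, mult = (\<lambda>_ _. undefined), one = undefined,
     zero = H, add = set_add M,
     smult = (\<lambda>c X. \<Union>x\<in>X. H +>\<^bsub>M\<^esub> (c \<odot>\<^bsub>M\<^esub> x))\<rparr>"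

definition dsum :: "'i set \<Rightarrow> ('i \<Rightarrow> ('k, 'a) module) \<Rightarrow> ('k, 'i \<Rightarrow> 'a) module" where
  "dsum I M = \<lparr>carrier = (\<Pi>\<^sub>E i\<in>I. carrier (M i)), mult = (\<lambda>_ _. undefined), one = undefined,
     zero = (\<lambda>i\<in>I. \<zero>\<^bsub>M i\<^esub>), add = (\<lambda>x y. \<lambda>i\<in>I. x i \<oplus>\<^bsub>M i\<^esub> y i),
     smult = (\<lambda>c x. \<lambda>i\<in>I. c \<odot>\<^bsub>M i\<^esub> x i)\<rparr>"

text \<open>
  A graded module \<open>{A\<^sub>n}\<close>, \<open>n \<ge> 0\<close>, is indexed by the integers with \<open>A\<^sub>n = 0\<close> for \<open>n < 0\<close>.
  This makes maps of negative degree, such as \<open>d : A\<^sub>0 \<rightarrow> A\<^sub>-\<^sub>1\<close>, total.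
\<close>

definition graded_module :: "('k, 'r) ring_scheme \<Rightarrow> (int \<Rightarrow> ('k, 'a) module) \<Rightarrow> bool" where
  "graded_module K A \<longleftrightarrow>
     (\<forall>n. module K (A n)) \<and> (\<forall>n<0. carrier (A n) = {\<zero>\<^bsub>A n\<^esub>})"


section \<open>Tensor powers of graded modules\<close>

text \<open>
  \<open>(A\<^sup>\<otimes>\<^sup>n)\<^sub>p\<close> is the free module on the words \<open>[(p\<^sub>1, a\<^sub>1), \<dots>, (p\<^sub>n, a\<^sub>n)]\<close> with
  \<open>a\<^sub>i \<in> A\<^bsub>p\<^sub>i\<^esub>\<close> and \<open>p\<^sub>1 + \<dots> + p\<^sub>n = p\<close>, modulo the relations of multilinearity. The word
  represents the tensor \<open>a\<^sub>1 \<otimes> \<dots> \<otimes> a\<^sub>n\<close>, of degree \<open>p\<close>.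
\<close>

type_synonym ('k, 'a) tens = "((int \<times> 'a) list \<Rightarrow> 'k) set"

definition wdeg :: "(int \<times> 'a) list \<Rightarrow> int" where
  "wdeg w = sum_list (map fst w)"

definition words :: "(int \<Rightarrow> ('k, 'a) module) \<Rightarrow> nat \<Rightarrow> int \<Rightarrow> (int \<times> 'a) list set" where
  "words A n p = {w. length w = n \<and> wdeg w = p \<and> (\<forall>(q, a)\<in>set w. a \<in> carrier (A q))}"

definition free_module :: "('k, 'r) ring_scheme \<Rightarrow> 's set \<Rightarrow> ('k, 's \<Rightarrow> 'k) module" where
  "free_module K S = \<lparr>carrier = {u. (\<forall>s. u s \<in> carrier K) \<and> finite {s. u s \<noteq> \<zero>\<^bsub>K\<^esub>}
       \<and> {s. u s \<noteq> \<zero>\<^bsub>K\<^esub>} \<subseteq> S},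
     mult = (\<lambda>_ _. undefined), one = undefined, zero = (\<lambda>s. \<zero>\<^bsub>K\<^esub>),
     add = (\<lambda>u v s. u s \<oplus>\<^bsub>K\<^esub> v s), smult = (\<lambda>c u s. c \<otimes>\<^bsub>K\<^esub> u s)\<rparr>"

definition basis_vec :: "('k, 'r) ring_scheme \<Rightarrow> 's \<Rightarrow> 's \<Rightarrow> 'k" where
  "basis_vec K s = (\<lambda>s'. if s' = s then \<one>\<^bsub>K\<^esub> else \<zero>\<^bsub>K\<^esub>)"

definition multilin_rels ::
  "('k, 'r) ring_scheme \<Rightarrow> (int \<Rightarrow> ('k, 'a) module) \<Rightarrow> nat \<Rightarrow> int \<Rightarrow> ((int \<times> 'a) list \<Rightarrow> 'k) set" where
  "multilin_rels K A n p = (let F = free_module K (words A n p); e = basis_vec K in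
     {e (u @ (q, a \<oplus>\<^bsub>A q\<^esub> b) # v)
        \<ominus>\<^bsub>F\<^esub> (e (u @ (q, a) # v) \<oplus>\<^bsub>F\<^esub> e (u @ (q, b) # v)) | u v q a b.
        u @ (q, a) # v \<in> words A n p \<and> b \<in> carrier (A q)} \<union>
     {e (u @ (q, c \<odot>\<^bsub>A q\<^esub> a) # v) \<ominus>\<^bsub>F\<^esub> c \<odot>\<^bsub>F\<^esub> e (u @ (q, a) # v) | u v q a c.
        u @ (q, a) # v \<in> words A n p \<and> c \<in> carrier K})"

definition multilin_submod ::
  "('k, 'r) ring_scheme \<Rightarrow> (int \<Rightarrow> ('k, 'a) module) \<Rightarrow> nat \<Rightarrow> int \<Rightarrow> ((int \<times> 'a) list \<Rightarrow> 'k) set" where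
  "multilin_submod K A n p =
     \<Inter>{H. submodule H K (free_module K (words A n p)) \<and> multilin_rels K A n p \<subseteq> H}"

definition tpow ::
  "('k, 'r) ring_scheme \<Rightarrow> (int \<Rightarrow> ('k, 'a) module) \<Rightarrow> nat \<Rightarrow> int \<Rightarrow> ('k, ('k, 'a) tens) module" where
  "tpow K A n p = quot_module (free_module K (words A n p)) (multilin_submod K A n p)"

definition pure ::
  "('k, 'r) ring_scheme \<Rightarrow> (int \<Rightarrow> ('k, 'a) module) \<Rightarrow> (int \<times> 'a) list \<Rightarrow> ('k, 'a) tens" where
  "pure K A w = multilin_submod K A (length w) (wdeg w)
     +>\<^bsub>free_module K (words A (length w) (wdeg w))\<^esub> basis_vec K w"

text \<open>
  The linear map on a tensor power with values in \<open>M\<close> sending the tensor represented by \<open>w\<close>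
  to \<open>g w\<close>. For multilinear \<open>g\<close> the choice of a representative \<open>u\<close> is immaterial.
\<close>

definition lin_ext ::
  "('k, 'r) ring_scheme \<Rightarrow> ('k, 'b) module \<Rightarrow> ((int \<times> 'a) list \<Rightarrow> 'b) \<Rightarrow> ('k, 'a) tens \<Rightarrow> 'b" where
  "lin_ext K M g X = (let u = (SOME u. u \<in> X) in
     finsum M (\<lambda>w. u w \<odot>\<^bsub>M\<^esub> g w) {w. u w \<noteq> \<zero>\<^bsub>K\<^esub>})"

text \<open>
  \<open>(k, e, \<phi>)\<close> stands for a map \<open>A\<^sup>\<otimes>\<^sup>k \<rightarrow> B\<close> of degree \<open>e\<close>, with components
  \<open>\<phi> p : (A\<^sup>\<otimes>\<^sup>k)\<^sub>p \<rightarrow> B\<^bsub>p + e\<^esub>\<close>.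
\<close>

type_synonym ('k, 'a, 'b) gmap = "nat \<times> int \<times> (int \<Rightarrow> ('k, 'a) tens \<Rightarrow> 'b)"

text \<open>
  The tensor product \<open>\<phi>\<^sub>1 \<otimes> \<dots> \<otimes> \<phi>\<^sub>r : A\<^bsup>\<otimes>(k\<^sub>1 + \<dots> + k\<^sub>r)\<^esup> \<rightarrow> B\<^sup>\<otimes>\<^sup>r\<close>. The Koszul sign and the
  value on a tensor of homogeneous elements come from iterating
  \<open>(\<phi> \<otimes> \<psi>)(a \<otimes> b) = (-1)\<^bsup>|\<psi>||a|\<^esup> \<phi>(a) \<otimes> \<psi>(b)\<close> with \<open>\<psi> = \<phi>\<^sub>2 \<otimes> \<dots> \<otimes> \<phi>\<^sub>r\<close>.
\<close>

fun koszul_exp :: "('k, 'a, 'b) gmap list \<Rightarrow> (int \<times> 'a) list \<Rightarrow> int" where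
  "koszul_exp [] w = 0"
| "koszul_exp ((k, e, \<phi>) # \<Phi>) w =
     sum_list (map (fst \<circ> snd) \<Phi>) * wdeg (take k w) + koszul_exp \<Phi> (drop k w)"

fun tmap_word ::
  "('k, 'r) ring_scheme \<Rightarrow> (int \<Rightarrow> ('k, 'a) module) \<Rightarrow> ('k, 'a, 'b) gmap list \<Rightarrow>
   (int \<times> 'a) list \<Rightarrow> (int \<times> 'b) list" where
  "tmap_word K A [] w = []"
| "tmap_word K A ((k, e, \<phi>) # \<Phi>) w =
     (wdeg (take k w) + e, \<phi> (wdeg (take k w)) (pure K A (take k w)))
       # tmap_word K A \<Phi> (drop k w)"

definition tmap ::
  "('k, 'r) ring_scheme \<Rightarrow> (int \<Rightarrow> ('k, 'a) module) \<Rightarrow> (int \<Rightarrow> ('k, 'b) module) \<Rightarrow>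
   ('k, 'a, 'b) gmap list \<Rightarrow> int \<Rightarrow> ('k, 'a) tens \<Rightarrow> ('k, 'b) tens" where
  "tmap K A B \<Phi> p =
     (let M = tpow K B (length \<Phi>) (p + sum_list (map (fst \<circ> snd) \<Phi>))
      in (\<lambda>X\<in>carrier (tpow K A (sum_list (map fst \<Phi>)) p).
            lin_ext K M (\<lambda>w. sgn_mult M (koszul_exp \<Phi> w) (pure K B (tmap_word K A \<Phi> w))) X))"

text \<open>The canonical isomorphism \<open>A\<^sup>\<otimes>\<^sup>1 \<rightarrow> A\<close>, i.e. the factor \<open>1\<close> in tensor products of maps.\<close>

definition id_gmap ::
  "('k, 'r) ring_scheme \<Rightarrow> (int \<Rightarrow> ('k, 'a) module) \<Rightarrow> ('k, 'a, 'a) gmap" where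
  "id_gmap K A =
     (1, 0, \<lambda>p. \<lambda>X\<in>carrier (tpow K A 1 p). lin_ext K (A p) (\<lambda>w. snd (hd w)) X)"


section \<open>\<open>A\<^sub>\<infinity>\<close>-algebras, their morphisms and homotopies\<close>

record ('k, 'a) ainf =
  amod :: "int \<Rightarrow> ('k, 'a) module"
  adiff :: "int \<Rightarrow> 'a \<Rightarrow> 'a"
  aop :: "nat \<Rightarrow> int \<Rightarrow> ('k, 'a) tens \<Rightarrow> 'a"

definition diff_gmap :: "('k, 'r) ring_scheme \<Rightarrow> ('k, 'a) ainf \<Rightarrow> ('k, 'a, 'a) gmap" where
  "diff_gmap K A = (1, -1, \<lambda>p X. adiff A p (snd (snd (id_gmap K (amod A))) p X))"

definition op_gmap :: "('k, 'a) ainf \<Rightarrow> nat \<Rightarrow> ('k, 'a, 'a) gmap" where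
  "op_gmap A n = (n + 2, int n, aop A n)"

text \<open>The map \<open>1\<^sup>\<otimes>\<^sup>i \<otimes> \<phi> \<otimes> 1\<^sup>\<otimes>\<^sup>j\<close> of tensor powers of \<open>A\<close>.\<close>

definition insert_map ::
  "('k, 'r) ring_scheme \<Rightarrow> ('k, 'a) ainf \<Rightarrow> nat \<Rightarrow> ('k, 'a, 'a) gmap \<Rightarrow> nat \<Rightarrow>
   int \<Rightarrow> ('k, 'a) tens \<Rightarrow> ('k, 'a) tens" where
  "insert_map K A i \<phi> j =
     (let \<iota> = id_gmap K (amod A)
      in tmap K (amod A) (amod A) (replicate i \<iota> @ [\<phi>] @ replicate j \<iota>))"

definition tdiff ::
  "('k, 'r) ring_scheme \<Rightarrow> ('k, 'a) ainf \<Rightarrow> nat \<Rightarrow> int \<Rightarrow> ('k, 'a) tens \<Rightarrow> ('k, 'a) tens" where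
  "tdiff K A n p = (\<lambda>X\<in>carrier (tpow K (amod A) n p).
     finsum (tpow K (amod A) n (p - 1))
       (\<lambda>i. insert_map K A i (diff_gmap K A) (n - 1 - i) p X) {..<n})"

text \<open>
  In all the structure relations below \<open>N\<close> is the index \<open>n + 1\<close> of the usual formulas, so
  \<open>n \<ge> -1\<close> becomes \<open>N \<ge> 0\<close> and \<open>0 \<le> m \<le> n\<close> becomes \<open>m < N\<close>; they are identities of maps
  on \<open>(A\<^sup>\<otimes>\<^sup>\<dots>)\<^sub>p\<close>.
\<close>

definition is_ainf :: "('k, 'r) ring_scheme \<Rightarrow> ('k, 'a) ainf \<Rightarrow> bool" where
  "is_ainf K A \<longleftrightarrow>
     graded_module K (amod A) \<and>
     (\<forall>p. adiff A p \<in> lin_maps K (amod A p) (amod A (p - 1))) \<and>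
     (\<forall>p. \<forall>x\<in>carrier (amod A p). adiff A (p - 1) (adiff A p x) = \<zero>\<^bsub>amod A (p - 2)\<^esub>) \<and>
     (\<forall>n p. aop A n p \<in> lin_maps K (tpow K (amod A) (n + 2) p) (amod A (p + int n))) \<and>
     (\<forall>N p. \<forall>X\<in>carrier (tpow K (amod A) (N + 2) p).
        let M = amod A (p + int N - 1) in
        adiff A (p + int N) (aop A N p X)
          \<oplus>\<^bsub>M\<^esub> sgn_mult M (int N - 1) (aop A N (p - 1) (tdiff K A (N + 2) p X))
        = finsum M (\<lambda>m. finsum M (\<lambda>t.
            sgn_mult M (int (t * (N - m) + N))
              (aop A m (p + int (N - 1 - m))
                (insert_map K A (t - 1) (op_gmap A (N - 1 - m)) (m + 2 - t) p X)))
            {1..m + 2}) {..<N})"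

type_synonym ('k, 'a, 'b) ainf_maps = "nat \<Rightarrow> int \<Rightarrow> ('k, 'a) tens \<Rightarrow> 'b"

definition mor_gmap :: "('k, 'a, 'b) ainf_maps \<Rightarrow> nat \<Rightarrow> ('k, 'a, 'b) gmap" where
  "mor_gmap f n = (n + 1, int n, f n)"

definition htpy_gmap :: "('k, 'a, 'b) ainf_maps \<Rightarrow> nat \<Rightarrow> ('k, 'a, 'b) gmap" where
  "htpy_gmap h n = (n + 1, int n + 1, h n)"

text \<open>\<open>J_tuples r s\<close> is the set of tuples \<open>(n\<^sub>1, \<dots>, n\<^sub>r)\<close> with sum \<open>s\<close>.\<close>

definition J_tuples :: "nat \<Rightarrow> nat \<Rightarrow> nat list set" where
  "J_tuples r s = {ns. length ns = r \<and> sum_list ns = s}"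

definition eps :: "nat list \<Rightarrow> nat" where
  "eps ns = (\<Sum>i<length ns - 1. (ns ! i + 1) * sum_list (drop (i + 1) ns))"

definition is_ainf_mor ::
  "('k, 'r) ring_scheme \<Rightarrow> ('k, 'a) ainf \<Rightarrow> ('k, 'b) ainf \<Rightarrow> ('k, 'a, 'b) ainf_maps \<Rightarrow> bool" where
  "is_ainf_mor K A B f \<longleftrightarrow>
     (\<forall>n p. f n p \<in> lin_maps K (tpow K (amod A) (n + 1) p) (amod B (p + int n))) \<and>
     (\<forall>N p. \<forall>X\<in>carrier (tpow K (amod A) (N + 1) p).
        let M = amod B (p + int N - 1) in
        adiff B (p + int N) (f N p X)
          \<oplus>\<^bsub>M\<^esub> sgn_mult M (int N - 1) (f N (p - 1) (tdiff K A (N + 1) p X))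
        = finsum M (\<lambda>m. finsum M (\<lambda>t.
            sgn_mult M (int (t * (N - m) + N))
              (f m (p + int (N - 1 - m))
                (insert_map K A (t - 1) (op_gmap A (N - 1 - m)) (m + 1 - t) p X)))
            {1..m + 1}) {..<N}
          \<ominus>\<^bsub>M\<^esub> finsum M (\<lambda>m. finsum M (\<lambda>ns.
            sgn_mult M (int (eps ns))
              (aop B m (p + int (N - 1 - m))
                (tmap K (amod A) (amod B) (map (mor_gmap f) ns) p X)))
            (J_tuples (m + 2) (N - 1 - m))) {..<N})"

definition ainf_id ::
  "('k, 'r) ring_scheme \<Rightarrow> ('k, 'a) ainf \<Rightarrow> ('k, 'a, 'a) ainf_maps" where
  "ainf_id K A n p =
     (if n = 0 then snd (snd (id_gmap K (amod A))) p
      else (\<lambda>X\<in>carrier (tpow K (amod A) (n + 1) p). \<zero>\<^bsub>amod A (p + int n)\<^esub>))"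

text \<open>Here \<open>m\<close> is the index \<open>m + 1\<close> of the usual formula for the composition \<open>gf\<close>.\<close>

definition ainf_comp ::
  "('k, 'r) ring_scheme \<Rightarrow> ('k, 'a) ainf \<Rightarrow> ('k, 'b) ainf \<Rightarrow> ('k, 'c) ainf \<Rightarrow>
   ('k, 'b, 'c) ainf_maps \<Rightarrow> ('k, 'a, 'b) ainf_maps \<Rightarrow> ('k, 'a, 'c) ainf_maps" where
  "ainf_comp K A B C g f N p = (\<lambda>X\<in>carrier (tpow K (amod A) (N + 1) p).
     let M = amod C (p + int N) in
     finsum M (\<lambda>m. finsum M (\<lambda>ns.
       sgn_mult M (int (eps ns))
         (g m (p + int (N - m)) (tmap K (amod A) (amod B) (map (mor_gmap f) ns) p X)))
       (J_tuples (m + 1) (N - m))) {..N})"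

definition is_ainf_htpy ::
  "('k, 'r) ring_scheme \<Rightarrow> ('k, 'a) ainf \<Rightarrow> ('k, 'b) ainf \<Rightarrow>
   ('k, 'a, 'b) ainf_maps \<Rightarrow> ('k, 'a, 'b) ainf_maps \<Rightarrow> ('k, 'a, 'b) ainf_maps \<Rightarrow> bool" where
  "is_ainf_htpy K A B f g h \<longleftrightarrow>
     (\<forall>n p. h n p \<in> lin_maps K (tpow K (amod A) (n + 1) p) (amod B (p + int n + 1))) \<and>
     (\<forall>N p. \<forall>X\<in>carrier (tpow K (amod A) (N + 1) p).
        let M = amod B (p + int N) in
        adiff B (p + int N + 1) (h N p X)
          \<oplus>\<^bsub>M\<^esub> sgn_mult M (int N) (h N (p - 1) (tdiff K A (N + 1) p X))
        = (f N p X \<ominus>\<^bsub>M\<^esub> g N p X)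
          \<oplus>\<^bsub>M\<^esub> finsum M (\<lambda>m. finsum M (\<lambda>t.
            sgn_mult M (int (t * (N - m)) + int N - 1)
              (h m (p + int (N - 1 - m))
                (insert_map K A (t - 1) (op_gmap A (N - 1 - m)) (m + 1 - t) p X)))
            {1..m + 1}) {..<N}
          \<oplus>\<^bsub>M\<^esub> finsum M (\<lambda>m. finsum M (\<lambda>ns. finsum M (\<lambda>i.
            sgn_mult M (int (m + eps ns + sum_list (take (i - 1) ns)))
              (aop B m (p + int (N - 1 - m) + 1)
                (tmap K (amod A) (amod B)
                  (map (mor_gmap g) (take (i - 1) ns) @ [htpy_gmap h (ns ! (i - 1))]
                    @ map (mor_gmap f) (drop i ns)) p X)))
            {1..m + 2}) (J_tuples (m + 2) (N - 1 - m))) {..<N})"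

definition ainf_homotopic ::
  "('k, 'r) ring_scheme \<Rightarrow> ('k, 'a) ainf \<Rightarrow> ('k, 'b) ainf \<Rightarrow>
   ('k, 'a, 'b) ainf_maps \<Rightarrow> ('k, 'a, 'b) ainf_maps \<Rightarrow> bool" where
  "ainf_homotopic K A B f g \<longleftrightarrow> (\<exists>h. is_ainf_htpy K A B f g h)"

definition ainf_homotopy_equiv ::
  "('k, 'r) ring_scheme \<Rightarrow> ('k, 'a) ainf \<Rightarrow> ('k, 'b) ainf \<Rightarrow> ('k, 'a, 'b) ainf_maps \<Rightarrow> bool" where
  "ainf_homotopy_equiv K A B f \<longleftrightarrow> is_ainf_mor K A B f \<and>
     (\<exists>g. is_ainf_mor K B A g \<and>
        ainf_homotopic K A A (ainf_comp K A B A g f) (ainf_id K A) \<and>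
        ainf_homotopic K B B (ainf_comp K B A B f g) (ainf_id K B))"


section \<open>Cyclic homology of \<open>CF\<^sub>\<infinity>\<close>-modules\<close>

text \<open>
  The data of a \<open>CF\<^sub>\<infinity>\<close>-module: \<open>xface X n p [i\<^sub>1, \<dots>, i\<^sub>k]\<close> is
  \<open>\<partial>\<^bsub>(i\<^sub>1, \<dots>, i\<^sub>k)\<^esub> : X\<^bsub>n, p\<^esub> \<rightarrow> X\<^bsub>n - k, p + k - 1\<^esub>\<close>, and \<open>xdiff X n p\<close>, \<open>xcyc X n p\<close> are \<open>d\<close>
  and \<open>t\<^sub>n\<close> on \<open>X\<^bsub>n, p\<^esub>\<close>; here \<open>X\<^bsub>n, p\<^esub> = 0\<close> for \<open>p < 0\<close>. The definition of cyclic homology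
  does not refer to the axioms, so they are not imposed here.
\<close>

record ('k, 'x) cf_data =
  xmod :: "nat \<Rightarrow> int \<Rightarrow> ('k, 'x) module"
  xdiff :: "nat \<Rightarrow> int \<Rightarrow> 'x \<Rightarrow> 'x"
  xface :: "nat \<Rightarrow> int \<Rightarrow> nat list \<Rightarrow> 'x \<Rightarrow> 'x"
  xcyc :: "nat \<Rightarrow> int \<Rightarrow> 'x \<Rightarrow> 'x"

text \<open>\<open>dq X q k n p\<close> is \<open>d\<^sub>q\<^sup>k\<close> on \<open>X\<^bsub>n, p\<^esub>\<close>.\<close>

definition dq :: "('k, 'x) cf_data \<Rightarrow> nat \<Rightarrow> nat \<Rightarrow> nat \<Rightarrow> int \<Rightarrow> 'x \<Rightarrow> 'x" where
  "dq X q k n p x =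
     (if k = 0 then xdiff X n p x
      else let M = xmod X (n - k) (p + int k - 1) in
        finsum M (\<lambda>is. sgn_mult M (int (sum_list is)) (xface X n p is x))
          {is. length is = k \<and> sorted_wrt (<) is \<and> (\<forall>i\<in>set is. i + q \<le> n)})"

definition Xbar :: "('k, 'x) cf_data \<Rightarrow> nat \<Rightarrow> ('k, nat \<Rightarrow> 'x) module" where
  "Xbar X n = dsum {..n} (\<lambda>k. xmod X k (int n - int k))"

text \<open>\<open>bq X 0 n\<close> is \<open>b\<close> and \<open>bq X 1 n\<close> is \<open>b'\<close>, as maps from \<open>Xbar X (n + 1)\<close> to \<open>Xbar X n\<close>.\<close>

definition bq :: "('k, 'x) cf_data \<Rightarrow> nat \<Rightarrow> nat \<Rightarrow> (nat \<Rightarrow> 'x) \<Rightarrow> nat \<Rightarrow> 'x" where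
  "bq X q n x = (\<lambda>k\<in>{..n}. finsum (xmod X k (int n - int k))
     (\<lambda>i. dq X q i (k + i) (int (n + 1) - int (k + i)) (x (k + i))) {..n + 1 - k})"

definition Tcyc :: "('k, 'x) cf_data \<Rightarrow> nat \<Rightarrow> int \<Rightarrow> 'x \<Rightarrow> 'x" where
  "Tcyc X n p x = sgn_mult (xmod X n p) (int n) (xcyc X n p x)"

definition Tbar :: "('k, 'x) cf_data \<Rightarrow> nat \<Rightarrow> (nat \<Rightarrow> 'x) \<Rightarrow> nat \<Rightarrow> 'x" where
  "Tbar X n x = (\<lambda>k\<in>{..n}. Tcyc X k (int n - int k) (x k))"

definition Nbar :: "('k, 'x) cf_data \<Rightarrow> nat \<Rightarrow> (nat \<Rightarrow> 'x) \<Rightarrow> nat \<Rightarrow> 'x" where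
  "Nbar X n x = (\<lambda>k\<in>{..n}. finsum (xmod X k (int n - int k))
     (\<lambda>j. (Tcyc X k (int n - int k) ^^ j) (x k)) {..k})"

text \<open>
  \<open>D\<^sub>1 : C\<^bsub>n, m\<^esub> \<rightarrow> C\<^bsub>n, m - 1\<^esub>\<close> (for \<open>m > 0\<close>) and \<open>D\<^sub>2 : C\<^bsub>n + 1, m\<^esub> \<rightarrow> C\<^bsub>n, m\<^esub>\<close> in the bicomplex
  with \<open>C\<^bsub>n, m\<^esub> = Xbar X n\<close>, \<open>n, m \<ge> 0\<close>.
\<close>

definition D1 :: "('k, 'x) cf_data \<Rightarrow> nat \<Rightarrow> int \<Rightarrow> (nat \<Rightarrow> 'x) \<Rightarrow> nat \<Rightarrow> 'x" where
  "D1 X n m x = (if odd m then x \<ominus>\<^bsub>Xbar X n\<^esub> Tbar X n x else Nbar X n x)"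

definition D2 :: "('k, 'x) cf_data \<Rightarrow> nat \<Rightarrow> int \<Rightarrow> (nat \<Rightarrow> 'x) \<Rightarrow> nat \<Rightarrow> 'x" where
  "D2 X n m x = (if even m then bq X 0 n x else \<ominus>\<^bsub>Xbar X n\<^esub> bq X 1 n x)"

text \<open>
  The total complex: \<open>z \<in> Tot X N\<close> has components \<open>z n \<in> C\<^bsub>n, N - n\<^esub>\<close>, \<open>0 \<le> n \<le> N\<close>. In the
  component \<open>C\<^bsub>n, N - 1 - n\<^esub>\<close> of \<open>D z\<close> the term \<open>D\<^sub>1\<close> comes from \<open>C\<^bsub>n, N - n\<^esub>\<close> and \<open>D\<^sub>2\<close> from
  \<open>C\<^bsub>n + 1, N - 1 - n\<^esub>\<close>.
\<close>

definition Tot :: "('k, 'x) cf_data \<Rightarrow> int \<Rightarrow> ('k, nat \<Rightarrow> nat \<Rightarrow> 'x) module" where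
  "Tot X N = dsum {n. int n \<le> N} (Xbar X)"

definition totD :: "('k, 'x) cf_data \<Rightarrow> int \<Rightarrow> (nat \<Rightarrow> nat \<Rightarrow> 'x) \<Rightarrow> nat \<Rightarrow> nat \<Rightarrow> 'x" where
  "totD X N z = (\<lambda>n\<in>{n. int n \<le> N - 1}.
     D1 X n (N - int n) (z n) \<oplus>\<^bsub>Xbar X n\<^esub> D2 X n (N - 1 - int n) (z (n + 1)))"

definition cycles :: "('k, 'x) cf_data \<Rightarrow> int \<Rightarrow> (nat \<Rightarrow> nat \<Rightarrow> 'x) set" where
  "cycles X N = {z \<in> carrier (Tot X N). totD X N z = \<zero>\<^bsub>Tot X (N - 1)\<^esub>}"

definition boundaries :: "('k, 'x) cf_data \<Rightarrow> int \<Rightarrow> (nat \<Rightarrow> nat \<Rightarrow> 'x) set" where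
  "boundaries X N = totD X (N + 1) ` carrier (Tot X (N + 1))"

definition cf_HC :: "('k, 'x) cf_data \<Rightarrow> int \<Rightarrow> ('k, (nat \<Rightarrow> nat \<Rightarrow> 'x) set) module" where
  "cf_HC X N = quot_module ((Tot X N)\<lparr>carrier := cycles X N\<rparr>) (boundaries X N)"

definition hclass ::
  "('k, 'x) cf_data \<Rightarrow> int \<Rightarrow> (nat \<Rightarrow> nat \<Rightarrow> 'x) \<Rightarrow> (nat \<Rightarrow> nat \<Rightarrow> 'x) set" where
  "hclass X N z = boundaries X N +>\<^bsub>Tot X N\<^esub> z"


section \<open>Cyclic homology of \<open>A\<^sub>\<infinity>\<close>-algebras\<close>

definition cyc_perm ::
  "('k, 'r) ring_scheme \<Rightarrow> ('k, 'a) ainf \<Rightarrow> nat \<Rightarrow> int \<Rightarrow> ('k, 'a) tens \<Rightarrow> ('k, 'a) tens" where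
  "cyc_perm K A n p = (let M = tpow K (amod A) (n + 1) p in (\<lambda>X\<in>carrier M.
     lin_ext K M (\<lambda>w. sgn_mult M (fst (last w) * wdeg (butlast w))
       (pure K (amod A) (last w # butlast w))) X))"

text \<open>\<open>\<partial>\<^bsub>(j, j+1, \<dots>, j+k-1)\<^esub>\<close> on \<open>(A\<^bsup>\<otimes>(n+1)\<^esup>)\<^sub>p\<close>.\<close>

definition block_face ::
  "('k, 'r) ring_scheme \<Rightarrow> ('k, 'a) ainf \<Rightarrow> nat \<Rightarrow> int \<Rightarrow> nat \<Rightarrow> nat \<Rightarrow>
   ('k, 'a) tens \<Rightarrow> ('k, 'a) tens" where
  "block_face K A n p j k X =
     sgn_mult (tpow K (amod A) (n - k + 1) (p + int k - 1)) (int k * (p - 1))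
       (insert_map K A j (op_gmap A (k - 1)) (n - k - j) p X)"

definition alg_face ::
  "('k, 'r) ring_scheme \<Rightarrow> ('k, 'a) ainf \<Rightarrow> nat \<Rightarrow> int \<Rightarrow> nat list \<Rightarrow>
   ('k, 'a) tens \<Rightarrow> ('k, 'a) tens" where
  "alg_face K A n p is =
     (let k = length is; M = tpow K (amod A) (n - k + 1) (p + int k - 1);
          P = (\<lambda>j. j + k \<le> n \<and> is = [j..<j + k]);
          Q = (\<lambda>q. 1 \<le> q \<and> q \<le> k \<and> is = [0..<k - q] @ [n - q + 1..<n + 1])
      in (\<lambda>X\<in>carrier (tpow K (amod A) (n + 1) p).
        if Ex P then block_face K A n p (THE j. P j) k X
        else if Ex Q then (let q = (THE q. Q q) in
          sgn_mult M (int (q * (k - 1))) (block_face K A n p 0 k ((cyc_perm K A n p ^^ q) X)))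
        else \<zero>\<^bsub>M\<^esub>))"

definition cyc_module ::
  "('k, 'r) ring_scheme \<Rightarrow> ('k, 'a) ainf \<Rightarrow> ('k, ('k, 'a) tens) cf_data" where
  "cyc_module K A = \<lparr>xmod = (\<lambda>n. tpow K (amod A) (n + 1)), xdiff = (\<lambda>n. tdiff K A (n + 1)),
     xface = alg_face K A, xcyc = cyc_perm K A\<rparr>"

type_synonym ('k, 'a) hc = "(nat \<Rightarrow> nat \<Rightarrow> ('k, 'a) tens) set"

definition HC ::
  "('k, 'r) ring_scheme \<Rightarrow> ('k, 'a) ainf \<Rightarrow> int \<Rightarrow> ('k, ('k, 'a) hc) module" where
  "HC K A = cf_HC (cyc_module K A)"


section \<open>Categories and functors\<close>

record ('o, 'm) cat =
  Obj :: "'o set"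
  Hom :: "'o \<Rightarrow> 'o \<Rightarrow> 'm set"
  Idm :: "'o \<Rightarrow> 'm"
  Cmp :: "'o \<Rightarrow> 'o \<Rightarrow> 'o \<Rightarrow> 'm \<Rightarrow> 'm \<Rightarrow> 'm"  \<comment> \<open>\<open>Cmp A B C g f\<close> is \<open>gf : A \<rightarrow> B \<rightarrow> C\<close>\<close>

definition is_functor ::
  "('o, 'm) cat \<Rightarrow> ('p, 'n) cat \<Rightarrow> ('o \<Rightarrow> 'p) \<Rightarrow> ('o \<Rightarrow> 'o \<Rightarrow> 'm \<Rightarrow> 'n) \<Rightarrow> bool" where
  "is_functor C D F0 F1 \<longleftrightarrow>
     (\<forall>A\<in>Obj C. F0 A \<in> Obj D) \<and>
     (\<forall>A\<in>Obj C. \<forall>B\<in>Obj C. \<forall>f\<in>Hom C A B. F1 A B f \<in> Hom D (F0 A) (F0 B)) \<and>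
     (\<forall>A\<in>Obj C. F1 A A (Idm C A) = Idm D (F0 A)) \<and>
     (\<forall>A\<in>Obj C. \<forall>B\<in>Obj C. \<forall>E\<in>Obj C. \<forall>f\<in>Hom C A B. \<forall>g\<in>Hom C B E.
        F1 A E (Cmp C A B E g f) = Cmp D (F0 A) (F0 B) (F0 E) (F1 B E g) (F1 A B f))"

definition is_isomorphism :: "('o, 'm) cat \<Rightarrow> 'o \<Rightarrow> 'o \<Rightarrow> 'm \<Rightarrow> bool" where
  "is_isomorphism C A B f \<longleftrightarrow> f \<in> Hom C A B \<and>
     (\<exists>g\<in>Hom C B A. Cmp C A B A g f = Idm C A \<and> Cmp C B A B f g = Idm C B)"

text \<open>
  The type \<open>'a\<close> plays the role of a universe: the objects are the \<open>A\<^sub>\<infinity>\<close>-algebras all of whose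
  homogeneous components are carried by subsets of \<open>'a\<close>.
\<close>

definition Ainf_cat ::
  "('k, 'r) ring_scheme \<Rightarrow> (('k, 'a) ainf, ('k, 'a, 'a) ainf_maps) cat" where
  "Ainf_cat K = \<lparr>Obj = {A. is_ainf K A}, Hom = (\<lambda>A B. {f. is_ainf_mor K A B f}),
     Idm = ainf_id K, Cmp = ainf_comp K\<rparr>"

definition GrM_cat ::
  "('k, 'r) ring_scheme \<Rightarrow> (int \<Rightarrow> ('k, 'x) module, int \<Rightarrow> 'x \<Rightarrow> 'x) cat" where
  "GrM_cat K = \<lparr>Obj = {M. graded_module K M},
     Hom = (\<lambda>M M'. {\<phi>. \<forall>n. \<phi> n \<in> lin_maps K (M n) (M' n)}),
     Idm = (\<lambda>M n. \<lambda>x\<in>carrier (M n). x),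
     Cmp = (\<lambda>M M' M'' \<psi> \<phi> n. compose (carrier (M n)) (\<psi> n) (\<phi> n))\<rparr>"

definition strict_mor ::
  "('k, 'r) ring_scheme \<Rightarrow> ('k, 'a) ainf \<Rightarrow> ('k, 'b) ainf \<Rightarrow> ('k, 'a, 'b) ainf_maps \<Rightarrow> bool" where
  "strict_mor K A B f \<longleftrightarrow> is_ainf_mor K A B f \<and>
     (\<forall>n\<ge>1. \<forall>p. \<forall>X\<in>carrier (tpow K (amod A) (n + 1) p). f n p X = \<zero>\<^bsub>amod B (p + int n)\<^esub>)"

definition strict_chain_map ::
  "('k, 'r) ring_scheme \<Rightarrow> ('k, 'a) ainf \<Rightarrow> ('k, 'b) ainf \<Rightarrow> ('k, 'a, 'b) ainf_maps \<Rightarrow> int \<Rightarrow>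
   (nat \<Rightarrow> nat \<Rightarrow> ('k, 'a) tens) \<Rightarrow> nat \<Rightarrow> nat \<Rightarrow> ('k, 'b) tens" where
  "strict_chain_map K A B f N z = (\<lambda>n\<in>{n. int n \<le> N}. \<lambda>k\<in>{..n}.
     tmap K (amod A) (amod B) (replicate (k + 1) (mor_gmap f 0)) (int n - int k) (z n k))"

text \<open>
  \<open>F1 A B f\<close> is the map induced on homology by the maps \<open>f\<^sub>0 \<otimes> \<dots> \<otimes> f\<^sub>0\<close> whenever
  \<open>f\<^sub>n = 0\<close> for \<open>n \<ge> 1\<close>. This ties the action on morphisms to cyclic homology, so that the
  functor is not an arbitrary one with the prescribed values on objects.
\<close>

definition induced_on_strict ::
  "('k, 'r) ring_scheme \<Rightarrow>
   (('k, 'a) ainf \<Rightarrow> ('k, 'a) ainf \<Rightarrow> ('k, 'a, 'a) ainf_maps \<Rightarrow>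
     int \<Rightarrow> ('k, 'a) hc \<Rightarrow> ('k, 'a) hc) \<Rightarrow> bool" where
  "induced_on_strict K F1 \<longleftrightarrow>
     (\<forall>A B f. is_ainf K A \<and> is_ainf K B \<and> strict_mor K A B f \<longrightarrow>
        (\<forall>N. \<forall>z\<in>cycles (cyc_module K A) N.
           F1 A B f N (hclass (cyc_module K A) N z)
           = hclass (cyc_module K B) N (strict_chain_map K A B f N z)))"

end

theory Submission
 imports Defs "HOL-Algebra.Free_Abelian_Groups"
begin

text \<open>
 Elements of the cyclic complexes are represented by formal integer combinations of words, a letter
 being a homogeneous element of \<open>A\<close>. If a letter of degree \<open>q\<close> gets the suspended degree \<open>q + 1\<close> and pure
 tensors are twisted accordingly, then the structure relations, the relations of a morphism and the
 operators \<open>b\<close>, \<open>b'\<close>, \<open>1 - T\<close>, \<open>N\<close> become those of the bar construction and carry only Koszul signs.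

 A morphism \<open>f\<close> acts on the odd columns by applying its suspended components to all consecutive subdivisions
 of a word, and on the even columns by the sum over the cyclic subdivisions; these maps commute with
 \<open>b'\<close>, \<open>b\<close>, \<open>1 - T\<close>, \<open>N\<close> and are multiplicative in \<open>f\<close>.

 For a homotopy equivalence only the component \<open>h\<^sub>0\<close> of the homotopy is needed: the map of complexes induced by \<open>gf\<close>
 differs from the identity by a homotopy and by terms that lower the filtration by word length
 and column. Since the filtration is exhaustive and bounded below, \<open>gf\<close> is bijective on homology.
\<close>

text \<open>Over an arbitrary ring \<open>K\<close> the tensor powers have no basis on which
  identities could be checked. On words every operator is a finite sum over cuttings, and an
  identity that involves only cuttings and signs is exact. Letters, however, cannot be added: a
  structure relation, which sums several operations, holds only after evaluation. Identities that
  use one are therefore stated modulo a subgroup, and a continuation \<phi> into an arbitrary group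
  turns a composite of operators into a nested call. The price is that an operator on formal sums
  need not respect the kernel of evaluation; that it does is a separate argument, by linearity in
  each letter. The action of \<open>K\<close>, lost in integer combinations, is recovered by scaling
  first letters. The map of gf on homology is only shown to be bijective. As the same holds for fg,
  the map of f is injective and surjective, and its inverse is taken as an inverse function.\<close>

type_synonym 'a word = "(int \<times> 'a) list"

section \<open>Signs and sums over the splittings of a word\<close>

locale additive_fun =
 fixes h :: "'g::ab_group_add \<Rightarrow> 'h::ab_group_add"
 assumes add: "h (x + y) = h x + h y"
begin

lemma zero: "h 0 = 0"
 using add[of 0 0] by simp

lemma minus: "h (- x) = - h x"
 using add[of x "- x"] zero by (simp add: eq_neg_iff_add_eq_0 add.commute)

end

text \<open>Formal sums form a type of class \<open>ab_group_add\<close>, whereas modules are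
  records. This is \<open>sgn_mult\<close> for the former; \<open>fhom_sgx\<close> later translates
  one into the other.\<close>

definition sgx :: "int \<Rightarrow> 'g::ab_group_add \<Rightarrow> 'g" where
 "sgx e x = (if even e then x else - x)"

lemma sgx_simps [simp]:
 "sgx e 0 = 0" "sgx 0 x = x" "sgx a (sgx b x) = sgx (a + b) x" "sgx e (- x) = - sgx e x"
 by (auto simp: sgx_def)

lemma sgx_add: "sgx e (x + y) = sgx e x + sgx e y"
 by (auto simp: sgx_def)

lemma sgx_diff: "sgx e (x - y) = sgx e x - sgx e y"
 by (auto simp: sgx_def)

lemma sgx_cong: "even (a - b) \<Longrightarrow> sgx a x = sgx b x"
 by (auto simp: sgx_def)

lemma sgx_odd: "odd (a - b) \<Longrightarrow> sgx a x = - sgx b x"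
 by (auto simp: sgx_def)

lemma additive_sgx: "additive_fun h \<Longrightarrow> h (sgx e x) = sgx e (h x)"
 by (simp add: sgx_def additive_fun.minus)

text \<open>Deconcatenation, the coproduct of the tensor coalgebra, tested against \<phi>; both
  parts of a splitting may be empty.\<close>

primrec ssum :: "('l list \<Rightarrow> 'l list \<Rightarrow> 'g::ab_group_add) \<Rightarrow> 'l list \<Rightarrow> 'g" where
 "ssum \<phi> [] = \<phi> [] []"
| "ssum \<phi> (a # v) = \<phi> [] (a # v) + ssum (\<lambda>x y. \<phi> (a # x) y) v"

lemma ssum_cong:
 "(\<And>x y. x @ y = w \<Longrightarrow> \<phi> x y = \<psi> x y) \<Longrightarrow> ssum \<phi> w = ssum \<psi> w"
proof (induction w arbitrary: \<phi> \<psi>)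
 case (Cons a v)
 show ?case
  using Cons.prems by (auto intro!: arg_cong2[where f = "(+)"] Cons.IH)
qed simp

lemma ssum_add: "ssum (\<lambda>x y. \<phi> x y + \<psi> x y) w = ssum \<phi> w + ssum \<psi> w"
 by (induction w arbitrary: \<phi> \<psi>) (auto simp: algebra_simps)

lemma ssum_zero [simp]: "ssum (\<lambda>x y. 0) w = 0"
 by (induction w) auto

lemma ssum_hom: "additive_fun h \<Longrightarrow> h (ssum \<phi> w) = ssum (\<lambda>x y. h (\<phi> x y)) w"
 by (induction w arbitrary: \<phi>) (auto simp: additive_fun.add)

lemma additive_sgx' [simp]: "additive_fun (sgx e)"
 by (simp add: additive_fun_def sgx_add)

lemma additive_uminus [simp]: "additive_fun (uminus :: 'g::ab_group_add \<Rightarrow> 'g)"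
 by (simp add: additive_fun_def)

lemma additive_frag_extend [simp]: "additive_fun (frag_extend \<psi>)"
 by (simp add: additive_fun_def frag_extend_add)

lemma ssum_sgx: "sgx e (ssum \<phi> w) = ssum (\<lambda>x y. sgx e (\<phi> x y)) w"
 by (rule ssum_hom) simp

lemma ssum_uminus: "- ssum \<phi> w = ssum (\<lambda>x y. - \<phi> x y) w"
 by (rule ssum_hom) simp

lemma ssum_diff: "ssum (\<lambda>x y. \<phi> x y - \<psi> x y) w = ssum \<phi> w - ssum \<psi> w"
 using ssum_add[of \<phi> "\<lambda>x y. - \<psi> x y" w] by (simp add: ssum_uminus)

lemma ssum_swap:
 "ssum (\<lambda>x y. ssum (\<lambda>p q. \<phi> x y p q) v) w = ssum (\<lambda>p q. ssum (\<lambda>x y. \<phi> x y p q) w) v"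
 by (induction w arbitrary: \<phi>) (auto simp: ssum_add)

text \<open>Coassociativity: both sides run over the cuttings of \<open>w\<close> into three
  pieces.\<close>

lemma ssum_assoc:
 "ssum (\<lambda>x u. ssum (\<lambda>y z. \<phi> x y z) u) w = ssum (\<lambda>u z. ssum (\<lambda>x y. \<phi> x y z) u) w"
 by (induction w arbitrary: \<phi>) (auto simp: ssum_add algebra_simps)

text \<open>A marked letter lies either in the right or in the left part of a splitting. Cyclic
  words are handled by marking their first letter, so that it can be followed through
  rotations.\<close>

lemma ssum_append:
 "ssum \<phi> (Z @ a # X) = ssum (\<lambda>x y. \<phi> x (y @ a # X)) Z + ssum (\<lambda>x y. \<phi> (Z @ a # x) y) X"
 by (induction Z arbitrary: \<phi>) (auto simp: algebra_simps)

definition ssum3 where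
 "ssum3 \<phi> w = ssum (\<lambda>x u. ssum (\<lambda>y z. \<phi> x y z) u) w"

lemma ssum3_cong:
 "(\<And>x y z. x @ y @ z = w \<Longrightarrow> \<phi> x y z = \<psi> x y z) \<Longrightarrow> ssum3 \<phi> w = ssum3 \<psi> w"
 unfolding ssum3_def by (intro ssum_cong) auto

lemma ssum3_hom: "additive_fun h \<Longrightarrow> h (ssum3 \<phi> w) = ssum3 (\<lambda>x y z. h (\<phi> x y z)) w"
 by (simp add: ssum3_def ssum_hom)

lemma ssum3_add: "ssum3 (\<lambda>x y z. \<phi> x y z + \<psi> x y z) w = ssum3 \<phi> w + ssum3 \<psi> w"
 by (simp add: ssum3_def ssum_add)

text \<open>Degree in the tensor algebra of the suspension, where every letter gains one. Koszul
  signs of the word operators are computed in \<open>wd\<close>, those of the original tensors in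
  \<open>wdeg\<close>.\<close>

definition wd :: "'a word \<Rightarrow> int" where
 "wd w = wdeg w + int (length w)"

lemma wdeg_simps [simp]:
 "wdeg [] = 0" "wdeg (a # v) = fst a + wdeg v" "wdeg (x @ y) = wdeg x + wdeg y"
 by (auto simp: wdeg_def)

lemma wd_simps [simp]:
 "wd [] = 0" "wd (a # v) = fst a + 1 + wd v" "wd (x @ y) = wd x + wd y"
 by (auto simp: wd_def)

section \<open>The bar differential and its cyclic analogue\<close>

text \<open>The recursion asks whether the block fed to \<open>m\<close> starts at the first letter.
  Unrolled, it is the coderivation of the tensor coalgebra with corestriction \<open>m\<close>: a
  sum over w = x @ y @ z with y nonempty, with the Koszul sign (-1)^(wd x) of an odd map passing
  x.\<close>

primrec Bs :: "('a word \<Rightarrow> int \<times> 'a) \<Rightarrow> 'a word \<Rightarrow>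
 ('a word \<Rightarrow> 'g::ab_group_add) \<Rightarrow> 'g" where
 "Bs m [] \<phi> = 0"
| "Bs m (a # v) \<phi> = ssum (\<lambda>x z. \<phi> (m (a # x) # z)) v
   + sgx (fst a + 1) (Bs m v (\<lambda>u. \<phi> (a # u)))"

lemma Bs_hom: "additive_fun h \<Longrightarrow> h (Bs m w \<phi>) = Bs m w (\<lambda>u. h (\<phi> u))"
 by (induction w arbitrary: \<phi>)
  (auto simp: additive_fun.zero additive_fun.add additive_sgx ssum_hom)

lemma Bs_add: "Bs m w (\<lambda>u. \<phi> u + \<psi> u) = Bs m w \<phi> + Bs m w \<psi>"
 by (induction w arbitrary: \<phi> \<psi>) (auto simp: sgx_add ssum_add algebra_simps)

lemma Bs_diff: "Bs m w (\<lambda>u. \<phi> u - \<psi> u) = Bs m w \<phi> - Bs m w \<psi>"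
 using Bs_add[of m w \<phi> "\<lambda>u. - \<psi> u"] Bs_hom[of uminus m w \<psi>] by simp

lemma Bs_sgx: "sgx e (Bs m w \<phi>) = Bs m w (\<lambda>u. sgx e (\<phi> u))"
 by (rule Bs_hom) simp

lemma Bs_ssum_swap:
 "Bs m w (\<lambda>u. ssum (\<lambda>p q. \<tau> u p q) v) = ssum (\<lambda>p q. Bs m w (\<lambda>u. \<tau> u p q)) v"
 by (induction v arbitrary: \<tau>) (auto simp: Bs_add)

text \<open>In suspended degrees \<open>m\<close> lowers the degree by one and is odd, while the
  maps of \<open>f_degree\<close> below preserve the degree and pass other letters without
  signs.\<close>

locale m_degree =
 fixes m :: "'a word \<Rightarrow> int \<times> 'a"
 assumes m_deg: "y \<noteq> [] \<Longrightarrow> fst (m y) = wd y - 2"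
begin

text \<open>The coderivation rule: a cut of the new word lies right or left of the new letter, which
  means that the operator has acted on the left or on the right part.\<close>

lemma Bs_ssum:
 "Bs m v (\<lambda>u. ssum \<tau> u) =
   ssum (\<lambda>x z. Bs m x (\<lambda>x'. \<tau> x' z) + sgx (wd x) (Bs m z (\<lambda>z'. \<tau> x z'))) v"
proof (induction v arbitrary: \<tau>)
 case (Cons a v)
 show ?case
  by (simp add: Cons.IH Bs_add ssum_add sgx_add ssum_sgx algebra_simps ssum_assoc)
qed simp

end

text \<open>The three sums are the blocks to the left of the marked letter, those containing it, and
  those to its right.\<close>

lemma Bs_middle:
 "Bs m (Z @ a # X) \<chi> = Bs m Z (\<lambda>u. \<chi> (u @ a # X))
   + ssum (\<lambda>z' z. ssum (\<lambda>x x'. sgx (wd z') (\<chi> (z' @ m (z @ a # x) # x'))) X) Z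
   + sgx (wd Z + fst a + 1) (Bs m X (\<lambda>u. \<chi> (Z @ a # u)))"
proof (induction Z arbitrary: \<chi>)
 case (Cons c Z)
 show ?case
  by (simp add: Cons.IH ssum_add sgx_add ssum_sgx ssum_append algebra_simps)
qed simp

section \<open>Subdivisions of a word into consecutive blocks\<close>

primrec Fs' :: "('a word \<Rightarrow> int \<times> 'b) \<Rightarrow> 'a word \<Rightarrow> 'a word \<Rightarrow>
 ('b word \<Rightarrow> 'g::ab_group_add) \<Rightarrow> 'g" where
 "Fs' f [] acc \<phi> = \<phi> [f acc]"
| "Fs' f (a # v) acc \<phi> = Fs' f v (acc @ [a]) \<phi> + Fs' f v [a] (\<lambda>u. \<phi> (f acc # u))"

definition Fs where
 "Fs f w \<phi> = (case w of [] \<Rightarrow> \<phi> [] | a # v \<Rightarrow> Fs' f v [a] \<phi>)"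

lemma Fs_Nil [simp]: "Fs f [] \<phi> = \<phi> []"
 by (simp add: Fs_def)

lemma Fs'_ssum: "Fs' f v acc \<phi> = ssum (\<lambda>x z. Fs f z (\<lambda>u. \<phi> (f (acc @ x) # u))) v"
proof (induction v arbitrary: acc \<phi>)
 case (Cons a v)
 show ?case
  by (simp add: Cons.IH[of "acc @ [a]"]) (simp add: Fs_def)
qed simp

text \<open>This recursion on the first block is the one used later; the accumulator
  \<open>acc\<close> of \<open>Fs'\<close>, which holds the block being collected, makes the
  definition primitive recursive.\<close>

lemma Fs_Cons: "Fs f (a # v) \<phi> = ssum (\<lambda>x z. Fs f z (\<lambda>u. \<phi> (f (a # x) # u))) v"
 by (simp add: Fs_def Fs'_ssum)

lemma Fs_hom: "additive_fun h \<Longrightarrow> h (Fs f w \<phi>) = Fs f w (\<lambda>u. h (\<phi> u))"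
proof (induction w arbitrary: \<phi> rule: length_induct)
 case (1 w)
 show ?case
 proof (cases w)
  case (Cons a v)
  show ?thesis
   unfolding Cons Fs_Cons using 1
   by (subst ssum_hom) (auto simp: Cons intro!: ssum_cong)
 qed simp
qed

lemma Fs_add: "Fs f w (\<lambda>u. \<phi> u + \<psi> u) = Fs f w \<phi> + Fs f w \<psi>"
proof -
 have "Fs' f w acc (\<lambda>u. \<phi> u + \<psi> u) = Fs' f w acc \<phi> + Fs' f w acc \<psi>" for w acc \<phi> \<psi>
  by (induction w arbitrary: acc \<phi> \<psi>) (auto simp: algebra_simps)
 then show ?thesis
  by (auto simp: Fs_def split: list.split)
qed

lemma Fs_diff: "Fs f w (\<lambda>u. \<phi> u - \<psi> u) = Fs f w \<phi> - Fs f w \<psi>"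
 using Fs_add[of f w \<phi> "\<lambda>u. - \<psi> u"] Fs_hom[of uminus f w \<psi>] by simp

lemma Fs_ssum_swap:
 "Fs f w (\<lambda>u. ssum (\<lambda>p q. \<tau> u p q) v) = ssum (\<lambda>p q. Fs f w (\<lambda>u. \<tau> u p q)) v"
 by (induction v arbitrary: \<tau>) (auto simp: Fs_add)

text \<open>Subdivision is a morphism of coalgebras: a cut between output letters is a cut of the
  input at a block boundary.\<close>

lemma Fs_ssum:
 fixes \<tau> :: "'b word \<Rightarrow> 'b word \<Rightarrow> 'g::ab_group_add"
 shows
 "Fs f w (\<lambda>u. ssum \<tau> u) = ssum (\<lambda>p q. Fs f p (\<lambda>u. Fs f q (\<lambda>u'. \<tau> u u'))) w"
proof (induction w arbitrary: \<tau> rule: length_induct)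
 case (1 w)
 show ?case
 proof (cases w)
  case (Cons a v)
  have IH: "Fs f z (\<lambda>u. ssum \<tau>' u) = ssum (\<lambda>p q. Fs f p (\<lambda>u. Fs f q (\<lambda>u'. \<tau>' u u'))) z"
   if "x @ z = v" for x z and \<tau>' :: "'b word \<Rightarrow> 'b word \<Rightarrow> 'g"
   by (rule 1[rule_format]) (use that in \<open>auto simp: Cons\<close>)
  have "Fs f w (\<lambda>u. ssum \<tau> u) = Fs f w (\<tau> []) +
    ssum (\<lambda>x z. ssum (\<lambda>p q. Fs f p (\<lambda>u. Fs f q (\<lambda>u'. \<tau> (f (a # x) # u) u'))) z) v"
   by (simp add: Cons Fs_Cons ssum_add Fs_add IH cong: ssum_cong)
  also have "\<dots> = Fs f w (\<tau> []) +
    ssum (\<lambda>p q. Fs f (a # p) (\<lambda>u. Fs f q (\<lambda>u'. \<tau> u u'))) v"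
   by (simp add: Fs_Cons ssum_assoc)
  finally show ?thesis
   by (simp add: Cons)
 qed simp
qed

text \<open>Exactly one block contains the marked letter; it is \<open>z @ a # x\<close>, and the
  pieces on both sides of it are subdivided independently.\<close>

lemma Fs_middle:
 fixes \<chi> :: "'b word \<Rightarrow> 'g::ab_group_add"
 shows
 "Fs f (Z @ a # X) \<chi> =
   ssum (\<lambda>z' z. ssum (\<lambda>x x'. Fs f z' (\<lambda>u. Fs f x' (\<lambda>u'. \<chi> (u @ f (z @ a # x) # u')))) X) Z"
proof (induction Z arbitrary: \<chi> rule: length_induct)
 case (1 Z)
 show ?case
 proof (cases Z)
  case Nil
  then show ?thesis by (simp add: Fs_Cons)
 next
  case (Cons c Y)
  have IH: "Fs f (y @ a # X) \<chi>' =
   ssum (\<lambda>z' z. ssum (\<lambda>x x'. Fs f z' (\<lambda>u. Fs f x' (\<lambda>u'. \<chi>' (u @ f (z @ a # x) # u')))) X) y"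
   if "x @ y = Y" for x y and \<chi>' :: "'b word \<Rightarrow> 'g"
   by (rule 1[rule_format]) (use that in \<open>auto simp: Cons\<close>)
  have "Fs f (Z @ a # X) \<chi> =
    ssum (\<lambda>x y. Fs f (y @ a # X) (\<lambda>u. \<chi> (f (c # x) # u))) Y
    + ssum (\<lambda>x y. Fs f y (\<lambda>u. \<chi> (f (Z @ a # x) # u))) X"
   by (simp add: Cons Fs_Cons ssum_append)
  also have "ssum (\<lambda>x y. Fs f (y @ a # X) (\<lambda>u. \<chi> (f (c # x) # u))) Y =
    ssum (\<lambda>x y. ssum (\<lambda>z' z. ssum (\<lambda>p x'. Fs f z' (\<lambda>u. Fs f x' (\<lambda>u'.
     \<chi> (f (c # x) # u @ f (z @ a # p) # u')))) X) y) Y"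
   by (rule ssum_cong) (simp add: IH)
  also have "\<dots> = ssum (\<lambda>y z. ssum (\<lambda>x z'. ssum (\<lambda>p x'. Fs f z' (\<lambda>u. Fs f x' (\<lambda>u'.
     \<chi> (f (c # x) # u @ f (z @ a # p) # u')))) X) y) Y"
   by (rule ssum_assoc)
  also have "\<dots> = ssum (\<lambda>y z. ssum (\<lambda>p x'. ssum (\<lambda>x z'. Fs f z' (\<lambda>u. Fs f x' (\<lambda>u'.
     \<chi> (f (c # x) # u @ f (z @ a # p) # u')))) y) X) Y"
   by (rule ssum_cong) (rule ssum_swap)
  finally show ?thesis
   by (simp add: Cons Fs_Cons add.commute)
 qed
qed

lemma Fs_swap: "Fs f w (\<lambda>u. Fs g w' (\<lambda>u'. \<tau> u u')) = Fs g w' (\<lambda>u'. Fs f w (\<lambda>u. \<tau> u u'))"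
proof -
 have "Fs' f w acc (\<lambda>u. Fs g w' (\<tau> u)) = Fs g w' (\<lambda>u'. Fs' f w acc (\<lambda>u. \<tau> u u'))" for w acc \<tau>
  by (induction w arbitrary: acc \<tau>) (auto simp: Fs_add)
 then show ?thesis
  by (auto simp: Fs_def split: list.split)
qed

locale f_degree =
 fixes f :: "'a word \<Rightarrow> int \<times> 'b"
 assumes f_deg: "y \<noteq> [] \<Longrightarrow> fst (f y) = wd y - 1"

text \<open>Comparing continuations only in the expected degree allows a Koszul sign that depends on
  the output word to be replaced by one that depends on the input, and then to be pulled
  out.\<close>

lemma (in m_degree) Bs_cong:
 "(\<And>u. wd u = wd w - 1 \<Longrightarrow> \<phi> u = \<psi> u) \<Longrightarrow> Bs m w \<phi> = Bs m w \<psi>"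
proof (induction w arbitrary: \<phi> \<psi>)
 case (Cons a v)
 have "\<phi> (m (a # x) # z) = \<psi> (m (a # x) # z)" if "x @ z = v" for x z
  using that by (intro Cons.prems) (auto simp: m_deg)
 moreover have "Bs m v (\<lambda>u. \<phi> (a # u)) = Bs m v (\<lambda>u. \<psi> (a # u))"
  by (rule Cons.IH) (auto intro!: Cons.prems)
 ultimately show ?case
  by (simp cong: ssum_cong)
qed simp

lemma (in f_degree) Fs_cong:
 "(\<And>u. wd u = wd w \<Longrightarrow> \<phi> u = \<psi> u) \<Longrightarrow> Fs f w \<phi> = Fs f w \<psi>"
proof (induction w arbitrary: \<phi> \<psi> rule: length_induct)
 case (1 w)
 show ?case
 proof (cases w)
  case (Cons a v)
  have "Fs f z (\<lambda>u. \<phi> (f (a # x) # u)) = Fs f z (\<lambda>u. \<psi> (f (a # x) # u))" if "x @ z = v" for x z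
   using that by (intro 1(1)[rule_format] 1(2)) (auto simp: Cons f_deg)
  then show ?thesis
   by (simp add: Cons Fs_Cons cong: ssum_cong)
 qed (use 1 in auto)
qed

section \<open>The cyclic operators and their relations\<close>

primrec lsum :: "('l list \<Rightarrow> 'l \<Rightarrow> 'l list \<Rightarrow> 'g::ab_group_add) \<Rightarrow> 'l list \<Rightarrow> 'g" where
 "lsum \<psi> [] = 0"
| "lsum \<psi> (a # v) = \<psi> [] a v + lsum (\<lambda>p. \<psi> (a # p)) v"

text \<open>A word has one more cut than letters. Leaving out the first or the last cut indexes the
  others by letters in two ways, and passing from one to the other is a cyclic shift.\<close>

lemma ssum_lsum1: "ssum \<psi> w = \<psi> [] w + lsum (\<lambda>p l q. \<psi> (p @ [l]) q) w"
 by (induction w arbitrary: \<psi>) auto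

lemma ssum_lsum2: "ssum \<psi> w = lsum (\<lambda>p l q. \<psi> p (l # q)) w + \<psi> w []"
 by (induction w arbitrary: \<psi>) auto

lemma lsum_cong:
 "(\<And>p l q. p @ l # q = w \<Longrightarrow> \<phi> p l q = \<psi> p l q) \<Longrightarrow> lsum \<phi> w = lsum \<psi> w"
proof (induction w arbitrary: \<phi> \<psi>)
 case (Cons a v)
 show ?case
  using Cons.prems by (auto intro!: arg_cong2[where f = "(+)"] Cons.IH)
qed simp

text \<open>The first sum contains the blocks through the first letter \<open>a\<close>, which may
  wrap around: the end \<open>z\<close> of the word is rotated to the front with its Koszul sign.
  For empty \<open>z\<close> these are the initial blocks of \<open>Bs\<close>.\<close>

definition bs :: "('a word \<Rightarrow> int \<times> 'a) \<Rightarrow> 'a word \<Rightarrow>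
 ('a word \<Rightarrow> 'g::ab_group_add) \<Rightarrow> 'g" where
 "bs m w \<phi> = (case w of [] \<Rightarrow> 0 | a # v \<Rightarrow>
   ssum3 (\<lambda>x y z. sgx (wd z * (fst a + 1 + wd x + wd y)) (\<phi> (m (z @ a # x) # y))) v
   + sgx (fst a + 1) (Bs m v (\<lambda>u. \<phi> (a # u))))"

text \<open>The block through the first letter becomes the first output letter, which fixes where
  the cyclic output is cut open. On the empty word \<open>Fcs\<close> vanishes whereas
  \<open>Fs\<close> does not; this discrepancy reappears whenever words may be empty.\<close>

definition Fcs :: "('a word \<Rightarrow> int \<times> 'b) \<Rightarrow> 'a word \<Rightarrow>
 ('b word \<Rightarrow> 'g::ab_group_add) \<Rightarrow> 'g" where
 "Fcs f w \<phi> = (case w of [] \<Rightarrow> 0 | a # v \<Rightarrow>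
   ssum3 (\<lambda>x y z. sgx (wd z * (fst a + 1 + wd x + wd y)) (Fs f y (\<lambda>u. \<phi> (f (z @ a # x) # u)))) v)"

definition Ts :: "'a word \<Rightarrow> ('a word \<Rightarrow> 'g::ab_group_add) \<Rightarrow> 'g" where
 "Ts w \<phi> = (if w = [] then 0
   else sgx ((fst (last w) + 1) * wd (butlast w)) (\<phi> (last w # butlast w)))"

definition Ns :: "'a word \<Rightarrow> ('a word \<Rightarrow> 'g::ab_group_add) \<Rightarrow> 'g" where
 "Ns w \<phi> = (case w of [] \<Rightarrow> 0 | a # v \<Rightarrow>
   ssum (\<lambda>x y. sgx (wd y * (fst a + 1 + wd x)) (\<phi> (y @ a # x))) v)"

lemma cyc_Nil [simp]: "bs m [] \<phi> = 0" "Fcs f [] \<phi> = 0" "Ts [] \<phi> = 0" "Ns [] \<phi> = 0"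
 by (simp_all add: bs_def Fcs_def Ts_def Ns_def)

lemma bs_Cons: "bs m (a # v) \<phi> =
   ssum3 (\<lambda>x y z. sgx (wd z * (fst a + 1 + wd x + wd y)) (\<phi> (m (z @ a # x) # y))) v
   + sgx (fst a + 1) (Bs m v (\<lambda>u. \<phi> (a # u)))"
 by (simp add: bs_def)

lemma Fcs_Cons: "Fcs f (a # v) \<phi> =
   ssum3 (\<lambda>x y z. sgx (wd z * (fst a + 1 + wd x + wd y)) (Fs f y (\<lambda>u. \<phi> (f (z @ a # x) # u)))) v"
 by (simp add: Fcs_def)

lemma Ts_snoc: "Ts (u @ [l]) \<phi> = sgx ((fst l + 1) * wd u) (\<phi> (l # u))"
 by (simp add: Ts_def)

lemma Ns_Cons: "Ns (a # v) \<phi> = ssum (\<lambda>x y. sgx (wd y * (fst a + 1 + wd x)) (\<phi> (y @ a # x))) v"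
 by (simp add: Ns_def)

lemma bs_hom: "additive_fun h \<Longrightarrow> h (bs m w \<phi>) = bs m w (\<lambda>u. h (\<phi> u))"
 by (auto simp: bs_def additive_fun.zero additive_fun.add additive_sgx ssum3_hom Bs_hom split: list.split)

lemma Fcs_hom: "additive_fun h \<Longrightarrow> h (Fcs f w \<phi>) = Fcs f w (\<lambda>u. h (\<phi> u))"
 by (auto simp: Fcs_def additive_fun.zero additive_sgx ssum3_hom Fs_hom split: list.split)

lemma Ts_hom: "additive_fun h \<Longrightarrow> h (Ts w \<phi>) = Ts w (\<lambda>u. h (\<phi> u))"
 by (auto simp: Ts_def additive_fun.zero additive_sgx)

lemma Ns_hom: "additive_fun h \<Longrightarrow> h (Ns w \<phi>) = Ns w (\<lambda>u. h (\<phi> u))"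
 by (auto simp: Ns_def additive_fun.zero additive_sgx ssum_hom split: list.split)

lemma Ns_diff: "Ns w (\<lambda>u. \<phi> u - \<psi> u) = Ns w \<phi> - Ns w \<psi>"
 by (simp add: Ns_def sgx_diff ssum_diff split: list.split)

lemma ssum3_snoc:
 "ssum3 \<tau> (v @ [l]) = ssum3 (\<lambda>x y z. \<tau> x y (z @ [l])) v + ssum (\<lambda>x y. \<tau> x y []) (v @ [l])"
 by (simp add: ssum3_def ssum_append ssum_add algebra_simps)

lemma ssum3_Cons:
 "ssum3 \<tau> (a # v) = ssum (\<lambda>y z. \<tau> [] y z) (a # v) + ssum3 (\<lambda>x. \<tau> (a # x)) v"
 by (simp add: ssum3_def)

lemma Bs_snoc:
 "Bs m (u @ [l]) \<chi> = Bs m u (\<lambda>u'. \<chi> (u' @ [l])) + ssum (\<lambda>z' z. sgx (wd z') (\<chi> (z' @ [m (z @ [l])]))) u"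
 using Bs_middle[of m u l "[]" \<chi>] by simp

lemma Fs_snoc:
 "Fs f (u @ [l]) \<chi> = ssum (\<lambda>z' z. Fs f z' (\<lambda>t. \<chi> (t @ [f (z @ [l])]))) u"
 using Fs_middle[of f u l "[]" \<chi>] by simp

text \<open>Since the inner continuation acts last, this is b(1 - T) = (1 - T)b'. The blocks
  crossing from the last letter to the first, collected in \<open>W\<close>, occur in b and in bT
  with the same sign and cancel.\<close>

lemma (in m_degree) bs_T:
 "bs m w \<phi> - Ts w (\<lambda>u. bs m u \<phi>) = Bs m w \<phi> - Bs m w (\<lambda>u. Ts u \<phi>)"
proof (cases w rule: rev_cases)
 case (snoc u l)
 show ?thesis
 proof (cases u)
  case Nil
  have "Ts [l'] \<phi> = \<phi> [l']" for l'
   using Ts_snoc[of "[]" l' \<phi>] by simp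
  then show ?thesis
   using Ts_snoc[of "[]" l "\<lambda>u. bs m u \<phi>"] by (simp add: snoc Nil bs_Cons ssum3_def)
 next
  case (Cons a v)
  define W where
   "W = ssum3 (\<lambda>x y z. sgx ((wd z + fst l + 1) * (fst a + 1 + wd x + wd y)) (\<phi> (m (z @ l # a # x) # y))) v"
  have 1: "bs m w \<phi> = W + Bs m w \<phi>"
   by (simp add: snoc Cons bs_Cons ssum3_snoc W_def add.assoc)
  have "Ts w (\<lambda>u. bs m u \<phi>) = sgx ((fst l + 1) * wd u) (bs m (l # u) \<phi>)"
   by (simp only: snoc Ts_snoc)
  also have "\<dots> = sgx ((fst l + 1) * wd u)
     (ssum (\<lambda>y z. sgx (wd z * (fst l + 1 + wd y)) (\<phi> (m (z @ [l]) # y))) u)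
    + sgx ((fst l + 1) * wd u)
     (ssum3 (\<lambda>x y z. sgx (wd z * (fst l + 1 + (fst a + 1 + wd x) + wd y)) (\<phi> (m (z @ l # a # x) # y))) v)
    + sgx ((fst l + 1) * wd u + fst l + 1) (Bs m u (\<lambda>u. \<phi> (l # u)))"
   by (simp add: bs_Cons Cons ssum3_Cons sgx_add add.assoc del: ssum.simps Bs.simps)
  also have "sgx ((fst l + 1) * wd u)
     (ssum3 (\<lambda>x y z. sgx (wd z * (fst l + 1 + (fst a + 1 + wd x) + wd y)) (\<phi> (m (z @ l # a # x) # y))) v) = W"
   unfolding W_def
   by (subst ssum3_hom) (auto intro!: ssum3_cong sgx_cong simp: Cons)
  also have "sgx ((fst l + 1) * wd u)
     (ssum (\<lambda>y z. sgx (wd z * (fst l + 1 + wd y)) (\<phi> (m (z @ [l]) # y))) u)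
    = ssum (\<lambda>z' z. sgx (wd z') (Ts (z' @ [m (z @ [l])]) \<phi>)) u"
   unfolding Ts_snoc
   by (subst ssum_hom) (auto intro!: ssum_cong sgx_cong simp: m_deg)
  also have "sgx ((fst l + 1) * wd u + fst l + 1) (Bs m u (\<lambda>u. \<phi> (l # u)))
    = Bs m u (\<lambda>u'. Ts (u' @ [l]) \<phi>)"
   unfolding Ts_snoc
   by (subst Bs_hom) (auto intro!: Bs_cong sgx_cong)
  finally have "Ts w (\<lambda>u. bs m u \<phi>) = W + Bs m w (\<lambda>u. Ts u \<phi>)"
   by (simp add: snoc Bs_snoc algebra_simps)
  with 1 show ?thesis by simp
 qed
qed simp

text \<open>The same cancellation of the blocks that cross from the last letter to the first. The
  empty word is excluded because of the different values of \<open>Fs\<close> and \<open>Fcs\<close>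
  there.\<close>

lemma (in f_degree) Fcs_T:
 assumes "w \<noteq> []"
 shows "Fcs f w \<phi> - Ts w (\<lambda>u. Fcs f u \<phi>) = Fs f w \<phi> - Fs f w (\<lambda>u. Ts u \<phi>)"
proof (cases w rule: rev_cases)
 case (snoc u l)
 show ?thesis
 proof (cases u)
  case Nil
  have "Ts [l'] \<phi> = \<phi> [l']" for l' and \<phi> :: "'b word \<Rightarrow> 'c"
   using Ts_snoc[of "[]" l' \<phi>] by simp
  then show ?thesis
   using Ts_snoc[of "[]" l "\<lambda>u. Fcs f u \<phi>"] by (simp add: snoc Nil Fcs_Cons ssum3_def Fs_Cons)
 next
  case (Cons a v)
  define W where
   "W = ssum3 (\<lambda>x y z. sgx ((wd z + fst l + 1) * (fst a + 1 + wd x + wd y))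
    (Fs f y (\<lambda>u. \<phi> (f (z @ l # a # x) # u)))) v"
  have 1: "Fcs f w \<phi> = W + Fs f w \<phi>"
   by (simp add: snoc Cons Fcs_Cons Fs_Cons ssum3_snoc W_def add.assoc)
  have "Ts w (\<lambda>u. Fcs f u \<phi>) = sgx ((fst l + 1) * wd u) (Fcs f (l # u) \<phi>)"
   by (simp only: snoc Ts_snoc)
  also have "\<dots> = sgx ((fst l + 1) * wd u)
     (ssum (\<lambda>y z. sgx (wd z * (fst l + 1 + wd y)) (Fs f y (\<lambda>u. \<phi> (f (z @ [l]) # u)))) u)
    + sgx ((fst l + 1) * wd u)
     (ssum3 (\<lambda>x y z. sgx (wd z * (fst l + 1 + (fst a + 1 + wd x) + wd y)) (Fs f y (\<lambda>u. \<phi> (f (z @ l # a # x) # u)))) v)"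
   by (simp add: Fcs_Cons Cons ssum3_Cons sgx_add add.assoc del: ssum.simps)
  also have "sgx ((fst l + 1) * wd u)
     (ssum3 (\<lambda>x y z. sgx (wd z * (fst l + 1 + (fst a + 1 + wd x) + wd y)) (Fs f y (\<lambda>u. \<phi> (f (z @ l # a # x) # u)))) v) = W"
   unfolding W_def
   by (subst ssum3_hom) (auto intro!: ssum3_cong sgx_cong simp: Cons)
  also have "sgx ((fst l + 1) * wd u)
     (ssum (\<lambda>y z. sgx (wd z * (fst l + 1 + wd y)) (Fs f y (\<lambda>u. \<phi> (f (z @ [l]) # u)))) u)
    = ssum (\<lambda>z' z. Fs f z' (\<lambda>t. Ts (t @ [f (z @ [l])]) \<phi>)) u"
   unfolding Ts_snoc
   by (subst ssum_hom) (auto intro!: ssum_cong Fs_cong sgx_cong simp: f_deg Fs_hom[of "sgx _"])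
  finally have "Ts w (\<lambda>u. Fcs f u \<phi>) = W + Fs f w (\<lambda>u. Ts u \<phi>)"
   by (simp add: snoc Fs_snoc algebra_simps)
  with 1 show ?thesis by simp
 qed
qed (use assms in simp)

text \<open>Two nestings of the cuttings of \<open>v\<close> into four pieces: on the left the
  middle one of three pieces is cut again, on the right each of two pieces. The next lemma does the
  same with five pieces.\<close>

lemma ssum_reindex4:
 "ssum3 (\<lambda>x y z. ssum (\<lambda>p q. G x p q z) y) v =
  ssum (\<lambda>X Y. ssum (\<lambda>z' z. ssum (\<lambda>x x'. G x x' z' z) X) Y) v"
proof -
 have "ssum (\<lambda>X Y. ssum (\<lambda>z' z. ssum (\<lambda>x x'. G x x' z' z) X) Y) v =
  ssum (\<lambda>X Y. ssum (\<lambda>x x'. ssum (\<lambda>z' z. G x x' z' z) Y) X) v"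
  by (rule ssum_cong) (rule ssum_swap)
 also have "\<dots> = ssum (\<lambda>x u. ssum (\<lambda>x' Y. ssum (\<lambda>z' z. G x x' z' z) Y) u) v"
  by (rule ssum_assoc[symmetric])
 finally show ?thesis
  by (simp add: ssum3_def ssum_assoc)
qed

lemma ssum_reindex5:
 "ssum3 (\<lambda>x y z. ssum3 (\<lambda>x' y' z'. G x x' y' z' z) y) v =
  ssum3 (\<lambda>X Y Z. ssum (\<lambda>z' z. ssum (\<lambda>x x'. G x x' Y z' z) X) Z) v"
proof -
 have "ssum3 (\<lambda>X Y Z. ssum (\<lambda>z' z. ssum (\<lambda>x x'. G x x' Y z' z) X) Z) v =
  ssum (\<lambda>X u. ssum (\<lambda>x x'. ssum (\<lambda>Y Z. ssum (\<lambda>z' z. G x x' Y z' z) Z) u) X) v"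
  unfolding ssum3_def
 proof (rule ssum_cong)
  fix X u
  show "ssum (\<lambda>Y Z. ssum (\<lambda>z' z. ssum (\<lambda>x x'. G x x' Y z' z) X) Z) u =
   ssum (\<lambda>x x'. ssum (\<lambda>Y Z. ssum (\<lambda>z' z. G x x' Y z' z) Z) u) X"
   unfolding ssum_swap[of _ X u, symmetric] by (intro ssum_cong ssum_swap)
 qed
 also have "\<dots> = ssum (\<lambda>x t. ssum (\<lambda>x' u. ssum (\<lambda>Y Z. ssum (\<lambda>z' z. G x x' Y z' z) Z) u) t) v"
  by (rule ssum_assoc[symmetric])
 also have "\<dots> = ssum3 (\<lambda>x y z. ssum3 (\<lambda>x' y' z'. G x x' y' z' z) y) v"
  unfolding ssum3_def
  by (intro ssum_cong trans[OF ssum_cong[OF ssum_assoc] ssum_assoc])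
 finally show ?thesis by simp
qed

text \<open>Nb = b'N: both sides run over a rotation together with a block of the rotated word. The
  fact \<open>mid\<close> collects the blocks through the marked letter \<open>a\<close>,
  \<open>out\<close> the others.\<close>

lemma (in m_degree) bs_N: "bs m w (\<lambda>u. Ns u \<phi>) = Ns w (\<lambda>u. Bs m u \<phi>)"
proof (cases w)
 case (Cons a v)
 let ?s = "\<lambda>x y. wd y * (fst a + 1 + wd x)"
 have mid: "ssum3 (\<lambda>x y z. sgx (wd z * (fst a + 1 + wd x + wd y)) (Ns (m (z @ a # x) # y) \<phi>)) v =
  ssum (\<lambda>X Y. sgx (?s X Y)
   (ssum (\<lambda>z' z. ssum (\<lambda>x x'. sgx (wd z') (\<phi> (z' @ m (z @ a # x) # x'))) X) Y)) v"
 proof -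
  have "ssum3 (\<lambda>x y z. sgx (wd z * (fst a + 1 + wd x + wd y)) (Ns (m (z @ a # x) # y) \<phi>)) v =
   ssum3 (\<lambda>x y z. ssum (\<lambda>p q. sgx (wd z * (fst a + 1 + wd x + wd p + wd q) + wd q * (fst (m (z @ a # x)) + 1 + wd p))
    (\<phi> (q @ m (z @ a # x) # p))) y) v"
   unfolding Ns_Cons ssum_sgx sgx_simps
   by (auto intro!: ssum3_cong ssum_cong sgx_cong)
  then show ?thesis
   unfolding ssum_reindex4 ssum_sgx sgx_simps
   by (auto intro!: ssum_cong sgx_cong simp: m_deg)
 qed
 have out: "sgx (fst a + 1) (Bs m v (\<lambda>u. Ns (a # u) \<phi>)) =
  ssum (\<lambda>X Y. sgx (?s X Y) (sgx (wd Y + fst a + 1) (Bs m X (\<lambda>u. \<phi> (Y @ a # u)))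
    + Bs m Y (\<lambda>u. \<phi> (u @ a # X)))) v"
  unfolding Ns_Cons Bs_ssum ssum_sgx
  by (intro ssum_cong)
   (auto simp: sgx_add Bs_sgx intro!: arg_cong2[where f = "(+)"] Bs_cong sgx_cong)
 show ?thesis
  unfolding Cons bs_Cons mid out
  by (simp add: Ns_Cons Bs_middle sgx_add ssum_add add_ac)
qed simp

lemma (in f_degree) Fcs_N: "Fcs f w (\<lambda>u. Ns u \<phi>) = Ns w (\<lambda>u. Fs f u \<phi>)"
proof (cases w)
 case (Cons a v)
 have "Fs f y (\<lambda>u. Ns (f (z @ a # x) # u) \<phi>) = ssum (\<lambda>p q. sgx (wd q * (wd (z @ a # x) + wd p))
   (Fs f q (\<lambda>u'. Fs f p (\<lambda>u. \<phi> (u' @ f (z @ a # x) # u))))) y" for x y z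
  unfolding Ns_Cons Fs_ssum
  by (subst (2) Fs_swap) (auto simp: Fs_hom[of "sgx _"] f_deg intro!: ssum_cong Fs_cong sgx_cong)
 then have "Fcs f w (\<lambda>u. Ns u \<phi>) = ssum3 (\<lambda>x y z. ssum (\<lambda>p q. sgx (wd z * (fst a + 1 + wd x + (wd p + wd q)) + wd q * (wd (z @ a # x) + wd p))
   (Fs f q (\<lambda>u'. Fs f p (\<lambda>u. \<phi> (u' @ f (z @ a # x) # u))))) y) v"
  by (auto simp: Cons Fcs_Cons ssum_sgx intro!: ssum3_cong ssum_cong)
 also have "\<dots> = Ns w (\<lambda>u. Fs f u \<phi>)"
  unfolding ssum_reindex4
  by (auto simp: Cons Ns_Cons Fs_middle ssum_sgx intro!: ssum_cong sgx_cong)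
 finally show ?thesis .
qed simp

lemma Ns_eq_lsum: "Ns w \<phi> = lsum (\<lambda>p l q. sgx (wd (p @ [l]) * wd q) (\<phi> (q @ p @ [l]))) w"
proof (cases w)
 case (Cons a v)
 have "ssum (\<lambda>x y. sgx (wd x * wd y) (\<phi> (y @ x))) w = \<phi> w + Ns w \<phi>"
  by (auto simp: Cons Ns_Cons intro!: ssum_cong sgx_cong)
 then show ?thesis
  by (simp add: ssum_lsum1)
qed simp

text \<open>TN = N, because T permutes the summands of N with the signs that N carries; the shift is
  the passage between the two indexings of cuts by letters.\<close>

lemma Ns_T1: "Ns w (\<lambda>u. Ts u \<phi>) = Ns w \<phi>"
proof -
 have "Ns w (\<lambda>u. Ts u \<phi>) = lsum (\<lambda>p l q. sgx (wd p * wd (l # q)) (\<phi> (l # q @ p))) w"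
  unfolding Ns_eq_lsum append_assoc[symmetric] Ts_snoc
  by (auto intro!: lsum_cong sgx_cong)
 also have "\<dots> = Ns w \<phi>"
  unfolding Ns_eq_lsum
  using ssum_lsum1[of "\<lambda>x y. sgx (wd x * wd y) (\<phi> (y @ x))" w]
   ssum_lsum2[of "\<lambda>x y. sgx (wd x * wd y) (\<phi> (y @ x))" w] by simp
 finally show ?thesis .
qed

lemma Ns_T2: "Ts w (\<lambda>u. Ns u \<phi>) = Ns w \<phi>"
proof (cases w rule: rev_cases)
 case (snoc u l)
 have "Ts w (\<lambda>u. Ns u \<phi>) = ssum (\<lambda>x y. sgx (wd x * wd (y @ [l])) (\<phi> (y @ l # x))) u"
  unfolding snoc Ts_snoc Ns_Cons ssum_sgx
  by (auto intro!: ssum_cong sgx_cong)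
 also have "\<dots> = Ns w \<phi>"
  using ssum_lsum1[of "\<lambda>x y. sgx (wd x * wd y) (\<phi> (y @ x))" w]
  by (simp add: Ns_eq_lsum snoc ssum_append)
 finally show ?thesis .
qed simp

lemma sgx_even: "even e \<Longrightarrow> sgx e x = x"
 by (simp add: sgx_def)

section \<open>Relations modulo a subgroup\<close>

text \<open>Later \<open>S\<close> is a kernel of evaluation, the sums supported on words of a given
  degree, or a kernel enlarged by a lower filtration step; the membership lemmas serve all these
  cases at once.\<close>

locale subgrp =
 fixes S :: "'g::ab_group_add set"
 assumes zero [simp]: "0 \<in> S" and diff: "x \<in> S \<Longrightarrow> y \<in> S \<Longrightarrow> x - y \<in> S"
begin

lemma minus: "x \<in> S \<Longrightarrow> - x \<in> S"
 using diff[of 0 x] by simp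

lemma add: "x \<in> S \<Longrightarrow> y \<in> S \<Longrightarrow> x + y \<in> S"
 using diff[of x "- y"] minus by simp

lemma sgx: "x \<in> S \<Longrightarrow> sgx e x \<in> S"
 by (simp add: sgx_def minus)

lemma ssum: "(\<And>x y. x @ y = w \<Longrightarrow> \<phi> x y \<in> S) \<Longrightarrow> ssum \<phi> w \<in> S"
 by (induction w arbitrary: \<phi>) (auto intro!: add)

lemma ssum3: "(\<And>x y z. x @ y @ z = w \<Longrightarrow> \<phi> x y z \<in> S) \<Longrightarrow> ssum3 \<phi> w \<in> S"
 unfolding ssum3_def by (intro ssum) auto

lemma Bs:
 assumes "\<And>y. y \<in> lists V \<Longrightarrow> y \<noteq> [] \<Longrightarrow> m y \<in> V"
 shows "w \<in> lists V \<Longrightarrow> (\<And>u. u \<in> lists V \<Longrightarrow> \<phi> u \<in> S) \<Longrightarrow> Bs m w \<phi> \<in> S"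
proof (induction w arbitrary: \<phi>)
 case (Cons a v)
 have "ssum (\<lambda>x z. \<phi> (m (a # x) # z)) v \<in> S"
  using Cons.prems by (intro ssum Cons.prems) (auto intro!: assms)
 moreover have "Bs m v (\<lambda>u. \<phi> (a # u)) \<in> S"
  using Cons.prems by (intro Cons.IH) auto
 ultimately show ?case by (auto intro: add sgx)
qed simp

lemma Fs:
 assumes "\<And>y. y \<in> lists V \<Longrightarrow> y \<noteq> [] \<Longrightarrow> f y \<in> V'"
 shows "w \<in> lists V \<Longrightarrow> (\<And>u. u \<in> lists V' \<Longrightarrow> \<phi> u \<in> S) \<Longrightarrow> Fs f w \<phi> \<in> S"
proof (induction w arbitrary: \<phi> rule: length_induct)
 case (1 w)
 show ?case
 proof (cases w)
  case (Cons a v)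
  have "Fs f z (\<lambda>u. \<phi> (f (a # x) # u)) \<in> S" if "x @ z = v" for x z
   by (rule 1(1)[rule_format]) (use 1(2) that in \<open>auto simp: Cons intro!: 1(3) assms\<close>)
  then show ?thesis
   by (auto simp: Cons Fs_Cons intro!: ssum)
 qed (use 1 in auto)
qed

end

text \<open>\<open>Z\<close> plays the role of the linear relations between letters.\<close>

definition mult_mod ::
 "'l set \<Rightarrow> ('l \<Rightarrow>\<^sub>0 int) set \<Rightarrow> ('c \<Rightarrow>\<^sub>0 int) set \<Rightarrow> ('l list \<Rightarrow> ('c \<Rightarrow>\<^sub>0 int)) \<Rightarrow> bool" where
 "mult_mod V Z S \<phi> \<longleftrightarrow>
   (\<forall>x\<in>lists V. \<forall>z\<in>lists V. \<forall>\<zeta>\<in>Z. frag_extend (\<lambda>l. \<phi> (x @ l # z)) \<zeta> \<in> S)"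

lemma mult_modD:
 "mult_mod V Z S \<phi> \<Longrightarrow> x \<in> lists V \<Longrightarrow> z \<in> lists V \<Longrightarrow> \<zeta> \<in> Z \<Longrightarrow> frag_extend (\<lambda>l. \<phi> (x @ l # z)) \<zeta> \<in> S"
 by (auto simp: mult_mod_def)

lemma mult_mod_Cons: "mult_mod V Z S \<phi> \<Longrightarrow> c \<in> V \<Longrightarrow> mult_mod V Z S (\<lambda>u. \<phi> (c # u))"
 using mult_modD[of V Z S \<phi> "c # x" for x] by (auto simp: mult_mod_def)

text \<open>\<open>rel_m\<close> says that the corestriction of the squared coderivation vanishes,
  which is the A-infinity relation after suspension. Being a sum of letters, it can only vanish
  modulo the linear relations \<open>Z\<close>.\<close>

locale ainf_rel = m_degree m for m :: "'a word \<Rightarrow> int \<times> 'a" +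
 fixes V :: "(int \<times> 'a) set" and Z :: "((int \<times> 'a) \<Rightarrow>\<^sub>0 int) set"
 assumes m_V: "y \<in> lists V \<Longrightarrow> y \<noteq> [] \<Longrightarrow> m y \<in> V"
  and rel_m: "w \<in> lists V \<Longrightarrow> w \<noteq> [] \<Longrightarrow> Bs m w (\<lambda>u. frag_of (m u)) \<in> Z"
begin

lemma Bs_m_mem:
 assumes "mult_mod V Z S \<phi>" "x \<in> lists V" "z \<in> lists V" "w \<in> lists V" "w \<noteq> []"
 shows "Bs m w (\<lambda>u. \<phi> (x @ m u # z)) \<in> S"
 using mult_modD[OF assms(1-3) rel_m[OF assms(4,5)]]
 by (simp add: Bs_hom[of "frag_extend _", OF additive_frag_extend])

lemma Bs_m_mem':
 "mult_mod V Z S \<phi> \<Longrightarrow> z \<in> lists V \<Longrightarrow> w \<in> lists V \<Longrightarrow> w \<noteq> [] \<Longrightarrow> Bs m w (\<lambda>u. \<phi> (m u # z)) \<in> S"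
 using Bs_m_mem[of S \<phi> "[]"] by simp

text \<open>Two disjoint blocks are processed in both orders with opposite signs, since
  \<open>m\<close> is odd; those with one block at the left end form \<open>E\<close>. Nested
  blocks, \<open>G\<close> and \<open>H\<close>, make up the relation for the prefixes
  \<open>a # X\<close>.\<close>

lemma Bs_Bs:
 assumes "subgrp S"
 shows "mult_mod V Z S \<phi> \<Longrightarrow> w \<in> lists V \<Longrightarrow> Bs m w (\<lambda>u. Bs m u \<phi>) \<in> S"
proof (induction w arbitrary: \<phi>)
 case (Cons a v)
 interpret subgrp S by fact
 define E where "E = ssum (\<lambda>x z. sgx (fst a + 1 + wd x) (Bs m z (\<lambda>z'. \<phi> (m (a # x) # z')))) v"
 define H where "H = ssum (\<lambda>x z. sgx (fst a + 1) (Bs m x (\<lambda>x'. \<phi> (m (a # x') # z)))) v"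
 define G where "G = ssum (\<lambda>x z. ssum (\<lambda>p q. \<phi> (m (m (a # x) # p) # q)) z) v"
 have "sgx (fst (m (a # x)) + 1) t = - sgx (fst a + 1 + wd x) t" for x and t :: "'b \<Rightarrow>\<^sub>0 int"
  by (rule sgx_odd) (simp add: m_deg)
 then have 1: "ssum (\<lambda>x z. Bs m (m (a # x) # z) \<phi>) v = G - E"
  by (simp add: G_def E_def ssum_diff)
 have 2: "sgx (fst a + 1) (Bs m v (\<lambda>u. Bs m (a # u) \<phi>)) = H + E + Bs m v (\<lambda>u. Bs m u (\<lambda>u. \<phi> (a # u)))"
  by (simp add: H_def E_def Bs_add Bs_ssum Bs_sgx[symmetric] sgx_add ssum_add ssum_sgx sgx_even)
 have 3: "G + H = ssum (\<lambda>X q. Bs m (a # X) (\<lambda>u. \<phi> (m u # q))) v"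
  unfolding G_def H_def ssum_assoc by (simp add: ssum_add)
 have 4: "ssum (\<lambda>X q. Bs m (a # X) (\<lambda>u. \<phi> (m u # q))) v \<in> S"
  using Cons.prems(2) by (intro ssum Bs_m_mem'[OF Cons.prems(1)]) auto
 have 5: "Bs m v (\<lambda>u. Bs m u (\<lambda>u. \<phi> (a # u))) \<in> S"
  using Cons.prems by (intro Cons.IH mult_mod_Cons) auto
 have "Bs m (a # v) (\<lambda>u. Bs m u \<phi>) = (G - E) + (H + E + Bs m v (\<lambda>u. Bs m u (\<lambda>u. \<phi> (a # u))))"
  unfolding Bs.simps(2)[of m a v "\<lambda>u. Bs m u \<phi>"] 1 2 ..
 also have "\<dots> = (G + H) + Bs m v (\<lambda>u. Bs m u (\<lambda>u. \<phi> (a # u)))"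
  by simp
 also have "\<dots> \<in> S"
  unfolding 3 by (intro add 4 5)
 finally show ?case .
qed (use assms in \<open>simp add: subgrp.zero\<close>)

lemma Bs_ssum3:
 "Bs m v (\<lambda>u. ssum3 \<tau> u) = ssum3 (\<lambda>x y z. Bs m x (\<lambda>x'. \<tau> x' y z)
   + (sgx (wd x) (Bs m y (\<lambda>y'. \<tau> x y' z)) + sgx (wd x + wd y) (Bs m z (\<lambda>z'. \<tau> x y z')))) v"
proof -
 have "Bs m v (\<lambda>u. ssum3 \<tau> u) = ssum (\<lambda>x u. ssum (\<lambda>y z. Bs m x (\<lambda>x'. \<tau> x' y z)) u
   + sgx (wd x) (ssum (\<lambda>y z. Bs m y (\<lambda>y'. \<tau> x y' z) + sgx (wd y) (Bs m z (\<lambda>z'. \<tau> x y z'))) u)) v"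
  by (simp add: ssum3_def Bs_ssum Bs_ssum_swap)
 then show ?thesis
  by (simp add: ssum3_def ssum_add[symmetric] sgx_add ssum_sgx)
qed

text \<open>As for \<open>Bs\<close>, but the outer block may wrap around. Nested pairs with outer
  block through \<open>a\<close> give the relation for the rotated segment \<open>Z @ a # X\<close>,
  disjoint pairs with one block through \<open>a\<close> cancel between \<open>A\<close> and
  \<open>B\<close>, and pairs avoiding \<open>a\<close> are left to \<open>Bs_Bs\<close>.\<close>

lemma bs_bs:
 assumes "subgrp S" "mult_mod V Z S \<phi>" "w \<in> lists V"
 shows "bs m w (\<lambda>u. bs m u \<phi>) \<in> S"
proof (cases w)
 case (Cons a v)
 interpret subgrp S by fact
 let ?e = "\<lambda>x y z. wd z * (fst a + 1 + wd x + wd y)"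
 let ?T = "\<lambda>x y z. sgx (?e x y z) (\<phi> (m (z @ a # x) # y))"
 have A: "ssum3 (\<lambda>x y z. sgx (?e x y z) (bs m (m (z @ a # x) # y) \<phi>)) v =
  ssum3 (\<lambda>X Y Z. ssum (\<lambda>z' z. ssum (\<lambda>x x'. sgx (?e X Y Z + wd z') (\<phi> (m (z' @ m (z @ a # x) # x') # Y))) X) Z) v
  - ssum3 (\<lambda>x y z. sgx (?e x y z + fst a + 1 + wd x + wd z) (Bs m y (\<lambda>u. \<phi> (m (z @ a # x) # u)))) v"
  (is "?L = ?R1 - ?R2")
 proof -
  have "?L = ssum3 (\<lambda>x y z. ssum3 (\<lambda>x' y' z'. sgx (?e (x @ x') y' (z' @ z) + wd z')
    (\<phi> (m (z' @ m (z @ a # x) # x') # y'))) y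
   - sgx (?e x y z + fst a + 1 + wd x + wd z) (Bs m y (\<lambda>u. \<phi> (m (z @ a # x) # u)))) v"
  proof (rule ssum3_cong)
   fix x y z assume "x @ y @ z = v"
   let ?l = "m (z @ a # x)"
   have l: "fst ?l = wd (z @ a # x) - 2"
    by (simp add: m_deg)
   have "sgx (?e x y z) (bs m (?l # y) \<phi>) =
    ssum3 (\<lambda>x' y' z'. sgx (?e x y z + wd z' * (fst ?l + 1 + wd x' + wd y')) (\<phi> (m (z' @ ?l # x') # y'))) y
    + sgx (?e x y z + (fst ?l + 1)) (Bs m y (\<lambda>u. \<phi> (?l # u)))"
    by (simp add: bs_Cons sgx_add ssum3_hom[OF additive_sgx'])
   also have "ssum3 (\<lambda>x' y' z'. sgx (?e x y z + wd z' * (fst ?l + 1 + wd x' + wd y')) (\<phi> (m (z' @ ?l # x') # y'))) y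
    = ssum3 (\<lambda>x' y' z'. sgx (?e (x @ x') y' (z' @ z) + wd z') (\<phi> (m (z' @ ?l # x') # y'))) y"
    by (intro ssum3_cong sgx_cong) (auto simp: l)
   also have "sgx (?e x y z + (fst ?l + 1)) (Bs m y (\<lambda>u. \<phi> (?l # u))) =
    - sgx (?e x y z + fst a + 1 + wd x + wd z) (Bs m y (\<lambda>u. \<phi> (?l # u)))"
    by (rule sgx_odd) (auto simp: l)
   finally show "sgx (?e x y z) (bs m (?l # y) \<phi>) =
    ssum3 (\<lambda>x' y' z'. sgx (?e (x @ x') y' (z' @ z) + wd z') (\<phi> (m (z' @ ?l # x') # y'))) y
    - sgx (?e x y z + fst a + 1 + wd x + wd z) (Bs m y (\<lambda>u. \<phi> (?l # u)))"
    by simp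
  qed
  also have "\<dots> = ssum3 (\<lambda>x y z. ssum3 (\<lambda>x' y' z'. sgx (?e (x @ x') y' (z' @ z) + wd z')
    (\<phi> (m (z' @ m (z @ a # x) # x') # y'))) y) v - ?R2"
   by (simp add: ssum3_def ssum_diff)
  also have "ssum3 (\<lambda>x y z. ssum3 (\<lambda>x' y' z'. sgx (?e (x @ x') y' (z' @ z) + wd z')
    (\<phi> (m (z' @ m (z @ a # x) # x') # y'))) y) v = ?R1"
   unfolding ssum_reindex5 by (auto intro!: ssum3_cong ssum_cong)
  finally show ?thesis .
 qed
 have B: "sgx (fst a + 1) (Bs m v (\<lambda>u. bs m (a # u) \<phi>)) =
  ssum3 (\<lambda>X Y Z. sgx (?e X Y Z + wd Z + fst a + 1) (Bs m X (\<lambda>x'. \<phi> (m (Z @ a # x') # Y)))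
   + sgx (?e X Y Z) (Bs m Z (\<lambda>z'. \<phi> (m (z' @ a # X) # Y)))) v
  + ssum3 (\<lambda>x y z. sgx (?e x y z + fst a + 1 + wd x + wd z) (Bs m y (\<lambda>u. \<phi> (m (z @ a # x) # u)))) v
  + Bs m v (\<lambda>u. Bs m u (\<lambda>u. \<phi> (a # u)))"
  (is "?L = ?R1 + ?R2 + ?R3")
 proof -
  have "?L = sgx (fst a + 1) (Bs m v (\<lambda>u. ssum3 ?T u)) + ?R3"
   unfolding bs_Cons by (simp add: Bs_add sgx_add Bs_sgx[symmetric] sgx_even)
  also have "sgx (fst a + 1) (Bs m v (\<lambda>u. ssum3 ?T u)) = ssum3 (\<lambda>X Y Z.
    sgx (?e X Y Z + wd Z + fst a + 1) (Bs m X (\<lambda>x'. \<phi> (m (Z @ a # x') # Y)))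
   + (sgx (?e X Y Z + fst a + 1 + wd X + wd Z) (Bs m Y (\<lambda>u. \<phi> (m (Z @ a # X) # u)))
   + sgx (?e X Y Z) (Bs m Z (\<lambda>z'. \<phi> (m (z' @ a # X) # Y))))) v"
   unfolding Bs_ssum3 ssum3_hom[OF additive_sgx'] sgx_add Bs_sgx sgx_simps
   by (intro ssum3_cong arg_cong2[where f = "(+)"] Bs_cong sgx_cong) auto
  also have "\<dots> = ?R1 + ?R2"
   by (simp add: ssum3_add add_ac)
  finally show ?thesis .
 qed
 have "bs m w (\<lambda>u. bs m u \<phi>) = ssum3 (\<lambda>X Y Z. sgx (?e X Y Z) (Bs m (Z @ a # X) (\<lambda>u. \<phi> (m u # Y)))) v
   + Bs m v (\<lambda>u. Bs m u (\<lambda>u. \<phi> (a # u)))"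
  unfolding Cons bs_Cons[of m a v "\<lambda>u. bs m u \<phi>"] A B Bs_middle sgx_add ssum3_add ssum_sgx sgx_simps
  by (simp add: algebra_simps)
 also have "\<dots> \<in> S"
 proof (intro add ssum3 sgx)
  fix x y z assume "x @ y @ z = v"
  then show "Bs m (z @ a # x) (\<lambda>u. \<phi> (m u # y)) \<in> S"
   using assms(3) Cons by (intro Bs_m_mem'[OF assms(2)]) auto
 next
  show "Bs m v (\<lambda>u. Bs m u (\<lambda>u. \<phi> (a # u))) \<in> S"
   using assms Cons by (intro Bs_Bs mult_mod_Cons) auto
 qed
 finally show ?thesis .
qed (use assms in \<open>simp add: subgrp.zero\<close>)

end

section \<open>Morphisms and bar differentials\<close>

lemma Fs_zero [simp]: "Fs f w (\<lambda>u. 0) = 0"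
 using Fs_diff[of f w "\<lambda>u. 0" "\<lambda>u. 0"] by simp

lemma Fs_Bs_swap: "Fs f y (\<lambda>u'. Bs m w (\<lambda>u. \<tau> u u')) = Bs m w (\<lambda>u. Fs f y (\<lambda>u'. \<tau> u u'))"
 by (induction w arbitrary: \<tau>) (auto simp: Fs_add Fs_ssum_swap Fs_hom[of "sgx _", symmetric])

lemma Fs_ssum3:
 "Fs f y (\<lambda>u. ssum3 \<tau> u) = ssum3 (\<lambda>p q r. Fs f p (\<lambda>p'. Fs f q (\<lambda>q'. Fs f r (\<lambda>r'. \<tau> p' q' r')))) y"
 by (simp add: ssum3_def Fs_ssum Fs_ssum_swap)

text \<open>With F the coalgebra map whose components are \<open>f\<close>, the element in
  \<open>rel_f\<close> is the corestriction of Fb' - b'F.\<close>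

locale ainf_mor_rel = A: ainf_rel mA VA ZA + B: ainf_rel mB VB ZB + f_degree f
 for mA :: "'a word \<Rightarrow> int \<times> 'a" and VA ZA
  and mB :: "'b word \<Rightarrow> int \<times> 'b" and VB ZB
  and f :: "'a word \<Rightarrow> int \<times> 'b" +
 assumes f_V: "y \<in> lists VA \<Longrightarrow> y \<noteq> [] \<Longrightarrow> f y \<in> VB"
  and rel_f: "w \<in> lists VA \<Longrightarrow> w \<noteq> [] \<Longrightarrow>
   Bs mA w (\<lambda>u. frag_of (f u)) - Fs f w (\<lambda>u. frag_of (mB u)) \<in> ZB"
begin

text \<open>The relation is applied to the first output letter; \<open>Fs_swap\<close> and
  \<open>Fs_Bs_swap\<close> bring the sum over the later blocks outside, where membership can be
  tested termwise.\<close>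

lemma rel_f_mem:
 assumes S: "subgrp S" and "mult_mod VB ZB S \<phi>" "w \<in> lists VA" "w \<noteq> []" "y \<in> lists VA"
 shows "Bs mA w (\<lambda>u. Fs f y (\<lambda>u'. \<phi> (f u # u'))) - Fs f w (\<lambda>u. Fs f y (\<lambda>u'. \<phi> (mB u # u'))) \<in> S"
proof -
 interpret subgrp S by fact
 have "Fs f y (\<lambda>u'. frag_extend (\<lambda>l. \<phi> ([] @ l # u')) (Bs mA w (\<lambda>u. frag_of (f u)) - Fs f w (\<lambda>u. frag_of (mB u)))) \<in> S"
  using assms by (intro Fs[of VA f VB] f_V mult_modD[OF assms(2)] rel_f) auto
 moreover have "frag_extend \<psi> (Bs mA w (\<lambda>u. frag_of (f u)) - Fs f w (\<lambda>u. frag_of (mB u))) =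
   Bs mA w (\<lambda>u. \<psi> (f u)) - Fs f w (\<lambda>u. \<psi> (mB u))" for \<psi> :: "int \<times> 'b \<Rightarrow> 'c \<Rightarrow>\<^sub>0 int"
  by (simp add: frag_extend_diff Bs_hom[of "frag_extend _", OF additive_frag_extend]
    Fs_hom[of "frag_extend _", OF additive_frag_extend])
 ultimately show ?thesis
  by (simp add: Fs_diff Fs_swap[of f y f w] Fs_Bs_swap)
qed

text \<open>A term either affects the first output letter, and then belongs to the relation for a
  prefix \<open>a # X\<close>, or leaves a first block \<open>a # x\<close> untouched, and then
  belongs to the shorter word behind it.\<close>

lemma Bs_Fs:
 assumes S: "subgrp S"
 shows "mult_mod VB ZB S \<phi> \<Longrightarrow> w \<in> lists VA \<Longrightarrow>
  Bs mA w (\<lambda>u. Fs f u \<phi>) - Fs f w (\<lambda>u. Bs mB u \<phi>) \<in> S"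
proof (induction w arbitrary: \<phi> rule: length_induct)
 case (1 w)
 interpret subgrp S by fact
 show ?case
 proof (cases w)
  case (Cons a v)
  let ?L = "\<lambda>x z. Bs mA z (\<lambda>u. Fs f u (\<lambda>u. \<phi> (f (a # x) # u)))"
  let ?R = "\<lambda>x z. Fs f z (\<lambda>u. Bs mB u (\<lambda>u. \<phi> (f (a # x) # u)))"
  have L: "Bs mA w (\<lambda>u. Fs f u \<phi>) =
    ssum (\<lambda>X q. Bs mA (a # X) (\<lambda>u. Fs f q (\<lambda>u'. \<phi> (f u # u')))) v
    + ssum (\<lambda>x z. sgx (fst a + 1 + wd x) (?L x z)) v"
   unfolding Cons
   by (simp add: Fs_Cons A.Bs_ssum ssum_assoc ssum_add sgx_add ssum_sgx add.assoc)
  have R: "Fs f w (\<lambda>u. Bs mB u \<phi>) =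
    ssum (\<lambda>X q. Fs f (a # X) (\<lambda>u. Fs f q (\<lambda>u'. \<phi> (mB u # u')))) v
    + ssum (\<lambda>x z. sgx (fst a + 1 + wd x) (?R x z)) v"
   unfolding Cons
   by (simp add: Fs_Cons Fs_add Fs_ssum ssum_assoc ssum_add f_deg Fs_hom[of "sgx _", symmetric] add_ac)
  have "Bs mA w (\<lambda>u. Fs f u \<phi>) - Fs f w (\<lambda>u. Bs mB u \<phi>) =
   ssum (\<lambda>X q. Bs mA (a # X) (\<lambda>u. Fs f q (\<lambda>u'. \<phi> (f u # u')))
    - Fs f (a # X) (\<lambda>u. Fs f q (\<lambda>u'. \<phi> (mB u # u')))) v
   + ssum (\<lambda>x z. sgx (fst a + 1 + wd x) (?L x z - ?R x z)) v"
   unfolding L R sgx_diff ssum_diff by simp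
  also have "\<dots> \<in> S"
  proof (intro add ssum sgx)
   fix x y assume xy: "x @ y = v"
   then show "Bs mA (a # x) (\<lambda>u. Fs f y (\<lambda>u'. \<phi> (f u # u')))
    - Fs f (a # x) (\<lambda>u. Fs f y (\<lambda>u'. \<phi> (mB u # u'))) \<in> S"
    using 1(3) by (intro rel_f_mem[OF S 1(2)]) (auto simp: Cons)
   show "?L x y - ?R x y \<in> S"
    using xy 1(2,3) by (intro 1(1)[rule_format] mult_mod_Cons f_V) (auto simp: Cons)
  qed
  finally show ?thesis .
 qed simp
qed

text \<open>The prefixes are replaced by the rotated segments \<open>Z @ a # X\<close>, to which the
  relation is applied; what happens in the complementary segment \<open>Y\<close> is the noncyclic
  statement.\<close>

lemma bs_Fcs:
 assumes S: "subgrp S" and \<phi>: "mult_mod VB ZB S \<phi>" and w: "w \<in> lists VA"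
 shows "bs mA w (\<lambda>u. Fcs f u \<phi>) - Fcs f w (\<lambda>u. bs mB u \<phi>) \<in> S"
proof (cases w)
 case (Cons a v)
 interpret subgrp S by fact
 let ?e = "\<lambda>x y z. wd z * (fst a + 1 + wd x + wd y)"
 let ?T = "\<lambda>x y z. sgx (?e x y z) (Fs f y (\<lambda>u. \<phi> (f (z @ a # x) # u)))"
 let ?d = "\<lambda>x y z. ?e x y z + fst a + 1 + wd x + wd z"
 have A1: "ssum3 (\<lambda>x y z. sgx (?e x y z) (Fcs f (mA (z @ a # x) # y) \<phi>)) v =
  ssum3 (\<lambda>X Y Z. ssum (\<lambda>z' z. ssum (\<lambda>x x'. sgx (?e X Y Z + wd z')
   (Fs f Y (\<lambda>u. \<phi> (f (z' @ mA (z @ a # x) # x') # u)))) X) Z) v"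
 proof -
  have "ssum3 (\<lambda>x y z. sgx (?e x y z) (Fcs f (mA (z @ a # x) # y) \<phi>)) v =
   ssum3 (\<lambda>x y z. ssum3 (\<lambda>x' y' z'. sgx (?e (x @ x') y' (z' @ z) + wd z')
    (Fs f y' (\<lambda>u. \<phi> (f (z' @ mA (z @ a # x) # x') # u)))) y) v"
   unfolding Fcs_Cons ssum3_hom[OF additive_sgx'] sgx_simps
   by (intro ssum3_cong sgx_cong) (auto simp: A.m_deg)
  then show ?thesis
   unfolding ssum_reindex5 by (auto intro!: ssum3_cong ssum_cong)
 qed
 have A2: "sgx (fst a + 1) (Bs mA v (\<lambda>u. Fcs f (a # u) \<phi>)) = ssum3 (\<lambda>X Y Z.
    sgx (?e X Y Z + wd Z + fst a + 1) (Bs mA X (\<lambda>x'. Fs f Y (\<lambda>u. \<phi> (f (Z @ a # x') # u))))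
   + (sgx (?d X Y Z) (Bs mA Y (\<lambda>y. Fs f y (\<lambda>u. \<phi> (f (Z @ a # X) # u))))
   + sgx (?e X Y Z) (Bs mA Z (\<lambda>z'. Fs f Y (\<lambda>u. \<phi> (f (z' @ a # X) # u)))))) v"
  unfolding Fcs_Cons A.Bs_ssum3 ssum3_hom[OF additive_sgx'] sgx_add Bs_sgx sgx_simps
  by (intro ssum3_cong arg_cong2[where f = "(+)"] A.Bs_cong sgx_cong) auto
 have A: "bs mA w (\<lambda>u. Fcs f u \<phi>) = ssum3 (\<lambda>X Y Z.
    sgx (?e X Y Z) (Bs mA (Z @ a # X) (\<lambda>u. Fs f Y (\<lambda>u'. \<phi> (f u # u'))))
   + sgx (?d X Y Z) (Bs mA Y (\<lambda>y. Fs f y (\<lambda>u. \<phi> (f (Z @ a # X) # u))))) v"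
  unfolding Cons bs_Cons A1 A2 Bs_middle sgx_add ssum3_add ssum_sgx sgx_simps
  by (simp add: algebra_simps)
 have B1: "Fs f y (\<lambda>u. ssum3 (\<lambda>x' y' z'. sgx (wd z' * (fst (f (z @ a # x)) + 1 + wd x' + wd y'))
    (\<phi> (mB (z' @ f (z @ a # x) # x') # y'))) u)
  = ssum3 (\<lambda>x' y' z'. sgx (wd z' * (wd (z @ a # x) + wd x' + wd y')) (Fs f z' (\<lambda>u. Fs f x' (\<lambda>u'.
    Fs f y' (\<lambda>t. \<phi> (mB (u @ f (z @ a # x) # u') # t)))))) y" for x y z
 proof -
  have "Fs f p (\<lambda>p'. Fs f q (\<lambda>q'. Fs f r (\<lambda>z'. sgx (wd z' * (fst (f (z @ a # x)) + 1 + wd p' + wd q'))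
    (\<phi> (mB (z' @ f (z @ a # x) # p') # q')))))
   = Fs f p (\<lambda>p'. Fs f q (\<lambda>q'. Fs f r (\<lambda>z'. sgx (wd r * (wd (z @ a # x) + wd p + wd q))
    (\<phi> (mB (z' @ f (z @ a # x) # p') # q')))))" for p q r
   by (intro Fs_cong sgx_cong) (auto simp: f_deg)
  moreover have "Fs f p (\<lambda>p'. Fs f q (\<lambda>q'. Fs f r (\<lambda>z'. \<phi> (mB (z' @ f (z @ a # x) # p') # q')))) =
   Fs f r (\<lambda>z'. Fs f p (\<lambda>p'. Fs f q (\<lambda>q'. \<phi> (mB (z' @ f (z @ a # x) # p') # q'))))" for p q r
   unfolding Fs_swap[of f q f r] by (rule Fs_swap)
  ultimately show ?thesis
   by (simp add: Fs_ssum3 Fs_hom[of "sgx _", symmetric])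
 qed
 have B2: "sgx (?e x y z) (Fs f y (\<lambda>u. bs mB (f (z @ a # x) # u) \<phi>)) =
   ssum3 (\<lambda>x' y' z'. sgx (?e (x @ x') y' (z' @ z)) (Fs f z' (\<lambda>u. Fs f x' (\<lambda>u'.
    Fs f y' (\<lambda>t. \<phi> (mB (u @ f (z @ a # x) # u') # t)))))) y
   + sgx (?d x y z) (Fs f y (\<lambda>u. Bs mB u (\<lambda>u. \<phi> (f (z @ a # x) # u))))" for x y z
  unfolding bs_Cons Fs_add B1 sgx_add Fs_hom[OF additive_sgx', symmetric] ssum3_hom[OF additive_sgx'] sgx_simps
  by (intro ssum3_cong arg_cong2[where f = "(+)"] sgx_cong) (auto simp: f_deg)
 have B: "Fcs f w (\<lambda>u. bs mB u \<phi>) = ssum3 (\<lambda>X Y Z.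
    sgx (?e X Y Z) (Fs f (Z @ a # X) (\<lambda>u. Fs f Y (\<lambda>u'. \<phi> (mB u # u'))))
   + sgx (?d X Y Z) (Fs f Y (\<lambda>u. Bs mB u (\<lambda>u. \<phi> (f (Z @ a # X) # u))))) v"
  unfolding Cons Fcs_Cons B2 ssum3_add ssum_reindex5 Fs_middle ssum_sgx
  by (intro arg_cong2[where f = "(+)"] ssum3_cong ssum_cong) auto
 have "bs mA w (\<lambda>u. Fcs f u \<phi>) - Fcs f w (\<lambda>u. bs mB u \<phi>) = ssum3 (\<lambda>X Y Z.
    sgx (?e X Y Z) (Bs mA (Z @ a # X) (\<lambda>u. Fs f Y (\<lambda>u'. \<phi> (f u # u')))
     - Fs f (Z @ a # X) (\<lambda>u. Fs f Y (\<lambda>u'. \<phi> (mB u # u'))))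
   + sgx (?d X Y Z) (Bs mA Y (\<lambda>y. Fs f y (\<lambda>u. \<phi> (f (Z @ a # X) # u)))
     - Fs f Y (\<lambda>u. Bs mB u (\<lambda>u. \<phi> (f (Z @ a # X) # u))))) v"
  unfolding A B ssum3_add sgx_diff by (simp add: ssum3_def ssum_diff)
 also have "\<dots> \<in> S"
 proof (intro add ssum3 sgx)
  fix X Y Z assume xyz: "X @ Y @ Z = v"
  show "Bs mA (Z @ a # X) (\<lambda>u. Fs f Y (\<lambda>u'. \<phi> (f u # u')))
     - Fs f (Z @ a # X) (\<lambda>u. Fs f Y (\<lambda>u'. \<phi> (mB u # u'))) \<in> S"
   using w xyz by (intro rel_f_mem[OF S \<phi>]) (auto simp: Cons)
  show "Bs mA Y (\<lambda>y. Fs f y (\<lambda>u. \<phi> (f (Z @ a # X) # u)))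
     - Fs f Y (\<lambda>u. Bs mB u (\<lambda>u. \<phi> (f (Z @ a # X) # u))) \<in> S"
   using w xyz by (intro Bs_Fs[OF S] mult_mod_Cons[OF \<phi>] f_V) (auto simp: Cons)
 qed
 finally show ?thesis .
qed (use S in \<open>simp add: subgrp.zero\<close>)

end

section \<open>Composition of morphisms on words\<close>

locale comp_rel = f: f_degree f + g: f_degree g + k: f_degree k
 for f :: "'a word \<Rightarrow> int \<times> 'b" and g :: "'b word \<Rightarrow> int \<times> 'c"
  and k :: "'a word \<Rightarrow> int \<times> 'c" +
 fixes VA VB VC ZC
 assumes f_V: "y \<in> lists VA \<Longrightarrow> y \<noteq> [] \<Longrightarrow> f y \<in> VB"
  and g_V: "y' \<in> lists VB \<Longrightarrow> y' \<noteq> [] \<Longrightarrow> g y' \<in> VC"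
  and k_V: "y \<in> lists VA \<Longrightarrow> y \<noteq> [] \<Longrightarrow> k y \<in> VC"
  and rel_k: "w \<in> lists VA \<Longrightarrow> w \<noteq> [] \<Longrightarrow> frag_of (k w) - Fs f w (\<lambda>u. frag_of (g u)) \<in> ZC"
begin

lemma rel_k_mem:
 assumes S: "subgrp S" and "mult_mod VC ZC S \<phi>" "w \<in> lists VA" "w \<noteq> []" "y \<in> lists VA"
 shows "Fs k y (\<lambda>u'. \<phi> (k w # u')) - Fs f w (\<lambda>u. Fs k y (\<lambda>u'. \<phi> (g u # u'))) \<in> S"
proof -
 interpret subgrp S by fact
 have "Fs k y (\<lambda>u'. frag_extend (\<lambda>l. \<phi> ([] @ l # u')) (frag_of (k w) - Fs f w (\<lambda>u. frag_of (g u)))) \<in> S"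
  using assms by (intro Fs[of VA k VC] k_V mult_modD[OF assms(2)] rel_k) auto
 moreover have "frag_extend \<psi> (frag_of (k w) - Fs f w (\<lambda>u. frag_of (g u))) =
   \<psi> (k w) - Fs f w (\<lambda>u. \<psi> (g u))" for \<psi> :: "int \<times> 'c \<Rightarrow> 'd \<Rightarrow>\<^sub>0 int"
  by (simp add: frag_extend_diff Fs_hom[of "frag_extend _", OF additive_frag_extend])
 ultimately show ?thesis
  by (simp add: Fs_diff Fs_swap[of k y f w])
qed

text \<open>Interpolation through \<open>?M\<close>: the leading letter \<open>k (a # x)\<close> is
  expanded by the relation, the remaining word by induction.\<close>

lemma Fs_comp:
 assumes S: "subgrp S"
 shows "mult_mod VC ZC S \<phi> \<Longrightarrow> w \<in> lists VA \<Longrightarrow> Fs k w \<phi> - Fs f w (\<lambda>u. Fs g u \<phi>) \<in> S"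
proof (induction w arbitrary: \<phi> rule: length_induct)
 case (1 w)
 interpret subgrp S by fact
 show ?case
 proof (cases w)
  case (Cons a v)
  let ?M = "\<lambda>x z. Fs f (a # x) (\<lambda>u. Fs k z (\<lambda>u'. \<phi> (g u # u')))"
  let ?N = "\<lambda>x z. Fs f (a # x) (\<lambda>u. Fs f z (\<lambda>u'. Fs g u' (\<lambda>t. \<phi> (g u # t))))"
  have R: "Fs f w (\<lambda>u. Fs g u \<phi>) = ssum ?N v"
   unfolding Cons
   by (simp add: Fs_Cons Fs_ssum ssum_assoc)
  have "Fs k w \<phi> - Fs f w (\<lambda>u. Fs g u \<phi>) =
   ssum (\<lambda>x z. (Fs k z (\<lambda>u. \<phi> (k (a # x) # u)) - ?M x z) + (?M x z - ?N x z)) v"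
   unfolding R unfolding Cons Fs_Cons[of k a v \<phi>] by (simp add: ssum_diff)
  also have "\<dots> \<in> S"
  proof (intro add ssum)
   fix x z assume xz: "x @ z = v"
   then show "Fs k z (\<lambda>u. \<phi> (k (a # x) # u)) - ?M x z \<in> S"
    using 1(3) by (intro rel_k_mem[OF S 1(2)]) (auto simp: Cons)
   have "Fs k z (\<lambda>t. \<phi> (g u # t)) - Fs f z (\<lambda>u'. Fs g u' (\<lambda>t. \<phi> (g u # t))) \<in> S"
    if "u \<in> lists VB" "u \<noteq> []" for u
    using xz 1(2,3) that by (intro 1(1)[rule_format] mult_mod_Cons g_V) (auto simp: Cons)
   \<comment> \<open>A nonempty word never yields the empty subdivision, but the membership lemma
     quantifies over all output words. The value 0 covers the empty one, where \<open>g u\<close>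
     need not be a letter of \<open>VC\<close>.\<close>
   then have "Fs f (a # x) (\<lambda>u. if u = [] then 0 else Fs k z (\<lambda>t. \<phi> (g u # t)) - Fs f z (\<lambda>u'. Fs g u' (\<lambda>t. \<phi> (g u # t)))) \<in> S"
    using xz 1(3) by (intro Fs[of VA f VB]) (auto simp: Cons f_V)
   then show "?M x z - ?N x z \<in> S"
    by (simp add: Fs_Cons Fs_diff ssum_diff)
  qed
  finally show ?thesis .
 qed simp
qed

lemma Fcs_comp:
 assumes S: "subgrp S" and \<phi>: "mult_mod VC ZC S \<phi>" and w: "w \<in> lists VA"
 shows "Fcs k w \<phi> - Fcs f w (\<lambda>u. Fcs g u \<phi>) \<in> S"
proof (cases w)
 case (Cons a v)
 interpret subgrp S by fact
 let ?e = "\<lambda>x y z. wd z * (fst a + 1 + wd x + wd y)"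
 have B1: "Fs f y (\<lambda>u. ssum3 (\<lambda>x' y' z'. sgx (wd z' * (fst (f (z @ a # x)) + 1 + wd x' + wd y'))
    (Fs g y' (\<lambda>t. \<phi> (g (z' @ f (z @ a # x) # x') # t)))) u)
  = ssum3 (\<lambda>x' y' z'. sgx (wd z' * (wd (z @ a # x) + wd x' + wd y')) (Fs f z' (\<lambda>u. Fs f x' (\<lambda>u'.
    Fs f y' (\<lambda>y'. Fs g y' (\<lambda>t. \<phi> (g (u @ f (z @ a # x) # u') # t))))))) y" for x y z
 proof -
  have "Fs f p (\<lambda>p'. Fs f q (\<lambda>q'. Fs f r (\<lambda>z'. sgx (wd z' * (fst (f (z @ a # x)) + 1 + wd p' + wd q'))
    (Fs g q' (\<lambda>t. \<phi> (g (z' @ f (z @ a # x) # p') # t))))))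
   = Fs f p (\<lambda>p'. Fs f q (\<lambda>q'. Fs f r (\<lambda>z'. sgx (wd r * (wd (z @ a # x) + wd p + wd q))
    (Fs g q' (\<lambda>t. \<phi> (g (z' @ f (z @ a # x) # p') # t))))))" for p q r
   by (intro f.Fs_cong sgx_cong) (auto simp: f.f_deg)
  moreover have "Fs f p (\<lambda>p'. Fs f q (\<lambda>q'. Fs f r (\<lambda>z'. (Fs g q' (\<lambda>t. \<phi> (g (z' @ f (z @ a # x) # p') # t)))))) =
   Fs f r (\<lambda>z'. Fs f p (\<lambda>p'. Fs f q (\<lambda>q'. (Fs g q' (\<lambda>t. \<phi> (g (z' @ f (z @ a # x) # p') # t))))))" for p q r
   unfolding Fs_swap[of f q f r] by (rule Fs_swap)
  ultimately show ?thesis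
   by (simp add: Fs_ssum3 Fs_hom[of "sgx _", symmetric])
 qed
 have B2: "sgx (?e x y z) (Fs f y (\<lambda>u. Fcs g (f (z @ a # x) # u) \<phi>)) =
   ssum3 (\<lambda>x' y' z'. sgx (?e (x @ x') y' (z' @ z)) (Fs f z' (\<lambda>u. Fs f x' (\<lambda>u'.
    Fs f y' (\<lambda>y'. Fs g y' (\<lambda>t. \<phi> (g (u @ f (z @ a # x) # u') # t))))))) y" for x y z
  unfolding Fcs_Cons B1 ssum3_hom[OF additive_sgx'] sgx_simps
  by (intro ssum3_cong sgx_cong) auto
 have B: "Fcs f w (\<lambda>u. Fcs g u \<phi>) = ssum3 (\<lambda>X Y Z.
    sgx (?e X Y Z) (Fs f (Z @ a # X) (\<lambda>u. Fs f Y (\<lambda>y. Fs g y (\<lambda>t. \<phi> (g u # t)))))) v"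
  unfolding Cons Fcs_Cons[of f] B2 ssum_reindex5 Fs_middle ssum_sgx
  by (intro ssum3_cong ssum_cong) auto
 let ?K = "\<lambda>X Y Z. Fs k Y (\<lambda>u. \<phi> (k (Z @ a # X) # u))"
 let ?M = "\<lambda>X Y Z. Fs f (Z @ a # X) (\<lambda>u. Fs k Y (\<lambda>u'. \<phi> (g u # u')))"
 let ?N = "\<lambda>X Y Z. Fs f (Z @ a # X) (\<lambda>u. Fs f Y (\<lambda>y. Fs g y (\<lambda>t. \<phi> (g u # t))))"
 have "Fcs k w \<phi> - Fcs f w (\<lambda>u. Fcs g u \<phi>) =
  ssum3 (\<lambda>X Y Z. sgx (?e X Y Z) ((?K X Y Z - ?M X Y Z) + (?M X Y Z - ?N X Y Z))) v"
  unfolding B unfolding Cons Fcs_Cons[of k] by (simp add: sgx_diff ssum3_def ssum_diff)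
 also have "\<dots> \<in> S"
 proof (intro add ssum3 sgx)
  fix X Y Z assume xyz: "X @ Y @ Z = v"
  then show "?K X Y Z - ?M X Y Z \<in> S"
   using w by (intro rel_k_mem[OF S \<phi>]) (auto simp: Cons)
  have "Fs k Y (\<lambda>t. \<phi> (g u # t)) - Fs f Y (\<lambda>u'. Fs g u' (\<lambda>t. \<phi> (g u # t))) \<in> S"
   if "u \<in> lists VB" "u \<noteq> []" for u
   using xyz w that by (intro Fs_comp[OF S] mult_mod_Cons[OF \<phi>] g_V) (auto simp: Cons)
  then have "Fs f (Z @ a # X) (\<lambda>u. if u = [] then 0 else Fs k Y (\<lambda>t. \<phi> (g u # t)) - Fs f Y (\<lambda>u'. Fs g u' (\<lambda>t. \<phi> (g u # t)))) \<in> S"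
   using xyz w by (intro Fs[of VA f VB]) (auto simp: Cons f_V)
  then show "?M X Y Z - ?N X Y Z \<in> S"
   by (simp add: Fs_middle Fs_diff[symmetric] ssum_diff[symmetric])
 qed
 finally show ?thesis .
qed (use S in \<open>simp add: subgrp.zero\<close>)

end

section \<open>Linear maps\<close>

text \<open>\<open>lin_maps\<close> without extensionality: linearity of a composite or of a sum can
  then be stated without restricting it to the carrier.\<close>

definition lin_on where
 "lin_on K M N g \<longleftrightarrow> g \<in> carrier M \<rightarrow> carrier N \<and>
   (\<forall>x\<in>carrier M. \<forall>y\<in>carrier M. g (x \<oplus>\<^bsub>M\<^esub> y) = g x \<oplus>\<^bsub>N\<^esub> g y) \<and>
   (\<forall>c\<in>carrier K. \<forall>x\<in>carrier M. g (c \<odot>\<^bsub>M\<^esub> x) = c \<odot>\<^bsub>N\<^esub> g x)"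

lemma lin_onI:
 assumes "\<And>x. x \<in> carrier M \<Longrightarrow> g x \<in> carrier N"
  and "\<And>x y. x \<in> carrier M \<Longrightarrow> y \<in> carrier M \<Longrightarrow> g (x \<oplus>\<^bsub>M\<^esub> y) = g x \<oplus>\<^bsub>N\<^esub> g y"
  and "\<And>c x. c \<in> carrier K \<Longrightarrow> x \<in> carrier M \<Longrightarrow> g (c \<odot>\<^bsub>M\<^esub> x) = c \<odot>\<^bsub>N\<^esub> g x"
 shows "lin_on K M N g"
 using assms by (auto simp: lin_on_def)

lemma lin_onD:
 assumes "lin_on K M N g"
 shows "x \<in> carrier M \<Longrightarrow> g x \<in> carrier N"
  and "x \<in> carrier M \<Longrightarrow> y \<in> carrier M \<Longrightarrow> g (x \<oplus>\<^bsub>M\<^esub> y) = g x \<oplus>\<^bsub>N\<^esub> g y"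
  and "c \<in> carrier K \<Longrightarrow> x \<in> carrier M \<Longrightarrow> g (c \<odot>\<^bsub>M\<^esub> x) = c \<odot>\<^bsub>N\<^esub> g x"
 using assms by (auto simp: lin_on_def)

lemma lin_maps_lin_on: "\<phi> \<in> lin_maps K M N \<Longrightarrow> lin_on K M N \<phi>"
 by (auto simp: lin_maps_def lin_on_def)

lemma lin_maps_iff: "\<phi> \<in> lin_maps K M N \<longleftrightarrow> lin_on K M N \<phi> \<and> \<phi> \<in> extensional (carrier M)"
 by (auto simp: lin_maps_def lin_on_def PiE_def)

lemma lin_on_cong:
 assumes "module K M" and "\<And>x. x \<in> carrier M \<Longrightarrow> f x = g x"
 shows "lin_on K M N f \<longleftrightarrow> lin_on K M N g"
proof -
 interpret M: module K M by fact
 show ?thesis using assms(2) by (auto simp: lin_on_def Pi_def)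
qed

lemma lin_maps_restrict:
 assumes "module K M" "lin_on K M N f"
 shows "(\<lambda>x\<in>carrier M. f x) \<in> lin_maps K M N"
 using assms lin_on_cong[OF assms(1), of "\<lambda>x\<in>carrier M. f x" f]
 by (auto simp: lin_maps_iff)

lemma sgn_mult_simps [simp]:
 "sgn_mult M 0 x = x"
 by (auto simp: sgn_mult_def)

context
 fixes K :: "('k, 'r) ring_scheme" and M :: "('k, 'a) module"
 assumes M: "module K M"
begin

interpretation M: module K M by fact

lemma sgn_mult_closed [simp, intro]: "x \<in> carrier M \<Longrightarrow> sgn_mult M e x \<in> carrier M"
 by (simp add: sgn_mult_def)

lemma sgn_mult_add: "x \<in> carrier M \<Longrightarrow> y \<in> carrier M \<Longrightarrow> sgn_mult M e (x \<oplus>\<^bsub>M\<^esub> y) = sgn_mult M e x \<oplus>\<^bsub>M\<^esub> sgn_mult M e y"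
 by (simp add: sgn_mult_def M.minus_add)

lemma sgn_mult_smult: "c \<in> carrier K \<Longrightarrow> x \<in> carrier M \<Longrightarrow> sgn_mult M e (c \<odot>\<^bsub>M\<^esub> x) = c \<odot>\<^bsub>M\<^esub> sgn_mult M e x"
 by (simp add: sgn_mult_def M.smult_r_minus)

lemma sgn_mult_sgn_mult: "x \<in> carrier M \<Longrightarrow> sgn_mult M d (sgn_mult M e x) = sgn_mult M (d + e) x"
 by (auto simp: sgn_mult_def)

lemma sgn_mult_zero [simp]: "sgn_mult M e \<zero>\<^bsub>M\<^esub> = \<zero>\<^bsub>M\<^esub>"
 by (simp add: sgn_mult_def)

lemma sgn_mult_cong: "even (d - e) \<Longrightarrow> sgn_mult M d x = sgn_mult M e x"
 by (auto simp: sgn_mult_def)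

context
 fixes N :: "('k, 'b) module"
 assumes N: "module K N"
begin

interpretation N: module K N by fact

lemma lin_on_zero: "lin_on K M N g \<Longrightarrow> g \<zero>\<^bsub>M\<^esub> = \<zero>\<^bsub>N\<^esub>"
 using lin_onD(3)[of K M N g "\<zero>\<^bsub>K\<^esub>" "\<zero>\<^bsub>M\<^esub>"] lin_onD(1)[of K M N g "\<zero>\<^bsub>M\<^esub>"] by simp

lemma lin_on_minus: "lin_on K M N g \<Longrightarrow> x \<in> carrier M \<Longrightarrow> g (\<ominus>\<^bsub>M\<^esub> x) = \<ominus>\<^bsub>N\<^esub> g x"
 using lin_onD(3)[of K M N g "\<ominus>\<^bsub>K\<^esub> \<one>\<^bsub>K\<^esub>" x] lin_onD(1)[of K M N g x] by (simp add: M.smult_l_minus N.smult_l_minus)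

lemma lin_on_sgn_mult: "lin_on K M N g \<Longrightarrow> x \<in> carrier M \<Longrightarrow> g (sgn_mult M e x) = sgn_mult N e (g x)"
 by (simp add: sgn_mult_def lin_on_minus)

lemma lin_on_finsum:
 "lin_on K M N g \<Longrightarrow> f \<in> I \<rightarrow> carrier M \<Longrightarrow> g (finsum M f I) = finsum N (\<lambda>i. g (f i)) I"
proof (induction I rule: infinite_finite_induct)
 case (insert i I)
 then show ?case
  using lin_onD[OF insert.prems(1)]
  by (subst M.finsum_insert) (auto simp: N.finsum_insert Pi_def intro!: M.finsum_closed)
qed (auto simp: lin_on_zero M.finsum_infinite N.finsum_infinite)

lemma lin_on_add_fun:
 assumes "lin_on K M N f" "lin_on K M N g"
 shows "lin_on K M N (\<lambda>x. f x \<oplus>\<^bsub>N\<^esub> g x)"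
 using lin_onD[OF assms(1)] lin_onD[OF assms(2)]
 by (intro lin_onI) (simp_all add: N.a_ac N.smult_r_distr)

lemma lin_on_zero_fun: "lin_on K M N (\<lambda>x. \<zero>\<^bsub>N\<^esub>)"
 by (intro lin_onI) simp_all

lemma lin_on_finsum_fun:
 "(\<And>i. i \<in> I \<Longrightarrow> lin_on K M N (f i)) \<Longrightarrow> lin_on K M N (\<lambda>x. finsum N (\<lambda>i. f i x) I)"
proof (induction I rule: infinite_finite_induct)
 case (insert i I)
 have "lin_on K M N (\<lambda>x. f i x \<oplus>\<^bsub>N\<^esub> finsum N (\<lambda>i. f i x) I)"
  using insert by (intro lin_on_add_fun) auto
 then show ?case
  using insert.hyps lin_onD(1)[OF insert.prems]
  by (subst lin_on_cong[OF M, of _ "\<lambda>x. f i x \<oplus>\<^bsub>N\<^esub> finsum N (\<lambda>i. f i x) I"])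
   (auto intro!: N.finsum_insert)
qed (auto simp: lin_on_zero_fun N.finsum_infinite)

end

end

lemma lin_on_comp: "lin_on K M N f \<Longrightarrow> lin_on K N P g \<Longrightarrow> lin_on K M P (\<lambda>x. g (f x))"
 by (auto simp: lin_on_def Pi_def)

lemma lin_on_sgn_mult_fun:
 assumes "module K N" "lin_on K M N f" shows "lin_on K M N (\<lambda>x. sgn_mult N e (f x))"
 using lin_onD[OF assms(2)] assms(1)
 by (intro lin_onI) (simp_all add: sgn_mult_closed sgn_mult_add sgn_mult_smult)

section \<open>Direct sums\<close>

lemma dsum_simps [simp]:
 "carrier (Defs.dsum I M) = (\<Pi>\<^sub>E i\<in>I. carrier (M i))" "\<zero>\<^bsub>Defs.dsum I M\<^esub> = (\<lambda>i\<in>I. \<zero>\<^bsub>M i\<^esub>)"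
 "x \<oplus>\<^bsub>Defs.dsum I M\<^esub> y = (\<lambda>i\<in>I. x i \<oplus>\<^bsub>M i\<^esub> y i)" "c \<odot>\<^bsub>Defs.dsum I M\<^esub> x = (\<lambda>i\<in>I. c \<odot>\<^bsub>M i\<^esub> x i)"
 by (simp_all add: Defs.dsum_def)

lemma dsum_module:
 assumes K: "cring K" and M: "\<And>i. i \<in> I \<Longrightarrow> module K (M i)"
 shows "module K (Defs.dsum I M)"
proof -
 let ?D = "Defs.dsum I M"
 note ab = module.axioms(2)[OF M]
 note am = abelian_group.axioms(1)[OF ab]
 note cl = abelian_monoid.a_closed[OF am] abelian_monoid.zero_closed[OF am] abelian_group.a_inv_closed[OF ab] module.smult_closed[OF M]
 have e: "x = y" if "x \<in> (\<Pi>\<^sub>E i\<in>I. carrier (M i))" "y \<in> (\<Pi>\<^sub>E i\<in>I. carrier (M i))" "\<And>i. i \<in> I \<Longrightarrow> x i = y i" for x y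
  using that by (rule PiE_ext)
 have r: "restrict x I \<in> (\<Pi>\<^sub>E i\<in>I. carrier (M i))" if "\<And>i. i \<in> I \<Longrightarrow> x i \<in> carrier (M i)" for x
  using that by auto
 show ?thesis
 proof (rule moduleI[OF K])
  show "abelian_group ?D"
  proof (rule abelian_groupI)
   fix x y z assume "x \<in> carrier ?D" "y \<in> carrier ?D" "z \<in> carrier ?D"
   then have xyz [simp]: "\<And>i. i \<in> I \<Longrightarrow> x i \<in> carrier (M i)" "\<And>i. i \<in> I \<Longrightarrow> y i \<in> carrier (M i)" "\<And>i. i \<in> I \<Longrightarrow> z i \<in> carrier (M i)"
    by auto
   show "x \<oplus>\<^bsub>?D\<^esub> y \<in> carrier ?D"
    by (simp add: r cl)
   show "x \<oplus>\<^bsub>?D\<^esub> y \<oplus>\<^bsub>?D\<^esub> z = x \<oplus>\<^bsub>?D\<^esub> (y \<oplus>\<^bsub>?D\<^esub> z)"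
    by (simp, intro restrict_ext) (simp add: abelian_monoid.a_assoc[OF am])
   show "x \<oplus>\<^bsub>?D\<^esub> y = y \<oplus>\<^bsub>?D\<^esub> x"
    by (simp, intro restrict_ext) (simp add: abelian_monoid.a_comm[OF am])
  next
   fix x assume x: "x \<in> carrier ?D"
   then have [simp]: "\<And>i. i \<in> I \<Longrightarrow> x i \<in> carrier (M i)" by auto
   show "\<zero>\<^bsub>?D\<^esub> \<oplus>\<^bsub>?D\<^esub> x = x"
    using x by (simp, intro e) (auto simp: abelian_monoid.l_zero[OF am] cl)
   show "\<exists>y\<in>carrier ?D. y \<oplus>\<^bsub>?D\<^esub> x = \<zero>\<^bsub>?D\<^esub>"
    by (intro bexI[of _ "\<lambda>i\<in>I. \<ominus>\<^bsub>M i\<^esub> x i"]) (simp_all add: r cl abelian_group.l_neg[OF ab] cong: restrict_cong)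
  qed (simp add: r cl)
 next
  fix a x assume a: "a \<in> carrier K" and "x \<in> carrier ?D"
  then have [simp]: "\<And>i. i \<in> I \<Longrightarrow> x i \<in> carrier (M i)" by auto
  show "a \<odot>\<^bsub>?D\<^esub> x \<in> carrier ?D" using a by (simp add: r cl)
  fix b assume b: "b \<in> carrier K"
  show "(a \<oplus>\<^bsub>K\<^esub> b) \<odot>\<^bsub>?D\<^esub> x = a \<odot>\<^bsub>?D\<^esub> x \<oplus>\<^bsub>?D\<^esub> b \<odot>\<^bsub>?D\<^esub> x"
   using a b by (simp, intro restrict_ext) (simp add: module.smult_l_distr[OF M])
  show "(a \<otimes>\<^bsub>K\<^esub> b) \<odot>\<^bsub>?D\<^esub> x = a \<odot>\<^bsub>?D\<^esub> (b \<odot>\<^bsub>?D\<^esub> x)"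
   using a b by (simp, intro restrict_ext) (simp add: module.smult_assoc1[OF M])
 next
  fix a x y assume a: "a \<in> carrier K" and "x \<in> carrier ?D" "y \<in> carrier ?D"
  then have [simp]: "\<And>i. i \<in> I \<Longrightarrow> x i \<in> carrier (M i)" "\<And>i. i \<in> I \<Longrightarrow> y i \<in> carrier (M i)" by auto
  show "a \<odot>\<^bsub>?D\<^esub> (x \<oplus>\<^bsub>?D\<^esub> y) = a \<odot>\<^bsub>?D\<^esub> x \<oplus>\<^bsub>?D\<^esub> a \<odot>\<^bsub>?D\<^esub> y"
   using a by (simp, intro restrict_ext) (simp add: module.smult_r_distr[OF M])
 next
  fix x assume x: "x \<in> carrier ?D"
  then have [simp]: "\<And>i. i \<in> I \<Longrightarrow> x i \<in> carrier (M i)" by auto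
  show "\<one>\<^bsub>K\<^esub> \<odot>\<^bsub>?D\<^esub> x = x"
   using x by (simp, intro e) (auto simp: module.smult_one[OF M])
 qed
qed

section \<open>Free modules and quotients\<close>

text \<open>The finitely supported functions form a submodule of the product of copies of
  \<open>K\<close>, which is already known to be a module; \<open>R\<close> is \<open>K\<close> as a
  module over itself.\<close>

lemma free_module_module:
 assumes K: "cring K" shows "module K (free_module K (S :: 's set))"
proof -
 interpret K: cring K by fact
 let ?F = "free_module K S"
 define R where "R = \<lparr>carrier = carrier K, mult = mult K, one = \<one>\<^bsub>K\<^esub>, ring.zero = \<zero>\<^bsub>K\<^esub>, ring.add = add K, smult = mult K\<rparr>"
 have e: "\<exists>y\<in>carrier K. y \<oplus>\<^bsub>K\<^esub> x = \<zero>\<^bsub>K\<^esub>" if "x \<in> carrier K" for x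
  using K.l_neg[OF that] K.a_inv_closed[OF that] by blast
 have "abelian_group R"
  by (rule abelian_groupI) (auto simp: R_def K.a_assoc e intro: K.a_comm)
 then have "module K R"
  by (intro moduleI[OF K]) (simp_all add: R_def K.l_distr K.r_distr K.m_assoc)
 then interpret D: module K "Defs.dsum (UNIV :: 's set) (\<lambda>_. R)" by (intro dsum_module[OF K])
 let ?D = "Defs.dsum (UNIV :: 's set) (\<lambda>_. R)"
 have ops: "\<zero>\<^bsub>?D\<^esub> = (\<lambda>_. \<zero>\<^bsub>K\<^esub>)" "add ?D u v = (\<lambda>s. u s \<oplus>\<^bsub>K\<^esub> v s)" "smult ?D c u = (\<lambda>s. c \<otimes>\<^bsub>K\<^esub> u s)"
  "u \<in> carrier ?D \<longleftrightarrow> (\<forall>s. u s \<in> carrier K)" for u v c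
  by (auto simp: R_def fun_eq_iff)
 have neg: "\<ominus>\<^bsub>?D\<^esub> u = (\<lambda>s. \<ominus>\<^bsub>K\<^esub> u s)" if "u \<in> carrier ?D" for u
  using that by (intro D.minus_equality) (simp_all add: ops K.l_neg del: dsum_simps)
 have F: "u \<in> carrier ?F \<longleftrightarrow> u \<in> carrier ?D \<and> finite {s. u s \<noteq> \<zero>\<^bsub>K\<^esub>} \<and> {s. u s \<noteq> \<zero>\<^bsub>K\<^esub>} \<subseteq> S" for u
  by (simp add: free_module_def ops del: dsum_simps)
 have supp: "f \<in> carrier ?F" if "f \<in> carrier ?D" "u \<in> carrier ?F" "v \<in> carrier ?F" "\<And>s. u s = \<zero>\<^bsub>K\<^esub> \<Longrightarrow> v s = \<zero>\<^bsub>K\<^esub> \<Longrightarrow> f s = \<zero>\<^bsub>K\<^esub>" for f u v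
 proof -
  have "{s. f s \<noteq> \<zero>\<^bsub>K\<^esub>} \<subseteq> {s. u s \<noteq> \<zero>\<^bsub>K\<^esub>} \<union> {s. v s \<noteq> \<zero>\<^bsub>K\<^esub>}" using that(4) by auto
  moreover have "finite ({s. u s \<noteq> \<zero>\<^bsub>K\<^esub>} \<union> {s. v s \<noteq> \<zero>\<^bsub>K\<^esub>})" using that(2,3) by (simp add: F del: dsum_simps)
  ultimately show ?thesis using that(1-3) by (auto simp: F simp del: dsum_simps dest: finite_subset)
 qed
 have "submodule (carrier ?F) K ?D"
 proof (rule D.submoduleI)
  show "carrier ?F \<subseteq> carrier ?D" "\<zero>\<^bsub>?D\<^esub> \<in> carrier ?F" by (auto simp: F ops simp del: dsum_simps)
  fix u assume u: "u \<in> carrier ?F"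
  then have uD: "u \<in> carrier ?D" by (simp add: F del: dsum_simps)
  show "\<ominus>\<^bsub>?D\<^esub> u \<in> carrier ?F" by (rule supp[OF D.a_inv_closed[OF uD] u u]) (simp add: neg[OF uD])
  show "add ?D u v \<in> carrier ?F" if "v \<in> carrier ?F" for v
   using that by (intro supp[OF D.a_closed[OF uD] u that]) (simp_all add: F ops del: dsum_simps)
  show "smult ?D c u \<in> carrier ?F" if "c \<in> carrier K" for c
   by (rule supp[OF D.smult_closed[OF that uD] u u]) (simp add: ops that del: dsum_simps)
 qed
 from submodule.submodule_is_module[OF this D.module_axioms] show ?thesis
  by (simp add: free_module_def Defs.dsum_def R_def restrict_def)
qed

lemma basis_vec_closed: "cring K \<Longrightarrow> s \<in> S \<Longrightarrow> basis_vec K s \<in> carrier (free_module K S)"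
proof -
 assume K: "cring K" and s: "s \<in> S"
 interpret K: cring K by fact
 have "{x. basis_vec K s x \<noteq> \<zero>\<^bsub>K\<^esub>} \<subseteq> {s}" by (auto simp: basis_vec_def)
 then show ?thesis
  using s by (auto simp: free_module_def basis_vec_def dest: finite_subset)
qed

definition lin_comb :: "('k, 'r) ring_scheme \<Rightarrow> ('k, 'b) module \<Rightarrow> ('s \<Rightarrow> 'b) \<Rightarrow> ('s \<Rightarrow> 'k) \<Rightarrow> 'b" where
 "lin_comb K M g u = finsum M (\<lambda>w. u w \<odot>\<^bsub>M\<^esub> g w) {w. u w \<noteq> \<zero>\<^bsub>K\<^esub>}"

lemma lin_comb_superset:
 assumes M: "module K M" and g: "g \<in> S \<rightarrow> carrier M" and u: "u \<in> carrier (free_module K S)"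
  and T: "finite T" "{w. u w \<noteq> \<zero>\<^bsub>K\<^esub>} \<subseteq> T" "T \<subseteq> S"
 shows "lin_comb K M g u = finsum M (\<lambda>w. u w \<odot>\<^bsub>M\<^esub> g w) T"
proof -
 interpret M: module K M by fact
 show ?thesis
  unfolding lin_comb_def
  using assms by (intro M.add.finprod_mono_neutral_cong_left) (auto simp: free_module_def Pi_def)
qed

lemma lin_comb_lin:
 assumes M: "module K M" and g: "g \<in> S \<rightarrow> carrier M"
 shows "lin_on K (free_module K S) M (lin_comb K M g)"
proof -
 let ?Fr = "free_module K S"
 interpret M: module K M by fact
 interpret F: module K "?Fr" by (rule free_module_module) (rule M.is_cring)
 have val: "u s \<in> carrier K" if "u \<in> carrier ?Fr" for u s
  using that by (auto simp: free_module_def)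
 have fin: "finite {s. u s \<noteq> \<zero>\<^bsub>K\<^esub>}" "{s. u s \<noteq> \<zero>\<^bsub>K\<^esub>} \<subseteq> S" if "u \<in> carrier ?Fr" for u
  using that by (auto simp: free_module_def)
 have gS: "g s \<in> carrier M" if "s \<in> S" for s using g that by auto
 show ?thesis
 proof (rule lin_onI)
  fix u assume u: "u \<in> carrier ?Fr"
  show "lin_comb K M g u \<in> carrier M"
   unfolding lin_comb_def using u val[OF u] fin[OF u] gS by (intro M.finsum_closed) auto
 next
  fix u v assume u: "u \<in> carrier ?Fr" and v: "v \<in> carrier ?Fr"
  let ?T = "{s. u s \<noteq> \<zero>\<^bsub>K\<^esub>} \<union> {s. v s \<noteq> \<zero>\<^bsub>K\<^esub>}"
  have T: "finite ?T" "?T \<subseteq> S" using fin u v by auto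
  have "lin_comb K M g (u \<oplus>\<^bsub>?Fr\<^esub> v) = finsum M (\<lambda>w. (u w \<oplus>\<^bsub>K\<^esub> v w) \<odot>\<^bsub>M\<^esub> g w) ?T"
   using F.a_closed[OF u v] T
   by (subst lin_comb_superset[OF M g _ T(1) _ T(2)]) (auto simp: free_module_def)
  also have "\<dots> = finsum M (\<lambda>w. u w \<odot>\<^bsub>M\<^esub> g w \<oplus>\<^bsub>M\<^esub> v w \<odot>\<^bsub>M\<^esub> g w) ?T"
   using val[OF u] val[OF v] T gS by (intro M.finsum_cong') (auto simp: M.smult_l_distr)
  also have "\<dots> = finsum M (\<lambda>w. u w \<odot>\<^bsub>M\<^esub> g w) ?T \<oplus>\<^bsub>M\<^esub> finsum M (\<lambda>w. v w \<odot>\<^bsub>M\<^esub> g w) ?T"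
   using val[OF u] val[OF v] T gS by (intro M.finsum_addf) auto
  also have "finsum M (\<lambda>w. u w \<odot>\<^bsub>M\<^esub> g w) ?T = lin_comb K M g u"
   by (rule lin_comb_superset[OF M g u T(1) _ T(2), symmetric]) auto
  also have "finsum M (\<lambda>w. v w \<odot>\<^bsub>M\<^esub> g w) ?T = lin_comb K M g v"
   by (rule lin_comb_superset[OF M g v T(1) _ T(2), symmetric]) auto
  finally show "lin_comb K M g (u \<oplus>\<^bsub>?Fr\<^esub> v) = lin_comb K M g u \<oplus>\<^bsub>M\<^esub> lin_comb K M g v" .
 next
  fix c u assume c: "c \<in> carrier K" and u: "u \<in> carrier ?Fr"
  let ?T = "{s. u s \<noteq> \<zero>\<^bsub>K\<^esub>}"
  have T: "finite ?T" "?T \<subseteq> S" using fin u by auto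
  have "lin_comb K M g (c \<odot>\<^bsub>?Fr\<^esub> u) = finsum M (\<lambda>w. (c \<otimes>\<^bsub>K\<^esub> u w) \<odot>\<^bsub>M\<^esub> g w) ?T"
   using F.smult_closed[OF c u] c T
   by (subst lin_comb_superset[OF M g _ T(1) _ T(2)]) (auto simp: free_module_def)
  also have "\<dots> = finsum M (\<lambda>w. c \<odot>\<^bsub>M\<^esub> (u w \<odot>\<^bsub>M\<^esub> g w)) ?T"
   using val[OF u] c T gS by (intro M.finsum_cong') (auto simp: M.smult_assoc1)
  also have "\<dots> = c \<odot>\<^bsub>M\<^esub> lin_comb K M g u"
   unfolding lin_comb_def using val[OF u] c T gS by (subst M.finsum_smult_ldistr) auto
  finally show "lin_comb K M g (c \<odot>\<^bsub>?Fr\<^esub> u) = c \<odot>\<^bsub>M\<^esub> lin_comb K M g u" .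
 qed
qed

lemma lin_comb_basis:
 assumes M: "module K M" and g: "g \<in> S \<rightarrow> carrier M" and s: "s \<in> S"
 shows "lin_comb K M g (basis_vec K s) = g s"
proof -
 interpret M: module K M by fact
 have "lin_comb K M g (basis_vec K s) = finsum M (\<lambda>w. basis_vec K s w \<odot>\<^bsub>M\<^esub> g w) {s}"
  using s basis_vec_closed[OF M.is_cring s]
  by (intro lin_comb_superset[OF M g]) (auto simp: basis_vec_def)
 also have "\<dots> = g s"
  using s g by (simp add: basis_vec_def Pi_def)
 finally show ?thesis .
qed

context
 fixes K :: "('k, 'r) ring_scheme" and M :: "('k, 'a) module" and H
 assumes M: "module K M" and H: "submodule H K M"
begin

interpretation M: module K M by fact
interpretation H: submodule H K M by fact
interpretation H: abelian_subgroup H M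
 using module.axioms(2)[OF M] by (intro abelian_subgroupI3) (auto simp: additive_subgroup_def H.subgroup_axioms)

lemma quot_carrier_iff: "X \<in> carrier (quot_module M H) \<longleftrightarrow> (\<exists>x\<in>carrier M. X = H +>\<^bsub>M\<^esub> x)"
 by (auto simp: quot_module_def A_RCOSETS_def')

lemma quot_mem: "x \<in> carrier M \<Longrightarrow> H +>\<^bsub>M\<^esub> x \<in> carrier (quot_module M H)"
 by (auto simp: quot_carrier_iff)

lemma quot_add:
 "x \<in> carrier M \<Longrightarrow> y \<in> carrier M \<Longrightarrow>
  (H +>\<^bsub>M\<^esub> x) \<oplus>\<^bsub>quot_module M H\<^esub> (H +>\<^bsub>M\<^esub> y) = H +>\<^bsub>M\<^esub> (x \<oplus>\<^bsub>M\<^esub> y)"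
 by (simp add: quot_module_def H.a_rcos_sum)

lemma quot_eq_iff:
 assumes "x \<in> carrier M" "y \<in> carrier M"
 shows "H +>\<^bsub>M\<^esub> x = H +>\<^bsub>M\<^esub> y \<longleftrightarrow> x \<ominus>\<^bsub>M\<^esub> y \<in> H"
 using assms H.a_rcos_module[of y x] H.a_rcos_self[of x] H.a_repr_independence'[of x y]
 by (auto simp: M.minus_eq)

lemma quot_zero: "\<zero>\<^bsub>quot_module M H\<^esub> = H +>\<^bsub>M\<^esub> \<zero>\<^bsub>M\<^esub>"
 using H.a_subset by (simp add: quot_module_def)

lemma quot_mem_iff:
 assumes "x \<in> carrier M"
 shows "y \<in> H +>\<^bsub>M\<^esub> x \<longleftrightarrow> y \<in> carrier M \<and> y \<ominus>\<^bsub>M\<^esub> x \<in> H"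
 using H.a_rcos_module[OF assms] M.a_r_coset_subset_G[OF H.a_subset assms]
 by (auto simp: M.minus_eq)

text \<open>The scalar action on the quotient is a union over all representatives; as they all give
  the same coset, the union is that coset.\<close>

lemma quot_smult:
 assumes c: "c \<in> carrier K" and x: "x \<in> carrier M"
 shows "c \<odot>\<^bsub>quot_module M H\<^esub> (H +>\<^bsub>M\<^esub> x) = H +>\<^bsub>M\<^esub> (c \<odot>\<^bsub>M\<^esub> x)"
proof -
 have "H +>\<^bsub>M\<^esub> (c \<odot>\<^bsub>M\<^esub> y) = H +>\<^bsub>M\<^esub> (c \<odot>\<^bsub>M\<^esub> x)" if "y \<in> H +>\<^bsub>M\<^esub> x" for y
 proof -
  have y: "y \<in> carrier M" "y \<ominus>\<^bsub>M\<^esub> x \<in> H" using that x by (auto simp: quot_mem_iff)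
  have "c \<odot>\<^bsub>M\<^esub> y \<ominus>\<^bsub>M\<^esub> c \<odot>\<^bsub>M\<^esub> x = c \<odot>\<^bsub>M\<^esub> (y \<ominus>\<^bsub>M\<^esub> x)"
   using c x y by (simp add: M.minus_eq M.smult_r_distr M.smult_r_minus)
  then show ?thesis using c x y by (subst quot_eq_iff) auto
 qed
 moreover have "x \<in> H +>\<^bsub>M\<^esub> x" using x by (rule H.a_rcos_self)
 ultimately have "(\<Union>y\<in>H +>\<^bsub>M\<^esub> x. H +>\<^bsub>M\<^esub> (c \<odot>\<^bsub>M\<^esub> y)) = H +>\<^bsub>M\<^esub> (c \<odot>\<^bsub>M\<^esub> x)"
  by (intro SUP_eq_const) blast+
 then show ?thesis
  by (simp add: quot_module_def)
qed

lemma quot_module_module: "module K (quot_module M H)"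
proof -
 let ?Q = "quot_module M H" and ?c = "\<lambda>x. H +>\<^bsub>M\<^esub> x"
 have rep: "\<exists>x\<in>carrier M. X = ?c x" if "X \<in> carrier ?Q" for X
  using that by (simp add: quot_carrier_iff)
 note s = quot_add quot_zero quot_smult
 show ?thesis
 proof (rule moduleI[OF M.is_cring])
  show "abelian_group ?Q"
  proof (rule abelian_groupI)
   fix X assume "X \<in> carrier ?Q"
   then obtain x where x: "x \<in> carrier M" "X = ?c x" using rep by blast
   then show "\<exists>Y\<in>carrier ?Q. Y \<oplus>\<^bsub>?Q\<^esub> X = \<zero>\<^bsub>?Q\<^esub>"
    by (intro bexI[of _ "?c (\<ominus>\<^bsub>M\<^esub> x)"]) (simp_all add: s quot_mem M.l_neg)
   show "\<zero>\<^bsub>?Q\<^esub> \<oplus>\<^bsub>?Q\<^esub> X = X" using x by (simp add: s)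
  next
   fix X Y assume "X \<in> carrier ?Q" "Y \<in> carrier ?Q"
   then obtain x y where x: "x \<in> carrier M" "X = ?c x" "y \<in> carrier M" "Y = ?c y"
    using rep by metis
   then show "X \<oplus>\<^bsub>?Q\<^esub> Y \<in> carrier ?Q" "X \<oplus>\<^bsub>?Q\<^esub> Y = Y \<oplus>\<^bsub>?Q\<^esub> X"
    by (simp_all add: s quot_mem M.a_comm)
   fix Z assume "Z \<in> carrier ?Q"
   then obtain z where "z \<in> carrier M" "Z = ?c z" using rep by blast
   then show "X \<oplus>\<^bsub>?Q\<^esub> Y \<oplus>\<^bsub>?Q\<^esub> Z = X \<oplus>\<^bsub>?Q\<^esub> (Y \<oplus>\<^bsub>?Q\<^esub> Z)"
    using x by (simp add: s M.a_assoc)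
  qed (simp add: quot_zero quot_mem)
 next
  fix a X assume a: "a \<in> carrier K" and "X \<in> carrier ?Q"
  then obtain x where x: "x \<in> carrier M" "X = ?c x" using rep by blast
  with a show "a \<odot>\<^bsub>?Q\<^esub> X \<in> carrier ?Q" by (simp add: s quot_mem)
  fix b assume "b \<in> carrier K"
  with a x show "(a \<oplus>\<^bsub>K\<^esub> b) \<odot>\<^bsub>?Q\<^esub> X = a \<odot>\<^bsub>?Q\<^esub> X \<oplus>\<^bsub>?Q\<^esub> b \<odot>\<^bsub>?Q\<^esub> X"
   "(a \<otimes>\<^bsub>K\<^esub> b) \<odot>\<^bsub>?Q\<^esub> X = a \<odot>\<^bsub>?Q\<^esub> (b \<odot>\<^bsub>?Q\<^esub> X)"
   by (simp_all add: s M.smult_l_distr M.smult_assoc1)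
 next
  fix a X Y assume a: "a \<in> carrier K" and "X \<in> carrier ?Q" "Y \<in> carrier ?Q"
  then obtain x y where "x \<in> carrier M" "X = ?c x" "y \<in> carrier M" "Y = ?c y"
   using rep by metis
  with a show "a \<odot>\<^bsub>?Q\<^esub> (X \<oplus>\<^bsub>?Q\<^esub> Y) = a \<odot>\<^bsub>?Q\<^esub> X \<oplus>\<^bsub>?Q\<^esub> a \<odot>\<^bsub>?Q\<^esub> Y"
   by (simp add: s M.smult_r_distr)
 next
  fix X assume "X \<in> carrier ?Q"
  then obtain x where "x \<in> carrier M" "X = ?c x" using rep by blast
  then show "\<one>\<^bsub>K\<^esub> \<odot>\<^bsub>?Q\<^esub> X = X" by (simp add: s)
 qed
qed

lemma quot_proj_lin: "lin_on K M (quot_module M H) (\<lambda>x. H +>\<^bsub>M\<^esub> x)"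
 by (intro lin_onI) (auto simp: quot_mem quot_add quot_smult)

end

section \<open>Tensor powers\<close>

definition Vl :: "(int \<Rightarrow> ('k, 'a) module) \<Rightarrow> (int \<times> 'a) set" where
 "Vl A = {l. snd l \<in> carrier (A (fst l))}"

lemma words_iff: "w \<in> words A n p \<longleftrightarrow> w \<in> lists (Vl A) \<and> length w = n \<and> wdeg w = p"
 by (auto simp: words_def Vl_def in_lists_conv_set)

lemma Vl_iff [simp]: "(q, a) \<in> Vl A \<longleftrightarrow> a \<in> carrier (A q)"
 by (simp add: Vl_def)

definition mlin where
 "mlin K A n p M g \<longleftrightarrow> (\<forall>x\<in>lists (Vl A). \<forall>z\<in>lists (Vl A). \<forall>q.
   Suc (length x + length z) = n \<longrightarrow> wdeg x + q + wdeg z = p \<longrightarrow> lin_on K (A q) M (\<lambda>a. g (x @ (q, a) # z)))"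

lemma mlinD: "mlin K A n p M g \<Longrightarrow> x \<in> lists (Vl A) \<Longrightarrow> z \<in> lists (Vl A) \<Longrightarrow>
  Suc (length x + length z) = n \<Longrightarrow> wdeg x + q + wdeg z = p \<Longrightarrow> lin_on K (A q) M (\<lambda>a. g (x @ (q, a) # z))"
 by (auto simp: mlin_def)

lemma mlin_closed:
 assumes "mlin K A n p M g" "n > 0" "w \<in> words A n p"
 shows "g w \<in> carrier M"
proof -
 obtain q a z where w: "w = (q, a) # z" using assms by (cases w) (auto simp: words_iff)
 then show ?thesis
  using assms mlinD[OF assms(1), of "[]" z q] by (auto simp: words_iff dest!: lin_onD(1)[where x = a])
qed

context
 fixes K :: "('k, 'r) ring_scheme" and A :: "int \<Rightarrow> ('k, 'a) module"
 assumes K: "cring K" and A: "\<And>q. module K (A q)"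
begin

interpretation K: cring K by fact

lemma multilin_rels_subset: "multilin_rels K A n p \<subseteq> carrier (free_module K (words A n p))"
proof -
 let ?Fr = "free_module K (words A n p)"
 interpret F: module K "?Fr" by (rule free_module_module) fact
 show ?thesis
 proof
  fix r assume r: "r \<in> multilin_rels K A n p"
  then show "r \<in> carrier ?Fr"
   unfolding multilin_rels_def Let_def
  proof (elim UnE CollectE exE conjE)
   fix u v q a b assume r: "r = basis_vec K (u @ (q, a \<oplus>\<^bsub>A q\<^esub> b) # v) \<ominus>\<^bsub>?Fr\<^esub>
     (basis_vec K (u @ (q, a) # v) \<oplus>\<^bsub>?Fr\<^esub> basis_vec K (u @ (q, b) # v))"
    and w: "u @ (q, a) # v \<in> words A n p" and b: "b \<in> carrier (A q)"
   interpret Aq: module K "A q" by (rule A)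
   have "u @ (q, a') # v \<in> words A n p" if "a' \<in> carrier (A q)" for a'
    using w that by (auto simp: words_iff)
   moreover have "a \<in> carrier (A q)" using w by (auto simp: words_iff)
   ultimately show ?thesis
    unfolding r using b by (intro F.minus_closed F.a_closed basis_vec_closed[OF K]) auto
  next
   fix u v q a c assume r: "r = basis_vec K (u @ (q, c \<odot>\<^bsub>A q\<^esub> a) # v) \<ominus>\<^bsub>?Fr\<^esub>
     c \<odot>\<^bsub>?Fr\<^esub> basis_vec K (u @ (q, a) # v)"
    and w: "u @ (q, a) # v \<in> words A n p" and c: "c \<in> carrier K"
   interpret Aq: module K "A q" by (rule A)
   have "u @ (q, a') # v \<in> words A n p" if "a' \<in> carrier (A q)" for a'
    using w that by (auto simp: words_iff)
   moreover have "a \<in> carrier (A q)" using w by (auto simp: words_iff)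
   ultimately show ?thesis
    unfolding r using c by (intro F.minus_closed F.smult_closed basis_vec_closed[OF K]) auto
  qed
 qed
qed

lemma multilin_submod: "submodule (multilin_submod K A n p) K (free_module K (words A n p))"
proof -
 let ?F = "free_module K (words A n p)"
 interpret F: module K ?F by (rule free_module_module) fact
 have c: "submodule (carrier ?F) K ?F" by (rule F.carrier_is_submodule)
 show ?thesis
 proof (rule F.submoduleI)
  show "multilin_submod K A n p \<subseteq> carrier ?F"
   using c multilin_rels_subset by (auto simp: multilin_submod_def)
 next
  show "\<zero>\<^bsub>?F\<^esub> \<in> multilin_submod K A n p"
   by (auto simp: multilin_submod_def intro: subgroup.one_closed[OF submodule.axioms(1), simplified])
 qed (auto simp: multilin_submod_def dest: F.submoduleE)
qed

lemma multilin_rels_sub: "multilin_rels K A n p \<subseteq> multilin_submod K A n p"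
 by (auto simp: multilin_submod_def)

lemma multilin_submod_least:
 "submodule H K (free_module K (words A n p)) \<Longrightarrow> multilin_rels K A n p \<subseteq> H \<Longrightarrow> multilin_submod K A n p \<subseteq> H"
 by (auto simp: multilin_submod_def)

lemma tpow_module: "module K (tpow K A n p)"
 unfolding tpow_def by (rule quot_module_module[OF free_module_module[OF K] multilin_submod])

lemma pure_eq: "w \<in> words A n p \<Longrightarrow>
  pure K A w = multilin_submod K A n p +>\<^bsub>free_module K (words A n p)\<^esub> basis_vec K w"
 by (simp add: pure_def words_iff)

lemma pure_closed: "w \<in> words A n p \<Longrightarrow> pure K A w \<in> carrier (tpow K A n p)"
 unfolding tpow_def
 by (simp add: pure_eq quot_mem[OF free_module_module[OF K] multilin_submod] basis_vec_closed[OF K])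

lemma pure_mlin: "mlin K A n p (tpow K A n p) (pure K A)"
 unfolding mlin_def
proof (intro ballI allI impI)
 fix x z q assume xz: "x \<in> lists (Vl A)" "z \<in> lists (Vl A)" "Suc (length x + length z) = n" "wdeg x + q + wdeg z = p"
 let ?F = "free_module K (words A n p)" and ?H = "multilin_submod K A n p"
 interpret F: module K ?F by (rule free_module_module) fact
 interpret Aq: module K "A q" by (rule A)
 note H = F.module_axioms multilin_submod[of n p]
 have w: "x @ (q, a) # z \<in> words A n p" if "a \<in> carrier (A q)" for a
  using xz that by (auto simp: words_iff)
 note bv = basis_vec_closed[OF K w]
 show "lin_on K (A q) (tpow K A n p) (\<lambda>a. pure K A (x @ (q, a) # z))"
 proof (rule lin_onI)
  fix a assume "a \<in> carrier (A q)"
  then show "pure K A (x @ (q, a) # z) \<in> carrier (tpow K A n p)" by (intro pure_closed w)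
 next
  fix a b assume ab: "a \<in> carrier (A q)" "b \<in> carrier (A q)"
  have "basis_vec K (x @ (q, a \<oplus>\<^bsub>A q\<^esub> b) # z) \<ominus>\<^bsub>?F\<^esub> (basis_vec K (x @ (q, a) # z) \<oplus>\<^bsub>?F\<^esub> basis_vec K (x @ (q, b) # z)) \<in> multilin_rels K A n p"
   unfolding multilin_rels_def Let_def using w ab by blast
  then have "basis_vec K (x @ (q, a \<oplus>\<^bsub>A q\<^esub> b) # z) \<ominus>\<^bsub>?F\<^esub> (basis_vec K (x @ (q, a) # z) \<oplus>\<^bsub>?F\<^esub> basis_vec K (x @ (q, b) # z)) \<in> ?H"
   using multilin_rels_sub by blast
  then show "pure K A (x @ (q, a \<oplus>\<^bsub>A q\<^esub> b) # z) = pure K A (x @ (q, a) # z) \<oplus>\<^bsub>tpow K A n p\<^esub> pure K A (x @ (q, b) # z)"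
   using ab w bv by (simp add: pure_eq[where n = n and p = p] tpow_def quot_add[OF H] quot_eq_iff[OF H])
 next
  fix c a assume ca: "c \<in> carrier K" "a \<in> carrier (A q)"
  have "basis_vec K (x @ (q, c \<odot>\<^bsub>A q\<^esub> a) # z) \<ominus>\<^bsub>?F\<^esub> c \<odot>\<^bsub>?F\<^esub> basis_vec K (x @ (q, a) # z) \<in> multilin_rels K A n p"
   unfolding multilin_rels_def Let_def using w ca by blast
  then have "basis_vec K (x @ (q, c \<odot>\<^bsub>A q\<^esub> a) # z) \<ominus>\<^bsub>?F\<^esub> c \<odot>\<^bsub>?F\<^esub> basis_vec K (x @ (q, a) # z) \<in> ?H"
   using multilin_rels_sub by blast
  then show "pure K A (x @ (q, c \<odot>\<^bsub>A q\<^esub> a) # z) = c \<odot>\<^bsub>tpow K A n p\<^esub> pure K A (x @ (q, a) # z)"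
   using ca w bv by (simp add: pure_eq[where n = n and p = p] tpow_def quot_smult[OF H] quot_eq_iff[OF H])
 qed
qed

context
 fixes M :: "('k, 'b) module" and g n p
 assumes M: "module K M" and g: "mlin K A n p M g" and n: "n > 0"
begin

interpretation M: module K M by fact

text \<open>The zero set of the linear extension is a submodule containing the generating relations,
  hence contains the least such submodule.\<close>

lemma mlin_comb_kills:
 assumes "u \<in> multilin_submod K A n p" shows "lin_comb K M g u = \<zero>\<^bsub>M\<^esub>"
proof -
 let ?F = "free_module K (words A n p)" and ?L = "lin_comb K M g"
 interpret F: module K ?F by (rule free_module_module) fact
 have gw: "g \<in> words A n p \<rightarrow> carrier M" using mlin_closed[OF g n] by auto
 note L = lin_comb_lin[OF M gw]
 note Ls = lin_onD[OF L] lin_on_zero[OF F.module_axioms M L] lin_on_minus[OF F.module_axioms M L]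
 have "submodule {u \<in> carrier ?F. ?L u = \<zero>\<^bsub>M\<^esub>} K ?F"
  by (rule F.submoduleI) (auto simp: Ls)
 moreover have "multilin_rels K A n p \<subseteq> {u \<in> carrier ?F. ?L u = \<zero>\<^bsub>M\<^esub>}"
 proof
  fix r assume r: "r \<in> multilin_rels K A n p"
  have "?L r = \<zero>\<^bsub>M\<^esub>"
   using r unfolding multilin_rels_def Let_def
  proof (elim UnE CollectE exE conjE)
   fix u v q a b assume r: "r = basis_vec K (u @ (q, a \<oplus>\<^bsub>A q\<^esub> b) # v) \<ominus>\<^bsub>?F\<^esub> (basis_vec K (u @ (q, a) # v) \<oplus>\<^bsub>?F\<^esub> basis_vec K (u @ (q, b) # v))"
    and w: "u @ (q, a) # v \<in> words A n p" and b: "b \<in> carrier (A q)"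
   interpret Aq: module K "A q" by (rule A)
   have a: "a \<in> carrier (A q)" using w by (auto simp: words_iff)
   have w': "u @ (q, a') # v \<in> words A n p" if "a' \<in> carrier (A q)" for a'
    using w that by (auto simp: words_iff)
   have lin: "lin_on K (A q) M (\<lambda>a. g (u @ (q, a) # v))"
    using w by (intro mlinD[OF g]) (auto simp: words_iff)
   show ?thesis
    using a b w' lin_onD(1)[OF lin]
    by (simp add: r F.minus_eq Ls basis_vec_closed[OF K] lin_comb_basis[OF M gw] lin_onD(2)[OF lin] M.r_neg)
  next
   fix u v q a c assume r: "r = basis_vec K (u @ (q, c \<odot>\<^bsub>A q\<^esub> a) # v) \<ominus>\<^bsub>?F\<^esub> c \<odot>\<^bsub>?F\<^esub> basis_vec K (u @ (q, a) # v)"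
    and w: "u @ (q, a) # v \<in> words A n p" and c: "c \<in> carrier K"
   interpret Aq: module K "A q" by (rule A)
   have a: "a \<in> carrier (A q)" using w by (auto simp: words_iff)
   have w': "u @ (q, a') # v \<in> words A n p" if "a' \<in> carrier (A q)" for a'
    using w that by (auto simp: words_iff)
   have lin: "lin_on K (A q) M (\<lambda>a. g (u @ (q, a) # v))"
    using w by (intro mlinD[OF g]) (auto simp: words_iff)
   show ?thesis
    using a c w' lin_onD(1)[OF lin]
    by (simp add: r F.minus_eq Ls basis_vec_closed[OF K] lin_comb_basis[OF M gw] lin_onD(3)[OF lin] M.r_neg)
  qed
  then show "r \<in> {u \<in> carrier ?F. ?L u = \<zero>\<^bsub>M\<^esub>}" using r multilin_rels_subset by auto
 qed
 ultimately show ?thesis using multilin_submod_least assms by blast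
qed

text \<open>\<open>lin_ext\<close> evaluates at a chosen representative \<open>v\<close>, which
  differs from \<open>u\<close> by an element that the linear extension of \<open>g\<close>
  kills.\<close>

lemma lin_ext_coset:
 assumes u: "u \<in> carrier (free_module K (words A n p))"
 shows "lin_ext K M g (multilin_submod K A n p +>\<^bsub>free_module K (words A n p)\<^esub> u) = lin_comb K M g u"
proof -
 let ?F = "free_module K (words A n p)" and ?L = "lin_comb K M g" and ?H = "multilin_submod K A n p"
 interpret F: module K ?F by (rule free_module_module) fact
 have gw: "g \<in> words A n p \<rightarrow> carrier M" using mlin_closed[OF g n] by auto
 note L = lin_comb_lin[OF M gw]
 note H = F.module_axioms multilin_submod[of n p]
 define v where "v = (SOME v. v \<in> ?H +>\<^bsub>?F\<^esub> u)"
 have "u \<in> ?H +>\<^bsub>?F\<^esub> u"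
  using u submodule.axioms(1)[OF H(2)] by (simp add: quot_mem_iff[OF H] F.r_neg F.minus_eq subgroup.one_closed[of ?H "add_monoid ?F", simplified])
 then have "v \<in> ?H +>\<^bsub>?F\<^esub> u" unfolding v_def by (rule someI[where P = "\<lambda>v. v \<in> ?H +>\<^bsub>?F\<^esub> u"])
 then have v: "v \<in> carrier ?F" "v \<ominus>\<^bsub>?F\<^esub> u \<in> ?H" using u by (auto simp: quot_mem_iff[OF H])
 have "?L v = ?L ((v \<ominus>\<^bsub>?F\<^esub> u) \<oplus>\<^bsub>?F\<^esub> u)"
  using v u by (simp add: F.minus_eq F.a_assoc F.l_neg)
 also have "\<dots> = ?L u"
  using v u lin_onD(1)[OF L u] by (subst lin_onD(2)[OF L]) (auto simp: mlin_comb_kills)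
 finally show ?thesis
  by (simp add: lin_ext_def Let_def v_def lin_comb_def)
qed

lemma lin_ext_lin: "lin_on K (tpow K A n p) M (lin_ext K M g)"
proof -
 let ?F = "free_module K (words A n p)"
 interpret F: module K ?F by (rule free_module_module) fact
 have gw: "g \<in> words A n p \<rightarrow> carrier M" using mlin_closed[OF g n] by auto
 note L = lin_onD[OF lin_comb_lin[OF M gw]]
 note H = F.module_axioms multilin_submod[of n p]
 show ?thesis
  unfolding tpow_def
  by (rule lin_onI) (auto simp: quot_carrier_iff[OF H] quot_add[OF H] quot_smult[OF H] lin_ext_coset L)
qed

lemma lin_ext_pure: "w \<in> words A n p \<Longrightarrow> lin_ext K M g (pure K A w) = g w"
 using mlin_closed[OF g n]
 by (simp add: pure_eq lin_ext_coset basis_vec_closed[OF K] lin_comb_basis[OF M, of _ "words A n p"])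

end

text \<open>Scalars do not occur among the cases because they can be moved into the first letter of
  a word; this is where \<open>n > 0\<close> enters.\<close>

lemma tpow_induct:
 assumes n: "n > 0" and X: "X \<in> carrier (tpow K A n p)"
  and zero: "P \<zero>\<^bsub>tpow K A n p\<^esub>"
  and pure: "\<And>w. w \<in> words A n p \<Longrightarrow> P (pure K A w)"
  and add: "\<And>X Y. X \<in> carrier (tpow K A n p) \<Longrightarrow> Y \<in> carrier (tpow K A n p) \<Longrightarrow> P X \<Longrightarrow> P Y \<Longrightarrow> P (X \<oplus>\<^bsub>tpow K A n p\<^esub> Y)"
 shows "P X"
proof -
 let ?T = "tpow K A n p"
 interpret T: module K ?T by (rule tpow_module)
 have smult: "P (c \<odot>\<^bsub>?T\<^esub> pure K A w)" if c: "c \<in> carrier K" and w: "w \<in> words A n p" for c w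
 proof -
  obtain q a z where wz: "w = (q, a) # z" using w n by (cases w) (auto simp: words_iff)
  have lin: "lin_on K (A q) ?T (\<lambda>a. pure K A ([] @ (q, a) # z))"
   using w wz by (intro mlinD[OF pure_mlin]) (auto simp: words_iff)
  have "c \<odot>\<^bsub>?T\<^esub> pure K A w = pure K A ((q, c \<odot>\<^bsub>A q\<^esub> a) # z)"
   using lin_onD(3)[OF lin c, of a] w wz by (auto simp: words_iff)
  then show ?thesis
   using w c module.smult_closed[OF A] by (auto simp: wz words_iff intro!: pure)
 qed
 have fs: "P (finsum ?T (\<lambda>w. u w \<odot>\<^bsub>?T\<^esub> pure K A w) I)"
  if "finite I" "I \<subseteq> words A n p" "\<And>w. u w \<in> carrier K" for I u
  using that
 proof (induction I rule: finite_induct)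
  case (insert w I)
  have "u v \<odot>\<^bsub>?T\<^esub> pure K A v \<in> carrier ?T" if "v \<in> insert w I" for v
   using that insert.prems pure_closed by (intro T.smult_closed) auto
  then show ?case
   using insert by (auto simp: Pi_def intro!: add smult T.finsum_closed)
 qed (simp add: zero)
 let ?F = "free_module K (words A n p)" and ?H = "multilin_submod K A n p"
 interpret F: module K ?F by (rule free_module_module) fact
 note H = F.module_axioms multilin_submod[of n p]
 obtain u where u: "u \<in> carrier ?F" "X = ?H +>\<^bsub>?F\<^esub> u"
  using X by (auto simp: tpow_def quot_carrier_iff[OF H])
 have bv: "basis_vec K w \<in> carrier ?F" if "w \<in> words A n p" for w
  using that by (rule basis_vec_closed[OF K])
 have uK: "u w \<in> carrier K" for w using u by (simp add: free_module_def)
 have comb: "finsum ?F (\<lambda>w. u w \<odot>\<^bsub>?F\<^esub> basis_vec K w) I = (\<lambda>s. if s \<in> I then u s else \<zero>\<^bsub>K\<^esub>)"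
  if "finite I" "I \<subseteq> words A n p" for I
  using that
 proof (induction I rule: finite_induct)
  case (insert w I)
  then have "finsum ?F (\<lambda>w. u w \<odot>\<^bsub>?F\<^esub> basis_vec K w) (insert w I) =
    u w \<odot>\<^bsub>?F\<^esub> basis_vec K w \<oplus>\<^bsub>?F\<^esub> (\<lambda>s. if s \<in> I then u s else \<zero>\<^bsub>K\<^esub>)"
   using bv uK by (subst F.finsum_insert) (auto intro!: F.smult_closed)
  also have "\<dots> = (\<lambda>s. if s \<in> insert w I then u s else \<zero>\<^bsub>K\<^esub>)"
   using insert.hyps uK by (auto simp: free_module_def basis_vec_def fun_eq_iff)
  finally show ?case .
 next
  case empty
  show ?case by (subst F.finsum_empty) (simp add: free_module_def)
 qed
 have I: "finite {w. u w \<noteq> \<zero>\<^bsub>K\<^esub>}" "{w. u w \<noteq> \<zero>\<^bsub>K\<^esub>} \<subseteq> words A n p"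
  using u by (auto simp: free_module_def)
 have "u = finsum ?F (\<lambda>w. u w \<odot>\<^bsub>?F\<^esub> basis_vec K w) {w. u w \<noteq> \<zero>\<^bsub>K\<^esub>}"
  unfolding comb[OF I] by auto
 then have "X = finsum ?T (\<lambda>w. ?H +>\<^bsub>?F\<^esub> (u w \<odot>\<^bsub>?F\<^esub> basis_vec K w)) {w. u w \<noteq> \<zero>\<^bsub>K\<^esub>}"
  using u(2) I bv uK lin_on_finsum[OF F.module_axioms T.module_axioms quot_proj_lin[OF H, folded tpow_def],
    of "\<lambda>w. u w \<odot>\<^bsub>?F\<^esub> basis_vec K w" "{w. u w \<noteq> \<zero>\<^bsub>K\<^esub>}"] by auto
 also have "\<dots> = finsum ?T (\<lambda>w. u w \<odot>\<^bsub>?T\<^esub> pure K A w) {w. u w \<noteq> \<zero>\<^bsub>K\<^esub>}"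
 proof (intro T.finsum_cong')
  fix w assume "w \<in> {w. u w \<noteq> \<zero>\<^bsub>K\<^esub>}"
  then have w: "w \<in> words A n p" using I by blast
  show "?H +>\<^bsub>?F\<^esub> (u w \<odot>\<^bsub>?F\<^esub> basis_vec K w) = u w \<odot>\<^bsub>?T\<^esub> pure K A w"
   using w uK bv by (simp add: tpow_def quot_smult[OF H] pure_eq[where n = n and p = p])
 qed (use I uK pure_closed in \<open>auto intro!: T.smult_closed\<close>)
 finally have "X = lin_comb K ?T (pure K A) u"
  by (simp add: lin_comb_def)
 then show ?thesis
  using fs[of "{w. u w \<noteq> \<zero>\<^bsub>K\<^esub>}" u] u by (auto simp: lin_comb_def free_module_def)
qed

end

lemma lin_on_congI:
 "module K M \<Longrightarrow> lin_on K M N g \<Longrightarrow> (\<And>x. x \<in> carrier M \<Longrightarrow> f x = g x) \<Longrightarrow> lin_on K M N f"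
 using lin_on_cong[of K M f g N] by blast

section \<open>Evaluating formal sums\<close>

text \<open>Additive only, since formal sums have integer coefficients; compatibility with
  \<open>K\<close> is dealt with separately.\<close>

definition fhom :: "('k, 'b) module \<Rightarrow> (('s \<Rightarrow>\<^sub>0 int) \<Rightarrow> 'b) \<Rightarrow> bool" where
 "fhom M h \<longleftrightarrow> (\<forall>x. h x \<in> carrier M) \<and> (\<forall>x y. h (x + y) = h x \<oplus>\<^bsub>M\<^esub> h y)"

text \<open>The extension provided by the universal property of the free abelian group;
  \<open>fev_ex\<close> shows that it exists once all \<open>e s\<close> lie in the carrier.\<close>

definition fev :: "('k, 'b) module \<Rightarrow> ('s \<Rightarrow> 'b) \<Rightarrow> ('s \<Rightarrow>\<^sub>0 int) \<Rightarrow> 'b" where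
 "fev M e = (SOME h. fhom M h \<and> (\<forall>s. h (frag_of s) = e s))"

lemma fhomD: "fhom M h \<Longrightarrow> h x \<in> carrier M" "fhom M h \<Longrightarrow> h (x + y) = h x \<oplus>\<^bsub>M\<^esub> h y"
 by (auto simp: fhom_def)

context
 fixes K :: "('k, 'r) ring_scheme" and M :: "('k, 'b) module"
 assumes M: "module K M"
begin

interpretation M: module K M by fact

lemma fev_ex:
 assumes "\<And>s. e s \<in> carrier M"
 shows "fhom M (fev M e) \<and> (\<forall>s. fev M e (frag_of s) = e s)"
proof -
 obtain h where h: "h \<in> hom (free_Abelian_group UNIV) (add_monoid M)" "\<And>x. x \<in> UNIV \<Longrightarrow> h (frag_of x) = e x"
  by (rule comm_group.free_Abelian_group_universal[OF abelian_group.a_comm_group[OF module.axioms(2)[OF M]], of e UNIV])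
   (use assms in auto)
 then have "fhom M h \<and> (\<forall>s. h (frag_of s) = e s)"
  by (auto simp: fhom_def hom_def free_Abelian_group_def Pi_def)
 then show ?thesis
  unfolding fev_def by (rule someI[where P = "\<lambda>h. fhom M h \<and> (\<forall>s. h (frag_of s) = e s)"])
qed

lemma fhom_zero: "fhom M h \<Longrightarrow> h 0 = \<zero>\<^bsub>M\<^esub>"
 using fhomD(1)[of M h 0] fhomD(2)[of M h 0 0] M.add.r_cancel_one'[of "h 0" "h 0"] by simp

lemma fhom_minus: "fhom M h \<Longrightarrow> h (- x) = \<ominus>\<^bsub>M\<^esub> h x"
 using fhomD(1)[of M h] fhomD(2)[of M h "- x" x] fhom_zero[of h] by (simp add: M.minus_equality)

lemma fhom_diff: "fhom M h \<Longrightarrow> h (x - y) = h x \<ominus>\<^bsub>M\<^esub> h y"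
 using fhomD(2)[of M h x "- y"] by (simp add: fhom_minus M.minus_eq)

lemma fhom_sgx: "fhom M h \<Longrightarrow> h (sgx e x) = sgn_mult M e (h x)"
 by (simp add: sgx_def sgn_mult_def fhom_minus)

lemma fhom_sum: "fhom M h \<Longrightarrow> h (\<Sum>i\<in>I. \<xi> i) = finsum M (\<lambda>i. h (\<xi> i)) I"
 by (induction I rule: infinite_finite_induct)
  (auto simp: fhom_zero fhomD M.finsum_infinite M.finsum_insert Pi_def)

lemma fhom_ext:
 assumes "fhom M h" "fhom M h'" "Poly_Mapping.keys x \<subseteq> S" "\<And>s. s \<in> S \<Longrightarrow> h (frag_of s) = h' (frag_of s)"
 shows "h x = h' x"
 using assms(3)
 by (induction x rule: frag_induction) (auto simp: fhom_zero fhom_diff assms)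

lemma fhom_ext': "fhom M h \<Longrightarrow> fhom M h' \<Longrightarrow> (\<And>s. h (frag_of s) = h' (frag_of s)) \<Longrightarrow> h x = h' x"
 by (rule fhom_ext[of _ _ _ UNIV]) auto

lemma fhom_frag_extend: "fhom M h \<Longrightarrow> fhom M (\<lambda>x. h (frag_extend \<psi> x))"
 by (auto simp: fhom_def frag_extend_add)

lemma fhom_const0: "fhom M (\<lambda>x. \<zero>\<^bsub>M\<^esub>)"
 by (auto simp: fhom_def)

lemma fhom_finsum:
 assumes "\<And>i. i \<in> I \<Longrightarrow> fhom M (h i)"
 shows "fhom M (\<lambda>x. finsum M (\<lambda>i. h i x) I)"
 unfolding fhom_def
proof (intro conjI allI)
 fix x y
 have "finsum M (\<lambda>i. h i (x + y)) I = finsum M (\<lambda>i. h i x \<oplus>\<^bsub>M\<^esub> h i y) I"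
  using fhomD[OF assms] by (intro M.finsum_cong') auto
 then show "finsum M (\<lambda>i. h i (x + y)) I = finsum M (\<lambda>i. h i x) I \<oplus>\<^bsub>M\<^esub> finsum M (\<lambda>i. h i y) I"
  using fhomD(1)[OF assms] by (subst M.finsum_addf[symmetric]) auto
qed (use fhomD(1)[OF assms] in \<open>auto intro!: M.finsum_closed\<close>)

end

lemma fhom_lin: "fhom M h \<Longrightarrow> lin_on K M N g \<Longrightarrow> fhom N (\<lambda>x. g (h x))"
 by (auto simp: fhom_def lin_on_def Pi_def)

text \<open>Letters of another degree, and pairs that are no elements of \<open>A\<close>, count as
  zero; so every formal sum of letters has a value, its component of degree
  \<open>q\<close>.\<close>

definition LE :: "(int \<Rightarrow> ('k, 'a) module) \<Rightarrow> int \<Rightarrow> ((int \<times> 'a) \<Rightarrow>\<^sub>0 int) \<Rightarrow> 'a" where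
 "LE A q = fev (A q) (\<lambda>l. if l \<in> Vl A \<and> fst l = q then snd l else \<zero>\<^bsub>A q\<^esub>)"

definition Zl :: "(int \<Rightarrow> ('k, 'a) module) \<Rightarrow> ((int \<times> 'a) \<Rightarrow>\<^sub>0 int) set" where
 "Zl A = {\<zeta>. \<forall>q. LE A q \<zeta> = \<zero>\<^bsub>A q\<^esub>}"

fun th :: "'a word \<Rightarrow> int" where
 "th [] = 0"
| "th (l # w) = th w + wdeg w"

text \<open>The twist by \<open>th\<close> makes all signs those of the suspension of \<open>A\<close>.\<close>

definition EV :: "('k, 'r) ring_scheme \<Rightarrow> (int \<Rightarrow> ('k, 'a) module) \<Rightarrow> nat \<Rightarrow> nat \<Rightarrow> int \<Rightarrow>
  ((nat \<times> 'a word) \<Rightarrow>\<^sub>0 int) \<Rightarrow> ('k, 'a) tens" where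
 "EV K A m n p = fev (tpow K A n p) (\<lambda>s. if fst s = m \<and> snd s \<in> words A n p
   then sgn_mult (tpow K A n p) (th (snd s)) (pure K A (snd s)) else \<zero>\<^bsub>tpow K A n p\<^esub>)"

text \<open>Through the restriction to positive \<open>n\<close> the empty words lie in
  \<open>Ker\<close>, in accordance with the cyclic module, whose tensors have at least one
  factor.\<close>

definition Ker where
 "Ker K A = {x. \<forall>m n p. n > 0 \<longrightarrow> EV K A m n p x = \<zero>\<^bsub>tpow K A n p\<^esub>}"

lemma th_append: "th (x @ y) = th x + th y + int (length x) * wdeg y"
 by (induction x) (auto simp: algebra_simps)

context
 fixes K :: "('k, 'r) ring_scheme" and A :: "int \<Rightarrow> ('k, 'a) module"
 assumes K: "cring K" and A: "\<And>q. module K (A q)"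
begin

lemma LE_fhom: "fhom (A q) (LE A q)"
 and LE_of: "LE A q (frag_of l) = (if l \<in> Vl A \<and> fst l = q then snd l else \<zero>\<^bsub>A q\<^esub>)"
proof -
 interpret module K "A q" by (rule A)
 show "fhom (A q) (LE A q)" "LE A q (frag_of l) = (if l \<in> Vl A \<and> fst l = q then snd l else \<zero>\<^bsub>A q\<^esub>)"
 proof -
  have "fhom (A q) (LE A q) \<and> (\<forall>l. LE A q (frag_of l) = (if l \<in> Vl A \<and> fst l = q then snd l else \<zero>\<^bsub>A q\<^esub>))"
   unfolding LE_def by (rule fev_ex[OF A]) (auto simp: Vl_def)
  then show "fhom (A q) (LE A q)" "LE A q (frag_of l) = (if l \<in> Vl A \<and> fst l = q then snd l else \<zero>\<^bsub>A q\<^esub>)"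
   by blast+
 qed
qed

lemma EV_fhom: "fhom (tpow K A n p) (EV K A m n p)"
 and EV_of: "EV K A m n p (frag_of s) = (if fst s = m \<and> snd s \<in> words A n p
   then sgn_mult (tpow K A n p) (th (snd s)) (pure K A (snd s)) else \<zero>\<^bsub>tpow K A n p\<^esub>)"
proof -
 let ?Tn = "tpow K A n p"
 interpret module K "?Tn" by (rule tpow_module[OF K A])
 have "fhom ?Tn (EV K A m n p) \<and> (\<forall>s. EV K A m n p (frag_of s) = (if fst s = m \<and> snd s \<in> words A n p
   then sgn_mult ?Tn (th (snd s)) (pure K A (snd s)) else \<zero>\<^bsub>?Tn\<^esub>))"
  unfolding EV_def
  by (rule fev_ex[OF tpow_module[OF K A]])
   (auto simp: pure_closed[OF K A] intro!: sgn_mult_closed[OF tpow_module[OF K A]])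
 then show "fhom ?Tn (EV K A m n p)" "EV K A m n p (frag_of s) = (if fst s = m \<and> snd s \<in> words A n p
   then sgn_mult ?Tn (th (snd s)) (pure K A (snd s)) else \<zero>\<^bsub>?Tn\<^esub>)"
  by blast+
qed

lemma Ker_subgrp: "subgrp (Ker K A)"
proof
 show "0 \<in> Ker K A"
  using fhom_zero[OF tpow_module[OF K A] EV_fhom] by (auto simp: Ker_def)
next
 fix x y assume xy: "x \<in> Ker K A" "y \<in> Ker K A"
 have "EV K A m n p (x - y) = \<zero>\<^bsub>tpow K A n p\<^esub>" if n: "n > 0" for m n p
 proof -
  interpret module K "tpow K A n p" by (rule tpow_module[OF K A])
  have T: "module K (tpow K A n p)" and h: "fhom (tpow K A n p) (EV K A m n p)"
   by (rule tpow_module[OF K A] EV_fhom)+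
  show ?thesis using xy n fhom_diff[OF T h, of x y]
   by (simp add: Ker_def minus_eq)
 qed
 then show "x - y \<in> Ker K A" by (simp add: Ker_def)
qed

text \<open>\<open>th\<close> depends only on the degrees of the letters, so the sign is constant
  while one letter varies within its degree.\<close>

lemma EV_letter_lin:
 assumes "x \<in> lists (Vl A)" "z \<in> lists (Vl A)"
 shows "lin_on K (A q) (tpow K A n p) (\<lambda>a. EV K A m n p (frag_of (m', x @ (q, a) # z)))"
proof (cases "m' = m \<and> Suc (length x + length z) = n \<and> wdeg x + q + wdeg z = p")
 case True
 note T = tpow_module[OF K A, where n = n and p = p]
 interpret Aq: module K "A q" by (rule A)
 define t where "t = th (x @ (q, \<zero>\<^bsub>A q\<^esub>) # z)"
 have th: "th (x @ (q, a) # z) = t" for a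
  by (simp add: th_append t_def)
 have "lin_on K (A q) (tpow K A n p) (\<lambda>a. sgn_mult (tpow K A n p) t (pure K A (x @ (q, a) # z)))"
  using assms True by (intro lin_on_sgn_mult_fun[OF T] mlinD[OF pure_mlin[OF K A]]) auto
 moreover have "EV K A m n p (frag_of (m', x @ (q, a) # z)) = sgn_mult (tpow K A n p) t (pure K A (x @ (q, a) # z))"
  if "a \<in> carrier (A q)" for a
  using assms True that by (simp add: EV_of words_iff th)
 ultimately show ?thesis
  by (rule lin_on_congI[OF A])
next
 case False
 then have "(\<lambda>a. EV K A m n p (frag_of (m', x @ (q, a) # z))) = (\<lambda>a. \<zero>\<^bsub>tpow K A n p\<^esub>)"
  by (auto simp: EV_of words_iff fun_eq_iff)
 then show ?thesis
  using lin_on_zero_fun[OF A tpow_module[OF K A]] by simp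
qed

text \<open>For fixed \<open>x\<close>, \<open>z\<close> and total degree \<open>p\<close> the
  degree \<open>q\<close> of the inserted letter is forced, and the evaluation of the word factors
  through \<open>LE A q\<close>, which kills \<zeta>.\<close>

lemma mult_mod_of: "mult_mod (Vl A) (Zl A) (Ker K A) (\<lambda>w. frag_of (m', w))"
 unfolding mult_mod_def
proof (intro ballI)
 fix x z \<zeta> assume xz: "x \<in> lists (Vl A)" "z \<in> lists (Vl A)" and \<zeta>: "\<zeta> \<in> Zl A"
 let ?\<psi> = "\<lambda>l. frag_of (m', x @ l # z)"
 have "EV K A m n p (frag_extend ?\<psi> \<zeta>) = \<zero>\<^bsub>tpow K A n p\<^esub>" for m n p
 proof -
  define q where "q = p - wdeg x - wdeg z"
  define \<kappa> where "\<kappa> a = EV K A m n p (frag_of (m', x @ (q, a) # z))" for a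
  have \<kappa>: "lin_on K (A q) (tpow K A n p) \<kappa>"
   unfolding \<kappa>_def using xz by (rule EV_letter_lin)
  have "EV K A m n p (frag_extend ?\<psi> \<zeta>) = \<kappa> (LE A q \<zeta>)"
  proof (rule fhom_ext'[OF tpow_module[OF K A, where n = n and p = p]])
   show "fhom (tpow K A n p) (\<lambda>\<zeta>. EV K A m n p (frag_extend ?\<psi> \<zeta>))"
    by (rule fhom_frag_extend[OF tpow_module[OF K A] EV_fhom])
   show "fhom (tpow K A n p) (\<lambda>\<zeta>. \<kappa> (LE A q \<zeta>))"
    by (rule fhom_lin[OF LE_fhom \<kappa>])
   fix l
   show "EV K A m n p (frag_extend ?\<psi> (frag_of l)) = \<kappa> (LE A q (frag_of l))"
   proof (cases "l \<in> Vl A \<and> fst l = q")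
    case True
    then have "l = (q, snd l)" by auto
    then have "\<kappa> (snd l) = EV K A m n p (frag_of (m', x @ l # z))"
     unfolding \<kappa>_def by metis
    then show ?thesis using True by (simp add: LE_of)
   next
    case False
    then have "x @ l # z \<notin> words A n p"
     by (auto simp: words_iff q_def)
    then have "EV K A m n p (frag_of (m', x @ l # z)) = \<zero>\<^bsub>tpow K A n p\<^esub>"
     by (simp add: EV_of)
    then show ?thesis
     using False by (auto simp: LE_of lin_on_zero[OF A tpow_module[OF K A] \<kappa>])
   qed
  qed
  also have "\<dots> = \<zero>\<^bsub>tpow K A n p\<^esub>"
   using \<zeta> by (simp add: Zl_def lin_on_zero[OF A tpow_module[OF K A] \<kappa>])
  finally show ?thesis .
 qed
 then show "frag_extend ?\<psi> \<zeta> \<in> Ker K A" by (simp add: Ker_def)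
qed

end

section \<open>Tensor products of maps\<close>

definition gm_lin where
 "gm_lin K A B \<phi> \<longleftrightarrow> fst \<phi> > 0 \<and> (\<forall>p. lin_on K (tpow K A (fst \<phi>) p) (B (p + fst (snd \<phi>))) (snd (snd \<phi>) p))"

lemma koszul_cong: "map fst w = map fst w' \<Longrightarrow> koszul_exp \<Phi> w = koszul_exp \<Phi> w'"
proof (induction \<Phi> w arbitrary: w' rule: koszul_exp.induct)
 case (2 k e \<phi> \<Phi> w)
 have "map fst (take k w) = map fst (take k w')" "map fst (drop k w) = map fst (drop k w')"
  using 2(2) by (metis take_map, metis drop_map)
 then show ?case using 2(1) by (simp add: wdeg_def)
qed simp

context
 fixes K :: "('k, 'r) ring_scheme" and A :: "int \<Rightarrow> ('k, 'a) module" and B :: "int \<Rightarrow> ('k, 'b) module"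
 assumes K: "cring K" and A: "\<And>q. module K (A q)" and B: "\<And>q. module K (B q)"
begin

lemma tmap_word_valid:
 "list_all (gm_lin K A B) \<Phi> \<Longrightarrow> w \<in> lists (Vl A) \<Longrightarrow> length w = sum_list (map fst \<Phi>) \<Longrightarrow>
  tmap_word K A \<Phi> w \<in> words B (length \<Phi>) (wdeg w + sum_list (map (fst \<circ> snd) \<Phi>))"
proof (induction \<Phi> arbitrary: w)
 case Nil
 then show ?case by (simp add: words_iff)
next
 case (Cons \<phi> \<Phi>)
 obtain k e f where \<phi>: "\<phi> = (k, e, f)" by (cases \<phi>)
 have tk: "take k w \<in> words A k (wdeg (take k w))"
  using Cons.prems by (auto simp: \<phi> words_iff dest: in_set_takeD)
 have "f (wdeg (take k w)) (pure K A (take k w)) \<in> carrier (B (wdeg (take k w) + e))"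
  using Cons.prems(1) pure_closed[OF K A tk] by (auto simp: \<phi> gm_lin_def dest!: spec lin_onD(1))
 moreover have "tmap_word K A \<Phi> (drop k w) \<in> words B (length \<Phi>) (wdeg (drop k w) + sum_list (map (fst \<circ> snd) \<Phi>))"
  using Cons.prems by (intro Cons.IH) (auto simp: \<phi> dest: in_set_dropD)
 moreover have "wdeg w = wdeg (take k w) + wdeg (drop k w)"
  by (metis append_take_drop_id wdeg_simps(3))
 ultimately show ?case
  by (auto simp: \<phi> words_iff comp_def)
qed

text \<open>A letter enters exactly one tensor factor, so it changes one output letter and does so
  linearly. Multilinearity of \<open>tmap\<close> thereby follows from that of
  \<open>pure\<close>.\<close>

lemma tmap_word_letter:
 assumes "list_all (gm_lin K A B) \<Phi>" "x \<in> lists (Vl A)" "z \<in> lists (Vl A)"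
  "Suc (length x + length z) = sum_list (map fst \<Phi>)"
 shows "\<exists>X Z q' \<kappa>. X \<in> lists (Vl B) \<and> Z \<in> lists (Vl B) \<and> lin_on K (A q) (B q') \<kappa> \<and>
   (\<forall>a\<in>carrier (A q). tmap_word K A \<Phi> (x @ (q, a) # z) = X @ (q', \<kappa> a) # Z)"
 using assms
proof (induction \<Phi> arbitrary: x)
 let ?W' = "lists (Vl B)"
 case (Cons \<phi> \<Phi>)
 obtain k e f where \<phi>: "\<phi> = (k, e, f)" by (cases \<phi>)
 have k: "k > 0" and f: "\<And>p. lin_on K (tpow K A k p) (B (p + e)) (f p)"
  using Cons.prems(1) by (auto simp: \<phi> gm_lin_def)
 show ?case
 proof (cases "k \<le> length x")
  case True
  have tk: "take k x \<in> words A k (wdeg (take k x))"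
   using Cons.prems True by (auto simp: \<phi> words_iff dest: in_set_takeD)
  have "\<exists>X Z q' \<kappa>. X \<in> ?W' \<and> Z \<in> ?W' \<and> lin_on K (A q) (B q') \<kappa> \<and>
   (\<forall>a\<in>carrier (A q). tmap_word K A \<Phi> (drop k x @ (q, a) # z) = X @ (q', \<kappa> a) # Z)"
   using Cons.prems True by (intro Cons.IH) (auto simp: \<phi> dest: in_set_dropD)
  then obtain X Z q' \<kappa> where *: "X \<in> ?W'" "Z \<in> ?W'" "lin_on K (A q) (B q') \<kappa>"
   "\<forall>a\<in>carrier (A q). tmap_word K A \<Phi> (drop k x @ (q, a) # z) = X @ (q', \<kappa> a) # Z" by blast
  then show ?thesis
   using True lin_onD(1)[OF f pure_closed[OF K A tk]]
   by (intro exI[of _ "(wdeg (take k x) + e, f (wdeg (take k x)) (pure K A (take k x))) # X"] exI[of _ Z]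
     exI[of _ q'] exI[of _ \<kappa>]) (simp add: \<phi>)
 next
  case False
  define y where "y = take (k - Suc (length x)) z"
  define p where "p = wdeg x + q + wdeg y"
  have tk: "take k (x @ (q, a) # z) = x @ (q, a) # y" and dk: "drop k (x @ (q, a) # z) = drop (k - Suc (length x)) z" for a
   using False by (auto simp: y_def take_Cons' drop_Cons')
  have "lin_on K (A q) (tpow K A k p) (\<lambda>a. pure K A (x @ (q, a) # y))"
   using Cons.prems False
   by (intro mlinD[OF pure_mlin[OF K A]]) (auto simp: y_def p_def \<phi> dest: in_set_takeD)
  then have lin: "lin_on K (A q) (B (p + e)) (\<lambda>a. f p (pure K A (x @ (q, a) # y)))"
   by (rule lin_on_comp[OF _ f])
  have "tmap_word K A \<Phi> (drop (k - Suc (length x)) z) \<in>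
    words B (length \<Phi>) (wdeg (drop (k - Suc (length x)) z) + sum_list (map (fst \<circ> snd) \<Phi>))"
   using Cons.prems False by (intro tmap_word_valid) (auto simp: \<phi> dest: in_set_dropD)
  then have "tmap_word K A \<Phi> (drop (k - Suc (length x)) z) \<in> ?W'"
   by (simp only: words_iff)
  then show ?thesis
   using lin
   by (intro exI[of _ "[]"] exI[of _ "tmap_word K A \<Phi> (drop (k - Suc (length x)) z)"] exI[of _ "p + e"]
     exI[of _ "\<lambda>a. f p (pure K A (x @ (q, a) # y))"])
    (auto simp: \<phi> tk dk p_def add.assoc simp del: take_append drop_append)
 qed
qed simp

lemma tmap_mlin:
 assumes "list_all (gm_lin K A B) \<Phi>" and n: "n = sum_list (map fst \<Phi>)"
  and N: "N = tpow K B (length \<Phi>) (p + sum_list (map (fst \<circ> snd) \<Phi>))"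
 shows "mlin K A n p N (\<lambda>w. sgn_mult N (koszul_exp \<Phi> w) (pure K B (tmap_word K A \<Phi> w)))"
 unfolding mlin_def
proof (intro ballI allI impI)
 fix x z q assume xz: "x \<in> lists (Vl A)" "z \<in> lists (Vl A)" "Suc (length x + length z) = n" "wdeg x + q + wdeg z = p"
 obtain X Z q' \<kappa> where *: "X \<in> lists (Vl B)" "Z \<in> lists (Vl B)" "lin_on K (A q) (B q') \<kappa>"
  "\<And>a. a \<in> carrier (A q) \<Longrightarrow> tmap_word K A \<Phi> (x @ (q, a) # z) = X @ (q', \<kappa> a) # Z"
  using tmap_word_letter[OF assms(1) xz(1,2)] xz(3) n by metis
 interpret Aq: module K "A q" by (rule A)
 have "X @ (q', \<kappa> \<zero>\<^bsub>A q\<^esub>) # Z \<in> words B (length \<Phi>) (p + sum_list (map (fst \<circ> snd) \<Phi>))"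
  using tmap_word_valid[OF assms(1), of "x @ (q, \<zero>\<^bsub>A q\<^esub>) # z"] xz n *(4) by (auto simp: add_ac)
 then have XZ: "Suc (length X + length Z) = length \<Phi>" "wdeg X + q' + wdeg Z = p + sum_list (map (fst \<circ> snd) \<Phi>)"
  by (auto simp: words_iff)
 define k where "k = koszul_exp \<Phi> (x @ (q, \<zero>\<^bsub>A q\<^esub>) # z)"
 have kz: "koszul_exp \<Phi> (x @ (q, a) # z) = k" for a
  unfolding k_def by (rule koszul_cong) simp
 have "lin_on K (A q) N (\<lambda>a. sgn_mult N k (pure K B (X @ (q', \<kappa> a) # Z)))"
  unfolding N
  by (intro lin_on_sgn_mult_fun tpow_module[OF K B] lin_on_comp[OF *(3)] mlinD[OF pure_mlin[OF K B]] * XZ)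
 moreover have "sgn_mult N (koszul_exp \<Phi> (x @ (q, a) # z)) (pure K B (tmap_word K A \<Phi> (x @ (q, a) # z)))
   = sgn_mult N k (pure K B (X @ (q', \<kappa> a) # Z))" if "a \<in> carrier (A q)" for a
  by (simp only: kz *(4)[OF that])
 ultimately show "lin_on K (A q) N (\<lambda>a. sgn_mult N (koszul_exp \<Phi> (x @ (q, a) # z)) (pure K B (tmap_word K A \<Phi> (x @ (q, a) # z))))"
  by (rule lin_on_congI[OF A])
qed

lemma tmap_lin:
 assumes "list_all (gm_lin K A B) \<Phi>" "\<Phi> \<noteq> []"
 shows "lin_on K (tpow K A (sum_list (map fst \<Phi>)) p)
   (tpow K B (length \<Phi>) (p + sum_list (map (fst \<circ> snd) \<Phi>))) (tmap K A B \<Phi> p)"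
proof -
 have n: "sum_list (map fst \<Phi>) > 0"
  using assms by (cases \<Phi>) (auto simp: gm_lin_def)
 have "lin_on K (tpow K A (sum_list (map fst \<Phi>)) p)
   (tpow K B (length \<Phi>) (p + sum_list (map (fst \<circ> snd) \<Phi>)))
   (lin_ext K (tpow K B (length \<Phi>) (p + sum_list (map (fst \<circ> snd) \<Phi>)))
    (\<lambda>w. sgn_mult (tpow K B (length \<Phi>) (p + sum_list (map (fst \<circ> snd) \<Phi>))) (koszul_exp \<Phi> w) (pure K B (tmap_word K A \<Phi> w))))"
  by (rule lin_ext_lin[OF K A tpow_module[OF K B] tmap_mlin[OF assms(1) refl refl] n])
 from lin_maps_lin_on[OF lin_maps_restrict[OF tpow_module[OF K A] this]] show ?thesis
  by (simp add: tmap_def Let_def)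
qed

lemma tmap_pure:
 assumes "list_all (gm_lin K A B) \<Phi>" "\<Phi> \<noteq> []" "w \<in> words A (sum_list (map fst \<Phi>)) p"
 shows "tmap K A B \<Phi> p (pure K A w) =
  sgn_mult (tpow K B (length \<Phi>) (p + sum_list (map (fst \<circ> snd) \<Phi>))) (koszul_exp \<Phi> w) (pure K B (tmap_word K A \<Phi> w))"
proof -
 have n: "sum_list (map fst \<Phi>) > 0"
  using assms by (cases \<Phi>) (auto simp: gm_lin_def)
 show ?thesis
  using lin_ext_pure[OF K A tpow_module[OF K B] tmap_mlin[OF assms(1) refl refl] n assms(3)] pure_closed[OF K A assms(3)]
  by (simp add: tmap_def Let_def)
qed

end

context
 fixes K :: "('k, 'r) ring_scheme" and A :: "int \<Rightarrow> ('k, 'a) module"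
 assumes K: "cring K" and A: "\<And>q. module K (A q)"
begin

lemma id_mlin: "mlin K A 1 p (A p) (\<lambda>w. snd (hd w))"
 by (auto simp: mlin_def lin_on_def)

lemma id_gmap_lin: "gm_lin K A A (id_gmap K A)"
proof -
 have "lin_on K (tpow K A 1 p) (A p) (\<lambda>X\<in>carrier (tpow K A 1 p). lin_ext K (A p) (\<lambda>w. snd (hd w)) X)" for p
  by (intro lin_maps_lin_on[OF lin_maps_restrict] tpow_module[OF K A] lin_ext_lin[OF K A A id_mlin]) simp
 then show ?thesis by (simp add: gm_lin_def id_gmap_def)
qed

lemma id_gmap_pure: "a \<in> carrier (A q) \<Longrightarrow> snd (snd (id_gmap K A)) q (pure K A [(q, a)]) = a"
 using lin_ext_pure[OF K A A id_mlin[of q], of "[(q, a)]"] pure_closed[OF K A, where w = "[(q, a)]" and n = 1 and p = q]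
 by (simp add: id_gmap_def words_iff)

lemma id_gmap_fst [simp]: "fst (id_gmap K A) = 1" "fst (snd (id_gmap K A)) = 0"
 by (simp_all add: id_gmap_def)

lemma tmap_word_id_append:
 "x \<in> lists (Vl A) \<Longrightarrow> tmap_word K A (replicate (length x) (id_gmap K A) @ \<Phi>) (x @ w) = x @ tmap_word K A \<Phi> w"
proof (induction x)
 case (Cons l x)
 obtain q a where l: "l = (q, a)" by (cases l)
 have "tmap_word K A (id_gmap K A # \<Phi>') (l # w') = l # tmap_word K A \<Phi>' w'" for \<Phi>' w'
  using id_gmap_pure[of a q] Cons.prems unfolding id_gmap_def by (auto simp: l)
 then show ?case using Cons by simp
qed simp

lemma koszul_id_append:
 "koszul_exp (replicate (length x) (id_gmap K A) @ \<Phi>) (x @ w) = sum_list (map (fst \<circ> snd) \<Phi>) * wdeg x + koszul_exp \<Phi> w"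
proof (induction x)
 case (Cons l x)
 have z: "sum_list (map (fst \<circ> snd) (replicate n (id_gmap K A))) = 0" for n
  by (induction n) (auto simp: id_gmap_def)
 have "koszul_exp (id_gmap K A # \<Phi>') (l # w') = sum_list (map (fst \<circ> snd) \<Phi>') * fst l + koszul_exp \<Phi>' w'" for \<Phi>' w'
  unfolding id_gmap_def by simp
 then show ?case using Cons z by (simp add: algebra_simps comp_def)
qed simp

lemma insert_map_pure:
 assumes \<phi>: "gm_lin K A A \<phi>" and A': "amod AA = A"
  and w: "x @ y @ z \<in> lists (Vl A)" "length x = i" "length y = fst \<phi>" "length z = j" "p = wdeg (x @ y @ z)"
 shows "insert_map K AA i \<phi> j p (pure K A (x @ y @ z)) =
   sgn_mult (tpow K A (Suc (i + j)) (p + fst (snd \<phi>))) (fst (snd \<phi>) * wdeg x)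
    (pure K A (x @ (wdeg y + fst (snd \<phi>), snd (snd \<phi>) (wdeg y) (pure K A y)) # z))"
proof -
 obtain k e f where \<phi>': "\<phi> = (k, e, f)" by (cases \<phi>)
 let ?\<Phi> = "replicate i (id_gmap K A) @ [\<phi>] @ replicate j (id_gmap K A)"
 have z: "sum_list (map (fst \<circ> snd) (replicate n (id_gmap K A))) = 0" for n
  by (induction n) (auto simp: id_gmap_def)
 have o: "sum_list (map fst (replicate n (id_gmap K A))) = n" for n
  by (induction n) (auto simp: id_gmap_def)
 note [simp] = sum_list_replicate comp_def
 have all: "list_all (gm_lin K A A) ?\<Phi>"
  using \<phi> id_gmap_lin by (auto simp: list_all_iff)
 have sums: "sum_list (map fst ?\<Phi>) = length (x @ y @ z)" "sum_list (map (fst \<circ> snd) ?\<Phi>) = e" "length ?\<Phi> = Suc (i + j)"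
  using w by (simp_all add: z o \<phi>')
 have "tmap_word K A ?\<Phi> (x @ y @ z) = x @ tmap_word K A (\<phi> # replicate j (id_gmap K A)) (y @ z)"
  using tmap_word_id_append[of x "\<phi> # replicate j (id_gmap K A)" "y @ z"] w by auto
 also have "tmap_word K A (\<phi> # replicate j (id_gmap K A)) (y @ z) = (wdeg y + e, f (wdeg y) (pure K A y)) # z"
  using tmap_word_id_append[of z "[]" "[]"] w by (auto simp: \<phi>')
 finally have tw: "tmap_word K A ?\<Phi> (x @ y @ z) = x @ (wdeg y + e, f (wdeg y) (pure K A y)) # z" .
 have "koszul_exp ?\<Phi> (x @ y @ z) = e * wdeg x + koszul_exp (\<phi> # replicate j (id_gmap K A)) (y @ z)"
  using koszul_id_append[of x "\<phi> # replicate j (id_gmap K A)" "y @ z"] w by (simp add: z \<phi>')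
 also have "koszul_exp (\<phi> # replicate j (id_gmap K A)) (y @ z) = 0"
  using koszul_id_append[of z "[]" "[]"] w by (auto simp: \<phi>' z)
 finally have kz: "koszul_exp ?\<Phi> (x @ y @ z) = e * wdeg x" by simp
 have "x @ y @ z \<in> words A (sum_list (map fst ?\<Phi>)) p"
  unfolding sums(1) using w by (simp add: words_iff)
 from tmap_pure[OF K A A all _ this] show ?thesis
  unfolding insert_map_def Let_def A' sums kz tw by (simp add: \<phi>')
qed

lemma insert_map_lin:
 assumes \<phi>: "gm_lin K A A \<phi>" and A': "amod AA = A"
 shows "lin_on K (tpow K A (i + fst \<phi> + j) p) (tpow K A (Suc (i + j)) (p + fst (snd \<phi>))) (insert_map K AA i \<phi> j p)"
proof -
 let ?\<Phi> = "replicate i (id_gmap K A) @ [\<phi>] @ replicate j (id_gmap K A)"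
 have z: "sum_list (map (fst \<circ> snd) (replicate n (id_gmap K A))) = 0" for n
  by (induction n) (auto simp: id_gmap_def)
 have o: "sum_list (map fst (replicate n (id_gmap K A))) = n" for n
  by (induction n) (auto simp: id_gmap_def)
 note [simp] = sum_list_replicate comp_def
 have all: "list_all (gm_lin K A A) ?\<Phi>"
  using \<phi> id_gmap_lin by (auto simp: list_all_iff)
 have sums: "sum_list (map fst ?\<Phi>) = i + fst \<phi> + j" "sum_list (map (fst \<circ> snd) ?\<Phi>) = fst (snd \<phi>)" "length ?\<Phi> = Suc (i + j)"
  by (simp_all add: z o)
 from tmap_lin[OF K A A all, of p] show ?thesis
  unfolding insert_map_def Let_def A' sums by simp
qed

end

section \<open>Index forms of the operators\<close>

lemma ssum_sum: "ssum \<phi> w = (\<Sum>i\<le>length w. \<phi> (take i w) (drop i w))"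
proof (induction w arbitrary: \<phi>)
 case (Cons a v)
 show ?case
  by (simp add: Cons.IH sum.atMost_Suc_shift del: sum.atMost_Suc)
qed simp

lemma sgx_sum: "sgx e (\<Sum>i\<in>I. \<phi> i) = (\<Sum>i\<in>I. sgx e (\<phi> i))"
 by (simp add: sgx_def sum_negf)

text \<open>Here \<open>k + 1\<close> is the length of the block and \<open>i\<close> its starting
  position, the indices of the classical formulas.\<close>

lemma Bs_sum:
 "Bs m w \<phi> = (\<Sum>k<length w. \<Sum>i<length w - k. sgx (wd (take i w))
   (\<phi> (take i w @ m (take (Suc k) (drop i w)) # drop (i + Suc k) w)))"
proof (induction w arbitrary: \<phi>)
 case (Cons a v)
 let ?t = "\<lambda>k i. sgx (wd (take i (a # v))) (\<phi> (take i (a # v) @ m (take (Suc k) (drop i (a # v))) # drop (i + Suc k) (a # v)))"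
 have "(\<Sum>k<length (a # v). \<Sum>i<length (a # v) - k. ?t k i)
   = (\<Sum>k<Suc (length v). ?t k 0 + (\<Sum>i<length v - k. ?t k (Suc i)))"
  by (intro sum.cong) (auto simp: Suc_diff_le sum.lessThan_Suc_shift simp del: sum.lessThan_Suc)
 also have "\<dots> = (\<Sum>k<Suc (length v). ?t k 0) + (\<Sum>k<Suc (length v). \<Sum>i<length v - k. ?t k (Suc i))"
  by (rule sum.distrib)
 also have "(\<Sum>k<Suc (length v). \<Sum>i<length v - k. ?t k (Suc i)) = (\<Sum>k<length v. \<Sum>i<length v - k. ?t k (Suc i))"
  by simp
 also have "(\<Sum>k<Suc (length v). ?t k 0) = (\<Sum>k\<le>length v. ?t k 0)"
  by (simp only: lessThan_Suc_atMost)
 finally show ?case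
  by (simp add: Cons.IH ssum_sum sgx_sum)
qed simp

definition rot :: "nat \<Rightarrow> 'l list \<Rightarrow> 'l list" where
 "rot q w = drop (length w - q) w @ take (length w - q) w"

lemma Ns_sum:
 "Ns w \<phi> = (\<Sum>j<length w. sgx (wd (drop (length w - j) w) * wd (take (length w - j) w)) (\<phi> (rot j w)))"
proof (cases w)
 case (Cons a v)
 have "Ns w \<phi> = (\<Sum>i\<le>length v. sgx (wd (drop i v) * wd (a # take i v)) (\<phi> (drop i v @ a # take i v)))"
  by (simp add: Cons Ns_Cons ssum_sum)
 also have "\<dots> = (\<Sum>j\<le>length v. sgx (wd (drop (length v - j) v) * wd (a # take (length v - j) v)) (\<phi> (drop (length v - j) v @ a # take (length v - j) v)))"
  by (rule sum.reindex_bij_witness[of _ "\<lambda>i. length v - i" "\<lambda>i. length v - i"]) auto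
 also have "\<dots> = (\<Sum>j<length w. sgx (wd (drop (length w - j) w) * wd (take (length w - j) w)) (\<phi> (rot j w)))"
  unfolding Cons list.size add_Suc_right add_0_right lessThan_Suc_atMost
  by (intro sum.cong refl) (simp add: rot_def Suc_diff_le)
 finally show ?thesis .
qed simp

text \<open>A wrapping block is described by the number \<open>q\<close> of letters that it takes
  from the end of the word. Of its \<open>k + 1\<close> letters at least one, the first letter of
  the word, is not among these, whence \<open>q \<le> k\<close>.\<close>

lemma bs_sum:
 "bs m w \<phi> = Bs m w \<phi> + (\<Sum>k\<in>{1..<length w}. \<Sum>q\<in>{1..k}.
   sgx (wd (drop (length w - q) w) * wd (take (length w - q) w))
    (\<phi> (m (take (Suc k) (rot q w)) # drop (Suc k) (rot q w))))"
proof (cases w)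
 case (Cons a v)
 let ?n = "length v"
 let ?\<tau> = "\<lambda>x y z. sgx (wd z * (fst a + 1 + wd x + wd y)) (\<phi> (m (z @ a # x) # y))"
 let ?t = "\<lambda>i q. ?\<tau> (take i v) (take (?n - q - i) (drop i v)) (drop (?n - q) v)"
 have "ssum3 ?\<tau> v = (\<Sum>i\<le>?n. \<Sum>j\<le>?n - i. ?\<tau> (take i v) (take j (drop i v)) (drop (i + j) v))"
  by (simp add: ssum3_def ssum_sum add.commute)
 also have "\<dots> = (\<Sum>i\<le>?n. \<Sum>q\<le>?n - i. ?t i q)"
 proof (rule sum.cong[OF refl])
  fix i assume "i \<in> {..?n}"
  then show "(\<Sum>j\<le>?n - i. ?\<tau> (take i v) (take j (drop i v)) (drop (i + j) v)) = (\<Sum>q\<le>?n - i. ?t i q)"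
   by (intro sum.reindex_bij_witness[of _ "\<lambda>q. ?n - i - q" "\<lambda>q. ?n - i - q"]) (auto simp: diff_commute)
 qed
 also have "\<dots> = (\<Sum>i\<le>?n. ?t i 0 + (\<Sum>q\<in>{1..?n - i}. ?t i q))"
  by (intro sum.cong refl) (simp add: atMost_atLeast0 sum.atLeast_Suc_atMost)
 also have "\<dots> = (\<Sum>i\<le>?n. ?t i 0) + (\<Sum>i\<le>?n. \<Sum>q\<in>{1..?n - i}. ?t i q)"
  by (rule sum.distrib)
 also have "(\<Sum>i\<le>?n. ?t i 0) = ssum (\<lambda>x z. \<phi> (m (a # x) # z)) v"
  by (simp add: ssum_sum)
 also have "(\<Sum>i\<le>?n. \<Sum>q\<in>{1..?n - i}. ?t i q) = (\<Sum>k\<in>{1..?n}. \<Sum>q\<in>{1..k}. ?t (k - q) q)"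
  by (auto simp: sum.Sigma add.commute intro!: sum.reindex_bij_witness[of _ "\<lambda>(k, q). (k - q, q)" "\<lambda>(i, q). (i + q, q)"])
 also have "\<dots> = (\<Sum>k\<in>{1..<length w}. \<Sum>q\<in>{1..k}. sgx (wd (drop (length w - q) w) * wd (take (length w - q) w))
    (\<phi> (m (take (Suc k) (rot q w)) # drop (Suc k) (rot q w))))"
 proof -
  have "?t (k - q) q = sgx (wd (drop (length w - q) w) * wd (take (length w - q) w))
    (\<phi> (m (take (Suc k) (rot q w)) # drop (Suc k) (rot q w)))"
   if kq: "1 \<le> q" "q \<le> k" "k \<le> ?n" for k q
  proof -
   have "take (?n - q) v = take ((k - q) + (?n - q - (k - q))) v" using kq by simp
   then have 1: "take (?n - q) v = take (k - q) v @ take (?n - q - (k - q)) (drop (k - q) v)"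
    by (simp only: take_add)
   have 2: "take (Suc k) (rot q w) = drop (?n - q) v @ a # take (k - q) v"
    "drop (Suc k) (rot q w) = take (?n - q - (k - q)) (drop (k - q) v)"
    using kq by (simp_all add: rot_def Cons Suc_diff_le take_Cons' drop_Cons' drop_take min_def)
   show ?thesis
    unfolding 2 using kq by (simp add: Cons Suc_diff_le 1 add.assoc)
  qed
  moreover have "{1..?n} = {1..<length w}" by (auto simp: Cons)
  ultimately show ?thesis by (intro sum.cong) (auto simp: Cons)
 qed
 finally show ?thesis
  by (simp add: Cons bs_Cons add_ac)
qed simp

text \<open>An entry \<open>n\<close> stands for a block of \<open>n + 1\<close> letters, because
  the component f_n takes n + 1 arguments; this explains the sum in \<open>comps\<close>.\<close>

fun chop :: "nat list \<Rightarrow> 'l list \<Rightarrow> 'l list list" where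
 "chop [] w = []"
| "chop (n # ns) w = take (Suc n) w # chop ns (drop (Suc n) w)"

definition comps :: "nat \<Rightarrow> nat list set" where
 "comps n = {ns. sum_list ns + length ns = n}"

lemma comps_0: "comps 0 = {[]}"
 by (auto simp: comps_def)

lemma comps_Suc: "comps (Suc n) = (\<Union>j\<le>n. (#) j ` comps (n - j))"
proof -
 have "ns \<in> comps (Suc n) \<longleftrightarrow> (\<exists>j\<le>n. \<exists>ms\<in>comps (n - j). ns = j # ms)" for ns
  by (cases ns) (auto simp: comps_def)
 then show ?thesis by blast
qed

lemma comps_finite [simp]: "finite (comps n)"
proof (induction n rule: less_induct)
 case (less n)
 then show ?case by (cases n) (auto simp: comps_0 comps_Suc)
qed

lemma Fs_comps: "Fs f w \<phi> = (\<Sum>ns\<in>comps (length w). \<phi> (map f (chop ns w)))"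
proof (induction w arbitrary: \<phi> rule: length_induct)
 case (1 w)
 show ?case
 proof (cases w)
  case (Cons a v)
  have "Fs f w \<phi> = (\<Sum>j\<le>length v. Fs f (drop j v) (\<lambda>u. \<phi> (f (a # take j v) # u)))"
   by (simp add: Cons Fs_Cons ssum_sum)
  also have "\<dots> = (\<Sum>j\<le>length v. \<Sum>ns\<in>comps (length v - j). \<phi> (map f (chop (j # ns) w)))"
   by (intro sum.cong refl) (simp add: 1[rule_format] Cons)
  also have "\<dots> = (\<Sum>j\<le>length v. \<Sum>ns\<in>(#) j ` comps (length v - j). \<phi> (map f (chop ns w)))"
   by (subst sum.reindex) (auto intro!: sum.cong)
  also have "\<dots> = (\<Sum>ns\<in>comps (length w). \<phi> (map f (chop ns w)))"
   unfolding Cons list.size add_Suc_right add_0_right comps_Suc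
   by (rule sum.UNION_disjoint[symmetric]) auto
  finally show ?thesis .
 qed (simp add: comps_0)
qed

lemma J_tuples_finite [simp]: "finite (J_tuples r s)"
 by (rule finite_subset[OF _ comps_finite[of "s + r"]]) (auto simp: J_tuples_def comps_def)

lemma Fs_sum:
 assumes "w \<noteq> []"
 shows "Fs f w \<phi> = (\<Sum>r<length w. \<Sum>ns\<in>J_tuples (Suc r) (length w - Suc r). \<phi> (map f (chop ns w)))"
proof -
 have "Fs f w \<phi> = (\<Sum>r<length w. \<Sum>ns\<in>{ns \<in> comps (length w). length ns - 1 = r}. \<phi> (map f (chop ns w)))"
  unfolding Fs_comps using assms
 proof (intro sum.group[symmetric] comps_finite)
  show "(\<lambda>ns. length ns - 1) ` comps (length w) \<subseteq> {..<length w}"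
  proof (clarsimp simp: comps_def)
   fix ns :: "nat list" assume "sum_list ns + length ns = length w"
   moreover have "length w > 0" using assms by simp
   ultimately show "length ns - Suc 0 < length w" by linarith
  qed
 qed simp
 also have "\<dots> = (\<Sum>r<length w. \<Sum>ns\<in>J_tuples (Suc r) (length w - Suc r). \<phi> (map f (chop ns w)))"
 proof (intro sum.cong refl)
  fix r assume "r \<in> {..<length w}"
  have "length ns > 0" if "ns \<in> comps (length w)" for ns
   using that assms by (cases ns) (auto simp: comps_def)
  then show "{ns \<in> comps (length w). length ns - 1 = r} = J_tuples (Suc r) (length w - Suc r)"
   using \<open>r \<in> _\<close> by (force simp: comps_def J_tuples_def)
 qed
 finally show ?thesis .
qed

section \<open>Signs\<close>

text \<open>k(k+1)/2, the exponent of the sign of reversing k + 1 odd symbols.\<close>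

definition tri :: "nat \<Rightarrow> int" where
 "tri k = int (\<Sum>i\<le>k. i)"

text \<open>Koszul exponent of applying the suspension to every factor of a word: a letter is passed
  by the symbols of all letters behind it.\<close>

fun nu :: "'a word \<Rightarrow> int" where
 "nu [] = 0"
| "nu (l # w) = int (length w) * fst l + nu w"

lemma nu_append: "nu (x @ y) = nu x + int (length y) * wdeg x + nu y"
 by (induction x) (auto simp: algebra_simps)

lemma tri_0 [simp]: "tri 0 = 0"
 by (simp add: tri_def)

lemma tri_Suc: "tri (Suc k) = tri k + int k + 1"
 by (simp add: tri_def)

lemma tri_add: "tri (a + b) = tri a + tri b + int a * int b"
 by (induction b) (auto simp: tri_Suc algebra_simps)

text \<open>The Koszul sign of the odd operation passing \<open>x\<close> and the suspension signs
  of the outer and the inner operation are compared with the suspension sign of the whole, the sign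
  of the structure relation and the Koszul sign of \<open>insert_map\<close>.\<close>

lemma sign_insert:
 assumes "length y = Suc \<kappa>" "\<kappa>' = length x + length z"
 shows "even (wd x + (tri \<kappa>' + nu (x @ (wdeg y + int \<kappa> - 1, a) # z)) + (tri \<kappa> + nu y)
   - (tri (\<kappa> + \<kappa>') + nu (x @ y @ z) + int (length x) * int \<kappa> + int \<kappa>' + (int \<kappa> - 1) * wdeg x))"
proof -
 have 1: "tri (\<kappa> + \<kappa>') = tri \<kappa> + tri \<kappa>' + int \<kappa> * (int (length x) + int (length z))"
  by (simp add: tri_add assms)
 have 2: "int \<kappa>' = int (length x) + int (length z)" by (simp add: assms)
 show ?thesis
  unfolding 1 2 by (auto simp: wd_def nu_append assms(1))
qed

lemma eps_Cons: "eps (n # ns) = (if ns = [] then 0 else (n + 1) * sum_list ns) + eps ns"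
proof (cases ns)
 case (Cons k ks)
 have "eps (n # ns) = (\<Sum>i<Suc (length ks). ((n # ns) ! i + 1) * sum_list (drop (i + 1) (n # ns)))"
  by (simp add: eps_def Cons)
 also have "\<dots> = (n + 1) * sum_list ns + (\<Sum>i<length ks. (ns ! i + 1) * sum_list (drop (i + 1) ns))"
  by (subst sum.lessThan_Suc_shift) simp
 finally show ?thesis by (simp add: eps_def Cons)
qed (simp add: eps_def)

section \<open>Suspended operations\<close>

text \<open>The suspension of a family \<open>Op r : A\<^sup>\<otimes>\<^sup>(r+1) \<rightarrow> B\<close> of maps of degrees \<open>r - s\<close>, as a letter-valued function of words.\<close>

definition slet :: "('k, 'r) ring_scheme \<Rightarrow> (int \<Rightarrow> ('k, 'a) module) \<Rightarrow> (int \<Rightarrow> ('k, 'b) module) \<Rightarrow> int \<Rightarrow>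
  (nat \<Rightarrow> int \<Rightarrow> ('k, 'a) tens \<Rightarrow> 'b) \<Rightarrow> 'a word \<Rightarrow> int \<times> 'b" where
 "slet K A B s Op y = (let d = wdeg y + int (length y) - 1 - s in
   (d, sgn_mult (B d) (tri (length y - 1) + nu y) (Op (length y - 1) (wdeg y) (pure K A y))))"

text \<open>\<open>slet\<close> without its sign, which is what \<open>tmap\<close> produces on the
  blocks of a word.\<close>

definition rlet :: "('k, 'r) ring_scheme \<Rightarrow> (int \<Rightarrow> ('k, 'a) module) \<Rightarrow> int \<Rightarrow>
  (nat \<Rightarrow> int \<Rightarrow> ('k, 'a) tens \<Rightarrow> 'b) \<Rightarrow> 'a word \<Rightarrow> int \<times> 'b" where
 "rlet K A s Op y = (wdeg y + int (length y) - 1 - s, Op (length y - 1) (wdeg y) (pure K A y))"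

definition ops_lin where
 "ops_lin K A B s Op \<longleftrightarrow> (\<forall>r p. lin_on K (tpow K A (Suc r) p) (B (p + int r - s)) (Op r p))"

lemma slet_f_degree: "f_degree (slet K A B 0 Op)"
 by unfold_locales (simp add: slet_def Let_def wd_def)

lemma slet_m_degree: "m_degree (slet K A A 1 Op)"
 by unfold_locales (simp add: slet_def Let_def wd_def)

text \<open>This is where the exponent \<open>eps\<close> comes from: it is what remains of the
  Koszul sign of the tensor product of the components once all suspension signs are taken off. Each
  further block changes the total by an explicit even number.\<close>

lemma sign_comp:
 assumes "length w = sum_list (map Suc ns)"
 shows "even (nu (map (\<lambda>y. (wdeg y + int (length y) - 1, a y)) (chop ns w))
   + sum_list (map (\<lambda>y. tri (length y - 1) + nu y) (chop ns w)) + nu w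
   + koszul_exp (map (\<lambda>n. (Suc n, int n, f n)) ns) w
   + (if ns = [] then 0 else tri (length ns - 1) + tri (length ns - 1 + sum_list ns)) + int (eps ns))"
 using assms
proof (induction ns arbitrary: w)
 case (Cons n ns)
 define y where "y = take (Suc n) w"
 define v where "v = drop (Suc n) w"
 have w: "w = y @ v" and ly: "length y = Suc n" and lv: "length v = sum_list (map Suc ns)"
  using Cons.prems by (auto simp: y_def v_def)
 have o: "length (chop ns v) = length ns" for ns :: "nat list" and v :: "'a word"
  by (induction ns v rule: chop.induct) auto
 have e: "sum_list (map (fst \<circ> snd) (map (\<lambda>n. (Suc n, int n, f n)) ns)) = int (sum_list ns)" for ns
  by (induction ns) auto
 have l: "int (length v) = int (length ns) + int (sum_list ns)"
  unfolding lv by (induction ns) auto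
 show ?case
 proof (cases ns)
  case Nil
  then show ?thesis
   using lv by (simp add: w ly eps_def)
 next
  case (Cons n' ns')
  then have ne: "ns \<noteq> []" by simp
  have t1: "tri (length ns) = tri (length ns - 1) + int (length ns)"
   using tri_Suc[of "length ns - 1"] ne by (simp add: of_nat_diff Suc_le_eq)
  have t0: "length ns + (n + sum_list ns) = (length ns - 1 + sum_list ns) + Suc n"
   using ne by (cases ns) auto
  have "int (length ns - 1 + sum_list ns) = int (length ns) - 1 + int (sum_list ns)"
   using ne by (simp add: of_nat_diff Suc_le_eq)
  then have t2: "tri (length ns + (n + sum_list ns)) = tri (length ns - 1 + sum_list ns) + (tri n + int n + 1)
    + (int (length ns) - 1 + int (sum_list ns)) * (int n + 1)"
   unfolding t0 by (simp only: tri_add[of "length ns - 1 + sum_list ns" "Suc n"] tri_Suc[of n] of_nat_Suc) simp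
  have t2': "tri (n + (sum_list ns + length ns)) = tri (length ns - 1 + sum_list ns) + (tri n + int n + 1)
    + (int (length ns) - 1 + int (sum_list ns)) * (int n + 1)"
   using t2 by (simp add: add_ac)
  let ?E' = "nu (map (\<lambda>y. (wdeg y + int (length y) - 1, a y)) (chop ns v))
   + sum_list (map (\<lambda>y. tri (length y - 1) + nu y) (chop ns v)) + nu v
   + koszul_exp (map (\<lambda>n. (Suc n, int n, f n)) ns) v
   + (tri (length ns - 1) + tri (length ns - 1 + sum_list ns)) + int (eps ns)"
  let ?E = "nu (map (\<lambda>y. (wdeg y + int (length y) - 1, a y)) (chop (n # ns) w))
   + sum_list (map (\<lambda>y. tri (length y - 1) + nu y) (chop (n # ns) w)) + nu w
   + koszul_exp (map (\<lambda>n. (Suc n, int n, f n)) (n # ns)) w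
   + (tri (length (n # ns) - 1) + tri (length (n # ns) - 1 + sum_list (n # ns))) + int (eps (n # ns))"
  have c: "chop (n # ns) w = y # chop ns v"
   by (simp add: y_def v_def)
  have k: "koszul_exp (map (\<lambda>n. (Suc n, int n, f n)) (n # ns)) w =
    int (sum_list ns) * wdeg y + koszul_exp (map (\<lambda>n. (Suc n, int n, f n)) ns) v"
   using e[of ns] by (simp add: y_def v_def)
  have "?E = ?E' + 2 * (int (length ns) * wdeg y + int (sum_list ns) * wdeg y + tri n + nu y
    + int (length ns) * int n + int (length ns) + int (sum_list ns) * (int n + 1))"
   unfolding c k using ne ly by (simp add: w o l eps_Cons t1 t2 t2' nu_append algebra_simps)
  moreover have "even ?E'"
   using Cons.IH[OF lv] ne by simp
  ultimately have "even ?E" by simp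
  then show ?thesis by simp
 qed
qed (simp add: eps_def)

context
 fixes K :: "('k, 'r) ring_scheme" and A :: "int \<Rightarrow> ('k, 'a) module" and B :: "int \<Rightarrow> ('k, 'b) module"
 assumes K: "cring K" and A: "\<And>q. module K (A q)" and B: "\<And>q. module K (B q)"
begin

lemma rlet_closed:
 assumes "ops_lin K A B s Op" "y \<in> lists (Vl A)" "y \<noteq> []"
 shows "rlet K A s Op y \<in> Vl B"
proof -
 have "pure K A y \<in> carrier (tpow K A (Suc (length y - 1)) (wdeg y))"
  using assms by (intro pure_closed[OF K A]) (simp add: words_iff)
 then have "Op (length y - 1) (wdeg y) (pure K A y) \<in> carrier (B (wdeg y + int (length y - 1) - s))"
  using assms(1) by (auto simp: ops_lin_def dest!: spec lin_onD(1))
 then show ?thesis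
  using assms(3) by (simp add: rlet_def of_nat_diff Suc_le_eq algebra_simps)
qed

lemma slet_rlet: "slet K A B s Op y = (fst (rlet K A s Op y),
  sgn_mult (B (fst (rlet K A s Op y))) (tri (length y - 1) + nu y) (snd (rlet K A s Op y)))"
 by (simp add: slet_def rlet_def Let_def)

lemma slet_closed:
 assumes "ops_lin K A B s Op" "y \<in> lists (Vl A)" "y \<noteq> []"
 shows "slet K A B s Op y \<in> Vl B"
 using rlet_closed[OF assms] sgn_mult_closed[OF B] by (auto simp: slet_rlet Vl_def)

lemma ops_letter_lin:
 assumes "ops_lin K A B s Op" "x \<in> lists (Vl A)" "z \<in> lists (Vl A)"
  "p = wdeg x + q + wdeg z" "r = length x + length z"
 shows "lin_on K (A q) (B (p + int r - s)) (\<lambda>a. Op r p (pure K A (x @ (q, a) # z)))"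
proof (rule lin_on_comp[where g = "Op r p"])
 show "lin_on K (A q) (tpow K A (Suc r) p) (\<lambda>a. pure K A (x @ (q, a) # z))"
  using assms by (intro mlinD[OF pure_mlin[OF K A]]) auto
 show "lin_on K (tpow K A (Suc r) p) (B (p + int r - s)) (Op r p)"
  using assms(1) by (simp add: ops_lin_def)
qed

lemma pure_slet:
 assumes "ops_lin K A B s Op" "list_all (\<lambda>y. y \<in> lists (Vl A) \<and> y \<noteq> []) ys" "X \<in> lists (Vl B)"
 shows "pure K B (X @ map (slet K A B s Op) ys) =
  sgn_mult (tpow K B (length X + length ys) (wdeg X + wdeg (map (rlet K A s Op) ys)))
   (sum_list (map (\<lambda>y. tri (length y - 1) + nu y) ys)) (pure K B (X @ map (rlet K A s Op) ys))"
 using assms(2,3)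
proof (induction ys arbitrary: X)
 case (Cons y ys)
 let ?r = "rlet K A s Op" and ?sl = "slet K A B s Op" and ?\<sigma> = "tri (length y - 1) + nu y"
 let ?T = "tpow K B (length X + length (y # ys)) (wdeg X + wdeg (map ?r (y # ys)))"
 note T = tpow_module[OF K B]
 have y: "?sl y \<in> Vl B" "?r y \<in> Vl B"
  using Cons.prems by (auto intro!: slet_closed[OF assms(1)] rlet_closed[OF assms(1)])
 have "?r y \<in> Vl B" if "y \<in> set ys" for y
  using Cons.prems that by (intro rlet_closed[OF assms(1)]) (auto simp: list_all_iff)
 then have ys: "map ?r ys \<in> lists (Vl B)"
  by (simp add: in_lists_conv_set)
 have "pure K B (X @ map ?sl (y # ys)) = sgn_mult ?T (sum_list (map (\<lambda>y. tri (length y - 1) + nu y) ys))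
   (pure K B (X @ ?sl y # map ?r ys))"
 proof -
  have "fst (?sl y) = fst (?r y)" by (simp add: slet_rlet)
  then show ?thesis
   using Cons.IH[of "X @ [?sl y]"] Cons.prems y by (simp add: add.assoc)
 qed
 also have "pure K B (X @ ?sl y # map ?r ys) = sgn_mult ?T ?\<sigma> (pure K B (X @ ?r y # map ?r ys))"
 proof -
  have lin: "lin_on K (B (fst (?r y))) ?T (\<lambda>a. pure K B (X @ (fst (?r y), a) # map ?r ys))"
   using Cons.prems ys by (intro mlinD[OF pure_mlin[OF K B]]) auto
  show ?thesis
   using lin_on_sgn_mult[OF B T lin, of "snd (?r y)" ?\<sigma>] y(2) by (simp add: slet_rlet Vl_def)
 qed
 also have "sgn_mult ?T (sum_list (map (\<lambda>y. tri (length y - 1) + nu y) ys)) (sgn_mult ?T ?\<sigma> (pure K B (X @ ?r y # map ?r ys)))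
   = sgn_mult ?T (sum_list (map (\<lambda>y. tri (length y - 1) + nu y) (y # ys))) (pure K B (X @ map ?r (y # ys)))"
  using Cons.prems y ys
  by (subst sgn_mult_sgn_mult[OF T])
   (simp_all add: pure_closed[OF K B] words_iff add.commute del: Vl_iff)
 finally show ?case .
qed (simp add: sgn_mult_def)

lemma LE_sum: "LE B q (\<Sum>i\<in>I. \<xi> i) = finsum (B q) (\<lambda>i. LE B q (\<xi> i)) I"
 by (rule fhom_sum[OF B LE_fhom[OF K B]])

lemma LE_sum_cong: "(\<And>i. i \<in> I \<Longrightarrow> LE B q (\<xi> i) = LE B q (\<eta> i)) \<Longrightarrow> LE B q (\<Sum>i\<in>I. \<xi> i) = LE B q (\<Sum>i\<in>I. \<eta> i)"
proof -
 interpret module K "B q" by (rule B)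
 assume "\<And>i. i \<in> I \<Longrightarrow> LE B q (\<xi> i) = LE B q (\<eta> i)"
 then show ?thesis
  unfolding LE_sum using fhomD(1)[OF LE_fhom[OF K B]] by (intro finsum_cong') auto
qed

lemma LE_sgx: "LE B q (sgx e \<xi>) = sgn_mult (B q) e (LE B q \<xi>)"
 by (rule fhom_sgx[OF B LE_fhom[OF K B]])

end

context
 fixes K :: "('k, 'r) ring_scheme" and A :: "int \<Rightarrow> ('k, 'a) module" and B :: "int \<Rightarrow> ('k, 'b) module"
 assumes K: "cring K" and A: "\<And>q. module K (A q)" and B: "\<And>q. module K (B q)"
begin

text \<open>One summand of \<open>Bs_link\<close>. Evaluated, each side is a sign times the same
  element \<open>b\<close>, so that only a parity remains to be compared.\<close>

lemma insert_term:
 assumes O': "ops_lin K A A 1 Op'" and O: "ops_lin K A B s Op" and AA: "amod AA = A"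
  and w: "x @ y @ z \<in> lists (Vl A)" "length y = Suc k" "length x = i" "length z = j"
   "N = k + i + j" "p = wdeg (x @ y @ z)" "q = p + int N - 1 - s"
 shows "LE B q (sgx (wd x) (frag_of (slet K A B s Op (x @ slet K A A 1 Op' y # z)))) =
  LE B q (sgx (tri N + nu (x @ y @ z) + int (i * k + (i + j))) (frag_of (q,
   Op (i + j) (p + int k - 1) (insert_map K AA i (Suc k, int k - 1, Op' k) j p (pure K A (x @ y @ z))))))"
proof -
 let ?P = "p + int k - 1" and ?d = "wdeg y + int k - 1" and ?\<mu> = "tri k + nu y"
 define a where "a = Op' k (wdeg y) (pure K A y)"
 have yv: "y \<in> lists (Vl A)" and xz: "x \<in> lists (Vl A)" "z \<in> lists (Vl A)"
  using w by auto
 have lin': "lin_on K (tpow K A (Suc k) (wdeg y)) (A ?d) (Op' k (wdeg y))"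
  using O' by (simp add: ops_lin_def)
 have a: "a \<in> carrier (A ?d)"
  unfolding a_def using yv w by (intro lin_onD(1)[OF lin'] pure_closed[OF K A]) (simp add: words_iff)
 have sy: "slet K A A 1 Op' y = (?d, sgn_mult (A ?d) ?\<mu> a)"
  using w by (simp add: slet_def Let_def a_def)
 have q: "q = ?P + int (i + j) - s" using w by simp
 have lin: "lin_on K (A ?d) (B q) (\<lambda>a. Op (i + j) ?P (pure K A (x @ (?d, a) # z)))"
  unfolding q using w by (intro ops_letter_lin[OF K A B O xz]) auto
 define b where "b = Op (i + j) ?P (pure K A (x @ (?d, a) # z))"
 have b: "b \<in> carrier (B q)"
  unfolding b_def by (rule lin_onD(1)[OF lin a])
 have gm: "gm_lin K A A (Suc k, int k - 1, Op' k)"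
  using O' by (simp add: gm_lin_def ops_lin_def add.assoc[symmetric] diff_add_eq add_diff_eq)
 have T: "module K (tpow K A (Suc (i + j)) ?P)" by (rule tpow_module[OF K A])
 have ins: "insert_map K AA i (Suc k, int k - 1, Op' k) j p (pure K A (x @ y @ z)) =
   sgn_mult (tpow K A (Suc (i + j)) ?P) ((int k - 1) * wdeg x) (pure K A (x @ (?d, a) # z))"
  using insert_map_pure[OF K A gm AA w(1) w(3) _ w(4) w(6)] w(2)
  by (simp add: a_def add_diff_eq)
 have linO: "lin_on K (tpow K A (Suc (i + j)) ?P) (B q) (Op (i + j) ?P)"
  unfolding q using O unfolding ops_lin_def by blast
 have pc: "pure K A (x @ (?d, a) # z) \<in> carrier (tpow K A (Suc (i + j)) ?P)"
  using w a xz by (intro pure_closed[OF K A]) (auto simp: words_iff)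
 have R: "Op (i + j) ?P (insert_map K AA i (Suc k, int k - 1, Op' k) j p (pure K A (x @ y @ z)))
   = sgn_mult (B q) ((int k - 1) * wdeg x) b"
  unfolding ins b_def by (rule lin_on_sgn_mult[OF T B linO pc])
 let ?\<nu> = "tri (i + j) + nu (x @ (?d, a) # z)"
 have nu: "nu (x @ (?d, sgn_mult (A ?d) ?\<mu> a) # z) = nu (x @ (?d, a) # z)"
  by (simp add: nu_append)
 have L: "slet K A B s Op (x @ slet K A A 1 Op' y # z) = (q, sgn_mult (B q) (?\<nu> + ?\<mu>) b)"
 proof -
  have "Op (i + j) ?P (pure K A (x @ (?d, sgn_mult (A ?d) ?\<mu> a) # z)) = sgn_mult (B q) ?\<mu> b"
   unfolding b_def using lin_on_sgn_mult[OF A B lin a] .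
  moreover have "wdeg (x @ (?d, c) # z) = ?P" and "length (x @ (?d, c) # z) - 1 = i + j"
   and "wdeg (x @ (?d, c) # z) + int (length (x @ (?d, c) # z)) - 1 - s = q" for c
   using w by simp_all
  ultimately show ?thesis
   unfolding slet_def[of K A B] Let_def sy nu by (simp only: sgn_mult_sgn_mult[OF B b])
 qed
 have "even ((wd x + (?\<nu> + ?\<mu>)) - ((tri N + nu (x @ y @ z) + int (i * k + (i + j))) + (int k - 1) * wdeg x))"
 proof -
  have N: "N = k + (i + j)" using w by simp
  have "(wd x + (?\<nu> + ?\<mu>)) - ((tri N + nu (x @ y @ z) + int (i * k + (i + j))) + (int k - 1) * wdeg x)
   = wd x + (tri (i + j) + nu (x @ (wdeg y + int k - 1, a) # z)) + (tri k + nu y)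
   - (tri (k + (i + j)) + nu (x @ y @ z) + int (length x) * int k + int (i + j) + (int k - 1) * wdeg x)"
   using w(3) by (simp add: N)
  moreover have "even \<dots>"
   using w by (intro sign_insert) auto
  ultimately show ?thesis by (simp only:)
 qed
 then have "sgn_mult (B q) (wd x + (?\<nu> + ?\<mu>)) b =
   sgn_mult (B q) ((tri N + nu (x @ y @ z) + int (i * k + (i + j))) + (int k - 1) * wdeg x) b"
  by (rule sgn_mult_cong[OF B])
 then show ?thesis
  unfolding L R LE_sgx[OF K A B]
  by (simp add: LE_of[OF K B] sgn_mult_closed[OF B b] sgn_mult_sgn_mult[OF B b])
qed

text \<open>The factor \<open>tri N + nu w\<close> belongs to the suspension of the whole relation.
  With k = N - m and t = i + 1 the remaining exponent \<open>i * k + (N - k)\<close> has the parity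
  of t(N - m) + N, the sign in the relation of a morphism.\<close>

lemma Bs_link:
 assumes O': "ops_lin K A A 1 Op'" and O: "ops_lin K A B s Op" and AA: "amod AA = A"
  and w: "w \<in> lists (Vl A)" "length w = Suc N" "p = wdeg w" "q = p + int N - 1 - s"
 shows "LE B q (Bs (slet K A A 1 Op') w (\<lambda>u. frag_of (slet K A B s Op u))) =
  LE B q (sgx (tri N + nu w) (\<Sum>k\<le>N. \<Sum>i\<le>N - k. sgx (int (i * k + (N - k))) (frag_of (q,
   Op (N - k) (p + int k - 1) (insert_map K AA i (Suc k, int k - 1, Op' k) (N - k - i) p (pure K A w))))))"
proof -
 let ?t = "\<lambda>k i. sgx (wd (take i w)) (frag_of (slet K A B s Op
   (take i w @ slet K A A 1 Op' (take (Suc k) (drop i w)) # drop (i + Suc k) w)))"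
 have "Bs (slet K A A 1 Op') w (\<lambda>u. frag_of (slet K A B s Op u)) = (\<Sum>k\<le>N. \<Sum>i\<le>N - k. ?t k i)"
  unfolding Bs_sum w(2)
  by (intro sum.cong) (auto simp: Suc_diff_le lessThan_Suc_atMost)
 moreover have "LE B q (\<Sum>k\<le>N. \<Sum>i\<le>N - k. ?t k i) = LE B q (\<Sum>k\<le>N. \<Sum>i\<le>N - k. sgx (tri N + nu w + int (i * k + (N - k))) (frag_of (q,
   Op (N - k) (p + int k - 1) (insert_map K AA i (Suc k, int k - 1, Op' k) (N - k - i) p (pure K A w)))))"
 proof (intro LE_sum_cong[OF K A B])
  fix k i assume ki: "k \<in> {..N}" "i \<in> {..N - k}"
  have d: "take i w @ take (Suc k) (drop i w) @ drop (i + Suc k) w = w"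
   by (metis append_take_drop_id drop_drop add.commute)
  show "LE B q (?t k i) = LE B q (sgx (tri N + nu w + int (i * k + (N - k))) (frag_of (q,
   Op (N - k) (p + int k - 1) (insert_map K AA i (Suc k, int k - 1, Op' k) (N - k - i) p (pure K A w)))))"
   using insert_term[OF O' O AA, of "take i w" "take (Suc k) (drop i w)" "drop (i + Suc k) w" k i "N - k - i" N p q]
    ki w unfolding d by simp
 qed
 ultimately show ?thesis
  by (simp add: sgx_sum)
qed

text \<open>Grouping the subdivisions by their number \<open>r + 1\<close> of blocks gives the sums
  over \<open>J_tuples\<close>, and \<open>sign_comp\<close> leaves \<open>eps\<close> as the
  sign.\<close>

lemma Fs_link:
 fixes C :: "int \<Rightarrow> ('k, 'c) module"
 assumes C: "\<And>q. module K (C q)" and f: "ops_lin K A B 0 f" and O: "ops_lin K B C s Op"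
  and w: "w \<in> lists (Vl A)" "length w = Suc N" "p = wdeg w" "q = p + int N - s"
 shows "LE C q (Fs (slet K A B 0 f) w (\<lambda>u. frag_of (slet K B C s Op u))) =
  LE C q (sgx (tri N + nu w) (\<Sum>r\<le>N. \<Sum>ns\<in>J_tuples (Suc r) (N - r). sgx (int (eps ns)) (frag_of (q,
   Op r (p + int (N - r)) (tmap K A B (map (mor_gmap f) ns) p (pure K A w))))))"
proof -
 let ?W = "lists (Vl A)"
 let ?t = "\<lambda>r ns. frag_of (slet K B C s Op (map (slet K A B 0 f) (chop ns w)))"
 let ?u = "\<lambda>r ns. sgx (tri N + nu w + int (eps ns)) (frag_of (q,
   Op r (p + int (N - r)) (tmap K A B (map (mor_gmap f) ns) p (pure K A w))))"
 have gl: "gm_lin K A B (mor_gmap f n)" for n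
  using f by (simp add: gm_lin_def mor_gmap_def ops_lin_def)
 have termeq: "LE C q (?t r ns) = LE C q (?u r ns)" if r: "r \<le> N" and ns: "ns \<in> J_tuples (Suc r) (N - r)" for r ns
 proof -
  let ?\<Phi> = "map (mor_gmap f) ns" and ?ys = "chop ns w"
  have lns: "length ns = Suc r" "sum_list ns = N - r" using ns by (auto simp: J_tuples_def)
  then have "ns \<noteq> []" by auto
  have sS: "sum_list (map Suc ns) = sum_list ns + length ns" for ns by (induction ns) auto
  have lw: "length w = sum_list (map Suc ns)" using lns w r by (simp add: sS)
  have \<Phi>1: "sum_list (map fst ?\<Phi>) = length w" unfolding lw by (simp add: mor_gmap_def comp_def)
  have \<Phi>2: "sum_list (map (fst \<circ> snd) ?\<Phi>) = int (N - r)"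
  proof -
   have "sum_list (map (fst \<circ> snd) (map (mor_gmap f) ns)) = int (sum_list ns)" for ns
    by (induction ns) (auto simp: mor_gmap_def)
   then show ?thesis using lns by simp
  qed
  have tm: "tmap K A B ?\<Phi> p (pure K A w) = sgn_mult (tpow K B (Suc r) (p + int (N - r))) (koszul_exp ?\<Phi> w) (pure K B (tmap_word K A ?\<Phi> w))"
   using \<open>ns \<noteq> []\<close> tmap_pure[where A = A and B = B and \<Phi> = ?\<Phi> and w = w and p = p, OF K A B] gl lns w unfolding \<Phi>1 \<Phi>2
   by (auto simp: list_all_iff words_iff)
  have "tmap_word K A (map (mor_gmap f) ns) w = map (rlet K A 0 f) (chop ns w)"
   if "length w = sum_list (map Suc ns)" for ns and w :: "'a word"
   using that by (induction ns arbitrary: w) (auto simp: mor_gmap_def rlet_def)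
  from this[OF lw] have tw: "tmap_word K A ?\<Phi> w = map (rlet K A 0 f) ?ys" .
  have "list_all (\<lambda>y. y \<in> ?W \<and> y \<noteq> []) (chop ns w)"
   if "length w = sum_list (map Suc ns)" "w \<in> ?W" for ns w
   using that
  proof (induction ns arbitrary: w)
   case (Cons n ns)
   have "take (Suc n) w \<in> ?W" "drop (Suc n) w \<in> ?W"
    using Cons.prems(2) by (auto dest: in_set_takeD in_set_dropD)
   moreover have "take (Suc n) w \<noteq> []" using Cons.prems(1) by auto
   ultimately show ?case using Cons.IH[of "drop (Suc n) w"] Cons.prems(1) by simp
  qed simp
  from this[OF lw w(1)] have ys: "list_all (\<lambda>y. y \<in> ?W \<and> y \<noteq> []) ?ys" .
  have lys: "length ?ys = Suc r"
   unfolding lns(1)[symmetric] by (induction ns w rule: chop.induct) auto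
  have rw: "map (rlet K A 0 f) ?ys \<in> words B (Suc r) (p + int (N - r))"
   using tmap_word_valid[where A = A and B = B and \<Phi> = ?\<Phi> and w = w, OF K A B] gl lw w lns unfolding tw \<Phi>1 \<Phi>2 by (auto simp: list_all_iff)
  let ?\<sigma> = "sum_list (map (\<lambda>y. tri (length y - 1) + nu y) ?ys)"
  let ?T = "tpow K B (Suc r) (p + int (N - r))"
  have T: "module K ?T" by (rule tpow_module[OF K B])
  define v where "v = map (rlet K A 0 f) ?ys"
  have v: "pure K B v \<in> carrier ?T" unfolding v_def by (rule pure_closed[OF K B rw])
  have wv: "wdeg v = p + int (N - r)" using rw by (simp add: v_def words_iff)
  have ps: "pure K B (map (slet K A B 0 f) ?ys) = sgn_mult ?T ?\<sigma> (pure K B v)"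
   using pure_slet[where A = A and B = B and X = "[]", OF K A B f ys] lys wv by (simp add: v_def)
  have wd_map: "wdeg (map (slet K A B 0 f) ?ys) = wdeg v" "nu (map (slet K A B 0 f) ?ys) = nu v"
  proof -
   have "wdeg (map (slet K A B 0 f) ys) = wdeg (map (rlet K A 0 f) ys)"
    "nu (map (slet K A B 0 f) ys) = nu (map (rlet K A 0 f) ys)" for ys
    by (induction ys) (auto simp: slet_def rlet_def Let_def)
   then show "wdeg (map (slet K A B 0 f) ?ys) = wdeg v" "nu (map (slet K A B 0 f) ?ys) = nu v"
    by (simp_all add: v_def)
  qed
  have q: "q = p + int (N - r) + int r - s" using w r by simp
  have lO: "lin_on K ?T (C q) (Op r (p + int (N - r)))"
   unfolding q using O unfolding ops_lin_def by blast
  define b where "b = Op r (p + int (N - r)) (pure K B v)"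
  have b: "b \<in> carrier (C q)" unfolding b_def by (rule lin_onD(1)[OF lO v])
  have L: "slet K B C s Op (map (slet K A B 0 f) ?ys) = (q, sgn_mult (C q) (tri r + nu v + ?\<sigma>) b)"
  proof -
   have "Op r (p + int (N - r)) (sgn_mult ?T ?\<sigma> (pure K B v)) = sgn_mult (C q) ?\<sigma> b"
    unfolding b_def by (rule lin_on_sgn_mult[OF T C lO v])
   moreover have "wdeg v + int (length (map (slet K A B 0 f) ?ys)) - 1 - s = q"
    using wv lys q by simp
   moreover have "length (map (slet K A B 0 f) ?ys) - 1 = r" using lys by simp
   ultimately show ?thesis
    unfolding slet_def[of K B C] Let_def wd_map ps by (simp only: wv sgn_mult_sgn_mult[OF C b])
  qed
  have R: "Op r (p + int (N - r)) (tmap K A B ?\<Phi> p (pure K A w)) = sgn_mult (C q) (koszul_exp ?\<Phi> w) b"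
   unfolding tm tw b_def v_def[symmetric] by (rule lin_on_sgn_mult[OF T C lO v])
  have "even (nu v + ?\<sigma> + nu w + koszul_exp ?\<Phi> w + (tri r + tri N) + int (eps ns))"
  proof -
   have mg: "mor_gmap f = (\<lambda>n. (Suc n, int n, f n))" by (auto simp: mor_gmap_def)
   have "nu v = nu (map (\<lambda>y. (wdeg y + int (length y) - 1, snd (rlet K A 0 f y))) (chop ns w))"
    by (simp add: v_def rlet_def[abs_def])
   moreover have "ns \<noteq> []" "length ns - 1 = r" "length ns - 1 + sum_list ns = N" using lns r by auto
   ultimately show ?thesis
    using sign_comp[OF lw, of "\<lambda>y. snd (rlet K A 0 f y)" f] by (simp add: mg)
  qed
  then have "sgn_mult (C q) (tri r + nu v + ?\<sigma>) b = sgn_mult (C q) ((tri N + nu w + int (eps ns)) + koszul_exp ?\<Phi> w) b"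
   by (intro sgn_mult_cong[OF C]) presburger
  then show ?thesis
   unfolding L R LE_sgx[OF K A C]
   by (simp add: LE_of[OF K C] sgn_mult_closed[OF C b] sgn_mult_sgn_mult[OF C b])
 qed
 have ne: "w \<noteq> []" using w by auto
 have "Fs (slet K A B 0 f) w (\<lambda>u. frag_of (slet K B C s Op u)) = (\<Sum>r\<le>N. \<Sum>ns\<in>J_tuples (Suc r) (N - r). ?t r ns)"
  unfolding Fs_sum[OF ne] w(2) by (simp add: lessThan_Suc_atMost)
 moreover have "LE C q (\<Sum>r\<le>N. \<Sum>ns\<in>J_tuples (Suc r) (N - r). ?t r ns) =
   LE C q (\<Sum>r\<le>N. \<Sum>ns\<in>J_tuples (Suc r) (N - r). ?u r ns)"
  by (intro LE_sum_cong[OF K A C] termeq) auto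
 ultimately show ?thesis
  by (simp add: sgx_sum)
qed

end

section \<open>The suspended structure relations\<close>

text \<open>The differential is counted as the operation with index 0, so that index
  \<open>r\<close> always means \<open>r + 1\<close> arguments and degree \<open>r - 1\<close>, and
  d and the products are treated alike.\<close>

definition mO :: "('k, 'r) ring_scheme \<Rightarrow> ('k, 'a) ainf \<Rightarrow> nat \<Rightarrow> int \<Rightarrow> ('k, 'a) tens \<Rightarrow> 'a" where
 "mO K A r = (if r = 0 then snd (snd (diff_gmap K A)) else aop A (r - 1))"

abbreviation "mlet K A \<equiv> slet K (amod A) (amod A) 1 (mO K A)"
abbreviation "flet K A B f \<equiv> slet K (amod A) (amod B) 0 f"

lemma is_ainfD:
 assumes "is_ainf K A"
 shows "module K (amod A q)" "q < 0 \<Longrightarrow> carrier (amod A q) = {\<zero>\<^bsub>amod A q\<^esub>}"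
  "lin_on K (amod A p) (amod A (p - 1)) (adiff A p)"
  "lin_on K (tpow K (amod A) (n + 2) p) (amod A (p + int n)) (aop A n p)"
  "x \<in> carrier (amod A p) \<Longrightarrow> adiff A (p - 1) (adiff A p x) = \<zero>\<^bsub>amod A (p - 2)\<^esub>"
 using assms unfolding is_ainf_def graded_module_def by (blast intro: lin_maps_lin_on)+

lemma is_ainf_rel:
 assumes "is_ainf K A" "X \<in> carrier (tpow K (amod A) (N + 2) p)" "M = amod A (p + int N - 1)"
 shows "adiff A (p + int N) (aop A N p X) \<oplus>\<^bsub>M\<^esub> sgn_mult M (int N - 1) (aop A N (p - 1) (tdiff K A (N + 2) p X))
    = finsum M (\<lambda>m. finsum M (\<lambda>t.
      sgn_mult M (int (t * (N - m) + N))
       (aop A m (p + int (N - 1 - m))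
        (insert_map K A (t - 1) (op_gmap A (N - 1 - m)) (m + 2 - t) p X)))
      {1..m + 2}) {..<N}"
 using assms unfolding is_ainf_def Let_def by blast

lemma gm_mO: "(Suc k, int k - 1, mO K A k) = (if k = 0 then diff_gmap K A else op_gmap A (k - 1))"
 by (auto simp: mO_def diff_gmap_def op_gmap_def)

context
 fixes K :: "('k, 'r) ring_scheme" and A :: "('k, 'a) ainf"
 assumes K: "cring K" and A: "is_ainf K A"
begin

lemma diff_lin: "lin_on K (tpow K (amod A) 1 p) (amod A (p - 1)) (snd (snd (diff_gmap K A)) p)"
proof -
 have "lin_on K (tpow K (amod A) 1 p) (amod A p) (snd (snd (id_gmap K (amod A))) p)"
  using id_gmap_lin[where A = "amod A", OF K is_ainfD(1)[OF A]] by (simp add: gm_lin_def id_gmap_def)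
 then show ?thesis
  using lin_on_comp[OF _ is_ainfD(3)[OF A]] by (fastforce simp: diff_gmap_def)
qed

lemma mO_lin: "ops_lin K (amod A) (amod A) 1 (mO K A)"
 unfolding ops_lin_def
proof (intro allI)
 fix r p
 show "lin_on K (tpow K (amod A) (Suc r) p) (amod A (p + int r - 1)) (mO K A r p)"
 proof (cases r)
  case 0
  then show ?thesis using diff_lin[of p] by (simp add: mO_def)
 next
  case (Suc n)
  then show ?thesis using is_ainfD(4)[OF A, of n p] by (simp add: mO_def)
 qed
qed

lemma gm_mO_lin: "gm_lin K (amod A) (amod A) (Suc k, int k - 1, mO K A k)"
 using mO_lin by (simp add: gm_lin_def ops_lin_def add_diff_eq)

lemma diff_pure: "a \<in> carrier (amod A q) \<Longrightarrow> snd (snd (diff_gmap K A)) q (pure K (amod A) [(q, a)]) = adiff A q a"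
 by (simp add: diff_gmap_def id_gmap_pure[where A = "amod A", OF K is_ainfD(1)[OF A]])

lemma insert_closed:
 assumes "X \<in> carrier (tpow K (amod A) (Suc N) p)" "k \<le> N" "i \<le> N - k"
 shows "insert_map K A i (Suc k, int k - 1, mO K A k) (N - k - i) p X \<in> carrier (tpow K (amod A) (Suc (N - k)) (p + int k - 1))"
proof -
 have "i + Suc k + (N - k - i) = Suc N" "Suc (i + (N - k - i)) = Suc (N - k)" using assms by auto
 then show ?thesis
  using lin_onD(1)[OF insert_map_lin[where A = "amod A" and i = i and j = "N - k - i" and p = p, OF K is_ainfD(1)[OF A] gm_mO_lin[of k] refl], of X] assms
  by (simp add: add_diff_eq)
qed

lemma tdiff_eq:
 assumes "X \<in> carrier (tpow K (amod A) (Suc N) p)"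
 shows "tdiff K A (Suc N) p X = finsum (tpow K (amod A) (Suc N) (p - 1)) (\<lambda>i. insert_map K A i (Suc 0, - 1, mO K A 0) (N - i) p X) {..N}"
 using assms gm_mO[of 0 K A] by (simp add: tdiff_def lessThan_Suc_atMost)

end

lemma LE_fs:
 assumes "cring K" "\<And>q. module K (B q)" "\<And>i. i \<in> I \<Longrightarrow> c i \<in> carrier (B q)"
 shows "finsum (B q) (\<lambda>i. sgn_mult (B q) (e i) (c i)) I = LE B q (\<Sum>i\<in>I. sgx (e i) (frag_of (q, c i)))"
proof -
 interpret module K "B q" by (rule assms(2))
 show ?thesis
  unfolding fhom_sum[OF assms(2) LE_fhom[where A = B, OF assms(1,2)]] fhom_sgx[OF assms(2) LE_fhom[where A = B, OF assms(1,2)]]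
  using assms(3) by (intro finsum_cong') (auto simp: LE_of[where A = B, OF assms(1,2)] sgn_mult_closed[OF assms(2)])
qed

lemma finsum_LE:
 assumes "cring K" "\<And>q. module K (B q)" "\<And>i. i \<in> I \<Longrightarrow> c i = LE B q (\<xi> i)"
 shows "finsum (B q) c I = LE B q (\<Sum>i\<in>I. \<xi> i)"
proof -
 interpret module K "B q" by (rule assms(2))
 show ?thesis
  unfolding fhom_sum[OF assms(2) LE_fhom[where A = B, OF assms(1,2)]]
  using assms(3) fhomD(1)[OF LE_fhom[where A = B, OF assms(1,2)]] by (intro finsum_cong') auto
qed

context
 fixes K :: "('k, 'r) ring_scheme" and A :: "('k, 'a) ainf" and B :: "int \<Rightarrow> ('k, 'b) module" and Op s
 assumes K: "cring K" and A: "is_ainf K A" and B: "\<And>q. module K (B q)" and Op: "ops_lin K (amod A) B s Op"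
begin

definition ins_val :: "nat \<Rightarrow> int \<Rightarrow> ('k, 'a) tens \<Rightarrow> nat \<Rightarrow> nat \<Rightarrow> 'b" where
 "ins_val N p X k i = Op (N - k) (p + int k - 1) (insert_map K A i (Suc k, int k - 1, mO K A k) (N - k - i) p X)"

lemma ins_val_closed:
 assumes "X \<in> carrier (tpow K (amod A) (Suc N) p)" "k \<le> N" "i \<le> N - k"
 shows "ins_val N p X k i \<in> carrier (B (p + int N - 1 - s))"
proof -
 have "lin_on K (tpow K (amod A) (Suc (N - k)) (p + int k - 1)) (B (p + int k - 1 + int (N - k) - s)) (Op (N - k) (p + int k - 1))"
  using Op unfolding ops_lin_def by blast
 then have "ins_val N p X k i \<in> carrier (B (p + int k - 1 + int (N - k) - s))"
  unfolding ins_val_def by (rule lin_onD(1)) (rule insert_closed[OF K A assms])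
 moreover have "p + int k - 1 + int (N - k) - s = p + int N - 1 - s" using assms by simp
 ultimately show ?thesis by (simp only:)
qed

lemma ins_val_0:
 assumes X: "X \<in> carrier (tpow K (amod A) (Suc N) p)" and q: "q = p + int N - 1 - s"
 shows "LE B q (\<Sum>i\<le>N. sgx e (frag_of (q, ins_val N p X 0 i))) = sgn_mult (B q) e (Op N (p - 1) (tdiff K A (Suc N) p X))"
proof -
 interpret B: module K "B q" by (rule B)
 interpret T: module K "tpow K (amod A) (Suc N) (p - 1)" by (rule tpow_module[OF K is_ainfD(1)[OF A]])
 have lin: "lin_on K (tpow K (amod A) (Suc N) (p - 1)) (B q) (Op N (p - 1))"
  using Op unfolding ops_lin_def q by (metis add.commute add_diff_eq)
 have ins: "insert_map K A i (Suc 0, - 1, mO K A 0) (N - i) p X \<in> carrier (tpow K (amod A) (Suc N) (p - 1))" if "i \<le> N" for i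
  using insert_closed[OF K A X, of 0 i] that by simp
 have lins: "lin_on K (B q) (B q) (sgn_mult (B q) e)"
  by (intro lin_onI) (simp_all add: sgn_mult_closed[OF B] sgn_mult_add[OF B] sgn_mult_smult[OF B])
 have "LE B q (\<Sum>i\<le>N. sgx e (frag_of (q, ins_val N p X 0 i))) = finsum (B q) (\<lambda>i. sgn_mult (B q) e (ins_val N p X 0 i)) {..N}"
  using ins_val_closed[OF X, of 0] q by (intro LE_fs[OF K B, symmetric]) auto
 also have "\<dots> = sgn_mult (B q) e (finsum (B q) (\<lambda>i. Op N (p - 1) (insert_map K A i (Suc 0, - 1, mO K A 0) (N - i) p X)) {..N})"
  using ins lin_onD(1)[OF lin] by (subst lin_on_finsum[OF B B lins]) (auto simp: ins_val_def)
 also have "finsum (B q) (\<lambda>i. Op N (p - 1) (insert_map K A i (Suc 0, - 1, mO K A 0) (N - i) p X)) {..N} = Op N (p - 1) (tdiff K A (Suc N) p X)"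
  unfolding tdiff_eq[OF K A X] using ins
  by (subst lin_on_finsum[OF T.module_axioms B lin]) auto
 finally show ?thesis .
qed

lemma ins_val_Suc:
 assumes "N = k + r" "k > 0"
 shows "ins_val N p X k i = Op r (p + int (k - 1)) (insert_map K A i (op_gmap A (k - 1)) (r - i) p X)"
 using assms gm_mO[of k K A] by (simp add: ins_val_def of_nat_diff Suc_le_eq add_diff_eq)

end

lemma LE_zero_subgrp:
 assumes "cring K" "\<And>q. module K (B q)"
 shows "subgrp {\<zeta>. LE B q \<zeta> = \<zero>\<^bsub>B q\<^esub>}"
proof -
 interpret module K "B q" by (rule assms(2))
 note h = LE_fhom[where A = B and q = q, OF assms]
 show ?thesis
  by unfold_locales (auto simp: fhom_zero[OF assms(2) h] fhom_diff[OF assms(2) h] minus_eq)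
qed

text \<open>All letters produced have the degree computed from \<open>wd w\<close>, so every other
  component vanishes for reasons of degree.\<close>

lemma LE_Bs_other:
 assumes K: "cring K" "\<And>q. module K (B q)" and "m_degree m" and "q \<noteq> wd w - 2 - s"
 shows "LE B q (Bs m w (\<lambda>u. frag_of (slet K A B s Op u))) = \<zero>\<^bsub>B q\<^esub>"
proof -
 interpret m_degree m by fact
 interpret S: subgrp "{\<zeta>. LE B q \<zeta> = \<zero>\<^bsub>B q\<^esub>}" by (rule LE_zero_subgrp[OF K])
 let ?\<phi> = "\<lambda>u. if wd u = wd w - 1 then frag_of (slet K A B s Op u) else 0"
 have "fst (slet K A B s Op u) = wd u - 1 - s" for u
  by (simp add: slet_def Let_def wd_def)
 then have "?\<phi> u \<in> {\<zeta>. LE B q \<zeta> = \<zero>\<^bsub>B q\<^esub>}" for u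
  using assms(4) S.zero by (auto simp: LE_of[where A = B, OF K])
 then have "Bs m w ?\<phi> \<in> {\<zeta>. LE B q \<zeta> = \<zero>\<^bsub>B q\<^esub>}"
  by (intro S.Bs[where V = UNIV]) auto
 moreover have "Bs m w ?\<phi> = Bs m w (\<lambda>u. frag_of (slet K A B s Op u))"
  by (rule Bs_cong) simp
 ultimately show ?thesis by simp
qed

lemma LE_Fs_other:
 assumes K: "cring K" "\<And>q. module K (B q)" and "f_degree f" and "q \<noteq> wd w - 1 - s"
 shows "LE B q (Fs f w (\<lambda>u. frag_of (slet K A B s Op u))) = \<zero>\<^bsub>B q\<^esub>"
proof -
 interpret f_degree f by fact
 interpret S: subgrp "{\<zeta>. LE B q \<zeta> = \<zero>\<^bsub>B q\<^esub>}" by (rule LE_zero_subgrp[OF K])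
 let ?\<phi> = "\<lambda>u. if wd u = wd w then frag_of (slet K A B s Op u) else 0"
 have "fst (slet K A B s Op u) = wd u - 1 - s" for u
  by (simp add: slet_def Let_def wd_def)
 then have "?\<phi> u \<in> {\<zeta>. LE B q \<zeta> = \<zero>\<^bsub>B q\<^esub>}" for u
  using assms(4) S.zero by (auto simp: LE_of[where A = B, OF K])
 then have "Fs f w ?\<phi> \<in> {\<zeta>. LE B q \<zeta> = \<zero>\<^bsub>B q\<^esub>}"
  by (intro S.Fs[where V = UNIV and V' = UNIV]) auto
 moreover have "Fs f w ?\<phi> = Fs f w (\<lambda>u. frag_of (slet K A B s Op u))"
  by (rule Fs_cong) simp
 ultimately show ?thesis by simp
qed

lemma sum_atMost_split: "(\<Sum>k\<le>N. g k) = g 0 + (\<Sum>k\<in>{1..N}. g k)" for g :: "nat \<Rightarrow> 'b::comm_monoid_add"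
 by (simp add: atMost_atLeast0 sum.atLeast_Suc_atMost)

text \<open>\<open>c = 1\<close> for the relation of an algebra, where t runs up to m + 2, and
  \<open>c = 0\<close> for that of a morphism.\<close>

lemma ins_sum_reindex:
 fixes g :: "nat \<Rightarrow> nat \<Rightarrow> 'g::ab_group_add"
 shows "(\<Sum>k\<in>{1..N}. \<Sum>i\<le>N + c - k. g k i) = (\<Sum>m<N. \<Sum>t\<in>{1..m + 1 + c}. g (N - m) (t - 1))"
proof -
 have "(\<Sum>m<N. \<Sum>t\<in>{1..m + 1 + c}. g (N - m) (t - 1)) = (\<Sum>m<N. \<Sum>i\<le>m + c. g (N - m) i)"
  by (intro sum.cong refl sum.reindex_bij_witness[of _ "\<lambda>i. i + 1" "\<lambda>t. t - 1"]) auto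
 also have "\<dots> = (\<Sum>k\<in>{1..N}. \<Sum>i\<le>N + c - k. g k i)"
  by (rule sum.reindex_bij_witness[of _ "\<lambda>k. N - k" "\<lambda>m. N - m"]) (auto simp: algebra_simps intro!: sum.cong)
 finally show ?thesis by simp
qed

text \<open>For a word of one letter this is dd = 0. For N + 1 letters, N > 0, the terms k = 0 and k
  = N contain the differential inside and outside, and the others are the right-hand side of the
  relation for the operation with index N - 1.\<close>

lemma rel_m_Zl:
 assumes K: "cring K" and A: "is_ainf K A" and w: "w \<in> lists (Vl (amod A))" "w \<noteq> []"
 shows "Bs (mlet K A) w (\<lambda>u. frag_of (mlet K A u)) \<in> Zl (amod A)"
proof -
 let ?ins = "insert_map K A" and ?A = "amod A"
 note mA = is_ainfD(1)[OF A]
 note LEh = LE_fhom[where A = "?A", OF K mA]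
 note lin = mO_lin[OF K A]
 obtain N where N: "length w = Suc N" using w by (cases w) auto
 define p where "p = wdeg w"
 define q where "q = p + int N - 1 - 1"
 define X where "X = pure K ?A w"
 have X: "X \<in> carrier (tpow K ?A (Suc N) p)"
  unfolding X_def using w N by (intro pure_closed[OF K mA]) (auto simp: words_iff p_def)
 interpret Aq: module K "?A q" by (rule mA)
 let ?v = "ins_val K A (mO K A) N p X"
 note vc = ins_val_closed[where B = "?A", OF K A mA lin X, folded q_def]
 have main: "LE ?A q (\<Sum>k\<le>N. \<Sum>i\<le>N - k. sgx (int (i * k + (N - k))) (frag_of (q, ?v k i))) = \<zero>\<^bsub>?A q\<^esub>"
 proof (cases N)
  case 0
  obtain a where wa: "w = [(p, a)]" "a \<in> carrier (?A p)"
   using N w 0 by (cases w) (auto simp: p_def)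
  have "?v 0 0 = snd (snd (diff_gmap K A)) (p - 1) (?ins 0 (diff_gmap K A) 0 p X)"
   using gm_mO[of 0 K A] by (simp add: ins_val_def[OF K A mA lin] 0 mO_def)
  also have "?ins 0 (diff_gmap K A) 0 p X = pure K ?A [(p - 1, adiff A p a)]"
  proof -
   have gl: "gm_lin K ?A ?A (diff_gmap K A)"
    using gm_mO_lin[OF K A, of 0] gm_mO[of 0 K A] by simp
   have f: "fst (diff_gmap K A) = 1" "fst (snd (diff_gmap K A)) = - 1" by (simp_all add: diff_gmap_def)
   note IM = insert_map_pure[where A = "?A" and AA = A and x = "[]" and y = w and z = "[]" and i = 0 and j = 0 and p = p and \<phi> = "diff_gmap K A", OF K mA gl refl]
   have IM': "?ins 0 (diff_gmap K A) 0 p (pure K ?A ([] @ w @ [])) =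
     sgn_mult (tpow K ?A (Suc (0 + 0)) (p + fst (snd (diff_gmap K A)))) (fst (snd (diff_gmap K A)) * wdeg (take 0 w))
     (pure K ?A ([] @ [(wdeg w + fst (snd (diff_gmap K A)), snd (snd (diff_gmap K A)) (wdeg w) (pure K ?A w))]))"
    unfolding take_0 by (rule IM) (use wa(2) in \<open>simp_all add: f wa(1)\<close>)
   have "wdeg w = p" by (simp add: p_def)
   then have "snd (snd (diff_gmap K A)) (wdeg w) (pure K ?A w) = adiff A p a"
    using diff_pure[OF K A wa(2)] by (simp only: wa(1))
   then show ?thesis
    using IM' \<open>wdeg w = p\<close> unfolding X_def by (simp add: f)
  qed
  also have "snd (snd (diff_gmap K A)) (p - 1) (pure K ?A [(p - 1, adiff A p a)]) = adiff A (p - 1) (adiff A p a)"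
   by (rule diff_pure[OF K A lin_onD(1)[OF is_ainfD(3)[OF A] wa(2)]])
  finally have "?v 0 0 = \<zero>\<^bsub>?A q\<^esub>"
   using is_ainfD(5)[OF A wa(2)] by (simp add: q_def 0)
  then show ?thesis by (simp add: 0 LE_of[where A = "?A", OF K mA])
 next
  case (Suc M)
  have v0: "LE ?A q (\<Sum>i\<le>N. sgx (int N) (frag_of (q, ?v 0 i))) = sgn_mult (?A q) (int N) (aop A M (p - 1) (tdiff K A (M + 2) p X))"
   using ins_val_0[where B = "?A" and e = "int N", OF K A mA lin X q_def] Suc by (simp add: mO_def)
  have gl: "gm_lin K ?A ?A (op_gmap A M)"
   using gm_mO_lin[OF K A, of N] gm_mO[of N K A] Suc by simp
  have "?v N 0 = snd (snd (diff_gmap K A)) (p + int M) (?ins 0 (op_gmap A M) 0 p X)"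
   using ins_val_Suc[where B = "?A" and k = N and r = 0 and N = N and i = 0 and p = p and X = X, OF K A mA lin] Suc by (simp add: mO_def)
  also have "?ins 0 (op_gmap A M) 0 p X = pure K ?A [(p + int M, aop A M p X)]"
  proof -
   note IM = insert_map_pure[where A = "?A" and AA = A and x = "[]" and y = w and z = "[]" and i = 0 and j = 0 and p = p and \<phi> = "op_gmap A M", OF K mA gl refl]
   show ?thesis
    using IM w N Suc by (simp add: op_gmap_def X_def p_def)
  qed
  also have "snd (snd (diff_gmap K A)) (p + int M) (pure K ?A [(p + int M, aop A M p X)]) = adiff A (p + int M) (aop A M p X)"
   using X Suc by (intro diff_pure[OF K A] lin_onD(1)[OF is_ainfD(4)[OF A]]) simp
  finally have vN: "?v N 0 = adiff A (p + int M) (aop A M p X)" .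
  define R where "R = (\<Sum>m<M. \<Sum>t\<in>{1..m + 2}. sgx (int (t * (M - m) + M)) (frag_of (q, ?v (M - m) (t - 1))))"
  define a1 where "a1 = adiff A (p + int M) (aop A M p X)"
  define a2 where "a2 = sgn_mult (?A q) (int M - 1) (aop A M (p - 1) (tdiff K A (M + 2) p X))"
  have vm: "?v (M - m) (t - 1) = aop A m (p + int (M - 1 - m)) (?ins (t - 1) (op_gmap A (M - 1 - m)) (m + 2 - t) p X)"
   if "m < M" "t \<in> {1..m + 2}" for m t
  proof -
   have "?v (M - m) (t - 1) = mO K A (Suc m) (p + int (M - m - 1)) (?ins (t - 1) (op_gmap A (M - m - 1)) (Suc m - (t - 1)) p X)"
    using that Suc by (intro ins_val_Suc[where B = "?A", OF K A mA lin]) auto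
   moreover have "Suc m - (t - 1) = m + 2 - t" using that by auto
   ultimately show ?thesis by (simp add: mO_def)
  qed
  have "a1 \<oplus>\<^bsub>?A q\<^esub> a2 = finsum (?A q) (\<lambda>m. finsum (?A q) (\<lambda>t.
      sgn_mult (?A q) (int (t * (M - m) + M))
       (aop A m (p + int (M - 1 - m))
        (?ins (t - 1) (op_gmap A (M - 1 - m)) (m + 2 - t) p X)))
      {1..m + 2}) {..<M}"
   unfolding a1_def a2_def using X Suc by (intro is_ainf_rel[OF A]) (simp_all add: q_def)
  also have "\<dots> = LE ?A q R"
   unfolding R_def
  proof (rule finsum_LE[OF K mA])
   fix m assume m: "m \<in> {..<M}"
   have "finsum (?A q) (\<lambda>t. sgn_mult (?A q) (int (t * (M - m) + M)) (?v (M - m) (t - 1))) {1..m + 2}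
     = LE ?A q (\<Sum>t\<in>{1..m + 2}. sgx (int (t * (M - m) + M)) (frag_of (q, ?v (M - m) (t - 1))))"
    using m Suc by (intro LE_fs[OF K mA] vc) auto
   moreover have "finsum (?A q) (\<lambda>t. sgn_mult (?A q) (int (t * (M - m) + M)) (?v (M - m) (t - 1))) {1..m + 2}
    = finsum (?A q) (\<lambda>t. sgn_mult (?A q) (int (t * (M - m) + M))
       (aop A m (p + int (M - 1 - m)) (?ins (t - 1) (op_gmap A (M - 1 - m)) (m + 2 - t) p X))) {1..m + 2}"
   proof (rule Aq.finsum_cong')
    show "(\<lambda>t. sgn_mult (?A q) (int (t * (M - m) + M))
       (aop A m (p + int (M - 1 - m)) (?ins (t - 1) (op_gmap A (M - 1 - m)) (m + 2 - t) p X))) \<in> {1..m + 2} \<rightarrow> carrier (?A q)"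
    proof
     fix t assume t: "t \<in> {1..m + 2}"
     have "?v (M - m) (t - 1) \<in> carrier (?A q)" using m t Suc by (intro vc) auto
     then show "sgn_mult (?A q) (int (t * (M - m) + M))
       (aop A m (p + int (M - 1 - m)) (?ins (t - 1) (op_gmap A (M - 1 - m)) (m + 2 - t) p X)) \<in> carrier (?A q)"
      using vm[of m t] m t by (simp add: sgn_mult_closed[OF mA])
    qed
   qed (use vm m in auto)
   ultimately show "finsum (?A q) (\<lambda>t. sgn_mult (?A q) (int (t * (M - m) + M))
       (aop A m (p + int (M - 1 - m)) (?ins (t - 1) (op_gmap A (M - 1 - m)) (m + 2 - t) p X))) {1..m + 2}
     = LE ?A q (\<Sum>t\<in>{1..m + 2}. sgx (int (t * (M - m) + M)) (frag_of (q, ?v (M - m) (t - 1))))"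
    by simp
  qed
  finally have rel: "a1 \<oplus>\<^bsub>?A q\<^esub> a2 = LE ?A q R" .
  let ?s = "\<lambda>k i. sgx (int (i * k + (N - k))) (frag_of (q, ?v k i))"
  have "(\<Sum>k\<le>N. \<Sum>i\<le>N - k. ?s k i) = (\<Sum>i\<le>N. ?s 0 i) + (\<Sum>k\<in>{1..M}. \<Sum>i\<le>M + 1 - k. ?s k i) + ?s N 0"
   unfolding sum_atMost_split by (simp add: Suc)
  also have "(\<Sum>k\<in>{1..M}. \<Sum>i\<le>M + 1 - k. ?s k i) = (\<Sum>m<M. \<Sum>t\<in>{1..m + 1 + 1}. ?s (M - m) (t - 1))"
   by (rule ins_sum_reindex)
  also have "\<dots> = - R"
   unfolding R_def sum_negf[symmetric]
  proof (intro sum.cong)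
   fix m t assume mt: "m \<in> {..<M}" "t \<in> {1..m + 2}"
   then obtain k t' where k: "M = m + k" "t = Suc t'" by (metis atLeastAtMost_iff le_add_diff_inverse lessThan_iff less_imp_le_nat not0_implies_Suc not_one_le_zero)
   \<comment> \<open>The parity is off by one because \<open>N = M + 1\<close>; this minus sign
     moves the right-hand side of the relation to the other side.\<close>
   show "?s (M - m) (t - 1) = - sgx (int (t * (M - m) + M)) (frag_of (q, ?v (M - m) (t - 1)))"
    by (rule sgx_odd) (use k Suc in auto)
  qed auto
  finally have "LE ?A q (\<Sum>k\<le>N. \<Sum>i\<le>N - k. ?s k i)
    = LE ?A q (\<Sum>i\<le>N. sgx (int N) (frag_of (q, ?v 0 i))) \<ominus>\<^bsub>?A q\<^esub> LE ?A q R \<oplus>\<^bsub>?A q\<^esub> ?v N 0"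
   using vc[of N 0]
   by (simp add: fhomD(2)[OF LEh] fhom_diff[OF mA LEh] LE_of[where A = "?A", OF K mA])
  also have "\<dots> = a2 \<ominus>\<^bsub>?A q\<^esub> (a1 \<oplus>\<^bsub>?A q\<^esub> a2) \<oplus>\<^bsub>?A q\<^esub> a1"
  proof -
   have "LE ?A q (\<Sum>i\<le>N. sgx (int N) (frag_of (q, ?v 0 i))) = a2"
    unfolding v0 a2_def by (rule sgn_mult_cong[OF mA]) (simp add: Suc)
   then show ?thesis unfolding vN rel a1_def[symmetric] by simp
  qed
  also have "\<dots> = \<zero>\<^bsub>?A q\<^esub>"
  proof -
   have "a1 \<in> carrier (?A q)" using vc[of N 0] vN by (simp add: a1_def)
   moreover have "a2 \<in> carrier (?A q)"
   proof -
    have "LE ?A q (\<Sum>i\<le>N. sgx (int N) (frag_of (q, ?v 0 i))) \<in> carrier (?A q)" by (rule fhomD(1)[OF LEh])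
    then show ?thesis unfolding v0 a2_def using Suc by (simp add: sgn_mult_def)
   qed
   ultimately show ?thesis
    by (simp add: Aq.minus_eq Aq.minus_add Aq.a_comm[of "\<ominus>\<^bsub>?A q\<^esub> a1" "\<ominus>\<^bsub>?A q\<^esub> a2"] Aq.r_neg1 Aq.r_neg2 Aq.l_neg)
  qed
  finally show ?thesis .
 qed
 have "LE ?A q' (Bs (mlet K A) w (\<lambda>u. frag_of (mlet K A u))) = \<zero>\<^bsub>?A q'\<^esub>" for q'
 proof (cases "q' = q")
  case True
  have "LE ?A q (Bs (mlet K A) w (\<lambda>u. frag_of (mlet K A u))) =
   LE ?A q (sgx (tri N + nu w) (\<Sum>k\<le>N. \<Sum>i\<le>N - k. sgx (int (i * k + (N - k))) (frag_of (q, ?v k i))))"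
   unfolding ins_val_def[OF K A mA lin] X_def
   by (rule Bs_link[OF K mA mA lin lin refl w(1) N p_def q_def])
  then show ?thesis
   using main by (simp add: True fhom_sgx[OF mA LEh] sgn_mult_zero[OF mA])
 next
  case False
  then show ?thesis
   using N by (intro LE_Bs_other[OF K mA slet_m_degree]) (simp add: q_def p_def wd_def)
 qed
 then show ?thesis by (simp add: Zl_def)
qed

lemma is_ainf_morD:
 assumes "is_ainf_mor K A B f"
 shows "lin_on K (tpow K (amod A) (n + 1) p) (amod B (p + int n)) (f n p)"
  and "X \<in> carrier (tpow K (amod A) (N + 1) p) \<Longrightarrow> M = amod B (p + int N - 1) \<Longrightarrow>
    adiff B (p + int N) (f N p X) \<oplus>\<^bsub>M\<^esub> sgn_mult M (int N - 1) (f N (p - 1) (tdiff K A (N + 1) p X))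
    = finsum M (\<lambda>m. finsum M (\<lambda>t.
      sgn_mult M (int (t * (N - m) + N))
       (f m (p + int (N - 1 - m))
        (insert_map K A (t - 1) (op_gmap A (N - 1 - m)) (m + 1 - t) p X)))
      {1..m + 1}) {..<N}
     \<ominus>\<^bsub>M\<^esub> finsum M (\<lambda>m. finsum M (\<lambda>ns.
      sgn_mult M (int (eps ns))
       (aop B m (p + int (N - 1 - m))
        (tmap K (amod A) (amod B) (map (mor_gmap f) ns) p X)))
      (J_tuples (m + 2) (N - 1 - m))) {..<N}"
 using assms unfolding is_ainf_mor_def Let_def by (blast intro: lin_maps_lin_on)+

lemma mor_ops_lin:
 assumes "is_ainf_mor K A B f" shows "ops_lin K (amod A) (amod B) 0 f"
 using is_ainf_morD(1)[OF assms] by (simp add: ops_lin_def)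

lemma tmap_mor_closed:
 assumes K: "cring K" and A: "\<And>q. module K (A q)" and B: "\<And>q. module K (B q)" and f: "ops_lin K A B 0 f"
  and X: "X \<in> carrier (tpow K A (Suc N) p)" and ns: "ns \<in> J_tuples (Suc r) (N - r)" "r \<le> N"
 shows "tmap K A B (map (mor_gmap f) ns) p X \<in> carrier (tpow K B (Suc r) (p + int (N - r)))"
proof -
 let ?\<Phi> = "map (mor_gmap f) ns"
 have gl: "list_all (gm_lin K A B) ?\<Phi>"
  using f by (simp add: list_all_iff gm_lin_def mor_gmap_def ops_lin_def)
 have "sum_list (map (fst \<circ> snd) (map (mor_gmap f) ns)) = int (sum_list ns)"
  "sum_list (map fst (map (mor_gmap f) ns)) = sum_list ns + length ns" for ns
  by (induction ns) (auto simp: mor_gmap_def)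
 then have s: "sum_list (map fst ?\<Phi>) = Suc N" "sum_list (map (fst \<circ> snd) ?\<Phi>) = int (N - r)" "length ?\<Phi> = Suc r"
  using ns by (auto simp: J_tuples_def)
 have "?\<Phi> \<noteq> []" using s(3) by auto
 from lin_onD(1)[OF tmap_lin[where A = A and B = B and p = p, OF K A B gl this]] X
 show ?thesis unfolding s by simp
qed

lemma ins_part:
 assumes K: "cring K" and A: "is_ainf K A" and B: "\<And>q. module K (B q)" and Op: "ops_lin K (amod A) B s Op"
  and X: "X \<in> carrier (tpow K (amod A) (Suc N) p)" and q: "q = p + int N - 1 - s"
 shows "finsum (B q) (\<lambda>m. finsum (B q) (\<lambda>t.
      sgn_mult (B q) (int (t * (N - m) + N))
       (Op m (p + int (N - 1 - m))
        (insert_map K A (t - 1) (op_gmap A (N - 1 - m)) (m + 1 - t) p X)))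
      {1..m + 1}) {..<N} \<in> carrier (B q)"
  and "LE B q (\<Sum>k\<le>N. \<Sum>i\<le>N - k. sgx (int (i * k + (N - k))) (frag_of (q, ins_val K A Op N p X k i)))
  = sgn_mult (B q) (int N) (Op N (p - 1) (tdiff K A (N + 1) p X)) \<oplus>\<^bsub>B q\<^esub>
   finsum (B q) (\<lambda>m. finsum (B q) (\<lambda>t.
      sgn_mult (B q) (int (t * (N - m) + N))
       (Op m (p + int (N - 1 - m))
        (insert_map K A (t - 1) (op_gmap A (N - 1 - m)) (m + 1 - t) p X)))
      {1..m + 1}) {..<N}"
proof -
 let ?ins = "insert_map K A"
 interpret Bq: module K "B q" by (rule B)
 let ?v = "ins_val K A Op N p X"
 note vc = ins_val_closed[where B = B, OF K A B Op X, folded q]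
 note LEh = LE_fhom[where A = B, OF K B]
 let ?R = "\<Sum>m<N. \<Sum>t\<in>{1..m + 1}. sgx (int (t * (N - m) + N)) (frag_of (q, ?v (N - m) (t - 1)))"
 let ?s = "\<lambda>k i. sgx (int (i * k + (N - k))) (frag_of (q, ?v k i))"
 have vm: "?v (N - m) (t - 1) = Op m (p + int (N - 1 - m)) (?ins (t - 1) (op_gmap A (N - 1 - m)) (m + 1 - t) p X)"
  if "m < N" "t \<in> {1..m + 1}" for m t
 proof -
  have "?v (N - m) (t - 1) = Op m (p + int (N - m - 1)) (?ins (t - 1) (op_gmap A (N - m - 1)) (m - (t - 1)) p X)"
   using that by (intro ins_val_Suc[where B = B, OF K A B Op]) auto
  moreover have "m - (t - 1) = m + 1 - t" using that by auto
  ultimately show ?thesis by simp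
 qed
 have fs: "finsum (B q) (\<lambda>m. finsum (B q) (\<lambda>t.
      sgn_mult (B q) (int (t * (N - m) + N))
       (Op m (p + int (N - 1 - m))
        (?ins (t - 1) (op_gmap A (N - 1 - m)) (m + 1 - t) p X)))
      {1..m + 1}) {..<N} = LE B q ?R"
 proof (rule finsum_LE[OF K B])
  fix m assume m: "m \<in> {..<N}"
  let ?c = "\<lambda>t. Op m (p + int (N - 1 - m)) (?ins (t - 1) (op_gmap A (N - 1 - m)) (m + 1 - t) p X)"
  have "?c t \<in> carrier (B q)" if "t \<in> {1..m + 1}" for t
   using vc[of "N - m" "t - 1"] vm[of m t] m that by auto
  then have "finsum (B q) (\<lambda>t. sgn_mult (B q) (int (t * (N - m) + N)) (?c t)) {1..m + 1}
     = LE B q (\<Sum>t\<in>{1..m + 1}. sgx (int (t * (N - m) + N)) (frag_of (q, ?c t)))"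
   by (rule LE_fs[OF K B])
  also have "(\<Sum>t\<in>{1..m + 1}. sgx (int (t * (N - m) + N)) (frag_of (q, ?c t))) = (\<Sum>t\<in>{1..m + 1}. sgx (int (t * (N - m) + N)) (frag_of (q, ?v (N - m) (t - 1))))"
   using vm m by (intro sum.cong) auto
  finally show "finsum (B q) (\<lambda>t. sgn_mult (B q) (int (t * (N - m) + N)) (?c t)) {1..m + 1}
   = LE B q (\<Sum>t\<in>{1..m + 1}. sgx (int (t * (N - m) + N)) (frag_of (q, ?v (N - m) (t - 1))))" .
 qed
 have "(\<Sum>k\<le>N. \<Sum>i\<le>N - k. ?s k i) = (\<Sum>i\<le>N. ?s 0 i) + (\<Sum>k\<in>{1..N}. \<Sum>i\<le>N + 0 - k. ?s k i)"
  unfolding sum_atMost_split by simp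
 also have "(\<Sum>k\<in>{1..N}. \<Sum>i\<le>N + 0 - k. ?s k i) = (\<Sum>m<N. \<Sum>t\<in>{1..m + 1 + 0}. ?s (N - m) (t - 1))"
  by (rule ins_sum_reindex)
 also have "\<dots> = ?R"
 proof (intro sum.cong)
  fix m t assume mt: "m \<in> {..<N}" "t \<in> {1..m + 1}"
  then obtain k t' where k: "N = m + k" "t = Suc t'" by (metis atLeastAtMost_iff le_add_diff_inverse lessThan_iff less_imp_le_nat not0_implies_Suc not_one_le_zero)
  show "?s (N - m) (t - 1) = sgx (int (t * (N - m) + N)) (frag_of (q, ?v (N - m) (t - 1)))"
   by (rule sgx_cong) (use k in auto)
 qed auto
 finally have S: "(\<Sum>k\<le>N. \<Sum>i\<le>N - k. ?s k i) = (\<Sum>i\<le>N. ?s 0 i) + ?R" .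
 have "LE B q (\<Sum>i\<le>N. ?s 0 i) = sgn_mult (B q) (int N) (Op N (p - 1) (tdiff K A (N + 1) p X))"
  using ins_val_0[where B = B and e = "int N", OF K A B Op X q] by simp
 then show "LE B q (\<Sum>k\<le>N. \<Sum>i\<le>N - k. ?s k i)
  = sgn_mult (B q) (int N) (Op N (p - 1) (tdiff K A (N + 1) p X)) \<oplus>\<^bsub>B q\<^esub>
   finsum (B q) (\<lambda>m. finsum (B q) (\<lambda>t.
      sgn_mult (B q) (int (t * (N - m) + N))
       (Op m (p + int (N - 1 - m))
        (?ins (t - 1) (op_gmap A (N - 1 - m)) (m + 1 - t) p X)))
      {1..m + 1}) {..<N}"
  unfolding S fs fhomD(2)[OF LEh] by (simp only:)
 show "finsum (B q) (\<lambda>m. finsum (B q) (\<lambda>t.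
      sgn_mult (B q) (int (t * (N - m) + N))
       (Op m (p + int (N - 1 - m))
        (?ins (t - 1) (op_gmap A (N - 1 - m)) (m + 1 - t) p X)))
      {1..m + 1}) {..<N} \<in> carrier (B q)"
  unfolding fs by (rule fhomD(1)[OF LEh])
qed

text \<open>The relation of a morphism is rearranged: d f_N is the summand of \<open>Fs\<close> with
  a single block, f_N d is the summand k = 0 of \<open>Bs\<close>, and moving the latter across the
  equation turns the exponent N - 1 into N.\<close>

lemma rel_f_Zl:
 assumes K: "cring K" and A: "is_ainf K A" and B: "is_ainf K B" and f: "is_ainf_mor K A B f"
  and w: "w \<in> lists (Vl (amod A))" "w \<noteq> []"
 shows "Bs (mlet K A) w (\<lambda>u. frag_of (flet K A B f u)) - Fs (flet K A B f) w (\<lambda>u. frag_of (mlet K B u)) \<in> Zl (amod B)"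
proof -
 let ?TA = "tpow K (amod A)" and ?ff = "flet K A B f" and ?tm = "tmap K (amod A) (amod B)" and ?B = "amod B"
 note mA = is_ainfD(1)[OF A] and mB = is_ainfD(1)[OF B]
 note LEh = LE_fhom[where A = "?B", OF K mB]
 note lin = mO_lin[OF K A] and linB = mO_lin[OF K B] and linf = mor_ops_lin[OF f]
 obtain N where N: "length w = Suc N" using w by (cases w) auto
 define p where "p = wdeg w"
 define q where "q = p + int N - 1"
 define X where "X = pure K (amod A) w"
 have X: "X \<in> carrier (?TA (Suc N) p)"
  unfolding X_def using w N by (intro pure_closed[OF K mA]) (auto simp: words_iff p_def)
 interpret Bq: module K "?B q" by (rule mB)
 let ?M = "?B q"
 let ?u = "\<lambda>r ns. mO K B r (p + int (N - r)) (?tm (map (mor_gmap f) ns) p X)"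
 have uc: "?u r ns \<in> carrier ?M" if "r \<le> N" "ns \<in> J_tuples (Suc r) (N - r)" for r ns
 proof -
  have "lin_on K (tpow K ?B (Suc r) (p + int (N - r))) (?B (p + int (N - r) + int r - 1)) (mO K B r (p + int (N - r)))"
   using linB unfolding ops_lin_def by blast
  from lin_onD(1)[OF this tmap_mor_closed[OF K mA mB linf X that(2,1)]]
  have "?u r ns \<in> carrier (?B (p + int (N - r) + int r - 1))" .
  moreover have "p + int (N - r) + int r - 1 = q" using that by (simp add: q_def)
  ultimately show ?thesis by (simp only:)
 qed
 define L1 where "L1 = adiff B (p + int N) (f N p X)"
 define L2 where "L2 = f N (p - 1) (tdiff K A (N + 1) p X)"
 define R1 where "R1 = finsum ?M (\<lambda>m. finsum ?M (\<lambda>t.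
      sgn_mult ?M (int (t * (N - m) + N))
       (f m (p + int (N - 1 - m))
        (insert_map K A (t - 1) (op_gmap A (N - 1 - m)) (m + 1 - t) p X)))
      {1..m + 1}) {..<N}"
 define R2 where "R2 = finsum ?M (\<lambda>m. finsum ?M (\<lambda>ns.
      sgn_mult ?M (int (eps ns))
       (aop B m (p + int (N - 1 - m))
        (?tm (map (mor_gmap f) ns) p X)))
      (J_tuples (m + 2) (N - 1 - m))) {..<N}"
 have rel: "L1 \<oplus>\<^bsub>?M\<^esub> sgn_mult ?M (int N - 1) L2 = R1 \<ominus>\<^bsub>?M\<^esub> R2"
  unfolding L1_def L2_def R1_def R2_def using X by (intro is_ainf_morD(2)[OF f]) (simp_all add: q_def)
 have left: "LE ?B q (\<Sum>k\<le>N. \<Sum>i\<le>N - k. sgx (int (i * k + (N - k))) (frag_of (q, ins_val K A f N p X k i)))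
   = sgn_mult ?M (int N) L2 \<oplus>\<^bsub>?M\<^esub> R1"
  unfolding L2_def R1_def by (rule ins_part(2)[where B = "?B", OF K A mB linf X]) (simp add: q_def)
 let ?S = "\<lambda>r. \<Sum>ns\<in>J_tuples (Suc r) (N - r). sgx (int (eps ns)) (frag_of (q, ?u r ns))"
 have u0: "?u 0 [N] = L1"
 proof -
  have "?tm (map (mor_gmap f) [N]) p X = pure K ?B [(p + int N, f N p X)]"
   using tmap_pure[where A = "amod A" and B = "?B" and \<Phi> = "map (mor_gmap f) [N]" and w = w and p = p, OF K mA mB] linf w N
   by (simp add: mor_gmap_def gm_lin_def ops_lin_def words_iff p_def X_def)
  moreover have "f N p X \<in> carrier (?B (p + int N))"
   using lin_onD(1)[OF is_ainf_morD(1)[OF f, of N p]] X by simp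
  ultimately show ?thesis
   using diff_pure[OF K B, of "f N p X" "p + int N"] unfolding mO_def L1_def by simp
 qed
 have S0: "LE ?B q (?S 0) = L1"
 proof -
  have J: "J_tuples (Suc 0) N = {[N]}" by (auto simp: J_tuples_def length_Suc_conv)
  have "L1 \<in> carrier ?M" using uc[of 0 "[N]"] u0 by (simp add: J)
  then show ?thesis using u0 by (simp add: J eps_def LE_of[where A = "?B", OF K mB])
 qed
 have R2': "R2 = LE ?B q (\<Sum>m<N. ?S (Suc m))"
  unfolding R2_def
 proof (rule finsum_LE[OF K mB])
  fix m assume m: "m \<in> {..<N}"
  have "finsum ?M (\<lambda>ns. sgn_mult ?M (int (eps ns)) (?u (Suc m) ns)) (J_tuples (Suc (Suc m)) (N - Suc m)) = LE ?B q (?S (Suc m))"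
   using m by (intro LE_fs[OF K mB] uc) auto
  then show "finsum ?M (\<lambda>ns. sgn_mult ?M (int (eps ns)) (aop B m (p + int (N - 1 - m))
    (?tm (map (mor_gmap f) ns) p X))) (J_tuples (m + 2) (N - 1 - m)) = LE ?B q (?S (Suc m))"
   by (simp add: mO_def)
 qed
 have right: "LE ?B q (\<Sum>r\<le>N. ?S r) = L1 \<oplus>\<^bsub>?M\<^esub> R2"
 proof -
  have "(\<Sum>r\<le>N. ?S r) = ?S 0 + (\<Sum>m<N. ?S (Suc m))"
   by (simp only: lessThan_Suc_atMost[symmetric] sum.lessThan_Suc_shift)
  then show ?thesis by (simp only: fhomD(2)[OF LEh] S0 R2')
 qed
 have eq: "sgn_mult ?M (int N) L2 \<oplus>\<^bsub>?M\<^esub> R1 = L1 \<oplus>\<^bsub>?M\<^esub> R2"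
 proof -
  have L1c: "L1 \<in> carrier ?M" unfolding S0[symmetric] by (rule fhomD(1)[OF LEh])
  have R2c: "R2 \<in> carrier ?M" unfolding R2' by (rule fhomD(1)[OF LEh])
  define t where "t = sgn_mult ?M (int N) L2"
  have "lin_on K (?TA (N + 1) (p - 1)) (?B (p - 1 + int N)) (f N (p - 1))"
   by (rule is_ainf_morD(1)[OF f])
  moreover have "tdiff K A (N + 1) p X \<in> carrier (?TA (N + 1) (p - 1))"
  proof -
   interpret T: module K "?TA (Suc N) (p - 1)" by (rule tpow_module[OF K mA])
   show ?thesis
    using tdiff_eq[OF K A X] insert_closed[OF K A X, of 0] by (auto intro!: T.finsum_closed)
  qed
  ultimately have L2c: "L2 \<in> carrier ?M"
   using lin_onD(1) by (fastforce simp: L2_def q_def algebra_simps)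
  have tc: "t \<in> carrier ?M" unfolding t_def by (rule sgn_mult_closed[OF mB L2c])
  have t': "sgn_mult ?M (int N - 1) L2 = \<ominus>\<^bsub>?M\<^esub> t"
   using L2c by (simp add: t_def sgn_mult_def)
  have R1c: "R1 \<in> carrier ?M"
   unfolding R1_def by (rule ins_part(1)[where B = "?B", OF K A mB linf X]) (simp add: q_def)
  have "t \<oplus>\<^bsub>?M\<^esub> R1 = t \<oplus>\<^bsub>?M\<^esub> ((R1 \<ominus>\<^bsub>?M\<^esub> R2) \<oplus>\<^bsub>?M\<^esub> R2)"
   using tc R1c R2c by (simp add: Bq.minus_eq Bq.a_assoc Bq.l_neg)
  also have "\<dots> = t \<oplus>\<^bsub>?M\<^esub> ((L1 \<oplus>\<^bsub>?M\<^esub> \<ominus>\<^bsub>?M\<^esub> t) \<oplus>\<^bsub>?M\<^esub> R2)"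
   using rel by (simp add: t')
  also have "\<dots> = L1 \<oplus>\<^bsub>?M\<^esub> R2"
   using tc L1c R2c by (simp add: Bq.a_ac Bq.r_neg Bq.r_neg1 Bq.r_neg2)
  finally show ?thesis by (simp add: t_def)
 qed
 have "LE ?B q' (Bs (mlet K A) w (\<lambda>u. frag_of (?ff u)) - Fs ?ff w (\<lambda>u. frag_of (mlet K B u))) = \<zero>\<^bsub>?B q'\<^esub>" for q'
 proof (cases "q' = q")
  case True
  have 1: "LE ?B q (Bs (mlet K A) w (\<lambda>u. frag_of (?ff u))) =
   LE ?B q (sgx (tri N + nu w) (\<Sum>k\<le>N. \<Sum>i\<le>N - k. sgx (int (i * k + (N - k))) (frag_of (q, ins_val K A f N p X k i))))"
   unfolding ins_val_def[where B = "?B", OF K A mB linf] X_def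
   by (rule Bs_link[OF K mA mB lin linf refl w(1) N p_def]) (simp add: q_def)
  have 2: "LE ?B q (Fs ?ff w (\<lambda>u. frag_of (mlet K B u))) =
   LE ?B q (sgx (tri N + nu w) (\<Sum>r\<le>N. ?S r))"
   unfolding X_def by (rule Fs_link[OF K mA mB mB linf linB w(1) N p_def]) (simp add: q_def)
  have "L1 \<oplus>\<^bsub>?M\<^esub> R2 \<in> carrier ?M" unfolding right[symmetric] by (rule fhomD(1)[OF LEh])
  then show ?thesis
   unfolding True fhom_diff[OF mB LEh] 1 2 fhom_sgx[OF mB LEh] left right eq
   using sgn_mult_closed[OF mB] by (simp add: Bq.minus_eq Bq.r_neg)
 next
  case False
  interpret Bq': module K "?B q'" by (rule mB)
  have "LE ?B q' (Bs (mlet K A) w (\<lambda>u. frag_of (?ff u))) = \<zero>\<^bsub>?B q'\<^esub>"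
   using N False by (intro LE_Bs_other[OF K mB slet_m_degree]) (simp add: q_def p_def wd_def)
  moreover have "LE ?B q' (Fs ?ff w (\<lambda>u. frag_of (mlet K B u))) = \<zero>\<^bsub>?B q'\<^esub>"
   using N False by (intro LE_Fs_other[OF K mB slet_f_degree]) (simp add: q_def p_def wd_def)
  ultimately show ?thesis by (simp add: fhom_diff[OF mB LEh] Bq'.minus_eq)
 qed
 then show ?thesis by (simp add: Zl_def)
qed

text \<open>The composition formula is the same sum over subdivisions, and both terms carry the
  suspension sign of \<open>w\<close>.\<close>

lemma rel_k_Zl:
 assumes K: "cring K" and A: "\<And>q. module K (amod A q)" and B: "\<And>q. module K (amod B q)" and C: "\<And>q. module K (amod C q)"
  and f: "ops_lin K (amod A) (amod B) 0 f" and g: "ops_lin K (amod B) (amod C) 0 g"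
  and w: "w \<in> lists (Vl (amod A))" "w \<noteq> []"
 shows "frag_of (flet K A C (ainf_comp K A B C g f) w) - Fs (flet K A B f) w (\<lambda>u. frag_of (flet K B C g u)) \<in> Zl (amod C)"
proof -
 let ?C = "amod C"
 note LEh = LE_fhom[where A = "?C", OF K C]
 obtain N where N: "length w = Suc N" using w by (cases w) auto
 define p where "p = wdeg w"
 define q where "q = p + int N"
 define X where "X = pure K (amod A) w"
 have X: "X \<in> carrier (tpow K (amod A) (Suc N) p)"
  unfolding X_def using w N by (intro pure_closed[OF K A]) (auto simp: words_iff p_def)
 interpret Cq: module K "?C q" by (rule C)
 let ?M = "?C q"
 let ?u = "\<lambda>r ns. g r (p + int (N - r)) (tmap K (amod A) (amod B) (map (mor_gmap f) ns) p X)"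
 have uc: "?u r ns \<in> carrier ?M" if "r \<le> N" "ns \<in> J_tuples (Suc r) (N - r)" for r ns
 proof -
  have "lin_on K (tpow K (amod B) (Suc r) (p + int (N - r))) (?C (p + int (N - r) + int r - 0)) (g r (p + int (N - r)))"
   using g unfolding ops_lin_def by blast
  from lin_onD(1)[OF this tmap_mor_closed[OF K A B f X that(2,1)]]
  have "?u r ns \<in> carrier (?C (p + int (N - r) + int r - 0))" .
  moreover have "p + int (N - r) + int r - 0 = q" using that by (simp add: q_def)
  ultimately show ?thesis by (simp only:)
 qed
 let ?S = "\<lambda>r. \<Sum>ns\<in>J_tuples (Suc r) (N - r). sgx (int (eps ns)) (frag_of (q, ?u r ns))"
 have "ainf_comp K A B C g f N p X = finsum ?M (\<lambda>m. finsum ?M (\<lambda>ns. sgn_mult ?M (int (eps ns)) (?u m ns)) (J_tuples (Suc m) (N - m))) {..N}"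
  using X by (simp add: ainf_comp_def Let_def q_def)
 also have "\<dots> = LE ?C q (\<Sum>r\<le>N. ?S r)"
  by (intro finsum_LE[OF K C] LE_fs[OF K C] uc) auto
 finally have comp: "ainf_comp K A B C g f N p X = LE ?C q (\<Sum>r\<le>N. ?S r)" .
 have cc: "ainf_comp K A B C g f N p X \<in> carrier ?M"
  unfolding comp by (rule fhomD(1)[OF LEh])
 have k: "flet K A C (ainf_comp K A B C g f) w = (q, sgn_mult ?M (tri N + nu w) (ainf_comp K A B C g f N p X))"
  using N by (simp add: slet_def Let_def q_def p_def X_def)
 have "LE ?C q' (frag_of (flet K A C (ainf_comp K A B C g f) w) - Fs (flet K A B f) w (\<lambda>u. frag_of (flet K B C g u))) = \<zero>\<^bsub>?C q'\<^esub>" for q'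
 proof (cases "q' = q")
  case True
  have 2: "LE ?C q (Fs (flet K A B f) w (\<lambda>u. frag_of (flet K B C g u))) =
   LE ?C q (sgx (tri N + nu w) (\<Sum>r\<le>N. ?S r))"
   unfolding X_def by (rule Fs_link[OF K A B C f g w(1) N p_def]) (simp add: q_def)
  have "LE ?C q (frag_of (flet K A C (ainf_comp K A B C g f) w)) = sgn_mult ?M (tri N + nu w) (ainf_comp K A B C g f N p X)"
   unfolding k using cc by (simp add: LE_of[where A = "?C", OF K C] sgn_mult_closed[OF C])
  then show ?thesis
   unfolding True fhom_diff[OF C LEh] 2 fhom_sgx[OF C LEh] comp[symmetric]
   using sgn_mult_closed[OF C cc] by (simp add: Cq.minus_eq Cq.r_neg)
 next
  case False
  interpret Cq': module K "?C q'" by (rule C)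
  have "LE ?C q' (frag_of (flet K A C (ainf_comp K A B C g f) w)) = \<zero>\<^bsub>?C q'\<^esub>"
   using False unfolding k by (simp add: LE_of[where A = "?C", OF K C])
  moreover have "LE ?C q' (Fs (flet K A B f) w (\<lambda>u. frag_of (flet K B C g u))) = \<zero>\<^bsub>?C q'\<^esub>"
   using N False by (intro LE_Fs_other[OF K C slet_f_degree]) (simp add: q_def p_def wd_def)
  ultimately show ?thesis by (simp add: fhom_diff[OF C LEh] Cq'.minus_eq)
 qed
 then show ?thesis by (simp add: Zl_def)
qed

section \<open>Membership of the values of the word operators\<close>

text \<open>Sharper than \<open>subgrp.Fs\<close>: the bounds on length and degree of the output
  words, here and in the next lemmas, are what later controls total degrees and filtration
  levels.\<close>

lemma (in f_degree) Fs_mem: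
 assumes S: "subgrp S" and fV: "\<And>y. y \<in> lists V \<Longrightarrow> y \<noteq> [] \<Longrightarrow> f y \<in> V'"
 shows "w \<in> lists V \<Longrightarrow> (\<And>u. u \<in> lists V' \<Longrightarrow> length u \<le> length w \<Longrightarrow> wd u = wd w \<Longrightarrow> \<phi> u \<in> S) \<Longrightarrow> Fs f w \<phi> \<in> S"
proof (induction w arbitrary: \<phi> rule: length_induct)
 case (1 w)
 show ?case
 proof (cases w)
  case Nil
  then show ?thesis using "1.prems" by simp
 next
  case (Cons a v)
  show ?thesis unfolding Cons Fs_Cons
  proof (rule subgrp.ssum[OF S])
   fix x y assume v: "x @ y = v"
   show "Fs f y (\<lambda>u. \<phi> (f (a # x) # u)) \<in> S"
   proof (rule "1.IH"[rule_format])
    show "length y < length w" "y \<in> lists V" using "1.prems"(1) Cons v by auto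
    fix u assume "u \<in> lists V'" "length u \<le> length y" "wd u = wd y"
    then show "\<phi> (f (a # x) # u) \<in> S"
     using "1.prems"(1) Cons v fV[of "a # x"] by (intro "1.prems"(2)) (auto simp: f_deg in_lists_conv_set ball_Un)
   qed
  qed
 qed
qed

lemma (in m_degree) Bs_mem:
 assumes S: "subgrp S" and mV: "\<And>y. y \<in> lists V \<Longrightarrow> y \<noteq> [] \<Longrightarrow> m y \<in> V"
 shows "w \<in> lists V \<Longrightarrow> (\<And>u. u \<in> lists V \<Longrightarrow> length u \<le> length w \<Longrightarrow> wd u = wd w - 1 \<Longrightarrow> \<phi> u \<in> S) \<Longrightarrow> Bs m w \<phi> \<in> S"
proof (induction w arbitrary: \<phi>)
 case Nil
 then show ?case using subgrp.zero[OF S] by simp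
next
 case (Cons a v)
 have "\<phi> (m (a # x) # z) \<in> S" if "x @ z = v" for x z
  using Cons.prems(1) that mV[of "a # x"] by (intro Cons.prems(2)) (auto simp: m_deg in_lists_conv_set ball_Un)
 moreover have "Bs m v (\<lambda>u. \<phi> (a # u)) \<in> S"
  using Cons.prems(1) by (intro Cons.IH Cons.prems(2)) auto
 ultimately show ?case
  by (auto intro!: subgrp.add[OF S] subgrp.ssum[OF S] subgrp.sgx[OF S])
qed

lemma (in m_degree) bs_mem:
 assumes S: "subgrp S" and mV: "\<And>y. y \<in> lists V \<Longrightarrow> y \<noteq> [] \<Longrightarrow> m y \<in> V"
  and w: "w \<in> lists V" and \<phi>: "\<And>u. u \<in> lists V \<Longrightarrow> length u \<le> length w \<Longrightarrow> wd u = wd w - 1 \<Longrightarrow> \<phi> u \<in> S"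
 shows "bs m w \<phi> \<in> S"
proof (cases w)
 case Nil
 then show ?thesis using subgrp.zero[OF S] by simp
next
 case (Cons a v)
 have "\<phi> (m (z @ a # x) # y) \<in> S" if "x @ y @ z = v" for x y z
  using w that mV[of "z @ a # x"] by (intro \<phi>) (auto simp: m_deg Cons in_lists_conv_set ball_Un)
 moreover have "Bs m v (\<lambda>u. \<phi> (a # u)) \<in> S"
  using w Cons by (intro Bs_mem[OF S mV] \<phi>) auto
 ultimately show ?thesis
  unfolding Cons bs_Cons by (intro subgrp.add[OF S] subgrp.ssum3[OF S] subgrp.sgx[OF S])
qed

lemma (in f_degree) Fcs_mem:
 assumes S: "subgrp S" and fV: "\<And>y. y \<in> lists V \<Longrightarrow> y \<noteq> [] \<Longrightarrow> f y \<in> V'"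
  and w: "w \<in> lists V" and \<phi>: "\<And>u. u \<in> lists V' \<Longrightarrow> length u \<le> length w \<Longrightarrow> wd u = wd w \<Longrightarrow> \<phi> u \<in> S"
 shows "Fcs f w \<phi> \<in> S"
proof (cases w)
 case Nil
 then show ?thesis using subgrp.zero[OF S] by simp
next
 case (Cons a v)
 have "Fs f y (\<lambda>u. \<phi> (f (z @ a # x) # u)) \<in> S" if "x @ y @ z = v" for x y z
  using w that fV[of "z @ a # x"] by (intro Fs_mem[OF S fV] \<phi>) (auto simp: f_deg Cons in_lists_conv_set ball_Un)
 then show ?thesis
  unfolding Cons Fcs_Cons by (intro subgrp.ssum3[OF S] subgrp.sgx[OF S])
qed

lemma Ts_mem:
 assumes S: "subgrp S" and w: "w \<in> lists V"
  and \<phi>: "\<And>u. u \<in> lists V \<Longrightarrow> length u = length w \<Longrightarrow> wdeg u = wdeg w \<Longrightarrow> \<phi> u \<in> S"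
 shows "Ts w \<phi> \<in> S"
proof (cases w rule: rev_cases)
 case Nil
 then show ?thesis using subgrp.zero[OF S] by simp
next
 case (snoc u l)
 then show ?thesis using w by (auto simp: Ts_snoc intro!: subgrp.sgx[OF S] \<phi>)
qed

lemma Ns_mem:
 assumes S: "subgrp S" and w: "w \<in> lists V"
  and \<phi>: "\<And>u. u \<in> lists V \<Longrightarrow> length u = length w \<Longrightarrow> wdeg u = wdeg w \<Longrightarrow> \<phi> u \<in> S"
 shows "Ns w \<phi> \<in> S"
proof (cases w)
 case Nil
 then show ?thesis using subgrp.zero[OF S] by simp
next
 case (Cons a v)
 then show ?thesis using w by (auto simp: Ns_Cons intro!: subgrp.ssum[OF S] subgrp.sgx[OF S] \<phi>)
qed

lemma dsum_uminus:
 assumes K: "cring K" and M: "\<And>i. i \<in> I \<Longrightarrow> module K (M i)" and x: "x \<in> carrier (Defs.dsum I M)"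
 shows "\<ominus>\<^bsub>Defs.dsum I M\<^esub> x = (\<lambda>i\<in>I. \<ominus>\<^bsub>M i\<^esub> x i)"
proof -
 interpret module K "Defs.dsum I M" by (rule dsum_module[OF K M])
 note ab = module.axioms(2)[OF M]
 have [simp]: "\<And>i. i \<in> I \<Longrightarrow> x i \<in> carrier (M i)" using x by auto
 show ?thesis
  using x by (intro minus_equality)
   (auto simp: abelian_group.l_neg[OF ab] abelian_group.a_inv_closed[OF ab] cong: restrict_cong)
qed

lemma lin_on_dsum:
 assumes g: "\<And>i. i \<in> I \<Longrightarrow> lin_on K M (N i) (\<lambda>x. g x i)" and e: "\<And>x. g x \<in> extensional I"
 shows "lin_on K M (Defs.dsum I N) g"
proof (rule lin_onI)
 fix x y c assume x: "x \<in> carrier M"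
 show "g x \<in> carrier (Defs.dsum I N)" using lin_onD(1)[OF g x] e by (simp add: PiE_iff)
 show "g (x \<oplus>\<^bsub>M\<^esub> y) = g x \<oplus>\<^bsub>Defs.dsum I N\<^esub> g y" if "y \<in> carrier M"
  by (rule extensionalityI[OF e]) (simp_all add: lin_onD(2)[OF g x that])
 show "g (c \<odot>\<^bsub>M\<^esub> x) = c \<odot>\<^bsub>Defs.dsum I N\<^esub> g x" if "c \<in> carrier K"
  by (rule extensionalityI[OF e]) (simp_all add: lin_onD(3)[OF g that x])
qed

lemma lin_on_proj: "i \<in> I \<Longrightarrow> lin_on K (Defs.dsum I M) (M i) (\<lambda>x. x i)"
 by (rule lin_onI) auto

section \<open>The cyclic module of an \<open>A\<^sub>\<infinity>\<close>-algebra\<close>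

text \<open>A letter is counted by \<open>nu\<close> once for each letter behind it and by
  \<open>th\<close> once for each letter in front of it.\<close>

lemma nu_th: "y \<noteq> [] \<Longrightarrow> nu y + th y = (int (length y) - 1) * wdeg y"
proof (induction y)
 case (Cons l y)
 then show ?case by (cases y) (auto simp: algebra_simps)
qed simp

section \<open>The total complex in terms of formal sums\<close>

text \<open>A word of k + 1 letters of total degree p has the first index n = k + p in the
  bicomplex, which is \<open>wd w - 1\<close>; adding the column \<open>m\<close> gives the total
  degree.\<close>

definition vk :: "(int \<Rightarrow> ('k, 'a) module) \<Rightarrow> int \<Rightarrow> (nat \<times> 'a word) set" where
 "vk A N = {(m, w). w \<in> lists (Vl A) \<and> int m + wd w - 1 = N}"

definition FN :: "(int \<Rightarrow> ('k, 'a) module) \<Rightarrow> int \<Rightarrow> ((nat \<times> 'a word) \<Rightarrow>\<^sub>0 int) set" where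
 "FN A N = {x. Poly_Mapping.keys x \<subseteq> vk A N}"

lemma keys_subgrp: "subgrp {x :: 'c \<Rightarrow>\<^sub>0 int. Poly_Mapping.keys x \<subseteq> V}"
proof
 fix x y :: "'c \<Rightarrow>\<^sub>0 int"
 assume "x \<in> {x. Poly_Mapping.keys x \<subseteq> V}" "y \<in> {x. Poly_Mapping.keys x \<subseteq> V}"
 then show "x - y \<in> {x. Poly_Mapping.keys x \<subseteq> V}" using keys_diff[of x y] by auto
qed simp

lemma FN_subgrp: "subgrp (FN A N)"
 unfolding FN_def by (rule keys_subgrp)

lemma FN_of: "frag_of (m, w) \<in> FN A N \<longleftrightarrow> w \<in> lists (Vl A) \<and> int m + wd w - 1 = N"
 by (simp add: FN_def vk_def)

lemma frag_extend_mem: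
 assumes S: "subgrp S" and x: "Poly_Mapping.keys x \<subseteq> V" and \<psi>: "\<And>s. s \<in> V \<Longrightarrow> \<psi> s \<in> S"
 shows "frag_extend \<psi> x \<in> S"
 using x
proof (induction x rule: frag_induction)
 case (diff a b)
 then show ?case by (simp add: frag_extend_diff subgrp.diff[OF S])
qed (auto simp: \<psi> subgrp.zero[OF S])

lemma subgrp_sum: "subgrp S \<Longrightarrow> (\<And>i. i \<in> I \<Longrightarrow> \<xi> i \<in> S) \<Longrightarrow> (\<Sum>i\<in>I. \<xi> i) \<in> S"
 by (induction I rule: infinite_finite_induct) (auto simp: subgrp.add subgrp.zero)

lemma frag_extend_comp: "frag_extend g (frag_extend f x) = frag_extend (frag_extend g \<circ> f) x"
 by (rule frag_induction[of x UNIV]) (simp_all add: frag_extend_diff)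

lemma FN_extend_mem: "subgrp S \<Longrightarrow> x \<in> FN A N \<Longrightarrow> (\<And>m w. w \<in> lists (Vl A) \<Longrightarrow> int m + wd w - 1 = N \<Longrightarrow> \<psi> (m, w) \<in> S) \<Longrightarrow> frag_extend \<psi> x \<in> S"
 by (rule frag_extend_mem[of S x "vk A N"]) (auto simp: FN_def vk_def)

definition Dk :: "('k, 'r) ring_scheme \<Rightarrow> ('k, 'a) ainf \<Rightarrow> nat \<times> 'a word \<Rightarrow> (nat \<times> 'a word) \<Rightarrow>\<^sub>0 int" where
 "Dk K A = (\<lambda>(m, w). (if even m then bs (mlet K A) w (\<lambda>u. frag_of (m, u)) else - Bs (mlet K A) w (\<lambda>u. frag_of (m, u)))
   + (if m = 0 then 0 else if even m then Ns w (\<lambda>u. frag_of (m - 1, u))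
    else frag_of (m - 1, w) - Ts w (\<lambda>u. frag_of (m - 1, u))))"

definition sck :: "('k, 'a) ainf \<Rightarrow> 'k \<Rightarrow> nat \<times> 'a word \<Rightarrow> (nat \<times> 'a word) \<Rightarrow>\<^sub>0 int" where
 "sck A c = (\<lambda>(m, w). case w of [] \<Rightarrow> 0 | l # v \<Rightarrow> frag_of (m, (fst l, c \<odot>\<^bsub>amod A (fst l)\<^esub> snd l) # v))"

text \<open>\<open>nat N - n\<close> is the column of the component \<open>n\<close>. For negative
  \<open>N\<close> there is no admissible \<open>n\<close>, so the conversion to \<open>nat\<close>
  is harmless.\<close>

definition tot :: "('k, 'r) ring_scheme \<Rightarrow> ('k, 'a) ainf \<Rightarrow> int \<Rightarrow> ((nat \<times> 'a word) \<Rightarrow>\<^sub>0 int) \<Rightarrow> nat \<Rightarrow> nat \<Rightarrow> ('k, 'a) tens" where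
 "tot K A N x = (\<lambda>n\<in>{n. int n \<le> N}. \<lambda>k\<in>{..n}. EV K (amod A) (nat N - n) (Suc k) (int n - int k) x)"

lemma sgn_mult_one: "sgn_mult M 1 x = \<ominus>\<^bsub>M\<^esub> x"
 by (simp add: sgn_mult_def)

lemma minus_zero_iff:
 assumes "module K M" "a \<in> carrier M" "b \<in> carrier M"
 shows "a \<ominus>\<^bsub>M\<^esub> b = \<zero>\<^bsub>M\<^esub> \<longleftrightarrow> a = b"
proof -
 interpret module K M by fact
 have "a = (a \<oplus>\<^bsub>M\<^esub> \<ominus>\<^bsub>M\<^esub> b) \<oplus>\<^bsub>M\<^esub> b" using assms by (simp add: a_assoc l_neg)
 then show ?thesis using assms by (auto simp: minus_eq r_neg)
qed

section \<open>Rotation, norm and faces of the cyclic module on words\<close>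

context
 fixes K :: "('k, 'r) ring_scheme" and A :: "('k, 'a) ainf"
 assumes K: "cring K" and A: "is_ainf K A"
begin

abbreviation (input) "TA \<equiv> tpow K (amod A)"
abbreviation (input) "EA \<equiv> EV K (amod A)"
abbreviation (input) "XA \<equiv> cyc_module K A"
abbreviation (input) "CY N \<equiv> (Tot XA N)\<lparr>carrier := cycles XA N\<rparr>"
abbreviation (input) "TC \<equiv> Tcyc XA"
abbreviation (input) "DQ \<equiv> dq XA"

lemma mA: "module K (amod A q)"
 by (rule is_ainfD(1)[OF A])

lemma T_module: "module K (TA n p)"
 by (rule tpow_module[OF K mA])

lemma EVh: "fhom (TA n p) (EA m n p)"
 by (rule EV_fhom[OF K mA])

lemma EVof: "w \<in> words (amod A) n p \<Longrightarrow> EA m n p (frag_of (m, w)) = sgn_mult (TA n p) (th w) (pure K (amod A) w)"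
 by (simp add: EV_of[where A = "amod A", OF K mA])

lemma EVof0: "m' \<noteq> m \<or> w \<notin> words (amod A) n p \<Longrightarrow> EA m n p (frag_of (m', w)) = \<zero>\<^bsub>TA n p\<^esub>"
 by (auto simp: EV_of[where A = "amod A", OF K mA])

lemma EV_sum0:
 assumes "\<And>i. i \<in> I \<Longrightarrow> EA m n p (\<xi> i) = \<zero>\<^bsub>TA n p\<^esub>"
 shows "EA m n p (\<Sum>i\<in>I. \<xi> i) = \<zero>\<^bsub>TA n p\<^esub>"
proof -
 interpret module K "TA n p" by (rule T_module)
 show ?thesis unfolding fhom_sum[OF T_module EVh] by (rule add.finprod_one_eqI) (rule assms)
qed

lemma cyc_mlin:
 "mlin K (amod A) (Suc n) p (TA (Suc n) p) (\<lambda>w. sgn_mult (TA (Suc n) p) (fst (last w) * wdeg (butlast w))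
    (pure K (amod A) (last w # butlast w)))"
 unfolding mlin_def
proof (intro ballI allI impI)
 fix x z q assume xz: "x \<in> lists (Vl (amod A))" "z \<in> lists (Vl (amod A))" "Suc (length x + length z) = Suc n" "wdeg x + q + wdeg z = p"
 show "lin_on K (amod A q) (TA (Suc n) p) (\<lambda>a. sgn_mult (TA (Suc n) p) (fst (last (x @ (q, a) # z)) * wdeg (butlast (x @ (q, a) # z)))
    (pure K (amod A) (last (x @ (q, a) # z) # butlast (x @ (q, a) # z))))"
 proof (cases z rule: rev_cases)
  case Nil
  have "lin_on K (amod A q) (TA (Suc n) p) (\<lambda>a. sgn_mult (TA (Suc n) p) (q * wdeg x) (pure K (amod A) ([] @ (q, a) # x)))"
   using xz Nil by (intro lin_on_sgn_mult_fun[OF T_module] mlinD[OF pure_mlin[OF K mA]]) auto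
  then show ?thesis by (simp add: Nil butlast_append)
 next
  case (snoc z' l)
  have "lin_on K (amod A q) (TA (Suc n) p) (\<lambda>a. sgn_mult (TA (Suc n) p) (fst l * (wdeg x + q + wdeg z')) (pure K (amod A) ((l # x) @ (q, a) # z')))"
   using xz snoc by (intro lin_on_sgn_mult_fun[OF T_module] mlinD[OF pure_mlin[OF K mA]]) auto
  then show ?thesis by (simp add: snoc butlast_append add.assoc)
 qed
qed

lemma cyc_lin: "lin_on K (TA (Suc n) p) (TA (Suc n) p) (cyc_perm K A n p)"
proof -
 have "lin_on K (TA (Suc n) p) (TA (Suc n) p) (lin_ext K (TA (Suc n) p) (\<lambda>w. sgn_mult (TA (Suc n) p) (fst (last w) * wdeg (butlast w))
    (pure K (amod A) (last w # butlast w))))"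
  by (rule lin_ext_lin[OF K mA T_module cyc_mlin]) simp
 from lin_maps_lin_on[OF lin_maps_restrict[OF T_module this]] show ?thesis
  by (simp add: cyc_perm_def Let_def)
qed

lemma cyc_pure:
 "u @ [l] \<in> words (amod A) (Suc n) p \<Longrightarrow>
  cyc_perm K A n p (pure K (amod A) (u @ [l])) = sgn_mult (TA (Suc n) p) (fst l * wdeg u) (pure K (amod A) (l # u))"
 using lin_ext_pure[where A = "amod A" and w = "u @ [l]" and n = "Suc n" and p = p, OF K mA T_module cyc_mlin]
  pure_closed[where A = "amod A" and w = "u @ [l]" and n = "Suc n" and p = p, OF K mA]
 by (simp add: cyc_perm_def Let_def)

lemma TC_eq: "TC n p = (\<lambda>x. sgn_mult (TA (Suc n) p) (int n) (cyc_perm K A n p x))"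
 by (simp add: Tcyc_def cyc_module_def fun_eq_iff)

lemma TC_lin: "lin_on K (TA (Suc n) p) (TA (Suc n) p) (TC n p)"
 unfolding TC_eq by (rule lin_on_sgn_mult_fun[OF T_module cyc_lin])

lemma TC_pow_lin: "lin_on K (TA (Suc n) p) (TA (Suc n) p) (TC n p ^^ j)"
proof (induction j)
 case 0
 then show ?case by (simp add: lin_on_def)
next
 case (Suc j)
 then show ?case using lin_on_comp[OF Suc TC_lin] by (simp add: comp_def)
qed

lemma TC_pow_cyc:
 assumes "x \<in> carrier (TA (Suc n) p)"
 shows "(cyc_perm K A n p ^^ j) x \<in> carrier (TA (Suc n) p) \<and>
  (TC n p ^^ j) x = sgn_mult (TA (Suc n) p) (int n * int j) ((cyc_perm K A n p ^^ j) x)"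
proof (induction j)
 case 0
 then show ?case using assms by simp
next
 case (Suc j)
 then show ?case
  using lin_onD(1)[OF cyc_lin] lin_on_sgn_mult[OF T_module T_module cyc_lin]
  by (simp add: TC_eq sgn_mult_sgn_mult[OF T_module] algebra_simps)
qed

lemma rot_letters: "w \<in> words (amod A) n p \<Longrightarrow> rot j w \<in> words (amod A) n p"
proof -
 assume w: "w \<in> words (amod A) n p"
 have "wdeg (take i w) + wdeg (drop i w) = wdeg w" for i
  by (metis append_take_drop_id wdeg_simps(3))
 then show ?thesis using w
  by (auto simp: rot_def words_iff add.commute dest: in_set_takeD in_set_dropD)
qed

text \<open>The sign (-1)^n in T, the Koszul sign of t and the change of \<open>th\<close> under the
  rotation combine into the Koszul sign for suspended degrees.\<close>

lemma TC_frag: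
 assumes "w \<in> words (amod A) (Suc n) p"
 shows "TC n p (EA m (Suc n) p (frag_of (m, w))) = EA m (Suc n) p (Ts w (\<lambda>u. frag_of (m, u)))"
proof -
 obtain u l where w: "w = u @ [l]" using assms by (cases w rule: rev_cases) (auto simp: words_iff)
 have lu: "l # u \<in> words (amod A) (Suc n) p" using assms by (simp add: w words_iff del: Vl_iff)
 have n: "int n = int (length u)" using assms by (simp add: w words_iff)
 note pc = pure_closed[where A = "amod A", OF K mA]
 have "TC n p (EA m (Suc n) p (frag_of (m, w)))
   = sgn_mult (TA (Suc n) p) (int n + (th w + fst l * wdeg u)) (pure K (amod A) (l # u))"
  using assms cyc_pure[of u l n p] pc[OF assms] pc[OF lu]
  by (simp add: TC_eq EVof w lin_on_sgn_mult[OF T_module T_module cyc_lin] sgn_mult_sgn_mult[OF T_module])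
 also have "\<dots> = sgn_mult (TA (Suc n) p) ((fst l + 1) * wd u + th (l # u)) (pure K (amod A) (l # u))"
  by (rule sgn_mult_cong[OF T_module]) (auto simp: n w th_append wd_def)
 also have "\<dots> = EA m (Suc n) p (Ts w (\<lambda>u. frag_of (m, u)))"
  unfolding w Ts_snoc fhom_sgx[OF T_module EVh] using lu pc[OF lu] by (simp add: EVof sgn_mult_sgn_mult[OF T_module])
 finally show ?thesis .
qed

lemma TC_pow_frag:
 assumes "w \<in> words (amod A) (Suc n) p" "j \<le> n"
 shows "(TC n p ^^ j) (EA m (Suc n) p (frag_of (m, w))) =
  EA m (Suc n) p (sgx (wd (drop (length w - j) w) * wd (take (length w - j) w)) (frag_of (m, rot j w)))"
 using assms(2)
proof (induction j)
 case 0
 then show ?case by (simp add: rot_def)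
next
 case (Suc j)
 have lw: "length w = Suc n" using assms by (simp add: words_iff)
 let ?z = "drop (length w - j) w" and ?u = "take (length w - j) w"
 obtain u' l where u: "?u = u' @ [l]" using Suc.prems lw by (cases ?u rule: rev_cases) auto
 have lu': "length u' = length w - Suc j"
  using arg_cong[OF u, of length] lw Suc.prems by simp
 have w: "w = u' @ l # ?z" using append_take_drop_id[of "length w - j" w] unfolding u by simp
 have t: "take (length w - Suc j) w = u'" "drop (length w - Suc j) w = l # ?z"
  unfolding lu'[symmetric] by (subst w, simp)+
 have r: "rot j w = (?z @ u') @ [l]" by (simp add: rot_def u)
 have rS: "rot (Suc j) w = l # ?z @ u'" by (simp add: rot_def t)
 have "(TC n p ^^ Suc j) (EA m (Suc n) p (frag_of (m, w))) =
  TC n p (sgn_mult (TA (Suc n) p) (wd ?z * wd ?u) (EA m (Suc n) p (frag_of (m, rot j w))))"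
  using Suc by (simp add: fhom_sgx[OF T_module EVh])
 also have "\<dots> = sgn_mult (TA (Suc n) p) (wd ?z * wd ?u) (EA m (Suc n) p (Ts (rot j w) (\<lambda>u. frag_of (m, u))))"
  using TC_frag[OF rot_letters[OF assms(1), of j]] lin_on_sgn_mult[OF T_module T_module TC_lin fhomD(1)[OF EVh]] by simp
 also have "\<dots> = EA m (Suc n) p (sgx (wd ?z * wd ?u + (fst l + 1) * wd (?z @ u')) (frag_of (m, rot (Suc j) w)))"
  unfolding r Ts_snoc rS by (simp add: fhom_sgx[OF T_module EVh, symmetric])
 also have "sgx (wd ?z * wd ?u + (fst l + 1) * wd (?z @ u')) (frag_of (m, rot (Suc j) w)) =
   sgx (wd (drop (length w - Suc j) w) * wd (take (length w - Suc j) w)) (frag_of (m, rot (Suc j) w))"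
  unfolding t u by (rule sgx_cong) auto
 finally show ?case .
qed

lemma Nbar_frag:
 assumes "w \<in> words (amod A) (Suc n) p"
 shows "finsum (TA (Suc n) p) (\<lambda>j. (TC n p ^^ j) (EA m (Suc n) p (frag_of (m, w)))) {..n}
   = EA m (Suc n) p (Ns w (\<lambda>u. frag_of (m, u)))"
proof -
 interpret module K "TA (Suc n) p" by (rule T_module)
 have lw: "length w = Suc n" using assms by (simp add: words_iff)
 show ?thesis
  unfolding Ns_sum lw lessThan_Suc_atMost fhom_sum[OF T_module EVh]
  using TC_pow_frag[OF assms, of _ m] fhomD(1)[OF EVh] by (intro finsum_cong') (auto simp: lw)
qed

text \<open>The exponent in front consists of the sum of the face indices j, ..., j + k - 1 and of
  the sign k(p - 1) in the definition of the face. Together with the twist in \<open>EV\<close> it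
  turns the operation with index \<open>k\<close> into its suspension; \<open>k = 0\<close> is the
  differential.\<close>

lemma insert_frag:
 assumes w: "w \<in> words (amod A) (Suc n) p" and k: "j + k \<le> n"
 shows "sgn_mult (TA (Suc (n - k)) (p + int k - 1)) (int (j * k) + (tri k - int k) + int k * (p - 1))
   (insert_map K A j (Suc k, int k - 1, mO K A k) (n - k - j) p (EA m (Suc n) p (frag_of (m, w))))
  = EA m (Suc (n - k)) (p + int k - 1) (sgx (wd (take j w))
    (frag_of (m, take j w @ mlet K A (take (Suc k) (drop j w)) # drop (j + Suc k) w)))"
proof -
 let ?WA = "lists (Vl (amod A))" and ?A = "amod A"
 define x y z where "x = take j w" "y = take (Suc k) (drop j w)" "z = drop (j + Suc k) w"
 have lw: "length w = Suc n" and wv: "w \<in> ?WA" and wp: "wdeg w = p" using w by (auto simp: words_iff)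
 have wxyz: "w = x @ y @ z"
  unfolding x_y_z_def by (metis append_take_drop_id drop_drop add.commute)
 have len: "length x = j" "length y = Suc k" "length z = n - k - j"
  using lw k by (auto simp: x_y_z_def)
 let ?\<phi> = "(Suc k, int k - 1, mO K A k)" and ?T' = "TA (Suc (n - k)) (p + int k - 1)"
 let ?d = "wdeg y + int k - 1" and ?a = "mO K A k (wdeg y) (pure K ?A y)"
 have sj: "Suc (j + (n - k - j)) = Suc (n - k)" "j + Suc k + (n - k - j) = Suc n" using k by auto
 have insl: "lin_on K (TA (Suc n) p) ?T' (insert_map K A j ?\<phi> (n - k - j) p)"
  using insert_map_lin[where A = "?A" and i = j and j = "n - k - j" and p = p, OF K mA gm_mO_lin[OF K A, of k] refl]
  by (simp only: fst_conv snd_conv sj add_diff_eq)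
 have insp: "insert_map K A j ?\<phi> (n - k - j) p (pure K ?A w) = sgn_mult ?T' ((int k - 1) * wdeg x) (pure K ?A (x @ (?d, ?a) # z))"
  using insert_map_pure[where A = "?A" and AA = A and x = x and y = y and z = z and i = j and j = "n - k - j" and p = p, OF K mA gm_mO_lin[OF K A, of k] refl]
   wv wp len unfolding wxyz by (simp only: fst_conv snd_conv sj add_diff_eq)
 have yv: "y \<in> ?WA" "y \<noteq> []" and xz: "x \<in> ?WA" "z \<in> ?WA"
  using wv len unfolding wxyz by auto
 have ml: "mlet K A y = (?d, sgn_mult (?A ?d) (tri k + nu y) ?a)"
  using len by (simp add: slet_def Let_def)
 have a: "?a \<in> carrier (?A ?d)"
  using rlet_closed[where A = "?A" and B = "?A" and y = y, OF K mA mA mO_lin[OF K A]] yv len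
  by (simp add: rlet_def)
 have lin: "lin_on K (?A ?d) ?T' (\<lambda>a. pure K ?A (x @ (?d, a) # z))"
  using xz len k by (intro mlinD[OF pure_mlin[OF K mA]]) (auto simp: wp[symmetric] wxyz)
 have out: "x @ (?d, c) # z \<in> words ?A (Suc (n - k)) (p + int k - 1)" if "c \<in> carrier (?A ?d)" for c
  using that xz len k by (auto simp: words_iff wp[symmetric] wxyz)
 define P where "P = pure K ?A (x @ (?d, ?a) # z)"
 have P: "P \<in> carrier ?T'" unfolding P_def by (rule pure_closed[OF K mA out[OF a]])
 have sa: "sgn_mult (?A ?d) (tri k + nu y) ?a \<in> carrier (?A ?d)" by (rule sgn_mult_closed[OF mA a])
 have L: "insert_map K A j ?\<phi> (n - k - j) p (EA m (Suc n) p (frag_of (m, w))) = sgn_mult ?T' (th w + (int k - 1) * wdeg x) P"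
  unfolding EVof[OF w] lin_on_sgn_mult[OF T_module T_module insl pure_closed[OF K mA w]] insp P_def[symmetric]
  by (rule sgn_mult_sgn_mult[OF T_module P])
 have R: "EA m (Suc (n - k)) (p + int k - 1) (sgx (wd x) (frag_of (m, x @ mlet K A y # z)))
   = sgn_mult ?T' (wd x + (th (x @ (?d, ?a) # z) + (tri k + nu y))) P"
 proof -
  have "th (x @ (?d, sgn_mult (?A ?d) (tri k + nu y) ?a) # z) = th (x @ (?d, ?a) # z)"
   by (simp add: th_append)
  then show ?thesis
   unfolding fhom_sgx[OF T_module EVh] ml EVof[OF out[OF sa]] lin_on_sgn_mult[OF mA T_module lin a] P_def[symmetric]
   by (simp only: sgn_mult_sgn_mult[OF T_module P] sgn_mult_sgn_mult[OF T_module sgn_mult_closed[OF T_module P]] sgn_mult_closed[OF T_module P] add.assoc)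
 qed
 have "even (int (j * k) + (tri k - int k) + int k * (p - 1) + (th w + (int k - 1) * wdeg x)
   - (wd x + (th (x @ (?d, ?a) # z) + (tri k + nu y))))"
 proof -
  have ny: "nu y = int k * wdeg y - th y" using nu_th[OF yv(2)] len by simp
  have "int (j * k) + (tri k - int k) + int k * (p - 1) + (th w + (int k - 1) * wdeg x)
   - (wd x + (th (x @ (?d, ?a) # z) + (tri k + nu y)))
   = 2 * (int k * wdeg x + int k * wdeg z + th y - int k - wdeg x)"
   unfolding ny wp[symmetric] wxyz by (simp add: th_append len wd_def algebra_simps)
  then show ?thesis by (simp only: dvd_triv_left)
 qed
 then show ?thesis
  unfolding x_y_z_def[symmetric] L R by (simp only: sgn_mult_sgn_mult[OF T_module P] sgn_mult_cong[OF T_module])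
qed

definition Pface :: "nat \<Rightarrow> nat \<Rightarrow> nat list" where
 "Pface k j = [j..<j + k]"

text \<open>The index tuples of the faces that multiply across the end of the cyclic word;
  \<open>q\<close> is the number of factors taken from the end.\<close>

definition Qface :: "nat \<Rightarrow> nat \<Rightarrow> nat \<Rightarrow> nat list" where
 "Qface n k q = [0..<k - q] @ [n - q + 1..<n + 1]"

lemma sum_upt: "int (sum_list [i..<i + k]) = int i * int k + (tri k - int k)"
 by (induction k) (auto simp: tri_Suc algebra_simps)

lemma sum_Pface: "int (sum_list (Pface k j)) = int (j * k) + (tri k - int k)"
 unfolding Pface_def sum_upt by simp

lemma sum_Qface:
 assumes "q \<le> k" "k \<le> n"
 shows "int (sum_list (Qface n k q)) = (tri k - int k) + int q * (int n + 1 - int k)"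
proof -
 have 1: "int (sum_list [0..<k - q]) = tri (k - q) - int (k - q)"
  using sum_upt[of 0 "k - q"] by simp
 have 2: "int (sum_list [n - q + 1..<n - q + 1 + q]) = int (n - q + 1) * int q + (tri q - int q)"
  by (rule sum_upt)
 have 3: "tri k = tri (k - q) + tri q + int (k - q) * int q"
  using tri_add[of "k - q" q] assms by simp
 have 4: "n - q + 1 + q = n + 1" using assms by simp
 have 5: "int (k - q) = int k - int q" "int (n - q + 1) = int n - int q + 1" using assms by auto
 have "int (sum_list (Qface n k q)) = int (sum_list [0..<k - q]) + int (sum_list [n - q + 1..<n - q + 1 + q])"
  unfolding Qface_def 4 by simp
 then show ?thesis
  unfolding 1 2 3 5 by (simp add: algebra_simps)
qed

lemma Pface_inj: "k > 0 \<Longrightarrow> Pface k j = Pface k j' \<longleftrightarrow> j = j'"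
proof -
 assume k: "k > 0"
 have "hd (Pface k j) = j" for j using k by (simp add: Pface_def)
 then show ?thesis by metis
qed

text \<open>Already the sums of the indices differ, because n + 1 - k is not zero.\<close>

lemma Qface_inj: "q \<le> k \<Longrightarrow> q' \<le> k \<Longrightarrow> k \<le> n \<Longrightarrow> Qface n k q = Qface n k q' \<longleftrightarrow> q = q'"
proof
 assume a: "q \<le> k" "q' \<le> k" "k \<le> n" and e: "Qface n k q = Qface n k q'"
 have "int q * (int n + 1 - int k) = int q' * (int n + 1 - int k)"
  using sum_Qface[OF a(1,3)] sum_Qface[OF a(2,3)] unfolding e by linarith
 moreover have "int n + 1 - int k \<noteq> 0" using a by simp
 ultimately show "q = q'" by (metis mult_right_cancel of_nat_eq_iff)
qed simp

lemma Qface_Pface: "1 \<le> q \<Longrightarrow> q \<le> k \<Longrightarrow> k \<le> n \<Longrightarrow> j + k \<le> n \<Longrightarrow> Qface n k q \<noteq> Pface k j"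
proof
 assume a: "1 \<le> q" "q \<le> k" "k \<le> n" "j + k \<le> n" and e: "Qface n k q = Pface k j"
 have "n \<in> set (Qface n k q)" using a by (auto simp: Qface_def)
 then show False using a unfolding e by (auto simp: Pface_def)
qed

text \<open>Injectivity and disjointness of the two families of tuples resolve the definite
  descriptions in \<open>alg_face\<close>.\<close>

lemma alg_face_eq:
 assumes k: "length is = k" "k > 0" "k \<le> n" and X: "X \<in> carrier (TA (Suc n) p)"
 shows "is = Pface k j \<Longrightarrow> j + k \<le> n \<Longrightarrow> alg_face K A n p is X = block_face K A n p j k X"
  and "is = Qface n k q \<Longrightarrow> 1 \<le> q \<Longrightarrow> q \<le> k \<Longrightarrow>
   alg_face K A n p is X = sgn_mult (TA (Suc (n - k)) (p + int k - 1)) (int (q * (k - 1))) (block_face K A n p 0 k ((cyc_perm K A n p ^^ q) X))"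
  and "(\<And>j. j + k \<le> n \<Longrightarrow> is \<noteq> Pface k j) \<Longrightarrow> (\<And>q. 1 \<le> q \<Longrightarrow> q \<le> k \<Longrightarrow> is \<noteq> Qface n k q) \<Longrightarrow>
   alg_face K A n p is X = \<zero>\<^bsub>TA (Suc (n - k)) (p + int k - 1)\<^esub>"
proof -
 let ?P = "\<lambda>j. j + k \<le> n \<and> is = Pface k j" and ?Q = "\<lambda>q. 1 \<le> q \<and> q \<le> k \<and> is = Qface n k q"
 have af: "alg_face K A n p is X = (if Ex ?P then block_face K A n p (THE j. ?P j) k X
    else if Ex ?Q then sgn_mult (TA (Suc (n - k)) (p + int k - 1)) (int ((THE q. ?Q q) * (k - 1)))
      (block_face K A n p 0 k ((cyc_perm K A n p ^^ (THE q. ?Q q)) X))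
    else \<zero>\<^bsub>TA (Suc (n - k)) (p + int k - 1)\<^esub>)"
  unfolding alg_face_def Let_def k(1) Pface_def Qface_def Suc_eq_plus1
  using X by (simp only: restrict_apply' Suc_eq_plus1)
 {
  assume j: "is = Pface k j" "j + k \<le> n"
  then have "(THE j. ?P j) = j" using k by (auto simp: Pface_inj)
  then show "alg_face K A n p is X = block_face K A n p j k X" using j af by auto
 next
  assume q: "is = Qface n k q" "1 \<le> q" "q \<le> k"
  then have t: "(THE q. ?Q q) = q" using k by (auto simp: Qface_inj)
  have "\<not> Ex ?P" using q k Qface_Pface by metis
  then show "alg_face K A n p is X = sgn_mult (TA (Suc (n - k)) (p + int k - 1)) (int (q * (k - 1))) (block_face K A n p 0 k ((cyc_perm K A n p ^^ q) X))"
   using q af unfolding t by auto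
 next
  assume "\<And>j. j + k \<le> n \<Longrightarrow> is \<noteq> Pface k j" "\<And>q. 1 \<le> q \<Longrightarrow> q \<le> k \<Longrightarrow> is \<noteq> Qface n k q"
  then show "alg_face K A n p is X = \<zero>\<^bsub>TA (Suc (n - k)) (p + int k - 1)\<^esub>"
   using af by auto
 }
qed

lemma insert_lin':
 assumes "j + k \<le> n"
 shows "lin_on K (TA (Suc n) p) (TA (Suc (n - k)) (p + int k - 1)) (insert_map K A j (Suc k, int k - 1, mO K A k) (n - k - j) p)"
proof -
 have sj: "Suc (j + (n - k - j)) = Suc (n - k)" "j + Suc k + (n - k - j) = Suc n" using assms by auto
 show ?thesis
  using insert_map_lin[where A = "amod A" and i = j and j = "n - k - j" and p = p, OF K mA gm_mO_lin[OF K A, of k] refl]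
  by (simp only: fst_conv snd_conv sj add_diff_eq)
qed

lemma block_face_eq:
 assumes "k > 0"
 shows "block_face K A n p j k = (\<lambda>X. sgn_mult (TA (Suc (n - k)) (p + int k - 1)) (int k * (p - 1))
   (insert_map K A j (Suc k, int k - 1, mO K A k) (n - k - j) p X))"
 using assms gm_mO[of k K A] by (auto simp: block_face_def)

lemma block_lin:
 assumes "j + k \<le> n" "k > 0"
 shows "lin_on K (TA (Suc n) p) (TA (Suc (n - k)) (p + int k - 1)) (block_face K A n p j k)"
 unfolding block_face_eq[OF assms(2)] by (rule lin_on_sgn_mult_fun[OF T_module insert_lin'[OF assms(1)]])

lemma cyc_pow_lin: "lin_on K (TA (Suc n) p) (TA (Suc n) p) (cyc_perm K A n p ^^ j)"
proof (induction j)
 case (Suc j)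
 then show ?case using lin_on_comp[OF Suc cyc_lin] by (simp add: comp_def)
qed (simp add: lin_on_def)

lemma alg_face_lin:
 assumes k: "length is = k" "k > 0" "k \<le> n"
 shows "lin_on K (TA (Suc n) p) (TA (Suc (n - k)) (p + int k - 1)) (alg_face K A n p is)"
proof -
 consider (P) j where "is = Pface k j" "j + k \<le> n" | (Q) q where "is = Qface n k q" "1 \<le> q" "q \<le> k"
  | (N) "\<And>j. j + k \<le> n \<Longrightarrow> is \<noteq> Pface k j" "\<And>q. 1 \<le> q \<Longrightarrow> q \<le> k \<Longrightarrow> is \<noteq> Qface n k q"
  by blast
 then show ?thesis
 proof cases
  case P
  show ?thesis
   by (rule lin_on_congI[OF T_module block_lin[OF P(2) k(2)]]) (rule alg_face_eq(1)[OF k _ P])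
 next
  case Q
  have "lin_on K (TA (Suc n) p) (TA (Suc (n - k)) (p + int k - 1))
    (\<lambda>X. sgn_mult (TA (Suc (n - k)) (p + int k - 1)) (int (q * (k - 1))) (block_face K A n p 0 k ((cyc_perm K A n p ^^ q) X)))"
   using k by (intro lin_on_sgn_mult_fun[OF T_module] lin_on_comp[OF cyc_pow_lin block_lin]) auto
  then show ?thesis
   by (rule lin_on_congI[OF T_module]) (rule alg_face_eq(2)[OF k _ Q])
 next
  case N
  show ?thesis
   by (rule lin_on_congI[OF T_module lin_on_zero_fun[OF T_module T_module]]) (rule alg_face_eq(3)[OF k _ N])
 qed
qed

lemma tdiff_lin: "lin_on K (TA (Suc n) p) (TA (Suc n) (p - 1)) (tdiff K A (Suc n) p)"
proof (rule lin_on_congI[OF T_module])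
 show "lin_on K (TA (Suc n) p) (TA (Suc n) (p - 1)) (\<lambda>X. finsum (TA (Suc n) (p - 1)) (\<lambda>i. insert_map K A i (Suc 0, - 1, mO K A 0) (n - i) p X) {..n})"
  using insert_lin'[of _ 0 n p] by (intro lin_on_finsum_fun[OF T_module T_module]) auto
qed (rule tdiff_eq[OF K A])

lemma DQ_lin:
 assumes "k \<le> n"
 shows "lin_on K (TA (Suc n) p) (TA (Suc (n - k)) (p + int k - 1)) (DQ r k n p)"
proof (cases "k = 0")
 case True
 then show ?thesis using tdiff_lin[of n p] by (simp add: dq_def[abs_def] cyc_module_def)
next
 case False
 have "lin_on K (TA (Suc n) p) (TA (Suc (n - k)) (p + int k - 1)) (\<lambda>x. finsum (TA (Suc (n - k)) (p + int k - 1))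
   (\<lambda>is. sgn_mult (TA (Suc (n - k)) (p + int k - 1)) (int (sum_list is)) (alg_face K A n p is x))
   {is. length is = k \<and> sorted_wrt (<) is \<and> (\<forall>i\<in>set is. i + r \<le> n)})"
  using False assms by (intro lin_on_finsum_fun[OF T_module T_module] lin_on_sgn_mult_fun[OF T_module] alg_face_lin) auto
 then show ?thesis using False by (simp add: dq_def[abs_def] cyc_module_def Let_def)
qed

text \<open>The part of \<open>b\<close> (\<open>r = 0\<close>) or \<open>b'\<close> (\<open>r = 1\<close>) that multiplies \<open>k + 1\<close> factors.\<close>

definition bpart :: "nat \<Rightarrow> 'a word \<Rightarrow> ('a word \<Rightarrow> 'g::ab_group_add) \<Rightarrow> nat \<Rightarrow> 'g" where
 "bpart r w \<phi> k = (\<Sum>i<length w - k. sgx (wd (take i w)) (\<phi> (take i w @ mlet K A (take (Suc k) (drop i w)) # drop (i + Suc k) w)))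
  + (if r = 0 then \<Sum>q\<in>{1..k}. sgx (wd (drop (length w - q) w) * wd (take (length w - q) w))
    (\<phi> (mlet K A (take (Suc k) (rot q w)) # drop (Suc k) (rot q w))) else 0)"

lemma bpart_sum:
 "(\<Sum>k<length w. bpart 0 w \<phi> k) = bs (mlet K A) w \<phi>"
 "(\<Sum>k<length w. bpart 1 w \<phi> k) = Bs (mlet K A) w \<phi>"
proof -
 have "(\<Sum>k<length w. \<Sum>q\<in>{1..k}. g k q) = (\<Sum>k\<in>{1..<length w}. \<Sum>q\<in>{1..k}. g k q)" for g :: "nat \<Rightarrow> nat \<Rightarrow> 'g::ab_group_add"
  by (rule sum.mono_neutral_right) auto
 then show "(\<Sum>k<length w. bpart 0 w \<phi> k) = bs (mlet K A) w \<phi>"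
  by (simp add: bpart_def bs_sum sum.distrib Bs_sum)
qed (simp add: bpart_def Bs_sum)

text \<open>Only the faces in the families \<open>Pface\<close> and \<open>Qface\<close> can be
  nonzero; they give the consecutive and the wrapping blocks. In b' the index n is excluded, which
  removes precisely the second family.\<close>

lemma DQ_frag:
 assumes w: "w \<in> words (amod A) (Suc n) p" and k: "k \<le> n" and r: "r \<in> {0, 1}"
 shows "DQ r k n p (EA m (Suc n) p (frag_of (m, w))) =
  EA m (Suc (n - k)) (p + int k - 1) (bpart r w (\<lambda>u. frag_of (m, u)) k)"
proof (cases "k = 0")
 case True
 have lw: "length w = Suc n" using w by (simp add: words_iff)
 interpret M: module K "TA (Suc n) (p - 1)" by (rule T_module)
 have "DQ r k n p (EA m (Suc n) p (frag_of (m, w))) =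
  finsum (TA (Suc n) (p - 1)) (\<lambda>i. insert_map K A i (Suc 0, - 1, mO K A 0) (n - i) p (EA m (Suc n) p (frag_of (m, w)))) {..n}"
  using tdiff_eq[OF K A fhomD(1)[OF EVh]] True by (simp add: dq_def cyc_module_def)
 also have "\<dots> = EA m (Suc n) (p - 1) (\<Sum>i\<le>n. sgx (wd (take i w)) (frag_of (m, take i w @ mlet K A (take (Suc 0) (drop i w)) # drop (i + Suc 0) w)))"
  unfolding fhom_sum[OF T_module EVh]
  using insert_frag[OF w, of _ 0 m] fhomD(1)[OF EVh] by (intro M.finsum_cong') auto
 finally show ?thesis
  by (simp add: True bpart_def lw lessThan_Suc_atMost)
next
 case False
 have lw: "length w = Suc n" using w by (simp add: words_iff)
 let ?T' = "TA (Suc (n - k)) (p + int k - 1)" and ?E = "EA m (Suc n) p (frag_of (m, w))"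
 let ?E' = "EA m (Suc (n - k)) (p + int k - 1)"
 interpret M: module K ?T' by (rule T_module)
 define S where "S = {is. length is = k \<and> sorted_wrt (<) is \<and> (\<forall>i\<in>set is. i + r \<le> n)}"
 define F where "F is = sgn_mult ?T' (int (sum_list is)) (alg_face K A n p is ?E)" for "is"
 have E: "?E \<in> carrier (TA (Suc n) p)" by (rule fhomD(1)[OF EVh])
 have finS: "finite S"
  by (rule finite_subset[OF _ finite_lists_length_eq[of "{..n}" k]]) (auto simp: S_def)
 have Fc: "F is \<in> carrier ?T'" if "length is = k" for "is"
  unfolding F_def using that False k by (intro sgn_mult_closed[OF T_module] lin_onD(1)[OF alg_face_lin] E) auto
 have FP: "F (Pface k j) = ?E' (sgx (wd (take j w)) (frag_of (m, take j w @ mlet K A (take (Suc k) (drop j w)) # drop (j + Suc k) w)))"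
  if "j + k \<le> n" for j
 proof -
  have lP: "length (Pface k j) = k" by (simp add: Pface_def)
  have "F (Pface k j) = sgn_mult ?T' (int (j * k) + (tri k - int k)) (sgn_mult ?T' (int k * (p - 1))
   (insert_map K A j (Suc k, int k - 1, mO K A k) (n - k - j) p ?E))"
   unfolding F_def sum_Pface using False
   by (simp add: alg_face_eq(1)[OF lP _ k E refl that] block_face_eq)
  also have "\<dots> = sgn_mult ?T' (int (j * k) + (tri k - int k) + int k * (p - 1)) (insert_map K A j (Suc k, int k - 1, mO K A k) (n - k - j) p ?E)"
   by (rule sgn_mult_sgn_mult[OF T_module lin_onD(1)[OF insert_lin'[OF that] E]])
  also note insert_frag[OF w that, of m]
  finally show ?thesis .
 qed
 have FQ: "F (Qface n k q) = ?E' (sgx (wd (drop (length w - q) w) * wd (take (length w - q) w))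
    (frag_of (m, mlet K A (take (Suc k) (rot q w)) # drop (Suc k) (rot q w))))"
  if q: "1 \<le> q" "q \<le> k" for q
 proof -
  have lQ: "length (Qface n k q) = k" using q k by (auto simp: Qface_def)
  let ?R = "EA m (Suc n) p (frag_of (m, rot q w))"
  have R: "?R \<in> carrier (TA (Suc n) p)" by (rule fhomD(1)[OF EVh])
  let ?c = "(cyc_perm K A n p ^^ q) ?E" and ?s = "wd (drop (length w - q) w) * wd (take (length w - q) w)"
  let ?I = "insert_map K A 0 (Suc k, int k - 1, mO K A k) (n - k - 0) p"
  have il: "lin_on K (TA (Suc n) p) ?T' ?I" using insert_lin'[of 0 k n p] k by simp
  have c: "?c \<in> carrier (TA (Suc n) p)" using TC_pow_cyc[OF E] by blast
  have "(TC n p ^^ q) ?E = sgn_mult (TA (Suc n) p) (int n * int q) ?c" using TC_pow_cyc[OF E] by blast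
  moreover have "(TC n p ^^ q) ?E = sgn_mult (TA (Suc n) p) ?s ?R"
   using TC_pow_frag[OF w, of q m] q k by (simp add: fhom_sgx[OF T_module EVh])
  \<comment> \<open>The power of t is known only through that of T; multiplying by the connecting
    sign once more isolates it.\<close>
  ultimately have "sgn_mult (TA (Suc n) p) (int n * int q) (sgn_mult (TA (Suc n) p) (int n * int q) ?c)
    = sgn_mult (TA (Suc n) p) (int n * int q) (sgn_mult (TA (Suc n) p) ?s ?R)" by simp
  then have cR: "?c = sgn_mult (TA (Suc n) p) (int n * int q + ?s) ?R"
   using c R by (simp add: sgn_mult_sgn_mult[OF T_module]) (simp add: sgn_mult_def)
  have "F (Qface n k q) = sgn_mult ?T' ((tri k - int k) + int q * (int n + 1 - int k))
    (sgn_mult ?T' (int (q * (k - 1))) (sgn_mult ?T' (int k * (p - 1)) (?I ?c)))"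
   unfolding F_def sum_Qface[OF q(2) k] using False
   by (simp add: alg_face_eq(2)[OF lQ _ k E refl q] block_face_eq)
  also have "?I ?c = sgn_mult ?T' (int n * int q + ?s) (?I ?R)"
   unfolding cR by (rule lin_on_sgn_mult[OF T_module T_module il R])
  also have "sgn_mult ?T' ((tri k - int k) + int q * (int n + 1 - int k))
    (sgn_mult ?T' (int (q * (k - 1))) (sgn_mult ?T' (int k * (p - 1)) (sgn_mult ?T' (int n * int q + ?s) (?I ?R))))
   = sgn_mult ?T' ((tri k - int k) + int q * (int n + 1 - int k) + (int (q * (k - 1)) + (int k * (p - 1) + (int n * int q + ?s)))) (?I ?R)"
   using lin_onD(1)[OF il R] by (simp add: sgn_mult_sgn_mult[OF T_module] sgn_mult_closed[OF T_module] add.assoc)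
  also have "\<dots> = sgn_mult ?T' (?s + (int (0 * k) + (tri k - int k) + int k * (p - 1))) (?I ?R)"
  proof (rule sgn_mult_cong[OF T_module])
   have "int (q * (k - 1)) = int q * (int k - 1)" using False by (simp add: of_nat_diff Suc_le_eq)
   then have "(tri k - int k) + int q * (int n + 1 - int k) + (int (q * (k - 1)) + (int k * (p - 1) + (int n * int q + ?s)))
    - (?s + (int (0 * k) + (tri k - int k) + int k * (p - 1))) = 2 * (int n * int q)"
    by (simp add: algebra_simps)
   then show "even ((tri k - int k) + int q * (int n + 1 - int k) + (int (q * (k - 1)) + (int k * (p - 1) + (int n * int q + ?s)))
    - (?s + (int (0 * k) + (tri k - int k) + int k * (p - 1))))" by (simp only: dvd_triv_left)
  qed
  also have "\<dots> = sgn_mult ?T' ?s (sgn_mult ?T' (int (0 * k) + (tri k - int k) + int k * (p - 1)) (?I ?R))"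
   by (rule sgn_mult_sgn_mult[OF T_module lin_onD(1)[OF il R], symmetric])
  also have "sgn_mult ?T' (int (0 * k) + (tri k - int k) + int k * (p - 1)) (?I ?R) =
    ?E' (frag_of (m, mlet K A (take (Suc k) (rot q w)) # drop (Suc k) (rot q w)))"
   using insert_frag[OF rot_letters[OF w, of q], of 0 k m] k by simp
  finally show ?thesis by (simp add: fhom_sgx[OF T_module EVh])
 qed
 define PS where "PS = Pface k ` {..n - k}"
 define QS where "QS = (if r = 0 then Qface n k ` {1..k} else {})"
 have sub: "PS \<union> QS \<subseteq> S"
 proof -
  have "Pface k j \<in> S" if "j + k \<le> n" for j
   using that r by (auto simp: S_def Pface_def)
  moreover have "Qface n k q \<in> S" if "r = 0" "1 \<le> q" "q \<le> k" for q
   using that k by (auto simp: S_def Qface_def sorted_wrt_append)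
  ultimately show ?thesis using k by (auto simp: PS_def QS_def)
 qed
 have zero: "F is = \<zero>\<^bsub>?T'\<^esub>" if i: "is \<in> S - (PS \<union> QS)" for "is"
 proof -
  have l: "length is = k" using i by (simp add: S_def)
  have "is \<noteq> Pface k j" if "j + k \<le> n" for j using i that by (auto simp: PS_def)
  moreover have "is \<noteq> Qface n k q" if "1 \<le> q" "q \<le> k" for q
  proof (cases "r = 0")
   case True
   then show ?thesis using i that by (auto simp: QS_def)
  next
   case False
   then have "r = 1" using r by simp
   moreover have "n \<in> set (Qface n k q)" using that k by (auto simp: Qface_def)
   moreover have "n \<notin> set is" using i \<open>r = 1\<close> by (force simp: S_def)
   ultimately show ?thesis by metis
  qed
  ultimately have "alg_face K A n p is ?E = \<zero>\<^bsub>?T'\<^esub>"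
   using l False k by (intro alg_face_eq(3)[OF l _ _ E]) auto
  then show ?thesis by (simp add: F_def sgn_mult_zero[OF T_module])
 qed
 have lS: "length is = k" if "is \<in> S" for "is" using that by (simp add: S_def)
 have "DQ r k n p ?E = finsum ?T' F S"
  using False by (simp add: dq_def cyc_module_def Let_def S_def F_def[abs_def])
 also have "\<dots> = finsum ?T' F (PS \<union> QS)"
  using finS sub zero Fc lS by (intro M.add.finprod_mono_neutral_cong_right) auto
 also have "\<dots> = finsum ?T' F PS \<oplus>\<^bsub>?T'\<^esub> finsum ?T' F QS"
 proof (rule M.finsum_Un_disjoint)
  show "PS \<inter> QS = {}" using Qface_Pface k by (auto simp: PS_def QS_def) (metis add.commute le_diff_conv2)
 qed (use finS sub Fc lS in \<open>auto intro: finite_subset\<close>)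
 also have "finsum ?T' F PS = finsum ?T' (\<lambda>j. F (Pface k j)) {..n - k}"
  unfolding PS_def
 proof (rule M.finsum_reindex)
  show "F \<in> Pface k ` {..n - k} \<rightarrow> carrier ?T'" using Fc by (auto simp: Pface_def)
  show "inj_on (Pface k) {..n - k}" using False by (simp add: inj_on_def Pface_inj)
 qed
 also have "\<dots> = ?E' (\<Sum>i\<le>n - k. sgx (wd (take i w)) (frag_of (m, take i w @ mlet K A (take (Suc k) (drop i w)) # drop (i + Suc k) w)))"
  unfolding fhom_sum[OF T_module EVh] using FP k fhomD(1)[OF EVh] by (intro M.finsum_cong') auto
 also have "finsum ?T' F QS = ?E' (if r = 0 then \<Sum>q\<in>{1..k}. sgx (wd (drop (length w - q) w) * wd (take (length w - q) w))
    (frag_of (m, mlet K A (take (Suc k) (rot q w)) # drop (Suc k) (rot q w))) else 0)"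
 proof (cases "r = 0")
  case True
  have "finsum ?T' F QS = finsum ?T' (\<lambda>q. F (Qface n k q)) {1..k}"
   unfolding QS_def if_P[OF True]
  proof (rule M.finsum_reindex)
   show "F \<in> Qface n k ` {1..k} \<rightarrow> carrier ?T'" using Fc k by (auto simp: Qface_def)
   show "inj_on (Qface n k) {1..k}" using k by (simp add: inj_on_def Qface_inj)
  qed
  also have "\<dots> = ?E' (\<Sum>q\<in>{1..k}. sgx (wd (drop (length w - q) w) * wd (take (length w - q) w))
    (frag_of (m, mlet K A (take (Suc k) (rot q w)) # drop (Suc k) (rot q w))))"
   unfolding fhom_sum[OF T_module EVh] using FQ fhomD(1)[OF EVh] by (intro M.finsum_cong') auto
  finally show ?thesis using True by simp
 next
  case False
  then show ?thesis by (simp add: QS_def fhom_zero[OF T_module EVh])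
 qed
 finally show ?thesis
  using k by (simp add: bpart_def lw Suc_diff_le lessThan_Suc_atMost fhomD(2)[OF EVh])
qed

section \<open>The bicomplex differential on formal sums\<close>

lemma m_rel: "ainf_rel (mlet K A) (Vl (amod A)) (Zl (amod A))"
proof -
 note cl = slet_closed[where A = "amod A" and B = "amod A", OF K mA mA mO_lin[OF K A]]
 show ?thesis
  by (intro ainf_rel.intro[OF slet_m_degree] ainf_rel_axioms.intro cl rel_m_Zl[OF K A])
qed

lemma mlet_V: "y \<in> lists (Vl (amod A)) \<Longrightarrow> y \<noteq> [] \<Longrightarrow> mlet K A y \<in> Vl (amod A)"
 by (rule ainf_rel.m_V[OF m_rel])

lemma Dk_FN:
 assumes "x \<in> FN (amod A) N"
 shows "frag_extend (Dk K A) x \<in> FN (amod A) (N - 1)"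
proof (rule FN_extend_mem[OF FN_subgrp assms])
 let ?A = "amod A"
 fix m w assume w: "w \<in> lists (Vl ?A)" "int m + wd w - 1 = N"
 note S = FN_subgrp[of "?A" "N - 1"]
 interpret m_degree "mlet K A" by (rule slet_m_degree)
 have "bs (mlet K A) w (\<lambda>u. frag_of (m, u)) \<in> FN ?A (N - 1)"
  using w by (intro bs_mem[OF S mlet_V w(1)]) (auto simp: FN_of)
 moreover have "Bs (mlet K A) w (\<lambda>u. frag_of (m, u)) \<in> FN ?A (N - 1)"
  using w by (intro Bs_mem[OF S mlet_V w(1)]) (auto simp: FN_of)
 moreover have "Ns w (\<lambda>u. frag_of (m - 1, u)) \<in> FN ?A (N - 1)" "Ts w (\<lambda>u. frag_of (m - 1, u)) \<in> FN ?A (N - 1)" "frag_of (m - 1, w) \<in> FN ?A (N - 1)" if "m > 0"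
 proof -
  have *: "frag_of (m - 1, u) \<in> FN ?A (N - 1)" if "u \<in> lists (Vl ?A)" "length u = length w" "wdeg u = wdeg w" for u
   using w that \<open>m > 0\<close> by (auto simp: FN_of wd_def of_nat_diff)
  show "Ns w (\<lambda>u. frag_of (m - 1, u)) \<in> FN ?A (N - 1)" by (rule Ns_mem[OF S w(1) *])
  show "Ts w (\<lambda>u. frag_of (m - 1, u)) \<in> FN ?A (N - 1)" by (rule Ts_mem[OF S w(1) *])
  show "frag_of (m - 1, w) \<in> FN ?A (N - 1)" by (rule *[OF w(1) refl refl])
 qed
 ultimately show "Dk K A (m, w) \<in> FN ?A (N - 1)"
  by (auto simp: Dk_def intro!: subgrp.add[OF S] subgrp.minus[OF S] subgrp.diff[OF S] subgrp.zero[OF S])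
qed

lemma frag_extend_hom:
 "frag_extend \<psi> (bs m w \<phi>) = bs m w (\<lambda>u. frag_extend \<psi> (\<phi> u))"
 "frag_extend \<psi> (Bs m w \<phi>) = Bs m w (\<lambda>u. frag_extend \<psi> (\<phi> u))"
 "frag_extend \<psi> (Ts w \<phi>) = Ts w (\<lambda>u. frag_extend \<psi> (\<phi> u))"
 "frag_extend \<psi> (Ns w \<phi>) = Ns w (\<lambda>u. frag_extend \<psi> (\<phi> u))"
 by (rule bs_hom[OF additive_frag_extend] Bs_hom[OF additive_frag_extend] Ts_hom[OF additive_frag_extend] Ns_hom[OF additive_frag_extend])+

lemma bs_add: "bs m w (\<lambda>u. \<phi> u + \<psi> u) = bs m w \<phi> + bs m w \<psi>"
 by (cases w) (simp_all add: bs_Cons Bs_add ssum3_add sgx_add add_ac)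

lemma Dk_even: "even m \<Longrightarrow> Dk K A (m, w) = bs (mlet K A) w (\<lambda>u. frag_of (m, u)) + (if m = 0 then 0 else Ns w (\<lambda>u. frag_of (m - 1, u)))"
 by (simp add: Dk_def)

lemma Dk_odd:
 assumes "odd m"
 shows "Dk K A (m, w) = frag_of (m - 1, w) - Ts w (\<lambda>u. frag_of (m - 1, u)) - Bs (mlet K A) w (\<lambda>u. frag_of (m, u))"
proof -
 have "m \<noteq> 0" using assms by (cases m) auto
 then show ?thesis
  unfolding Dk_def prod.case if_not_P[OF assms] if_not_P[OF \<open>m \<noteq> 0\<close>] by (simp only: uminus_add_conv_diff)
qed

text \<open>The mixed terms and the products of horizontal maps cancel exactly, by b(1 - T) = (1 -
  T)b', Nb = b'N and TN = N = NT; the squares bb and b'b' vanish only after evaluation.\<close>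

lemma Dk_Dk:
 assumes "x \<in> FN (amod A) N"
 shows "frag_extend (Dk K A) (frag_extend (Dk K A) x) \<in> Ker K (amod A)"
proof -
 note S = Ker_subgrp[where A = "amod A", OF K mA]
 interpret ainf_rel "mlet K A" "Vl (amod A)" "Zl (amod A)" by (rule m_rel)
 note mm = mult_mod_of[where A = "amod A", OF K mA]
 note bb = bs_bs[OF S mm] and BB = Bs_Bs[OF S mm]
 let ?D = "frag_extend (Dk K A)" and ?m = "mlet K A"
 have "frag_extend (?D \<circ> Dk K A) x \<in> Ker K (amod A)"
 proof (rule FN_extend_mem[OF S assms])
  fix m w assume w: "w \<in> lists (Vl (amod A))"
  let ?\<phi> = "\<lambda>m u. frag_of (m, u)"
  define \<nu> :: "nat \<Rightarrow> 'a word \<Rightarrow> (nat \<times> 'a word) \<Rightarrow>\<^sub>0 int"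
   where "\<nu> = (\<lambda>m u. if m = 0 then 0 else Ns u (?\<phi> (m - 1)))"
  show "(?D \<circ> Dk K A) (m, w) \<in> Ker K (amod A)"
  proof (cases "even m")
   case False
   then have e: "even (m - 1)" by (auto elim: oddE)
   have De: "Dk K A (m - 1, u) = bs ?m u (?\<phi> (m - 1)) + \<nu> (m - 1) u" for u
    by (simp only: Dk_even[OF e] \<nu>_def)
   have T: "Ts w (\<lambda>u. bs ?m u (?\<phi> (m - 1)) + \<nu> (m - 1) u) = Ts w (\<lambda>u. bs ?m u (?\<phi> (m - 1))) + \<nu> (m - 1) w"
    using Ns_T2[of w "?\<phi> (m - 1 - 1)"] by (auto simp: \<nu>_def Ts_def sgx_add)
   have "(?D \<circ> Dk K A) (m, w) = Dk K A (m - 1, w) - Ts w (\<lambda>u. Dk K A (m - 1, u)) - Bs ?m w (\<lambda>u. Dk K A (m, u))"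
    unfolding o_def Dk_odd[OF False, of w] frag_extend_diff frag_extend_hom by simp
   also have "\<dots> = (bs ?m w (?\<phi> (m - 1)) - Ts w (\<lambda>u. bs ?m u (?\<phi> (m - 1)))) - (Bs ?m w (?\<phi> (m - 1)) - Bs ?m w (\<lambda>u. Ts u (?\<phi> (m - 1))))
     + Bs ?m w (\<lambda>u. Bs ?m u (?\<phi> m))"
    unfolding De T Dk_odd[OF False] Bs_diff by simp
   also have "\<dots> = Bs ?m w (\<lambda>u. Bs ?m u (?\<phi> m))"
    unfolding bs_T by simp
   finally show ?thesis using BB[OF w] by simp
  next
   case True
   show ?thesis
   proof (cases "m = 0")
    case True
    then show ?thesis using bb[OF w] by (simp add: Dk_even frag_extend_hom)
   next
    case False
    then have o: "odd (m - 1)" using True by simp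
    have "(?D \<circ> Dk K A) (m, w) = bs ?m w (\<lambda>u. Dk K A (m, u)) + Ns w (\<lambda>u. Dk K A (m - 1, u))"
     unfolding o_def Dk_even[OF True, of w] if_not_P[OF False] frag_extend_add frag_extend_hom by simp
    also have "\<dots> = bs ?m w (\<lambda>u. bs ?m u (?\<phi> m)) + (bs ?m w (\<lambda>u. Ns u (?\<phi> (m - 1))) - Ns w (\<lambda>u. Bs ?m u (?\<phi> (m - 1))))
      + (Ns w (?\<phi> (m - 1 - 1)) - Ns w (\<lambda>u. Ts u (?\<phi> (m - 1 - 1))))"
     unfolding Dk_even[OF True] Dk_odd[OF o] if_not_P[OF False] bs_add Ns_diff by simp
    also have "\<dots> = bs ?m w (\<lambda>u. bs ?m u (?\<phi> m))"
     unfolding bs_N Ns_T1 by simp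
    finally show ?thesis using bb[OF w] by simp
   qed
  qed
 qed
 then show ?thesis by (simp add: frag_extend_comp)
qed

text \<open>Scaling the first letter realises the scalar multiplication.\<close>

lemma sck_FN: "c \<in> carrier K \<Longrightarrow> x \<in> FN (amod A) N \<Longrightarrow> frag_extend (sck A c) x \<in> FN (amod A) N"
proof (rule FN_extend_mem[OF FN_subgrp])
 fix m w assume w: "c \<in> carrier K" "w \<in> lists (Vl (amod A))" "int m + wd w - 1 = N"
 then show "sck A c (m, w) \<in> FN (amod A) N"
  using subgrp.zero[OF FN_subgrp] module.smult_closed[OF mA]
  by (cases w) (auto simp: sck_def FN_of Vl_def)
qed

lemma EV_sck:
 assumes c: "c \<in> carrier K" and x: "x \<in> FN (amod A) N" and n: "n > 0"
 shows "EA m n p (frag_extend (sck A c) x) = c \<odot>\<^bsub>TA n p\<^esub> EA m n p x"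
proof (rule fhom_ext[OF T_module])
 interpret module K "TA n p" by (rule T_module)
 have lin: "lin_on K (TA n p) (TA n p) (\<lambda>x. c \<odot>\<^bsub>TA n p\<^esub> x)"
  using c by (intro lin_onI) (auto simp: smult_r_distr smult_assoc1[symmetric] m_comm)
 show "fhom (TA n p) (\<lambda>x. EA m n p (frag_extend (sck A c) x))" by (rule fhom_frag_extend[OF T_module EVh])
 show "fhom (TA n p) (\<lambda>x. c \<odot>\<^bsub>TA n p\<^esub> EA m n p x)" by (rule fhom_lin[OF EVh lin])
 show "Poly_Mapping.keys x \<subseteq> vk (amod A) N" using x by (simp add: FN_def)
 fix s assume s: "s \<in> vk (amod A) N"
 obtain m' w where mw: "s = (m', w)" by (cases s)
 have w: "w \<in> lists (Vl (amod A))" using s by (simp add: mw vk_def)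
 show "EA m n p (frag_extend (sck A c) (frag_of s)) = c \<odot>\<^bsub>TA n p\<^esub> EA m n p (frag_of s)"
 proof (cases w)
  case Nil
  then show ?thesis using n c by (simp add: mw sck_def fhom_zero[OF T_module EVh] EVof0 words_iff)
 next
  case (Cons l v)
  have "lin_on K (amod A (fst l)) (TA n p) (\<lambda>a. EA m n p (frag_of (m', [] @ (fst l, a) # v)))"
   using w Cons by (intro EV_letter_lin[where A = "amod A", OF K mA]) auto
  from lin_onD(3)[OF this c, of "snd l"] show ?thesis
   using w Cons by (simp add: mw sck_def Vl_def)
 qed
qed

section \<open>The total complex as a quotient of formal sums\<close>

lemma TA_neg:
 assumes "p < 0" "n > 0"
 shows "carrier (TA n p) = {\<zero>\<^bsub>TA n p\<^esub>}"
proof -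
 let ?A = "amod A"
 interpret module K "TA n p" by (rule T_module)
 have "X = \<zero>\<^bsub>TA n p\<^esub>" if "X \<in> carrier (TA n p)" for X
 proof (rule tpow_induct[where A = "?A" and P = "\<lambda>X. X = \<zero>\<^bsub>TA n p\<^esub>", OF K mA assms(2) that])
  fix w assume w: "w \<in> words ?A n p"
  \<comment> \<open>A word of negative total degree has a letter of negative degree, and such a
    letter is zero.\<close>
  have "\<exists>l\<in>set w. fst l < 0"
  proof (rule ccontr)
   assume "\<not> ?thesis"
   then have "wdeg w \<ge> 0" unfolding wdeg_def by (intro sum_list_nonneg) auto
   then show False using w assms by (simp add: words_iff)
  qed
  then obtain x l z where l: "w = x @ l # z" "fst l < 0" by (metis split_list)
  have v: "x \<in> lists (Vl ?A)" "z \<in> lists (Vl ?A)" "snd l \<in> carrier (?A (fst l))"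
   "Suc (length x + length z) = n" "wdeg x + fst l + wdeg z = p"
   using w by (auto simp: words_iff l Vl_def)
  then have "snd l = \<zero>\<^bsub>?A (fst l)\<^esub>" using is_ainfD(2)[OF A l(2)] by auto
  moreover have "lin_on K (?A (fst l)) (TA n p) (\<lambda>a. pure K ?A (x @ (fst l, a) # z))"
   using v by (intro mlinD[OF pure_mlin[OF K mA]]) auto
  ultimately have "pure K ?A (x @ (fst l, snd l) # z) = \<zero>\<^bsub>TA n p\<^esub>"
   using lin_on_zero[OF mA T_module] by metis
  then show "pure K ?A w = \<zero>\<^bsub>TA n p\<^esub>" by (simp add: l)
 qed simp_all
 then show ?thesis by auto
qed

lemma Xbar_module: "module K (Xbar XA n)"
 unfolding Xbar_def using T_module by (intro dsum_module[OF K]) (simp add: cyc_module_def)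

lemma Tot_module: "module K (Tot XA N)"
 unfolding Tot_def by (intro dsum_module[OF K] Xbar_module)

lemma Tot_carrier: "carrier (Tot XA N) = (\<Pi>\<^sub>E n\<in>{n. int n \<le> N}. \<Pi>\<^sub>E k\<in>{..n}. carrier (TA (Suc k) (int n - int k)))"
 by (simp add: Tot_def Xbar_def cyc_module_def)

lemma tot_fhom: "fhom (Tot XA N) (tot K A N)"
proof -
 have "tot K A N x \<in> carrier (Tot XA N)" for x
  unfolding Tot_carrier tot_def using fhomD(1)[OF EVh] by auto
 moreover have "tot K A N (x + y) = tot K A N x \<oplus>\<^bsub>Tot XA N\<^esub> tot K A N y" for x y
  unfolding tot_def by (auto simp: Tot_def Xbar_def cyc_module_def fhomD(2)[OF EVh] cong: restrict_cong)
 ultimately show ?thesis by (simp add: fhom_def)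
qed

lemma tot_smult: "c \<in> carrier K \<Longrightarrow> x \<in> FN (amod A) M \<Longrightarrow> tot K A N (frag_extend (sck A c) x) = c \<odot>\<^bsub>Tot XA N\<^esub> tot K A N x"
 unfolding tot_def by (auto simp: Tot_def Xbar_def cyc_module_def EV_sck cong: restrict_cong)

text \<open>\<open>Ker\<close> tests all triples (m, n, p), \<open>tot\<close> only those of total
  degree \<open>N\<close> with p at least 0. In the others either no word of \<open>x\<close> has
  this shape, or p < 0 and the tensor power is zero.\<close>

lemma tot_zero_iff:
 assumes x: "x \<in> FN (amod A) N"
 shows "tot K A N x = \<zero>\<^bsub>Tot XA N\<^esub> \<longleftrightarrow> x \<in> Ker K (amod A)"
proof
 assume z: "tot K A N x = \<zero>\<^bsub>Tot XA N\<^esub>"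
 have "EA m n p x = \<zero>\<^bsub>TA n p\<^esub>" if n: "n > 0" for m n p
 proof (cases "int m + int n - 1 + p = N \<and> p \<ge> 0")
  case True
  define n' where "n' = nat p + (n - 1)"
  have n': "int n' \<le> N" "nat N - n' = m" "Suc (n - 1) = n" "int n' - int (n - 1) = p" "n - 1 \<le> n'"
   using True n by (auto simp: n'_def of_nat_diff Suc_le_eq)
  from fun_cong[OF fun_cong[OF z, of n'], of "n - 1"] show ?thesis
   using n' n by (simp add: tot_def Tot_def Xbar_def cyc_module_def)
 next
  case False
  show ?thesis
  proof (cases "p < 0")
   case True
   have "EA m n p x \<in> carrier (TA n p)" by (rule fhomD(1)[OF EVh])
   then show ?thesis unfolding TA_neg[OF True n] by simp
  next
   case F: False
   show ?thesis
   proof (rule fhom_ext[OF T_module EVh fhom_const0[OF T_module]])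
    show "Poly_Mapping.keys x \<subseteq> vk (amod A) N" using x by (simp add: FN_def)
    fix s assume "s \<in> vk (amod A) N"
    then show "EA m n p (frag_of s) = \<zero>\<^bsub>TA n p\<^esub>"
     using False F by (cases s) (auto simp: vk_def words_iff wd_def intro!: EVof0)
   qed
  qed
 qed
 then show "x \<in> Ker K (amod A)" by (simp add: Ker_def)
next
 assume "x \<in> Ker K (amod A)"
 then show "tot K A N x = \<zero>\<^bsub>Tot XA N\<^esub>"
  unfolding tot_def by (auto simp: Ker_def Tot_def Xbar_def cyc_module_def cong: restrict_cong)
qed

lemma EV_surj:
 assumes n: "n > 0" and X: "X \<in> carrier (TA n p)"
 shows "\<exists>x. Poly_Mapping.keys x \<subseteq> {m} \<times> words (amod A) n p \<and> EA m n p x = X"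
proof (rule tpow_induct[where A = "amod A", OF K mA n X])
 show "\<exists>x. Poly_Mapping.keys x \<subseteq> {m} \<times> words (amod A) n p \<and> EA m n p x = \<zero>\<^bsub>TA n p\<^esub>"
  by (rule exI[of _ 0]) (simp add: fhom_zero[OF T_module EVh])
next
 fix w assume w: "w \<in> words (amod A) n p"
 note pc = pure_closed[OF K mA w]
 interpret module K "TA n p" by (rule T_module)
 have "EA m n p (sgx (th w) (frag_of (m, w))) = pure K (amod A) w"
  using pc by (simp add: fhom_sgx[OF T_module EVh] EVof[OF w] sgn_mult_sgn_mult[OF T_module]) (simp add: sgn_mult_def)
 moreover have "Poly_Mapping.keys (sgx (th w) (frag_of (m, w))) \<subseteq> {m} \<times> words (amod A) n p"
  using w by (simp add: sgx_def)
 ultimately show "\<exists>x. Poly_Mapping.keys x \<subseteq> {m} \<times> words (amod A) n p \<and> EA m n p x = pure K (amod A) w" by blast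
next
 fix X Y assume "\<exists>x. Poly_Mapping.keys x \<subseteq> {m} \<times> words (amod A) n p \<and> EA m n p x = X"
  "\<exists>x. Poly_Mapping.keys x \<subseteq> {m} \<times> words (amod A) n p \<and> EA m n p x = Y"
 then obtain x y where "Poly_Mapping.keys x \<subseteq> {m} \<times> words (amod A) n p" "EA m n p x = X"
  "Poly_Mapping.keys y \<subseteq> {m} \<times> words (amod A) n p" "EA m n p y = Y" by blast
 then show "\<exists>x. Poly_Mapping.keys x \<subseteq> {m} \<times> words (amod A) n p \<and> EA m n p x = X \<oplus>\<^bsub>TA n p\<^esub> Y"
  using keys_add[of x y] by (intro exI[of _ "x + y"]) (auto simp: fhomD(2)[OF EVh])
qed

text \<open>Preimages of the components are chosen separately and added; they do not interfere, as
  two components differ in the column or in the number of letters.\<close>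

lemma tot_surj:
 assumes z: "z \<in> carrier (Tot XA N)"
 shows "\<exists>x\<in>FN (amod A) N. tot K A N x = z"
proof -
 have "\<exists>x. int n \<le> N \<longrightarrow> k \<le> n \<longrightarrow> Poly_Mapping.keys x \<subseteq> {nat N - n} \<times> words (amod A) (Suc k) (int n - int k)
   \<and> EA (nat N - n) (Suc k) (int n - int k) x = z n k" for n k
 proof (cases "int n \<le> N \<and> k \<le> n")
  case True
  then have "z n k \<in> carrier (TA (Suc k) (int n - int k))"
   using PiE_mem[OF PiE_mem[OF z[unfolded Tot_carrier]]] by blast
  from EV_surj[OF _ this] show ?thesis by blast
 qed auto
 then obtain X where X: "\<And>n k. int n \<le> N \<Longrightarrow> k \<le> n \<Longrightarrow> Poly_Mapping.keys (X n k) \<subseteq> {nat N - n} \<times> words (amod A) (Suc k) (int n - int k)"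
  "\<And>n k. int n \<le> N \<Longrightarrow> k \<le> n \<Longrightarrow> EA (nat N - n) (Suc k) (int n - int k) (X n k) = z n k"
  by metis
 define I where "I = (SIGMA n:{n. int n \<le> N}. {..n})"
 have fI: "finite I"
  unfolding I_def by (rule finite_SigmaI) (auto intro: finite_subset[of _ "{..nat N}"])
 define x where "x = (\<Sum>i\<in>I. X (fst i) (snd i))"
 have "x \<in> FN (amod A) N"
 proof -
  have "X n k \<in> FN (amod A) N" if "int n \<le> N" "k \<le> n" for n k
   using X(1)[OF that] that unfolding FN_def vk_def by (force simp: words_iff wd_def of_nat_diff nat_le_iff le_nat_iff)
  then show ?thesis unfolding x_def by (intro subgrp_sum[OF FN_subgrp]) (auto simp: I_def)
 qed
 moreover have "tot K A N x = z"
 proof -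
  have "EA (nat N - n) (Suc k) (int n - int k) x = z n k" if nk: "int n \<le> N" "k \<le> n" for n k
  proof -
   let ?T = "TA (Suc k) (int n - int k)" and ?E = "EA (nat N - n) (Suc k) (int n - int k)"
   interpret module K ?T by (rule T_module)
   have 0: "?E (X n' k') = \<zero>\<^bsub>?T\<^esub>" if "(n', k') \<in> I" "(n', k') \<noteq> (n, k)" for n' k'
   proof (rule fhom_ext[OF T_module EVh fhom_const0[OF T_module] X(1)])
    show "int n' \<le> N" "k' \<le> n'" using that by (auto simp: I_def)
    fix s assume "s \<in> {nat N - n'} \<times> words (amod A) (Suc k') (int n' - int k')"
    then show "?E (frag_of s) = \<zero>\<^bsub>?T\<^esub>"
     using that nk by (cases s) (auto simp: I_def words_iff intro!: EVof0)
   qed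
   have "?E x = finsum ?T (\<lambda>i. ?E (X (fst i) (snd i))) I"
    unfolding x_def by (rule fhom_sum[OF T_module EVh])
   also have "\<dots> = finsum ?T (\<lambda>i. ?E (X (fst i) (snd i))) {(n, k)}"
   proof (rule add.finprod_mono_neutral_cong_right[OF fI])
    show "{(n, k)} \<subseteq> I" using nk by (simp add: I_def)
    fix i assume "i \<in> I - {(n, k)}"
    then show "?E (X (fst i) (snd i)) = \<zero>\<^bsub>?T\<^esub>"
     using 0[of "fst i" "snd i"] by auto
   next
    show "(\<lambda>i. ?E (X (fst i) (snd i))) \<in> I \<rightarrow> carrier ?T"
     using fhomD(1)[OF EVh] by (intro Pi_I)
   qed (rule refl)
   also have "\<dots> = z n k"
   proof -
    have "?E (X n k) \<in> carrier ?T" by (rule fhomD(1)[OF EVh])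
    then show ?thesis using X(2)[OF nk] by (subst finsum_insert) auto
   qed
   finally show ?thesis .
  qed
  note nk = this
  have t: "tot K A N x \<in> carrier (Tot XA N)" by (rule fhomD(1)[OF tot_fhom])
  show ?thesis
  proof (rule PiE_ext[OF t[unfolded Tot_carrier] z[unfolded Tot_carrier]])
   fix n assume n: "n \<in> {n. int n \<le> N}"
   show "tot K A N x n = z n"
    by (rule PiE_ext[OF PiE_mem[OF t[unfolded Tot_carrier] n] PiE_mem[OF z[unfolded Tot_carrier] n]])
     (use n nk in \<open>simp add: tot_def\<close>)
  qed
 qed
 ultimately show ?thesis by blast
qed

section \<open>The total differential in components\<close>

lemma Xbar_eq: "Xbar XA n = Defs.dsum {..n} (\<lambda>k. TA (Suc k) (int n - int k))"
 by (simp add: Xbar_def cyc_module_def)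

lemma xmod_eq: "xmod XA n p = TA (Suc n) p"
 by (simp add: cyc_module_def)

text \<open>\<open>Scomp\<close> and, below, \<open>Hcomp\<close> are the entries with index (n, k)
  of D2, without its sign in odd columns, and of D1, as they enter \<open>totD\<close>.\<close>

definition Scomp :: "nat \<Rightarrow> nat \<Rightarrow> nat \<Rightarrow> (nat \<Rightarrow> nat \<Rightarrow> ('k, 'a) tens) \<Rightarrow> ('k, 'a) tens" where
 "Scomp r n k z = finsum (TA (Suc k) (int n - int k))
   (\<lambda>i. dq XA r i (k + i) (int (n + 1) - int (k + i)) (z (n + 1) (k + i))) {..n + 1 - k}"

lemma Tot_proj:
 assumes "int n \<le> N" "k \<le> n"
 shows "lin_on K (Tot XA N) (TA (Suc k) (int n - int k)) (\<lambda>z. z n k)"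
proof -
 have "lin_on K (Tot XA N) (Xbar XA n) (\<lambda>z. z n)"
  unfolding Tot_def using assms by (intro lin_on_proj) simp
 moreover have "lin_on K (Xbar XA n) (TA (Suc k) (int n - int k)) (\<lambda>z. z k)"
  unfolding Xbar_eq using assms by (intro lin_on_proj[where M = "\<lambda>k. TA (Suc k) (int n - int k)"]) simp
 ultimately show ?thesis by (rule lin_on_comp)
qed

lemma DQ_lin':
 assumes "k \<le> n" "i \<le> n + 1 - k"
 shows "lin_on K (TA (Suc (k + i)) (int (n + 1) - int (k + i))) (TA (Suc k) (int n - int k))
   (dq XA r i (k + i) (int (n + 1) - int (k + i)))"
proof -
 have e: "k + i - i = k" "int (n + 1) - int (k + i) + int i - 1 = int n - int k" by auto
 show ?thesis using DQ_lin[ of i "k + i" "int (n + 1) - int (k + i)" r] unfolding e by simp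
qed

lemma Scomp_lin:
 assumes "int n \<le> N - 1" "k \<le> n"
 shows "lin_on K (Tot XA N) (TA (Suc k) (int n - int k)) (Scomp r n k)"
proof -
 have "lin_on K (Tot XA N) (TA (Suc k) (int n - int k))
   (\<lambda>z. dq XA r i (k + i) (int (n + 1) - int (k + i)) (z (n + 1) (k + i)))" if "i \<in> {..n + 1 - k}" for i
  using assms that by (intro lin_on_comp[OF Tot_proj DQ_lin']) auto
 then show ?thesis
  unfolding Scomp_def[abs_def] by (intro lin_on_finsum_fun[OF Tot_module T_module]) auto
qed

definition Hcomp :: "bool \<Rightarrow> nat \<Rightarrow> nat \<Rightarrow> (nat \<Rightarrow> nat \<Rightarrow> ('k, 'a) tens) \<Rightarrow> ('k, 'a) tens" where
 "Hcomp b n k z = (let M = TA (Suc k) (int n - int k); t = Tcyc XA k (int n - int k) in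
   if b then z n k \<oplus>\<^bsub>M\<^esub> sgn_mult M 1 (t (z n k)) else finsum M (\<lambda>j. (t ^^ j) (z n k)) {..k})"

lemma Hcomp_lin:
 assumes "int n \<le> N" "k \<le> n"
 shows "lin_on K (Tot XA N) (TA (Suc k) (int n - int k)) (Hcomp b n k)"
proof -
 note P = Tot_proj[OF assms]
 have "lin_on K (Tot XA N) (TA (Suc k) (int n - int k)) (\<lambda>z. z n k \<oplus>\<^bsub>TA (Suc k) (int n - int k)\<^esub> sgn_mult (TA (Suc k) (int n - int k)) 1 (Tcyc XA k (int n - int k) (z n k)))"
  by (intro lin_on_add_fun[OF Tot_module T_module] lin_on_sgn_mult_fun[OF T_module] P lin_on_comp[OF P TC_lin])
 moreover have "lin_on K (Tot XA N) (TA (Suc k) (int n - int k)) (\<lambda>z. finsum (TA (Suc k) (int n - int k)) (\<lambda>j. (Tcyc XA k (int n - int k) ^^ j) (z n k)) {..k})"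
  by (intro lin_on_finsum_fun[OF Tot_module T_module] lin_on_comp[OF P TC_pow_lin])
 ultimately show ?thesis by (cases b) (simp_all add: Hcomp_def[abs_def] Let_def)
qed

lemma totD_comp:
 assumes z: "z \<in> carrier (Tot XA N)" and nk: "int n \<le> N - 1" "k \<le> n"
 shows "totD XA N z n k = Hcomp (odd (N - int n)) n k z \<oplus>\<^bsub>TA (Suc k) (int n - int k)\<^esub>
   (if even (N - 1 - int n) then Scomp 0 n k z else sgn_mult (TA (Suc k) (int n - int k)) 1 (Scomp 1 n k z))"
proof -
 have zc: "z n k \<in> carrier (TA (Suc k) (int n - int k))" if "int n \<le> N" "k \<le> n" for n k
  by (rule lin_onD(1)[OF Tot_proj[OF that] z])
 have Tb: "Tbar XA n (z n) \<in> carrier (Xbar XA n)"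
  unfolding Tbar_def Xbar_eq using zc nk by (auto intro!: lin_onD(1)[OF TC_lin])
 have B: "bq XA r n (z (n + 1)) = (\<lambda>k\<in>{..n}. Scomp r n k z)" for r
  by (simp add: bq_def Scomp_def xmod_eq)
 have Bc: "(\<lambda>k\<in>{..n}. Scomp r n k z) \<in> carrier (Xbar XA n)" for r
  unfolding Xbar_eq using nk by (auto intro!: lin_onD(1)[OF Scomp_lin z])
 have um: "(\<ominus>\<^bsub>Xbar XA n\<^esub> x) k = sgn_mult (TA (Suc k) (int n - int k)) 1 (x k)" if "x \<in> carrier (Xbar XA n)" for x
  using dsum_uminus[OF K T_module that[unfolded Xbar_eq]] nk unfolding Xbar_eq by (simp add: sgn_mult_one)
 have "D1 XA n (N - int n) (z n) k = Hcomp (odd (N - int n)) n k z"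
  using nk um[OF Tb] by (auto simp: D1_def a_minus_def Hcomp_def Let_def Xbar_eq Tbar_def Nbar_def xmod_eq)
 moreover have "D2 XA n (N - 1 - int n) (z (n + 1)) k = (if even (N - 1 - int n) then Scomp 0 n k z else sgn_mult (TA (Suc k) (int n - int k)) 1 (Scomp 1 n k z))"
  unfolding D2_def B using nk um[OF Bc] by simp
 ultimately show ?thesis
  using nk by (simp add: totD_def Xbar_eq)
qed

lemma totD_lin: "lin_on K (Tot XA N) (Tot XA (N - 1)) (totD XA N)"
proof -
 have "lin_on K (Tot XA N) (Xbar XA n) (\<lambda>z. totD XA N z n)" if n: "int n \<le> N - 1" for n
  unfolding Xbar_eq
 proof (rule lin_on_dsum)
  fix k assume "k \<in> {..n}"
  then have k: "k \<le> n" by simp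
  have "int n \<le> N" using n by simp
  have "lin_on K (Tot XA N) (TA (Suc k) (int n - int k)) (\<lambda>z. Hcomp (odd (N - int n)) n k z \<oplus>\<^bsub>TA (Suc k) (int n - int k)\<^esub>
   (if even (N - 1 - int n) then Scomp 0 n k z else sgn_mult (TA (Suc k) (int n - int k)) 1 (Scomp 1 n k z)))"
   using Scomp_lin[OF n k] lin_on_sgn_mult_fun[OF T_module Scomp_lin[OF n k]]
   by (intro lin_on_add_fun[OF Tot_module T_module Hcomp_lin[OF \<open>int n \<le> N\<close> k]]) (cases "even (N - 1 - int n)"; simp only: if_True if_False)
  then show "lin_on K (Tot XA N) (TA (Suc k) (int n - int k)) (\<lambda>z. totD XA N z n k)"
   by (rule lin_on_congI[OF Tot_module]) (rule totD_comp[OF _ n k])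
 next
  fix z show "totD XA N z n \<in> extensional {..n}"
   using n by (simp add: totD_def Xbar_eq)
 qed
 then show ?thesis
  unfolding Tot_def[of XA "N - 1"] by (intro lin_on_dsum) (auto simp: totD_def)
qed

lemma EV_zero_subgrp: "subgrp {x. EA m n p x = \<zero>\<^bsub>TA n p\<^esub>}"
proof -
 interpret module K "TA n p" by (rule T_module)
 show ?thesis
  by unfold_locales (auto simp: fhom_zero[OF T_module EVh] fhom_diff[OF T_module EVh] minus_eq)
qed

lemma bpart_EV0:
 assumes w: "w \<in> lists (Vl (amod A))" and j: "j < length w" "length w - j \<noteq> Suc k"
 shows "EA m (Suc k) p (bpart r w (\<lambda>u. frag_of (m, u)) j) = \<zero>\<^bsub>TA (Suc k) p\<^esub>"
proof -
 define S where "S = {x. EA m (Suc k) p x = \<zero>\<^bsub>TA (Suc k) p\<^esub>}"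
 have S: "subgrp S" unfolding S_def by (rule EV_zero_subgrp)
 have of: "frag_of (m, u) \<in> S" if "length u \<noteq> Suc k" for u
  using that by (simp add: S_def EVof0 words_iff)
 have "bpart r w (\<lambda>u. frag_of (m, u)) j \<in> S"
  unfolding bpart_def
  using j by (intro subgrp.add[OF S] subgrp_sum[OF S] subgrp.sgx[OF S] of) (auto simp: rot_def intro!: subgrp_sum[OF S] subgrp.sgx[OF S] of subgrp.zero[OF S])
 then show ?thesis by (simp only: S_def mem_Collect_eq)
qed

text \<open>On the left only the summand i with k + i + 1 = \<open>length w\<close> survives, on the
  right only the part of b or b' that removes i letters; the claim then is
  \<open>DQ_frag\<close>.\<close>

lemma Scomp_frag:
 assumes w: "w \<in> lists (Vl (amod A))" "int m + wd w - 1 = N" and nk: "int n \<le> N - 1" "k \<le> n" and r: "r \<in> {0, 1}"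
  and m: "m = nat N - 1 - n"
 shows "Scomp r n k (tot K A N (frag_of (m, w))) =
   EA m (Suc k) (int n - int k) (if r = 0 then bs (mlet K A) w (\<lambda>u. frag_of (m, u)) else Bs (mlet K A) w (\<lambda>u. frag_of (m, u)))"
proof -
 let ?T = "TA (Suc k) (int n - int k)" and ?\<phi> = "\<lambda>u. frag_of (m, u)"
 interpret module K ?T by (rule T_module)
 have s1: "finsum ?T f {i} = f i" if "f i \<in> carrier ?T" for f and i :: nat
  using that by simp
 have wd: "wd w = int n + 2" using w(2) m nk by (simp add: of_nat_diff)
 let ?E = "\<lambda>l. EA m (Suc l) (int (n + 1) - int l) (frag_of (m, w))"
 have S: "Scomp r n k (tot K A N (frag_of (m, w))) = finsum ?T (\<lambda>i. dq XA r i (k + i) (int (n + 1) - int (k + i)) (?E (k + i))) {..n + 1 - k}"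
  unfolding Scomp_def
 proof (intro finsum_cong' refl)
  show "(\<lambda>i. dq XA r i (k + i) (int (n + 1) - int (k + i)) (?E (k + i))) \<in> {..n + 1 - k} \<rightarrow> carrier ?T"
   using nk by (intro Pi_I lin_onD(1)[OF DQ_lin'] fhomD(1)[OF EVh]) auto
  fix i assume "i \<in> {..n + 1 - k}"
  then have "k + i \<le> n + 1" using nk by auto
  then have "tot K A N (frag_of (m, w)) (n + 1) (k + i) = ?E (k + i)"
   using nk m by (simp add: tot_def)
  then show "dq XA r i (k + i) (int (n + 1) - int (k + i)) (tot K A N (frag_of (m, w)) (n + 1) (k + i)) = dq XA r i (k + i) (int (n + 1) - int (k + i)) (?E (k + i))"
   by (rule arg_cong)
 qed
 have R: "(if r = 0 then bs (mlet K A) w ?\<phi> else Bs (mlet K A) w ?\<phi>) = (\<Sum>j<length w. bpart r w ?\<phi> j)"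
  using r bpart_sum[ of w ?\<phi>] by auto
 have z: "dq XA r i (k + i) (int (n + 1) - int (k + i)) (?E (k + i)) = \<zero>\<^bsub>?T\<^esub>" if "i \<in> {..n + 1 - k}" "length w \<noteq> Suc (k + i)" for i
 proof -
  have "?E (k + i) = \<zero>\<^bsub>TA (Suc (k + i)) (int (n + 1) - int (k + i))\<^esub>" using that by (intro EVof0) (auto simp: words_iff)
  then show ?thesis using that nk lin_on_zero[OF T_module T_module DQ_lin'[of k n i r]] by simp
 qed
 have z': "EA m (Suc k) (int n - int k) (bpart r w ?\<phi> j) = \<zero>\<^bsub>?T\<^esub>" if "j < length w" "length w \<noteq> Suc (k + j)" for j
  using that w(1) by (intro bpart_EV0) auto
 show ?thesis
 proof (cases "length w \<ge> Suc k")
  case False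
  have "EA m (Suc k) (int n - int k) (\<Sum>j<length w. bpart r w ?\<phi> j) = \<zero>\<^bsub>?T\<^esub>"
   using False by (intro EV_sum0 z') auto
  moreover have "finsum ?T (\<lambda>i. dq XA r i (k + i) (int (n + 1) - int (k + i)) (?E (k + i))) {..n + 1 - k} = \<zero>\<^bsub>?T\<^esub>"
   using False z by (intro add.finprod_one_eqI) auto
  ultimately show ?thesis unfolding S R by simp
 next
  case True
  define i where "i = length w - Suc k"
  have lw: "length w = Suc (k + i)" using True by (simp add: i_def)
  have ww: "w \<in> words (amod A) (Suc (k + i)) (int (n + 1) - int (k + i))"
   using w wd lw by (simp add: words_iff wd_def)
  have DQ: "dq XA r i (k + i) (int (n + 1) - int (k + i)) (?E (k + i)) = EA m (Suc k) (int n - int k) (bpart r w ?\<phi> i)"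
   using DQ_frag[OF ww _ r, of i m] by (simp add: algebra_simps)
  have "EA m (Suc k) (int n - int k) (\<Sum>j<length w. bpart r w ?\<phi> j)
    = finsum ?T (\<lambda>j. EA m (Suc k) (int n - int k) (bpart r w ?\<phi> j)) {..<length w}"
   by (rule fhom_sum[OF T_module EVh])
  also have "\<dots> = finsum ?T (\<lambda>j. EA m (Suc k) (int n - int k) (bpart r w ?\<phi> j)) {i}"
  proof (rule add.finprod_mono_neutral_cong_right)
   show "(\<lambda>j. EA m (Suc k) (int n - int k) (bpart r w ?\<phi> j)) \<in> {..<length w} \<rightarrow> carrier ?T"
    by (intro Pi_I fhomD(1)[OF EVh])
  qed (use lw z' in auto)
  also have "\<dots> = EA m (Suc k) (int n - int k) (bpart r w ?\<phi> i)"
   by (simp add: fhomD(1)[OF EVh])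
  finally have Rz: "EA m (Suc k) (int n - int k) (\<Sum>j<length w. bpart r w ?\<phi> j) = EA m (Suc k) (int n - int k) (bpart r w ?\<phi> i)" .
  show ?thesis
  proof (cases "i \<le> n + 1 - k")
   case i: True
   have c: "(\<lambda>i. dq XA r i (k + i) (int (n + 1) - int (k + i)) (?E (k + i))) \<in> {..n + 1 - k} \<rightarrow> carrier ?T"
    using nk by (intro Pi_I lin_onD(1)[OF DQ_lin'] fhomD(1)[OF EVh]) auto
   have "finsum ?T (\<lambda>i. dq XA r i (k + i) (int (n + 1) - int (k + i)) (?E (k + i))) {..n + 1 - k}
    = finsum ?T (\<lambda>i. dq XA r i (k + i) (int (n + 1) - int (k + i)) (?E (k + i))) {i}"
    by (rule add.finprod_mono_neutral_cong_right) (use lw z c i in auto)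
   also have "\<dots> = EA m (Suc k) (int n - int k) (bpart r w ?\<phi> i)"
    by (subst s1) (simp_all only: DQ fhomD(1)[OF EVh])
   finally show ?thesis unfolding S R Rz .
  next
   case False
   \<comment> \<open>The surviving index lies outside the range of summation. The tensor power
     containing the word then has negative degree, so both sides are zero.\<close>
   have "int (n + 1) - int (k + i) < 0" using False nk by simp
   then have "?E (k + i) = \<zero>\<^bsub>TA (Suc (k + i)) (int (n + 1) - int (k + i))\<^esub>"
    using TA_neg fhomD(1)[OF EVh] by (metis singletonD zero_less_Suc)
   moreover have "lin_on K (TA (Suc (k + i)) (int (n + 1) - int (k + i))) (TA (Suc (k + i - i)) (int (n + 1) - int (k + i) + int i - 1)) (dq XA r i (k + i) (int (n + 1) - int (k + i)))"
    by (rule DQ_lin) simp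
   ultimately have "dq XA r i (k + i) (int (n + 1) - int (k + i)) (?E (k + i)) = \<zero>\<^bsub>?T\<^esub>"
    using lin_on_zero[OF T_module T_module] by (fastforce simp: algebra_simps)
   moreover have "finsum ?T (\<lambda>i. dq XA r i (k + i) (int (n + 1) - int (k + i)) (?E (k + i))) {..n + 1 - k} = \<zero>\<^bsub>?T\<^esub>"
    using False lw z by (intro add.finprod_one_eqI) auto
   ultimately show ?thesis unfolding S R Rz using DQ by simp
  qed
 qed
qed

lemma Hcomp_frag:
 assumes w: "w \<in> lists (Vl (amod A))" and nk: "int n \<le> N - 1" "k \<le> n" and m: "m = nat N - 1 - n"
 shows "Hcomp b n k (tot K A N (frag_of (m', w))) = EA m (Suc k) (int n - int k)
  (if m' = Suc m then (if b then frag_of (m, w) - Ts w (\<lambda>u. frag_of (m, u)) else Ns w (\<lambda>u. frag_of (m, u))) else 0)"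
proof -
 let ?p = "int n - int k"
 let ?T = "TA (Suc k) ?p" and ?\<phi> = "\<lambda>u. frag_of (m, u)"
 interpret module K ?T by (rule T_module)
 have t: "tot K A N (frag_of (m', w)) n k = EA (Suc m) (Suc k) ?p (frag_of (m', w))"
  using nk m by (simp add: tot_def Suc_diff_Suc)
 show ?thesis
 proof (cases "m' = Suc m \<and> w \<in> words (amod A) (Suc k) ?p")
  case True
  then have e: "EA (Suc m) (Suc k) ?p (frag_of (m', w)) = EA m (Suc k) ?p (frag_of (m, w))"
   by (simp add: EVof)
  show ?thesis
   unfolding Hcomp_def Let_def t e
   using True TC_frag[ of w k ?p m] Nbar_frag[ of w k ?p m]
   by (simp add: fhom_diff[OF T_module EVh] minus_eq sgn_mult_one)
 next
  case False
  then have z: "EA (Suc m) (Suc k) ?p (frag_of (m', w)) = \<zero>\<^bsub>?T\<^esub>" by (intro EVof0) auto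
  have H0: "Hcomp b n k (tot K A N (frag_of (m', w))) = \<zero>\<^bsub>?T\<^esub>"
   using lin_on_zero[OF T_module T_module TC_lin] lin_on_zero[OF T_module T_module TC_pow_lin]
   by (simp add: Hcomp_def Let_def t z sgn_mult_one)
  define S where "S = {x. EA m (Suc k) ?p x = \<zero>\<^bsub>?T\<^esub>}"
  have S: "subgrp S" unfolding S_def by (rule EV_zero_subgrp)
  have "(if m' = Suc m then (if b then frag_of (m, w) - Ts w ?\<phi> else Ns w ?\<phi>) else 0) \<in> S"
  proof (cases "m' = Suc m")
   case True
   then have "frag_of (m, u) \<in> S" if "length u = length w" "wdeg u = wdeg w" for u
    using False w that by (auto simp: S_def words_iff intro!: EVof0)
   then show ?thesis using True by (auto intro!: subgrp.diff[OF S] Ts_mem[OF S w] Ns_mem[OF S w])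
  qed (simp add: subgrp.zero[OF S])
  then show ?thesis unfolding H0 by (simp only: S_def mem_Collect_eq)
 qed
qed

lemma totD_frag:
 assumes w: "w \<in> lists (Vl (amod A))" "int m' + wd w - 1 = N" and nk: "int n \<le> N - 1" "k \<le> n"
 shows "totD XA N (tot K A N (frag_of (m', w))) n k = EA (nat (N - 1) - n) (Suc k) (int n - int k) (Dk K A (m', w))"
proof -
 define m where "m = nat N - 1 - n"
 let ?p = "int n - int k"
 let ?T = "TA (Suc k) ?p" and ?z = "tot K A N (frag_of (m', w))"
 interpret module K ?T by (rule T_module)
 have m: "nat (N - 1) - n = m" "N - int n = int (Suc m)" "N - 1 - int n = int m" using nk by (auto simp: m_def nat_diff_distrib)
 define h where "h = (if m' = Suc m then (if odd (Suc m) then frag_of (m, w) - Ts w (\<lambda>u. frag_of (m, u)) else Ns w (\<lambda>u. frag_of (m, u))) else 0)"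
 define v where "v = (if even m' then bs (mlet K A) w (\<lambda>u. frag_of (m', u)) else - Bs (mlet K A) w (\<lambda>u. frag_of (m', u)))"
 define h' where "h' = (if m' = 0 then 0 else if even m' then Ns w (\<lambda>u. frag_of (m' - 1, u)) else frag_of (m' - 1, w) - Ts w (\<lambda>u. frag_of (m' - 1, u)))"
 have Dk: "Dk K A (m', w) = v + h'" by (simp add: Dk_def v_def h'_def)
 define S where "S = {x. EA m (Suc k) ?p x = \<zero>\<^bsub>?T\<^esub>}"
 have S: "subgrp S" unfolding S_def by (rule EV_zero_subgrp)
 have Sof: "frag_of (m'', u) \<in> S" if "m'' \<noteq> m" for m'' u
  using that by (auto simp: S_def intro!: EVof0)
 have V: "(if even m then Scomp 0 n k ?z else sgn_mult ?T 1 (Scomp 1 n k ?z)) = EA m (Suc k) ?p v"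
 proof (cases "m' = m")
  case True
  have Sc: "Scomp r n k ?z = EA m (Suc k) ?p (if r = 0 then bs (mlet K A) w (\<lambda>u. frag_of (m, u)) else Bs (mlet K A) w (\<lambda>u. frag_of (m, u)))"
   if "r \<in> {0, 1}" for r
   unfolding True using w(2) True by (intro Scomp_frag[OF w(1) _ nk that m_def]) simp
  show ?thesis using Sc[of 0] Sc[of 1] by (simp add: v_def True sgn_mult_one fhom_minus[OF T_module EVh])
 next
  case False
  interpret m_degree "mlet K A" by (rule slet_m_degree)
  have mV: "\<And>y. y \<in> lists (Vl (amod A)) \<Longrightarrow> y \<noteq> [] \<Longrightarrow> mlet K A y \<in> Vl (amod A)" by (rule mlet_V)
  have "v \<in> S"
   unfolding v_def using False by (auto intro!: subgrp.minus[OF S] bs_mem[OF S mV w(1)] Bs_mem[OF S mV w(1)] Sof)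
  then have "EA m (Suc k) ?p v = \<zero>\<^bsub>?T\<^esub>" by (simp only: S_def mem_Collect_eq)
  moreover have "Scomp r n k ?z = \<zero>\<^bsub>?T\<^esub>" for r
   unfolding Scomp_def
  proof (rule add.finprod_one_eqI)
   fix i assume i: "i \<in> {..n + 1 - k}"
   then have "k + i \<le> n + 1" using nk by auto
   then have "?z (n + 1) (k + i) = EA m (Suc (k + i)) (int (n + 1) - int (k + i)) (frag_of (m', w))"
    using nk by (simp add: tot_def m_def)
   also have "\<dots> = \<zero>\<^bsub>TA (Suc (k + i)) (int (n + 1) - int (k + i))\<^esub>" using False by (intro EVof0) auto
   finally show "dq XA r i (k + i) (int (n + 1) - int (k + i)) (?z (n + 1) (k + i)) = \<zero>\<^bsub>?T\<^esub>"
    using lin_on_zero[OF T_module T_module DQ_lin'[of k n i r]] nk i by simp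
  qed
  ultimately show ?thesis by (simp add: sgn_mult_one)
 qed
 have H: "EA m (Suc k) ?p h = EA m (Suc k) ?p h'"
 proof (cases "m' = Suc m")
  case True
  then show ?thesis by (simp add: h_def h'_def)
 next
  case False
  have "h' \<in> S"
   unfolding h'_def using False by (auto intro!: subgrp.zero[OF S] subgrp.diff[OF S] Ns_mem[OF S w(1)] Ts_mem[OF S w(1)] Sof)
  then have "EA m (Suc k) ?p h' = \<zero>\<^bsub>?T\<^esub>" by (simp only: S_def mem_Collect_eq)
  then show ?thesis using False by (simp add: h_def fhom_zero[OF T_module EVh])
 qed
 have "totD XA N ?z n k = Hcomp (odd (Suc m)) n k ?z \<oplus>\<^bsub>?T\<^esub> (if even m then Scomp 0 n k ?z else sgn_mult ?T 1 (Scomp 1 n k ?z))"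
  unfolding totD_comp[OF fhomD(1)[OF tot_fhom] nk] m(2,3) by simp
 also have "\<dots> = EA m (Suc k) ?p h \<oplus>\<^bsub>?T\<^esub> EA m (Suc k) ?p v"
  unfolding V Hcomp_frag[OF w(1) nk m_def] h_def ..
 also have "\<dots> = EA m (Suc k) ?p (v + h')"
  unfolding H by (simp add: fhomD[OF EVh] a_comm)
 finally show ?thesis unfolding Dk m(1) .
qed

lemma totD_tot:
 assumes x: "x \<in> FN (amod A) N"
 shows "totD XA N (tot K A N x) = tot K A (N - 1) (frag_extend (Dk K A) x)"
proof -
 let ?DA = "frag_extend (Dk K A)"
 have a: "totD XA N (tot K A N x) \<in> carrier (Tot XA (N - 1))"
  by (rule lin_onD(1)[OF totD_lin fhomD(1)[OF tot_fhom]])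
 have b: "tot K A (N - 1) (?DA x) \<in> carrier (Tot XA (N - 1))"
  by (rule fhomD(1)[OF tot_fhom])
 show ?thesis
 proof (rule PiE_ext[OF a[unfolded Tot_carrier] b[unfolded Tot_carrier]])
  fix n assume n: "n \<in> {n. int n \<le> N - 1}"
  show "totD XA N (tot K A N x) n = tot K A (N - 1) (?DA x) n"
  proof (rule PiE_ext[OF PiE_mem[OF a[unfolded Tot_carrier] n] PiE_mem[OF b[unfolded Tot_carrier] n]])
   fix k assume k: "k \<in> {..n}"
   have nk: "int n \<le> N - 1" "k \<le> n" using n k by auto
   let ?T = "TA (Suc k) (int n - int k)"
   have "totD XA N (tot K A N x) n k = EA (nat (N - 1) - n) (Suc k) (int n - int k) (?DA x)"
   proof (rule fhom_ext[where h = "\<lambda>x. totD XA N (tot K A N x) n k" and h' = "\<lambda>x. EA (nat (N - 1) - n) (Suc k) (int n - int k) (?DA x)", OF T_module])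
    show "fhom ?T (\<lambda>x. totD XA N (tot K A N x) n k)"
     by (rule fhom_lin[OF fhom_lin[OF tot_fhom totD_lin] Tot_proj[OF nk]])
    show "fhom ?T (\<lambda>x. EA (nat (N - 1) - n) (Suc k) (int n - int k) (?DA x))"
     by (rule fhom_frag_extend[OF T_module EVh])
    show "Poly_Mapping.keys x \<subseteq> vk (amod A) N" using x by (simp add: FN_def)
    fix s assume "s \<in> vk (amod A) N"
    then show "totD XA N (tot K A N (frag_of s)) n k = EA (nat (N - 1) - n) (Suc k) (int n - int k) (?DA (frag_of s))"
     using nk by (cases s) (simp add: vk_def totD_frag)
   qed
   then show "totD XA N (tot K A N x) n k = tot K A (N - 1) (?DA x) n k"
    using nk by (simp add: tot_def)
  qed
 qed
qed

section \<open>Cyclic homology in terms of formal sums\<close>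

text \<open>Instead of inspecting multilinear relations, the argument passes through the total
  complex: \<open>tot\<close> identifies \<open>Ker\<close> with the zero chain, and
  \<open>totD\<close> is linear.\<close>

lemma Dk_Ker:
 assumes "x \<in> FN (amod A) N" "x \<in> Ker K (amod A)"
 shows "frag_extend (Dk K A) x \<in> Ker K (amod A)"
proof -
 have "tot K A N x = \<zero>\<^bsub>Tot XA N\<^esub>" using assms tot_zero_iff by blast
 then have "tot K A (N - 1) (frag_extend (Dk K A) x) = \<zero>\<^bsub>Tot XA (N - 1)\<^esub>"
  using totD_tot[OF assms(1)] lin_on_zero[OF Tot_module Tot_module totD_lin] by simp
 then show ?thesis using tot_zero_iff Dk_FN[OF assms(1)] by blast
qed

definition cyc where "cyc N = {x \<in> FN (amod A) N. frag_extend (Dk K A) x \<in> Ker K (amod A)}"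

definition cl where "cl N x = hclass XA N (tot K A N x)"

lemma cycles_iff: "x \<in> FN (amod A) N \<Longrightarrow> tot K A N x \<in> cycles XA N \<longleftrightarrow> x \<in> cyc N"
 using tot_zero_iff[OF Dk_FN] fhomD(1)[OF tot_fhom] by (auto simp: cycles_def cyc_def totD_tot)

lemma boundaries_iff: "x \<in> FN (amod A) N \<Longrightarrow> tot K A N x \<in> boundaries XA N \<longleftrightarrow> (\<exists>u\<in>FN (amod A) (N + 1). x - frag_extend (Dk K A) u \<in> Ker K (amod A))"
proof -
 let ?DA = "frag_extend (Dk K A)" and ?A = "amod A"
 assume x: "x \<in> FN ?A N"
 interpret module K "Tot XA N" by (rule Tot_module)
 have "boundaries XA N = (\<lambda>u. tot K A N (?DA u)) ` FN ?A (N + 1)"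
 proof -
  have "carrier (Tot XA (N + 1)) = tot K A (N + 1) ` FN ?A (N + 1)"
   using tot_surj fhomD(1)[OF tot_fhom] by blast
  then show ?thesis using totD_tot[of _ "N + 1"] by (simp add: boundaries_def image_image)
 qed
 moreover have "tot K A N x = tot K A N (?DA u) \<longleftrightarrow> x - ?DA u \<in> Ker K ?A" if "u \<in> FN ?A (N + 1)" for u
 proof -
  have D: "?DA u \<in> FN ?A N" using Dk_FN[OF that] by simp
  have "x - ?DA u \<in> Ker K ?A \<longleftrightarrow> tot K A N x \<ominus>\<^bsub>Tot XA N\<^esub> tot K A N (?DA u) = \<zero>\<^bsub>Tot XA N\<^esub>"
   using tot_zero_iff[OF subgrp.diff[OF FN_subgrp x D]] by (simp add: fhom_diff[OF Tot_module tot_fhom])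
  then show ?thesis using minus_zero_iff[OF Tot_module fhomD(1)[OF tot_fhom] fhomD(1)[OF tot_fhom]] by simp
 qed
 ultimately show "tot K A N x \<in> boundaries XA N \<longleftrightarrow> (\<exists>u\<in>FN ?A (N + 1). x - ?DA u \<in> Ker K ?A)"
  by auto
qed

lemma cycles_submodule: "submodule (cycles XA N) K (Tot XA N)"
proof -
 interpret module K "Tot XA N" by (rule Tot_module)
 interpret M': module K "Tot XA (N - 1)" by (rule Tot_module)
 note lin = lin_onD[OF totD_lin] lin_on_zero[OF Tot_module Tot_module totD_lin] lin_on_minus[OF Tot_module Tot_module totD_lin]
 show ?thesis
  by (rule submoduleI) (simp_all add: cycles_def lin subset_iff)
qed

lemma Ker_S: "subgrp (Ker K (amod A))"
 by (rule Ker_subgrp[where A = "amod A", OF K mA])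

lemma CY_module: "module K (CY N)"
 by (rule submodule.submodule_is_module[OF cycles_submodule Tot_module])

lemma boundaries_cycles: "boundaries XA N \<subseteq> cycles XA N"
proof
 let ?DA = "frag_extend (Dk K A)"
 fix b assume "b \<in> boundaries XA N"
 then obtain u where u: "u \<in> FN (amod A) (N + 1)" "b = totD XA (N + 1) (tot K A (N + 1) u)"
  unfolding boundaries_def using tot_surj by blast
 have D: "?DA u \<in> FN (amod A) N" using Dk_FN[OF u(1)] by simp
 have "b = tot K A N (?DA u)" using totD_tot[OF u(1)] u(2) by simp
 moreover have "?DA u \<in> cyc N"
  using D Dk_Dk[OF u(1)] by (simp add: cyc_def)
 ultimately show "b \<in> cycles XA N" using cycles_iff[OF D] by simp
qed

text \<open>Negation is defined through the carrier of the record, so for the submodule of cycles it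
  has to be identified with that of the ambient module.\<close>

lemma CY_uminus: "z \<in> cycles XA N \<Longrightarrow> \<ominus>\<^bsub>CY N\<^esub> z = \<ominus>\<^bsub>Tot XA N\<^esub> z"
proof -
 assume z: "z \<in> cycles XA N"
 interpret M: module K "Tot XA N" by (rule Tot_module)
 interpret C: module K "CY N" by (rule CY_module)
 have zc: "z \<in> carrier (Tot XA N)" using z by (simp add: cycles_def)
 have "\<ominus>\<^bsub>Tot XA N\<^esub> z \<in> cycles XA N"
  using M.submoduleE(3)[OF cycles_submodule z] .
 then show "\<ominus>\<^bsub>CY N\<^esub> z = \<ominus>\<^bsub>Tot XA N\<^esub> z"
  using z zc by (intro C.minus_equality) (auto simp: M.l_neg)
qed

lemma boundaries_submodule: "submodule (boundaries XA N) K (CY N)"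
proof -
 interpret M: module K "Tot XA N" by (rule Tot_module)
 interpret M1: module K "Tot XA (N + 1)" by (rule Tot_module)
 interpret C: module K "CY N" by (rule CY_module)
 have lin': "lin_on K (Tot XA (N + 1)) (Tot XA N) (totD XA (N + 1))" using totD_lin[of "N + 1"] by simp
 note lin = lin_onD(2,3)[OF lin', symmetric] lin_on_minus[OF Tot_module Tot_module lin', symmetric]
 have 0: "totD XA (N + 1) \<zero>\<^bsub>Tot XA (N + 1)\<^esub> = \<zero>\<^bsub>Tot XA N\<^esub>" by (rule lin_on_zero[OF Tot_module Tot_module lin'])
 show ?thesis
 proof (rule C.submoduleI)
  show "boundaries XA N \<subseteq> carrier (CY N)" using boundaries_cycles by simp
  show "\<zero>\<^bsub>CY N\<^esub> \<in> boundaries XA N" unfolding boundaries_def using 0 by force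
 next
  fix a assume "a \<in> boundaries XA N"
  moreover from this have "\<ominus>\<^bsub>CY N\<^esub> a = \<ominus>\<^bsub>Tot XA N\<^esub> a" using boundaries_cycles by (intro CY_uminus) blast
  ultimately show "\<ominus>\<^bsub>CY N\<^esub> a \<in> boundaries XA N"
   unfolding boundaries_def by (auto simp: lin)
 qed (auto simp: boundaries_def lin)
qed

lemma hclass_CY: "hclass XA N z = boundaries XA N +>\<^bsub>CY N\<^esub> z"
 by (simp add: hclass_def a_r_coset_def r_coset_def)

lemma HC_eq: "HC K A N = quot_module (CY N) (boundaries XA N)"
 by (simp add: HC_def cf_HC_def)

lemma HC_module: "module K (HC K A N)"
 unfolding HC_eq by (rule quot_module_module[OF CY_module boundaries_submodule])

lemma tot_cyc: "x \<in> cyc N \<Longrightarrow> tot K A N x \<in> carrier (CY N)"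
 using cycles_iff by (simp add: cyc_def)

lemma HC_carrier: "X \<in> carrier (HC K A N) \<longleftrightarrow> (\<exists>x\<in>cyc N. X = cl N x)"
proof -
 have "cycles XA N = tot K A N ` cyc N"
  using tot_surj cycles_iff by (force simp: cycles_def cyc_def)
 then show ?thesis
  unfolding HC_eq quot_carrier_iff[OF CY_module boundaries_submodule] by (auto simp: cl_def hclass_CY)
qed

lemma cl_eq:
 assumes "x \<in> cyc N" "y \<in> cyc N"
 shows "cl N x = cl N y \<longleftrightarrow> (\<exists>u\<in>FN (amod A) (N + 1). x - y - frag_extend (Dk K A) u \<in> Ker K (amod A))"
proof -
 have xy: "x - y \<in> FN (amod A) N" using assms by (auto simp: cyc_def intro: subgrp.diff[OF FN_subgrp])
 have "cl N x = cl N y \<longleftrightarrow> tot K A N x \<ominus>\<^bsub>CY N\<^esub> tot K A N y \<in> boundaries XA N"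
  unfolding cl_def hclass_CY by (rule quot_eq_iff[OF CY_module boundaries_submodule tot_cyc[OF assms(1)] tot_cyc[OF assms(2)]])
 also have "tot K A N x \<ominus>\<^bsub>CY N\<^esub> tot K A N y = tot K A N (x - y)"
  using CY_uminus[of "tot K A N y" N] tot_cyc[OF assms(2)] by (simp add: a_minus_def fhom_diff[OF Tot_module tot_fhom])
 finally show ?thesis using boundaries_iff[OF xy] by simp
qed

lemma cl_add: "x \<in> cyc N \<Longrightarrow> y \<in> cyc N \<Longrightarrow> cl N (x + y) = cl N x \<oplus>\<^bsub>HC K A N\<^esub> cl N y"
 unfolding cl_def hclass_CY HC_eq
 by (simp only: quot_add[OF CY_module boundaries_submodule tot_cyc tot_cyc] fhomD(2)[OF tot_fhom]) simp

lemma sck_cyc: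
 assumes c: "c \<in> carrier K" and x: "x \<in> cyc N"
 shows "frag_extend (sck A c) x \<in> cyc N"
proof -
 have xF: "x \<in> FN (amod A) N" using x by (simp add: cyc_def)
 have "c \<odot>\<^bsub>Tot XA N\<^esub> tot K A N x \<in> cycles XA N"
  using submodule.smult_closed[OF cycles_submodule c] tot_cyc[OF x] by simp
 then show ?thesis
  using cycles_iff[OF sck_FN[OF c xF]] tot_smult[OF c xF] by simp
qed

lemma cl_smult:
 assumes c: "c \<in> carrier K" and x: "x \<in> cyc N"
 shows "cl N (frag_extend (sck A c) x) = c \<odot>\<^bsub>HC K A N\<^esub> cl N x"
proof -
 have xF: "x \<in> FN (amod A) N" using x by (simp add: cyc_def)
 show ?thesis
  unfolding cl_def hclass_CY HC_eq quot_smult[OF CY_module boundaries_submodule c tot_cyc[OF x]] tot_smult[OF c xF] by simp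
qed

lemma HC_graded: "graded_module K (HC K A)"
proof -
 have "carrier (HC K A N) = {\<zero>\<^bsub>HC K A N\<^esub>}" if "N < 0" for N
 proof -
  interpret module K "HC K A N" by (rule HC_module)
  \<comment> \<open>For N < 0 the index set of the total complex is empty, so there is only one
    chain.\<close>
  have "tot K A N x = tot K A N y" for x y using that by (auto simp: tot_def)
  then have "cl N x = cl N y" for x y unfolding cl_def by metis
  then have "X = Y" if "X \<in> carrier (HC K A N)" "Y \<in> carrier (HC K A N)" for X Y
   using that unfolding HC_carrier by metis
  then show ?thesis by blast
 qed
 then show ?thesis by (auto simp: graded_module_def HC_module)
qed

end

section \<open>Maps induced on homology\<close>

text \<open>The chain groups are \<open>F N\<close> modulo \<open>Kr\<close>, and \<open>c N\<close>
  sends a cycle modulo \<open>Kr\<close> to its class in \<open>M N\<close>. The map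
  \<open>sc\<close> acts on representatives and becomes the scalar multiplication of
  \<open>M N\<close>.\<close>

locale hcx =
 fixes K :: "('k, 'r) ring_scheme" and F :: "int \<Rightarrow> ('g::ab_group_add) set" and Kr :: "'g set" and D :: "'g \<Rightarrow> 'g"
  and sc :: "'k \<Rightarrow> 'g \<Rightarrow> 'g" and c :: "int \<Rightarrow> 'g \<Rightarrow> 'h" and M :: "int \<Rightarrow> ('k, 'h) module"
 assumes F: "subgrp (F N)" and Kr: "subgrp Kr" and D: "additive_fun D"
  and D_F: "x \<in> F N \<Longrightarrow> D x \<in> F (N - 1)" and D_Kr: "x \<in> F N \<Longrightarrow> x \<in> Kr \<Longrightarrow> D x \<in> Kr"
  and D_D: "x \<in> F N \<Longrightarrow> D (D x) \<in> Kr"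
  and sc_F: "e \<in> carrier K \<Longrightarrow> x \<in> F N \<Longrightarrow> sc e x \<in> F N"
  and sc_D: "e \<in> carrier K \<Longrightarrow> x \<in> F N \<Longrightarrow> D x \<in> Kr \<Longrightarrow> D (sc e x) \<in> Kr"
  and M: "module K (M N)"
  and M_carrier: "X \<in> carrier (M N) \<longleftrightarrow> (\<exists>x. x \<in> F N \<and> D x \<in> Kr \<and> X = c N x)"
  and c_eq: "x \<in> F N \<Longrightarrow> D x \<in> Kr \<Longrightarrow> y \<in> F N \<Longrightarrow> D y \<in> Kr \<Longrightarrow> c N x = c N y \<longleftrightarrow> (\<exists>u\<in>F (N + 1). x - y - D u \<in> Kr)"
  and c_add: "x \<in> F N \<Longrightarrow> D x \<in> Kr \<Longrightarrow> y \<in> F N \<Longrightarrow> D y \<in> Kr \<Longrightarrow> c N (x + y) = c N x \<oplus>\<^bsub>M N\<^esub> c N y"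
  and c_smult: "e \<in> carrier K \<Longrightarrow> x \<in> F N \<Longrightarrow> D x \<in> Kr \<Longrightarrow> c N (sc e x) = e \<odot>\<^bsub>M N\<^esub> c N x"
begin

definition Z where "Z N = {x \<in> F N. D x \<in> Kr}"

lemma D_diff: "D (x - y) = D x - D y"
 using additive_fun.add[OF D, of x "- y"] additive_fun.minus[OF D, of y] by simp

lemma Z_diff: "x \<in> Z N \<Longrightarrow> y \<in> Z N \<Longrightarrow> x - y \<in> Z N"
 by (simp add: Z_def D_diff subgrp.diff[OF F] subgrp.diff[OF Kr])

lemma Z_0: "0 \<in> Z N"
 using additive_fun.zero[OF D] by (simp add: Z_def subgrp.zero[OF F] subgrp.zero[OF Kr])

lemma Z_add: "x \<in> Z N \<Longrightarrow> y \<in> Z N \<Longrightarrow> x + y \<in> Z N"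
 using Z_diff[of x N "- y"] Z_diff[OF Z_0, of y N] by simp

lemma Z_Kr: "x \<in> F N \<Longrightarrow> x \<in> Kr \<Longrightarrow> x \<in> Z N"
 by (simp add: Z_def D_Kr)

lemma Z_D: "u \<in> F (N + 1) \<Longrightarrow> D u \<in> Z N"
 using D_F[of u "N + 1"] by (simp add: Z_def D_D)

lemma c_eq': "x \<in> Z N \<Longrightarrow> y \<in> Z N \<Longrightarrow> u \<in> F (N + 1) \<Longrightarrow> x - y - D u \<in> Kr \<Longrightarrow> c N x = c N y"
 using c_eq by (auto simp: Z_def)

lemma c_eq_Kr: "x \<in> Z N \<Longrightarrow> y \<in> Z N \<Longrightarrow> x - y \<in> Kr \<Longrightarrow> c N x = c N y"
 using c_eq'[of x N y 0] additive_fun.zero[OF D] by (simp add: subgrp.zero[OF F])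

lemma c_add': "x \<in> Z N \<Longrightarrow> y \<in> Z N \<Longrightarrow> c N (x + y) = c N x \<oplus>\<^bsub>M N\<^esub> c N y"
 by (simp add: Z_def c_add)

lemma carrierE:
 assumes "X \<in> carrier (M N)" obtains x where "x \<in> Z N" "X = c N x"
 using assms unfolding M_carrier Z_def by blast

lemma c_mem: "x \<in> Z N \<Longrightarrow> c N x \<in> carrier (M N)"
 unfolding M_carrier Z_def by blast

lemma c_zero: "c N 0 = \<zero>\<^bsub>M N\<^esub>"
proof -
 interpret module K "M N" by (rule M)
 show ?thesis using c_add'[OF Z_0 Z_0, of N] c_mem[OF Z_0, of N] add.r_cancel_one'[of "c N 0" "c N 0"] by simp
qed

lemma c_diff: "x \<in> Z N \<Longrightarrow> y \<in> Z N \<Longrightarrow> c N (x - y) = c N x \<ominus>\<^bsub>M N\<^esub> c N y"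
proof -
 assume xy: "x \<in> Z N" "y \<in> Z N"
 interpret module K "M N" by (rule M)
 have "c N x = c N (x - y) \<oplus>\<^bsub>M N\<^esub> c N y"
  using c_add'[OF Z_diff[OF xy] xy(2)] by simp
 then show ?thesis using c_mem Z_diff xy by (simp add: minus_eq a_assoc r_neg)
qed

end

text \<open>Commutation with differentials and scalars is asked only modulo \<open>KB\<close>, since
  a morphism satisfies its relations only after evaluation.\<close>

locale hcx_map = A: hcx K FA KA DA sA cA MA + B: hcx K FB KB DB sB cB MB
 for K :: "('k, 'r) ring_scheme" and FA :: "int \<Rightarrow> ('g::ab_group_add) set" and KA DA sA and cA :: "int \<Rightarrow> 'g \<Rightarrow> 'h" and MA
  and FB :: "int \<Rightarrow> ('i::ab_group_add) set" and KB DB sB and cB :: "int \<Rightarrow> 'i \<Rightarrow> 'j" and MB +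
 fixes op :: "'g \<Rightarrow> 'i"
 assumes op: "additive_fun op" and op_F: "x \<in> FA N \<Longrightarrow> op x \<in> FB N"
  and op_K: "x \<in> FA N \<Longrightarrow> x \<in> KA \<Longrightarrow> op x \<in> KB"
  and op_D: "x \<in> FA N \<Longrightarrow> op (DA x) - DB (op x) \<in> KB"
  and op_s: "e \<in> carrier K \<Longrightarrow> x \<in> FA N \<Longrightarrow> op (sA e x) - sB e (op x) \<in> KB"
begin

lemma op_diff: "op (x - y) = op x - op y"
 using additive_fun.add[OF op, of x "- y"] additive_fun.minus[OF op, of y] by simp

lemma op_Z: "x \<in> A.Z N \<Longrightarrow> op x \<in> B.Z N"
proof -
 assume x: "x \<in> A.Z N"
 have "op (DA x) \<in> KB" using x A.D_F by (auto simp: A.Z_def intro: op_K)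
 then show ?thesis
  using x op_D[of x N] subgrp.diff[OF B.Kr, of "op (DA x)" "op (DA x) - DB (op x)"] by (simp add: A.Z_def B.Z_def op_F)
qed

lemma op_c: "x \<in> A.Z N \<Longrightarrow> y \<in> A.Z N \<Longrightarrow> cA N x = cA N y \<Longrightarrow> cB N (op x) = cB N (op y)"
proof -
 assume xy: "x \<in> A.Z N" "y \<in> A.Z N" "cA N x = cA N y"
 then obtain u where u: "u \<in> FA (N + 1)" "x - y - DA u \<in> KA"
  using A.c_eq by (auto simp: A.Z_def)
 have "op (x - y - DA u) \<in> KB"
  using A.D_F[OF u(1)] xy by (intro op_K[OF _ u(2)] subgrp.diff[OF A.F]) (auto simp: A.Z_def)
 from subgrp.add[OF B.Kr this op_D[OF u(1)]] have "op x - op y - DB (op u) \<in> KB"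
  by (simp add: op_diff)
 then show ?thesis using xy u op_F by (intro B.c_eq'[OF op_Z op_Z]) auto
qed

definition imap :: "int \<Rightarrow> 'h \<Rightarrow> 'j" where
 "imap N = (\<lambda>X\<in>carrier (MA N). cB N (op (SOME x. x \<in> A.Z N \<and> cA N x = X)))"

lemma imap_c: "x \<in> A.Z N \<Longrightarrow> imap N (cA N x) = cB N (op x)"
proof -
 assume x: "x \<in> A.Z N"
 have "(SOME y. y \<in> A.Z N \<and> cA N y = cA N x) \<in> A.Z N \<and> cA N (SOME y. y \<in> A.Z N \<and> cA N y = cA N x) = cA N x"
  using x by (intro someI[of "\<lambda>y. y \<in> A.Z N \<and> cA N y = cA N x"]) simp
 then show ?thesis using x A.c_mem[OF x] by (auto simp: imap_def intro: op_c)
qed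

lemma imap_lin: "imap N \<in> lin_maps K (MA N) (MB N)"
proof -
 have "lin_on K (MA N) (MB N) (imap N)"
 proof (rule lin_onI)
  fix X assume X: "X \<in> carrier (MA N)"
  obtain x where x: "x \<in> A.Z N" "X = cA N x" by (rule A.carrierE[OF X])
  show "imap N X \<in> carrier (MB N)"
   using x by (simp add: imap_c B.c_mem op_Z)
  show "imap N (e \<odot>\<^bsub>MA N\<^esub> X) = e \<odot>\<^bsub>MB N\<^esub> imap N X" if e: "e \<in> carrier K" for e
  proof -
   have s: "sA e x \<in> A.Z N" "sB e (op x) \<in> B.Z N"
    using x(1) op_Z[OF x(1)] e A.sc_F A.sc_D B.sc_F B.sc_D by (auto simp: A.Z_def B.Z_def)
   have "e \<odot>\<^bsub>MA N\<^esub> X = cA N (sA e x)" using x e A.c_smult by (simp add: A.Z_def)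
   then have "imap N (e \<odot>\<^bsub>MA N\<^esub> X) = cB N (op (sA e x))" using imap_c[OF s(1)] by simp
   also have "\<dots> = cB N (sB e (op x))"
    using s op_Z[OF s(1)] op_s[OF e] x by (intro B.c_eq_Kr) (auto simp: A.Z_def)
   also have "\<dots> = e \<odot>\<^bsub>MB N\<^esub> imap N X"
    using B.c_smult[OF e] op_Z[OF x(1)] by (simp add: x imap_c B.Z_def)
   finally show ?thesis .
  qed
  fix Y assume Y: "Y \<in> carrier (MA N)"
  obtain y where y: "y \<in> A.Z N" "Y = cA N y" by (rule A.carrierE[OF Y])
  have "X \<oplus>\<^bsub>MA N\<^esub> Y = cA N (x + y)" using x y by (simp add: A.c_add')
  then show "imap N (X \<oplus>\<^bsub>MA N\<^esub> Y) = imap N X \<oplus>\<^bsub>MB N\<^esub> imap N Y"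
   using x y by (simp add: imap_c A.Z_add additive_fun.add[OF op] B.c_add' op_Z)
 qed
 then show ?thesis by (simp add: lin_maps_iff imap_def)
qed

end

text \<open>An endomorphism that is homotopic to the identity up to terms of lower filtration is bijective on homology.\<close>

locale hcx_endo = hcx_map K F Kr D sc c M F Kr D sc c M op
 for K :: "('k, 'r) ring_scheme" and F :: "int \<Rightarrow> ('g::ab_group_add) set" and Kr D sc and c :: "int \<Rightarrow> 'g \<Rightarrow> 'h" and M and op +
 fixes H :: "'g \<Rightarrow> 'g" and L :: "nat \<Rightarrow> 'g set"
 assumes H_F: "x \<in> F N \<Longrightarrow> H x \<in> F (N + 1)" and H_K: "x \<in> F N \<Longrightarrow> x \<in> Kr \<Longrightarrow> H x \<in> Kr"
  and L_0: "x \<in> L 0 \<Longrightarrow> x = 0" and L_ex: "x \<in> F N \<Longrightarrow> \<exists>s. x \<in> L s"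
  and op_H: "x \<in> F N \<Longrightarrow> x \<in> L (Suc s) \<Longrightarrow> \<exists>y\<in>F N \<inter> L s. op x - x - D (H x) - H (D x) - y \<in> Kr"
begin

text \<open>On a cycle H(Dx) lies in \<open>Kr\<close>, so op x - x agrees with \<open>y\<close> up
  to a boundary and \<open>Kr\<close>; hence \<open>y\<close> is a cycle, being a difference of
  cycles.\<close>

lemma op_cl:
 assumes x: "x \<in> A.Z N" "x \<in> L (Suc s)"
 shows "\<exists>y. y \<in> A.Z N \<inter> L s \<and> c N (op x) = c N x \<oplus>\<^bsub>M N\<^esub> c N y"
proof -
 have xF: "x \<in> F N" using x by (simp add: A.Z_def)
 obtain y where y: "y \<in> F N" "y \<in> L s" "op x - x - D (H x) - H (D x) - y \<in> Kr"
  using op_H[OF xF x(2)] by blast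
 have "H (D x) \<in> Kr" using x A.D_F[OF xF] by (intro H_K) (auto simp: A.Z_def)
 from subgrp.add[OF A.Kr y(3) this] have k: "op x - x - D (H x) - y \<in> Kr" by simp
 have DH: "D (H x) \<in> A.Z N" by (rule A.Z_D[OF H_F[OF xF]])
 have w: "op x - x - D (H x) \<in> A.Z N" using x(1) DH op_Z by (intro A.Z_diff) auto
 have kF: "op x - x - D (H x) - y \<in> F N" using w y(1) by (auto simp: A.Z_def intro: subgrp.diff[OF A.F])
 have yZ: "y \<in> A.Z N"
  using A.Z_diff[OF w A.Z_Kr[OF kF k]] by simp
 have "c N (op x) = c N (x + y)"
  using A.c_eq'[OF op_Z[OF x(1)] A.Z_add[OF x(1) yZ] H_F[OF xF]] k by (simp add: algebra_simps)
 then show ?thesis using yZ y(2) A.c_add'[OF x(1) yZ] by auto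
qed

text \<open>On homology the class of a cycle goes to itself plus a class of lower level.
  Surjectivity and injectivity follow by induction on the level, which starts from the zero chain at
  level 0.\<close>

lemma imap_bij: "bij_betw (imap N) (carrier (M N)) (carrier (M N))"
proof -
 interpret module K "M N" by (rule A.M)
 note lin = lin_maps_lin_on[OF imap_lin[of N]]
 have surj: "x \<in> A.Z N \<Longrightarrow> x \<in> L s \<Longrightarrow> c N x \<in> imap N ` carrier (M N)" for s x
 proof (induction s arbitrary: x)
  case 0
  have "x = 0" by (rule L_0[OF 0(2)])
  then have "c N x = imap N (c N x)" using imap_c[OF A.Z_0, of N] additive_fun.zero[OF op] by simp
  then show ?case using A.c_mem[OF 0(1)] by blast
 next
  case (Suc s)
  obtain y where y: "y \<in> A.Z N" "y \<in> L s" "c N (op x) = c N x \<oplus>\<^bsub>M N\<^esub> c N y" using op_cl[OF Suc.prems] by blast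
  obtain Y where Y: "Y \<in> carrier (M N)" "c N y = imap N Y" using Suc.IH[OF y(1,2)] by blast
  note mem = A.c_mem[OF Suc.prems(1)] A.c_mem[OF y(1)]
  have "c N x = imap N (c N x) \<oplus>\<^bsub>M N\<^esub> \<ominus>\<^bsub>M N\<^esub> c N y"
   using y(3) mem by (simp add: imap_c[OF Suc.prems(1)] a_assoc r_neg)
  also have "\<dots> = imap N (c N x \<oplus>\<^bsub>M N\<^esub> \<ominus>\<^bsub>M N\<^esub> Y)"
   using mem Y by (simp add: lin_onD(2)[OF lin] lin_on_minus[OF A.M A.M lin])
  finally show ?case using mem Y by blast
 qed
 have inj: "x \<in> A.Z N \<Longrightarrow> x \<in> L s \<Longrightarrow> imap N (c N x) = \<zero>\<^bsub>M N\<^esub> \<Longrightarrow> c N x = \<zero>\<^bsub>M N\<^esub>" for s x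
 proof (induction s arbitrary: x)
  case 0
  have "x = 0" by (rule L_0[OF 0(2)])
  then show ?case using A.c_zero by simp
 next
  case (Suc s)
  obtain y where y: "y \<in> A.Z N" "y \<in> L s" "c N (op x) = c N x \<oplus>\<^bsub>M N\<^esub> c N y" using op_cl[OF Suc.prems(1,2)] by blast
  note mem = A.c_mem[OF Suc.prems(1)] A.c_mem[OF y(1)]
  have "c N x \<oplus>\<^bsub>M N\<^esub> c N y = \<zero>\<^bsub>M N\<^esub>" using Suc.prems y(3) by (simp add: imap_c)
  then have e: "c N x = \<ominus>\<^bsub>M N\<^esub> c N y" using mem minus_equality[of "c N x" "c N y"] by simp
  then have "\<ominus>\<^bsub>M N\<^esub> imap N (c N y) = \<zero>\<^bsub>M N\<^esub>"
   using Suc.prems(3) mem by (simp add: lin_on_minus[OF A.M A.M lin])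
  then have "imap N (c N y) = \<zero>\<^bsub>M N\<^esub>"
   using lin_onD(1)[OF lin mem(2)] minus_minus[of "imap N (c N y)"] by simp
  then have "c N y = \<zero>\<^bsub>M N\<^esub>" by (rule Suc.IH[OF y(1,2)])
  then show ?case using e by simp
 qed
 show ?thesis
  unfolding bij_betw_def
 proof
  show "inj_on (imap N) (carrier (M N))"
  proof (rule inj_onI)
   fix X Y assume X: "X \<in> carrier (M N)" and Y: "Y \<in> carrier (M N)" and e: "imap N X = imap N Y"
   obtain x where x: "x \<in> A.Z N" "X = c N x" by (rule A.carrierE[OF X])
   obtain y where y: "y \<in> A.Z N" "Y = c N y" by (rule A.carrierE[OF Y])
   have Z: "x - y \<in> A.Z N" using x y by (intro A.Z_diff)
   then obtain s where s: "x - y \<in> L s" using L_ex by (auto simp: A.Z_def)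
   have "imap N (c N (x - y)) = imap N X \<oplus>\<^bsub>M N\<^esub> \<ominus>\<^bsub>M N\<^esub> imap N Y"
    using X Y x y by (simp add: A.c_diff minus_eq lin_onD(2)[OF lin] lin_on_minus[OF A.M A.M lin])
   also have "\<dots> = \<zero>\<^bsub>M N\<^esub>" using e lin_onD(1)[OF lin Y] by (simp add: r_neg)
   finally have "c N (x - y) = \<zero>\<^bsub>M N\<^esub>" by (rule inj[OF Z s])
   then show "X = Y" using minus_zero_iff[OF A.M X Y] x y A.c_diff by simp
  qed
  show "imap N ` carrier (M N) = carrier (M N)"
  proof
   show "imap N ` carrier (M N) \<subseteq> carrier (M N)" using lin_onD(1)[OF lin] by blast
   show "carrier (M N) \<subseteq> imap N ` carrier (M N)"
   proof
    fix X assume X: "X \<in> carrier (M N)"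
    obtain x where x: "x \<in> A.Z N" "X = c N x" by (rule A.carrierE[OF X])
    then obtain s where "x \<in> L s" using L_ex by (auto simp: A.Z_def)
    then show "X \<in> imap N ` carrier (M N)" using surj x by blast
   qed
  qed
 qed
qed

end

lemma HC_hcx:
 assumes K: "cring K" and A: "is_ainf K A"
 shows "hcx K (FN (amod A)) (Ker K (amod A)) (frag_extend (Dk K A)) (\<lambda>c. frag_extend (sck A c)) (cl K A) (HC K A)"
proof -
 let ?KA = "Ker K (amod A)" and ?DA = "frag_extend (Dk K A)" and ?A = "amod A"
 note mA = is_ainfD(1)[OF A]
 have cyc: "x \<in> cyc K A N \<longleftrightarrow> x \<in> FN ?A N \<and> ?DA x \<in> ?KA" for x N
  by (simp add: cyc_def[OF K A])
 show ?thesis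
 proof (rule hcx.intro)
  show "subgrp (FN ?A N)" for N by (rule FN_subgrp)
  show "subgrp ?KA" by (rule Ker_S[OF K A])
  show "additive_fun ?DA" by (rule additive_frag_extend)
  show "X \<in> carrier (HC K A N) \<longleftrightarrow> (\<exists>x. x \<in> FN ?A N \<and> ?DA x \<in> ?KA \<and> X = cl K A N x)" for X N
   unfolding HC_carrier[OF K A] using cyc by blast
  show "cl K A N x = cl K A N y \<longleftrightarrow> (\<exists>u\<in>FN ?A (N + 1). x - y - ?DA u \<in> ?KA)"
   if "x \<in> FN ?A N" "?DA x \<in> ?KA" "y \<in> FN ?A N" "?DA y \<in> ?KA" for x y N
   using that by (intro cl_eq[OF K A]) (simp_all add: cyc)
  show "cl K A N (x + y) = cl K A N x \<oplus>\<^bsub>HC K A N\<^esub> cl K A N y"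
   if "x \<in> FN ?A N" "?DA x \<in> ?KA" "y \<in> FN ?A N" "?DA y \<in> ?KA" for x y N
   using that by (intro cl_add[OF K A]) (simp_all add: cyc)
  show "cl K A N (frag_extend (sck A e) x) = e \<odot>\<^bsub>HC K A N\<^esub> cl K A N x"
   if "e \<in> carrier K" "x \<in> FN ?A N" "?DA x \<in> ?KA" for e x N
   using that by (intro cl_smult[OF K A]) (simp_all add: cyc)
  show "?DA (frag_extend (sck A e) x) \<in> ?KA"
   if "e \<in> carrier K" "x \<in> FN ?A N" "?DA x \<in> ?KA" for e x N
   using that sck_cyc[OF K A, of e x N] by (simp add: cyc)
 qed (rule Dk_FN[OF K A] Dk_Ker[OF K A] Dk_Dk[OF K A] sck_FN[OF K A] HC_module[OF K A]; assumption)+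
qed

section \<open>Letterwise linear operators\<close>

text \<open>\<open>h\<close> is an evaluation in the target. Length and degree of the word are left
  free, so that the condition can be passed on to parts of words inside an operator.\<close>

definition lwl where
 "lwl K A M h \<phi> \<longleftrightarrow> (\<forall>x\<in>lists (Vl A). \<forall>z\<in>lists (Vl A). \<forall>q. lin_on K (A q) M (\<lambda>a. h (\<phi> (x @ (q, a) # z))))"

lemma lwlD: "lwl K A M h \<phi> \<Longrightarrow> x \<in> lists (Vl A) \<Longrightarrow> z \<in> lists (Vl A) \<Longrightarrow> lin_on K (A q) M (\<lambda>a. h (\<phi> (x @ (q, a) # z)))"
 by (simp add: lwl_def)

lemma lwl_Cons: "lwl K A M h \<phi> \<Longrightarrow> l \<in> Vl A \<Longrightarrow> lwl K A M h (\<lambda>u. \<phi> (l # u))"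
 using lwlD[of K A M h \<phi> "l # _"] by (simp add: lwl_def)

context
 fixes K :: "('k, 'r) ring_scheme" and N :: "('k, 'a) module" and M :: "('k, 'm) module" and h :: "('c \<Rightarrow>\<^sub>0 int) \<Rightarrow> 'm"
 assumes N: "module K N" and M: "module K M" and h: "fhom M h"
begin

lemma lf_zero: "lin_on K N M (\<lambda>a. h 0)"
 using lin_on_zero_fun[OF N M] by (simp add: fhom_zero[OF M h])

lemma lf_add: "lin_on K N M (\<lambda>a. h (\<xi> a)) \<Longrightarrow> lin_on K N M (\<lambda>a. h (\<xi>' a)) \<Longrightarrow> lin_on K N M (\<lambda>a. h (\<xi> a + \<xi>' a))"
 using lin_on_add_fun[OF N M] by (simp add: fhomD(2)[OF h])

lemma lf_sgx: "lin_on K N M (\<lambda>a. h (\<xi> a)) \<Longrightarrow> lin_on K N M (\<lambda>a. h (sgx e (\<xi> a)))"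
 using lin_on_sgn_mult_fun[OF M] by (simp add: fhom_sgx[OF M h])

lemma lf_ssum: "(\<And>x y. x @ y = w \<Longrightarrow> lin_on K N M (\<lambda>a. h (\<xi> a x y))) \<Longrightarrow> lin_on K N M (\<lambda>a. h (ssum (\<xi> a) w))"
proof (induction w arbitrary: \<xi>)
 case (Cons l w)
 then show ?case by (auto intro!: lf_add Cons.IH[where \<xi> = "\<lambda>a x. \<xi> a (l # x)"])
qed simp

lemma lf_ssum3: "(\<And>x y z. x @ y @ z = w \<Longrightarrow> lin_on K N M (\<lambda>a. h (\<xi> a x y z))) \<Longrightarrow> lin_on K N M (\<lambda>a. h (ssum3 (\<xi> a) w))"
 unfolding ssum3_def by (intro lf_ssum) auto

lemma lf_lsum: "(\<And>x l z. x @ l # z = w \<Longrightarrow> lin_on K N M (\<lambda>a. h (\<xi> a x l z))) \<Longrightarrow> lin_on K N M (\<lambda>a. h (lsum (\<xi> a) w))"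
proof (induction w arbitrary: \<xi>)
 case (Cons l w)
 then show ?case by (auto intro!: lf_add Cons.IH[where \<xi> = "\<lambda>a x. \<xi> a (l # x)"])
qed (simp add: lf_zero)

lemma lf_Fs:
 assumes fV: "\<And>y. y \<in> lists V \<Longrightarrow> y \<noteq> [] \<Longrightarrow> f y \<in> V'"
 shows "w \<in> lists V \<Longrightarrow> (\<And>u. u \<in> lists V' \<Longrightarrow> lin_on K N M (\<lambda>a. h (\<xi> a u))) \<Longrightarrow> lin_on K N M (\<lambda>a. h (Fs f w (\<xi> a)))"
proof (induction w arbitrary: \<xi> rule: length_induct)
 case (1 w)
 show ?case
 proof (cases w)
  case Nil
  then show ?thesis using "1.prems" by simp
 next
  case (Cons l v)
  show ?thesis unfolding Cons Fs_Cons
  proof (rule lf_ssum)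
   fix x y assume v: "x @ y = v"
   have l: "l # x \<in> lists V" "y \<in> lists V" using "1.prems"(1) Cons v by auto
   show "lin_on K N M (\<lambda>a. h (Fs f y (\<lambda>u. \<xi> a (f (l # x) # u))))"
   proof (rule "1.IH"[rule_format])
    show "length y < length w" using Cons v by auto
    fix u assume "u \<in> lists V'"
    then show "lin_on K N M (\<lambda>a. h (\<xi> a (f (l # x) # u)))" using fV[OF l(1)] by (intro "1.prems"(2)) auto
   qed (rule l(2))
  qed
 qed
qed

end

text \<open>The degree \<open>q'\<close> of the output may depend on the degrees of the inputs but
  not on the element \<open>a\<close>; this makes \<kappa> a map between fixed modules.\<close>

definition lin_let where
 "lin_let K A B f \<longleftrightarrow> (\<forall>x\<in>lists (Vl A). \<forall>z\<in>lists (Vl A). \<forall>q. \<exists>q' \<kappa>. lin_on K (A q) (B q') \<kappa> \<and> (\<forall>a. f (x @ (q, a) # z) = (q', \<kappa> a)))"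

lemma slet_lin_let:
 assumes K: "cring K" and A: "\<And>q. module K (A q)" and B: "\<And>q. module K (B q)" and Op: "ops_lin K A B s Op"
 shows "lin_let K A B (slet K A B s Op)"
 unfolding lin_let_def
proof (intro ballI allI)
 fix x z q assume xz: "x \<in> lists (Vl A)" "z \<in> lists (Vl A)"
 let ?p = "wdeg x + q + wdeg z" and ?r = "length x + length z"
 let ?d = "?p + int ?r - s" and ?e = "tri ?r + nu (x @ (q, undefined) # z)"
 have "lin_on K (A q) (B ?d) (\<lambda>a. sgn_mult (B ?d) ?e (Op ?r ?p (pure K A (x @ (q, a) # z))))"
  by (intro lin_on_sgn_mult_fun[OF B] ops_letter_lin[OF K A B Op xz]) simp_all
 moreover have "slet K A B s Op (x @ (q, a) # z) = (?d, sgn_mult (B ?d) ?e (Op ?r ?p (pure K A (x @ (q, a) # z))))" for a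
  by (simp add: slet_def Let_def nu_append algebra_simps)
 ultimately show "\<exists>q' \<kappa>. lin_on K (A q) (B q') \<kappa> \<and> (\<forall>a. slet K A B s Op (x @ (q, a) # z) = (q', \<kappa> a))"
  by blast
qed

context
 fixes K :: "('k, 'r) ring_scheme" and A :: "int \<Rightarrow> ('k, 'a) module" and B :: "int \<Rightarrow> ('k, 'b) module"
  and M :: "('k, 'm) module" and h :: "('c \<Rightarrow>\<^sub>0 int) \<Rightarrow> 'm" and f :: "'a word \<Rightarrow> int \<times> 'b"
 assumes A: "\<And>q. module K (A q)" and M: "module K M" and h: "fhom M h"
  and fV: "\<And>y. y \<in> lists (Vl A) \<Longrightarrow> y \<noteq> [] \<Longrightarrow> f y \<in> Vl B" and fl: "lin_let K A B f"
begin

lemma lwl_letter: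
 assumes "lwl K B M h \<phi>" "x' \<in> lists (Vl B)" "z' \<in> lists (Vl B)" "x \<in> lists (Vl A)" "z \<in> lists (Vl A)"
 shows "lin_on K (A q) M (\<lambda>a. h (\<phi> (x' @ f (x @ (q, a) # z) # z')))"
proof -
 obtain q' \<kappa> where \<kappa>: "lin_on K (A q) (B q') \<kappa>" "\<And>a. f (x @ (q, a) # z) = (q', \<kappa> a)"
  using fl assms(4,5) unfolding lin_let_def by metis
 show ?thesis unfolding \<kappa>(2) by (rule lin_on_comp[OF \<kappa>(1) lwlD[OF assms(1-3)]])
qed

lemma lwl_letter0:
 assumes "lwl K B M h \<phi>" "z' \<in> lists (Vl B)" "x \<in> lists (Vl A)" "z \<in> lists (Vl A)"
 shows "lin_on K (A q) M (\<lambda>a. h (\<phi> (f (x @ (q, a) # z) # z')))"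
 using lwl_letter[of \<phi> "[]" z' x z q] assms by simp

text \<open>By \<open>Fs_middle\<close> the varying letter sits in a single block, whose value
  depends linearly on it.\<close>

lemma lwl_Fs:
 assumes \<phi>: "lwl K B M h \<phi>"
 shows "lwl K A M h (\<lambda>w. Fs f w \<phi>)"
 unfolding lwl_def Fs_middle
proof (intro ballI allI)
 let ?W = "lists (Vl A)"
 fix Z X q assume ZX: "Z \<in> ?W" "X \<in> ?W"
 show "lin_on K (A q) M (\<lambda>a. h (ssum (\<lambda>z' z. ssum (\<lambda>x x'. Fs f z' (\<lambda>u. Fs f x' (\<lambda>u'. \<phi> (u @ f (z @ (q, a) # x) # u')))) X) Z))"
 proof (intro lf_ssum[OF A M h])
  fix z' z x x' assume "z' @ z = Z" "x @ x' = X"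
  then have l: "z' \<in> ?W" "z \<in> ?W" "x \<in> ?W" "x' \<in> ?W" using ZX by auto
  show "lin_on K (A q) M (\<lambda>a. h (Fs f z' (\<lambda>u. Fs f x' (\<lambda>u'. \<phi> (u @ f (z @ (q, a) # x) # u')))))"
   by (intro lf_Fs[OF A M h fV, where V = "Vl A"] lwl_letter[OF \<phi>] l)
 qed
qed

text \<open>A varying letter other than the first lies in one of the pieces x, y, z of the cyclic
  cutting: in x or z it belongs to the block through the first letter, in y it is covered by
  \<open>lwl_Fs\<close>.\<close>

lemma lwl_Fcs:
 assumes \<phi>: "lwl K B M h \<phi>"
 shows "lwl K A M h (\<lambda>w. Fcs f w \<phi>)"
 unfolding lwl_def
proof (intro ballI allI)
 let ?W = "lists (Vl A)"
 fix x0 z0 q assume xz: "x0 \<in> ?W" "z0 \<in> ?W"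
 note I = lf_ssum[OF A M h] lf_add[OF A M h] lf_sgx[OF A M h]
 show "lin_on K (A q) M (\<lambda>a. h (Fcs f (x0 @ (q, a) # z0) \<phi>))"
 proof (cases x0)
  case Nil
  have "lin_on K (A q) M (\<lambda>a. h (ssum3 (\<lambda>x y z. sgx (wd z * (q + 1 + wd x + wd y)) (Fs f y (\<lambda>u. \<phi> (f (z @ (q, a) # x) # u)))) z0))"
  proof (intro lf_ssum3[OF A M h] lf_sgx[OF A M h])
   fix x y z assume "x @ y @ z = z0"
   then have l: "x \<in> ?W" "y \<in> ?W" "z \<in> ?W" using xz by auto
   show "lin_on K (A q) M (\<lambda>a. h (Fs f y (\<lambda>u. \<phi> (f (z @ (q, a) # x) # u))))"
    by (intro lf_Fs[OF A M h fV, where V = "Vl A"] lwl_letter0[OF \<phi>] l)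
  qed
  then show ?thesis by (simp add: Nil Fcs_Cons)
 next
  case (Cons l Z)
  have lZ: "l \<in> Vl A" "Z \<in> ?W" using xz Cons by auto
  obtain lq la where l: "l = (lq, la)" by (cases l)
  let ?s = "\<lambda>x y z. wd z * (fst l + 1 + wd x + wd y)"
  let ?G = "\<lambda>x y z. Fs f y (\<lambda>u. \<phi> (f (z @ l # x) # u))"
  have *: "lin_on K (A q) M (\<lambda>a. h (sgx (?s x y (z1 @ (q, a) # z2)) (?G x y (z1 @ (q, a) # z2))))"
   if "x \<in> ?W" "y \<in> ?W" "z1 \<in> ?W" "z2 \<in> ?W" for x y z1 z2
  proof -
   \<comment> \<open>Signs see only degrees, so \<open>undefined\<close> can stand for the varying
     element in the exponent.\<close>
   have "lin_on K (A q) M (\<lambda>a. h (sgx (?s x y (z1 @ (q, undefined) # z2)) (Fs f y (\<lambda>u. \<phi> (f (z1 @ (q, a) # (z2 @ l # x)) # u)))))"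
    using that lZ by (intro lf_sgx[OF A M h] lf_Fs[OF A M h fV, where V = "Vl A"] lwl_letter0[OF \<phi>]) auto
   then show ?thesis by simp
  qed
  have **: "lin_on K (A q) M (\<lambda>a. h (sgx (?s x (y1 @ (q, a) # y2) z) (?G x (y1 @ (q, a) # y2) z)))"
   if "x \<in> ?W" "y1 \<in> ?W" "y2 \<in> ?W" "z \<in> ?W" for x y1 y2 z
  proof -
   have "f (z @ l # x) \<in> Vl B" using that lZ by (intro fV) auto
   then have "lin_on K (A q) M (\<lambda>a. h (sgx (?s x (y1 @ (q, undefined) # y2) z) (Fs f (y1 @ (q, a) # y2) (\<lambda>u. \<phi> (f (z @ l # x) # u)))))"
    using that by (intro lf_sgx[OF A M h] lwlD[OF lwl_Fs[OF lwl_Cons[OF \<phi>]]])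
   then show ?thesis by simp
  qed
  have ***: "lin_on K (A q) M (\<lambda>a. h (sgx (?s (x1 @ (q, a) # x2) y z) (?G (x1 @ (q, a) # x2) y z)))"
   if "x1 \<in> ?W" "x2 \<in> ?W" "y \<in> ?W" "z \<in> ?W" for x1 x2 y z
  proof -
   have "lin_on K (A q) M (\<lambda>a. h (sgx (?s (x1 @ (q, undefined) # x2) y z) (Fs f y (\<lambda>u. \<phi> (f ((z @ l # x1) @ (q, a) # x2) # u)))))"
    using that lZ by (intro lf_sgx[OF A M h] lf_Fs[OF A M h fV, where V = "Vl A"] lwl_letter0[OF \<phi>]) auto
   then show ?thesis by simp
  qed
  show ?thesis
   unfolding Cons append_Cons Fcs_Cons ssum3_def ssum_append
   by (intro I * ** ***; use xz(2) lZ(2) in \<open>auto simp del: append_assoc\<close>)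
 qed
qed

end

context
 fixes K :: "('k, 'r) ring_scheme" and A :: "int \<Rightarrow> ('k, 'a) module" and M :: "('k, 'm) module" and h :: "('c \<Rightarrow>\<^sub>0 int) \<Rightarrow> 'm"
  and \<psi> :: "nat \<times> 'a word \<Rightarrow> 'c \<Rightarrow>\<^sub>0 int"
 assumes K: "cring K" and A: "\<And>q. module K (A q)" and M: "module K M" and h: "fhom M h"
  and \<psi>: "\<And>m. lwl K A M h (\<lambda>w. \<psi> (m, w))" and \<psi>0: "\<And>m. h (\<psi> (m, [])) = \<zero>\<^bsub>M\<^esub>"
begin

text \<open>The factorization of \<open>h\<close> after \<psi> through the tensor powers, one map
  for each shape (column, length, degree); the sign \<open>th\<close> undoes the twist in
  \<open>EV\<close>.\<close>

definition Lam :: "nat \<times> nat \<times> int \<Rightarrow> ('k, 'a) tens \<Rightarrow> 'm" where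
 "Lam = (\<lambda>(m, n, p). lin_ext K M (\<lambda>w. sgn_mult M (th w) (h (\<psi> (m, w)))))"

lemma Lam_mlin: "mlin K A n p M (\<lambda>w. sgn_mult M (th w) (h (\<psi> (m, w))))"
 unfolding mlin_def
proof (intro ballI allI impI)
 fix x z q assume xz: "x \<in> lists (Vl A)" "z \<in> lists (Vl A)"
 have "lin_on K (A q) M (\<lambda>a. sgn_mult M (th (x @ (q, undefined) # z)) (h (\<psi> (m, x @ (q, a) # z))))"
  by (intro lin_on_sgn_mult_fun[OF M] lwlD[OF \<psi>] xz)
 then show "lin_on K (A q) M (\<lambda>a. sgn_mult M (th (x @ (q, a) # z)) (h (\<psi> (m, x @ (q, a) # z))))"
  by (simp add: th_append)
qed

lemma Lam_lin: "n > 0 \<Longrightarrow> lin_on K (tpow K A n p) M (Lam (m, n, p))"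
 unfolding Lam_def prod.case by (rule lin_ext_lin[OF K A M Lam_mlin])

definition shape :: "nat \<times> 'a word \<Rightarrow> nat \<times> nat \<times> int" where
 "shape = (\<lambda>(m, w). (m, length w, wdeg w))"

definition shapes :: "(nat \<times> 'a word \<Rightarrow>\<^sub>0 int) \<Rightarrow> (nat \<times> nat \<times> int) set" where
 "shapes x = shape ` {s \<in> Poly_Mapping.keys x. snd s \<noteq> []}"

definition ev :: "nat \<times> nat \<times> int \<Rightarrow> (nat \<times> 'a word \<Rightarrow>\<^sub>0 int) \<Rightarrow> ('k, 'a) tens" where
 "ev = (\<lambda>(m, n, p). EV K A m n p)"

text \<open>A formal sum may mix shapes, so its value is a sum over finitely many shapes of what the
  corresponding tensor powers see; empty words contribute zero by \<open>\<psi>0\<close>.\<close>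

lemma Lam_formula:
 assumes I: "finite I" "\<And>m n p. (m, n, p) \<in> I \<Longrightarrow> n > 0"
  and y: "Poly_Mapping.keys y \<subseteq> {s. snd s \<in> lists (Vl A) \<and> (snd s = [] \<or> shape s \<in> I)}"
 shows "h (frag_extend \<psi> y) = finsum M (\<lambda>i. Lam i (ev i y)) I"
proof (rule fhom_ext[where h = "\<lambda>y. h (frag_extend \<psi> y)" and h' = "\<lambda>y. finsum M (\<lambda>i. Lam i (ev i y)) I", OF M _ _ y])
 interpret module K M by (rule M)
 have ih: "fhom M (\<lambda>y. Lam i (ev i y))" if "i \<in> I" for i
 proof -
  obtain m n p where i: "i = (m, n, p)" by (cases i)
  show ?thesis unfolding i ev_def prod.case using that I(2) by (intro fhom_lin[OF EV_fhom[OF K A] Lam_lin]) (auto simp: i)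
 qed
 show "fhom M (\<lambda>y. h (frag_extend \<psi> y))" by (rule fhom_frag_extend[OF M h])
 show "fhom M (\<lambda>y. finsum M (\<lambda>i. Lam i (ev i y)) I)" by (rule fhom_finsum[OF M ih])
 fix s assume s: "s \<in> {s. snd s \<in> lists (Vl A) \<and> (snd s = [] \<or> shape s \<in> I)}"
 obtain m w where mw: "s = (m, w)" by (cases s)
 have w: "w \<in> lists (Vl A)" using s by (simp add: mw)
 have z: "Lam i (ev i (frag_of s)) = \<zero>\<^bsub>M\<^esub>" if "i \<in> I" "i \<noteq> shape s \<or> w = []" for i
 proof -
  obtain m' n p where i: "i = (m', n, p)" by (cases i)
  have n: "n > 0" using that I(2) i by blast
  have "ev i (frag_of s) = \<zero>\<^bsub>tpow K A n p\<^esub>"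
   using that n by (auto simp: i ev_def mw shape_def EV_of[OF K A] words_iff)
  then show ?thesis using lin_on_zero[OF tpow_module[OF K A] M Lam_lin[OF n]] by (simp add: i)
 qed
 show "h (frag_extend \<psi> (frag_of s)) = finsum M (\<lambda>i. Lam i (ev i (frag_of s))) I"
 proof (cases "w = []")
  case True
  then have "finsum M (\<lambda>i. Lam i (ev i (frag_of s))) I = \<zero>\<^bsub>M\<^esub>"
   using z by (intro add.finprod_one_eqI) auto
  then show ?thesis using \<psi>0 True by (simp add: mw)
 next
  case False
  define i where "i = shape s"
  have i: "i \<in> I" "i = (m, length w, wdeg w)" using s False by (simp_all add: i_def mw shape_def)
  have ww: "w \<in> words A (length w) (wdeg w)" using w by (simp add: words_iff)
  note T = tpow_module[OF K A, where n = "length w" and p = "wdeg w"]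
  have "Lam i (ev i (frag_of s)) = sgn_mult M (th w) (Lam i (pure K A w))"
   using lin_on_sgn_mult[OF T M Lam_lin pure_closed[OF K A ww]] False
   by (simp add: i(2) ev_def mw EV_of[OF K A] ww)
  also have "Lam i (pure K A w) = sgn_mult M (th w) (h (\<psi> (m, w)))"
   unfolding i(2) Lam_def prod.case using False by (intro lin_ext_pure[OF K A M Lam_mlin _ ww]) simp
  also have "sgn_mult M (th w) (sgn_mult M (th w) (h (\<psi> (m, w)))) = h (\<psi> (m, w))"
   using fhomD(1)[OF h, of "\<psi> (m, w)"] by (simp add: sgn_mult_sgn_mult[OF M]) (simp add: sgn_mult_def)
  finally have Li: "Lam i (ev i (frag_of s)) = h (\<psi> (m, w))" .
  have "finsum M (\<lambda>i. Lam i (ev i (frag_of s))) I = finsum M (\<lambda>i. Lam i (ev i (frag_of s))) {i}"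
  proof (rule add.finprod_mono_neutral_cong_right[OF I(1)])
   show "{i} \<subseteq> I" using i by simp
  next
   fix j assume "j \<in> I - {i}"
   then show "Lam j (ev j (frag_of s)) = \<zero>\<^bsub>M\<^esub>" using z by (auto simp: i_def)
  next
   show "(\<lambda>i. Lam i (ev i (frag_of s))) \<in> I \<rightarrow> carrier M" using fhomD(1)[OF ih] by blast
  qed (rule refl)
  also have "\<dots> = h (\<psi> (m, w))" using fhomD(1)[OF h, of "\<psi> (m, w)"] by (simp add: Li)
  finally show ?thesis by (simp add: mw)
 qed
qed

lemma shapes_props:
 assumes "x \<in> FN A N"
 shows "finite (shapes x)" "(m, n, p) \<in> shapes x \<Longrightarrow> n > 0"
  "Poly_Mapping.keys x \<subseteq> {s. snd s \<in> lists (Vl A) \<and> (snd s = [] \<or> shape s \<in> shapes x)}"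
proof -
 show "finite (shapes x)" by (simp add: shapes_def)
 show "n > 0" if "(m, n, p) \<in> shapes x" using that by (auto simp: shapes_def shape_def)
 show "Poly_Mapping.keys x \<subseteq> {s. snd s \<in> lists (Vl A) \<and> (snd s = [] \<or> shape s \<in> shapes x)}"
  using assms unfolding FN_def vk_def shapes_def by (force simp del: in_lists_conv_set)
qed

text \<open>The purpose of linearity in the letters: an operator that factors through the tensor
  powers respects the kernel of evaluation.\<close>

lemma lwl_Ker:
 assumes x: "x \<in> FN A N" "x \<in> Ker K A"
 shows "h (frag_extend \<psi> x) = \<zero>\<^bsub>M\<^esub>"
proof -
 interpret module K M by (rule M)
 note I = shapes_props[OF x(1)]
 have "Lam i (ev i x) = \<zero>\<^bsub>M\<^esub>" if "i \<in> shapes x" for i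
 proof -
  obtain m n p where i: "i = (m, n, p)" by (cases i)
  have n: "n > 0" using that I(2) i by blast
  have "ev i x = \<zero>\<^bsub>tpow K A n p\<^esub>" using x(2) n by (simp add: i ev_def Ker_def)
  then show ?thesis using lin_on_zero[OF tpow_module[OF K A] M Lam_lin[OF n]] by (simp add: i)
 qed
 then have "finsum M (\<lambda>i. Lam i (ev i x)) (shapes x) = \<zero>\<^bsub>M\<^esub>" by (rule add.finprod_one_eqI)
 then show ?thesis using Lam_formula[OF I(1) I(2) I(3)] by simp
qed

text \<open>Scaling the first letter does not change the shape of a word, so both sides are sums
  over the same shapes, and each \<open>Lam\<close> is linear.\<close>

lemma lwl_sc:
 assumes x: "x \<in> FN A N" and c: "c \<in> carrier K" and AA: "is_ainf K AA" "amod AA = A"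
 shows "h (frag_extend \<psi> (frag_extend (sck AA c) x)) = c \<odot>\<^bsub>M\<^esub> h (frag_extend \<psi> x)"
proof -
 interpret module K M by (rule M)
 note I = shapes_props[OF x(1)]
 let ?V = "{s. snd s \<in> lists (Vl A) \<and> (snd s = [] \<or> shape s \<in> shapes x)}"
 have "frag_extend (sck AA c) x \<in> {y. Poly_Mapping.keys y \<subseteq> ?V}"
 proof (rule frag_extend_mem[OF keys_subgrp I(3)])
  fix s assume s: "s \<in> ?V"
  obtain m w where mw: "s = (m, w)" by (cases s)
  show "sck AA c s \<in> {y. Poly_Mapping.keys y \<subseteq> ?V}"
   using s c AA module.smult_closed[OF A]
   by (cases w) (auto simp: mw sck_def shape_def Vl_def)
 qed
 then have k: "Poly_Mapping.keys (frag_extend (sck AA c) x) \<subseteq> ?V" by blast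
 have L: "Lam i (ev i (frag_extend (sck AA c) x)) = c \<odot>\<^bsub>M\<^esub> Lam i (ev i x)" "Lam i (ev i x) \<in> carrier M" if "i \<in> shapes x" for i
 proof -
  obtain m n p where i: "i = (m, n, p)" by (cases i)
  have n: "n > 0" using that I(2) i by blast
  have "ev i (frag_extend (sck AA c) x) = c \<odot>\<^bsub>tpow K A n p\<^esub> ev i x"
   using EV_sck[OF K AA(1) c, of x N n m p] x n by (simp add: i ev_def AA(2))
  then show "Lam i (ev i (frag_extend (sck AA c) x)) = c \<odot>\<^bsub>M\<^esub> Lam i (ev i x)" "Lam i (ev i x) \<in> carrier M"
   using lin_onD(1,3)[OF Lam_lin[OF n]] c fhomD(1)[OF EV_fhom[OF K A]] by (simp_all add: i ev_def)
 qed
 have "finsum M (\<lambda>i. Lam i (ev i (frag_extend (sck AA c) x))) (shapes x) = finsum M (\<lambda>i. c \<odot>\<^bsub>M\<^esub> Lam i (ev i x)) (shapes x)"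
  using L c by (intro finsum_cong') auto
 also have "\<dots> = c \<odot>\<^bsub>M\<^esub> finsum M (\<lambda>i. Lam i (ev i x)) (shapes x)"
  using L c I(1) by (intro finsum_smult_ldistr[symmetric]) auto
 finally show ?thesis using Lam_formula[OF I(1) I(2) k] Lam_formula[OF I(1) I(2) I(3)] by simp
qed

end

section \<open>The map of complexes induced by a morphism\<close>

lemma ssum_first: "subgrp S \<Longrightarrow> (\<And>x y. x @ y = w \<Longrightarrow> x \<noteq> [] \<Longrightarrow> \<phi> x y \<in> S) \<Longrightarrow> ssum \<phi> w - \<phi> [] w \<in> S"
 by (cases w) (auto simp: subgrp.zero intro!: subgrp.ssum)

lemma ssum_last: "subgrp S \<Longrightarrow> (\<And>x y. x @ y = w \<Longrightarrow> y \<noteq> [] \<Longrightarrow> \<phi> x y \<in> S) \<Longrightarrow> ssum \<phi> w - \<phi> w [] \<in> S"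
proof (induction w arbitrary: \<phi>)
 case Nil
 then show ?case by (simp add: subgrp.zero)
next
 case (Cons a w)
 have "ssum (\<lambda>x. \<phi> (a # x)) w - \<phi> (a # w) [] \<in> S" using Cons.prems by (intro Cons.IH) auto
 moreover have "\<phi> [] (a # w) \<in> S" using Cons.prems by auto
 ultimately have "\<phi> [] (a # w) + (ssum (\<lambda>x. \<phi> (a # x)) w - \<phi> (a # w) []) \<in> S" by (intro subgrp.add[OF Cons.prems(1)])
 then show ?case by (simp add: add_diff_eq)
qed

context f_degree
begin

text \<open>Every subdivision other than the one into single letters has a block \<open>y\<close> of
  at least two letters. Such blocks give zero for a strict morphism, and they shorten the word in
  the filtration argument; both cases are covered by the choice of \<open>S\<close>.\<close>

lemma Fs_len1:
 assumes S: "subgrp S" and fV: "\<And>y. y \<in> lists V \<Longrightarrow> y \<noteq> [] \<Longrightarrow> f y \<in> V'"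
 shows "w \<in> lists V \<Longrightarrow> (\<And>x y z. x \<in> lists V' \<Longrightarrow> z \<in> lists V' \<Longrightarrow> y \<in> lists V \<Longrightarrow> length y \<ge> 2 \<Longrightarrow>
   length x + length y + length z \<le> length w \<Longrightarrow> wd x + wd y + wd z = wd w \<Longrightarrow> \<phi> (x @ f y # z) \<in> S) \<Longrightarrow>
  Fs f w \<phi> - \<phi> (map (\<lambda>l. f [l]) w) \<in> S"
proof (induction w arbitrary: \<phi>)
 case Nil
 then show ?case by (simp add: subgrp.zero[OF S])
next
 case (Cons a v)
 have av: "a \<in> V" "v \<in> lists V" using Cons.prems(1) by auto
 have fa: "f [a] \<in> V'" "fst (f [a]) = fst a" using av fV[of "[a]"] by (auto simp: f_deg)
 have "Fs f (a # v) \<phi> - Fs f v (\<lambda>u. \<phi> (f [a] # u)) \<in> S"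
  unfolding Fs_Cons
 proof (rule ssum_first[OF S])
  fix x y assume xy: "x @ y = v" "x \<noteq> []"
  have l: "x \<in> lists V" "y \<in> lists V" using xy av by auto
  show "Fs f y (\<lambda>u. \<phi> (f (a # x) # u)) \<in> S"
  proof (rule Fs_mem[OF S fV l(2)])
   fix u assume u: "u \<in> lists V'" "length u \<le> length y" "wd u = wd y"
   have "Suc 0 \<le> length x" using xy(2) by (cases x) auto
   then show "\<phi> (f (a # x) # u) \<in> S"
    using Cons.prems(2)[of "[]" u "a # x"] xy u av l by auto
  qed
 qed
 moreover have "Fs f v (\<lambda>u. \<phi> (f [a] # u)) - \<phi> (f [a] # map (\<lambda>l. f [l]) v) \<in> S"
 proof (rule Cons.IH[OF av(2)])
  fix x y z assume "x \<in> lists V'" "z \<in> lists V'" "y \<in> lists V" "length y \<ge> 2"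
   "length x + length y + length z \<le> length v" "wd x + wd y + wd z = wd v"
  then show "\<phi> (f [a] # x @ f y # z) \<in> S"
   using Cons.prems(2)[of "f [a] # x" z y] fa by simp
 qed
 ultimately show ?case using subgrp.add[OF S] by fastforce
qed

lemma Fcs_len1:
 assumes S: "subgrp S" and fV: "\<And>y. y \<in> lists V \<Longrightarrow> y \<noteq> [] \<Longrightarrow> f y \<in> V'" and w: "w \<in> lists V" "w \<noteq> []"
  and \<phi>: "\<And>x y z. x \<in> lists V' \<Longrightarrow> z \<in> lists V' \<Longrightarrow> y \<in> lists V \<Longrightarrow> length y \<ge> 2 \<Longrightarrow>
   length x + length y + length z \<le> length w \<Longrightarrow> wd x + wd y + wd z = wd w \<Longrightarrow> \<phi> (x @ f y # z) \<in> S"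
 shows "Fcs f w \<phi> - \<phi> (map (\<lambda>l. f [l]) w) \<in> S"
proof -
 obtain a v where aw: "w = a # v" using w(2) by (cases w) auto
 have av: "a \<in> V" "v \<in> lists V" using w(1) aw by auto
 have fa: "f [a] \<in> V'" "fst (f [a]) = fst a" using av fV[of "[a]"] by (auto simp: f_deg)
 define \<tau> where "\<tau> x y z = sgx (wd z * (fst a + 1 + wd x + wd y)) (Fs f y (\<lambda>u. \<phi> (f (z @ a # x) # u)))" for x y z
 have t: "\<tau> x y z \<in> S" if xyz: "x @ y @ z = v" "x \<noteq> [] \<or> z \<noteq> []" for x y z
 proof -
  have l: "x \<in> lists V" "y \<in> lists V" "z \<in> lists V" using xyz av by auto
  show ?thesis
   unfolding \<tau>_def
  proof (rule subgrp.sgx[OF S], rule Fs_mem[OF S fV l(2)])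
   fix u assume u: "u \<in> lists V'" "length u \<le> length y" "wd u = wd y"
   have "Suc 0 \<le> length x + length z" using xyz(2) by (cases x; cases z) auto
   then show "\<phi> (f (z @ a # x) # u) \<in> S"
    using \<phi>[of "[]" u "z @ a # x"] xyz u av l aw by auto
  qed
 qed
 have "Fcs f w \<phi> - ssum (\<lambda>y z. \<tau> [] y z) v \<in> S"
  unfolding aw Fcs_Cons ssum3_def \<tau>_def[symmetric]
  by (rule ssum_first[OF S, where \<phi> = "\<lambda>x u. ssum (\<tau> x) u"]) (auto intro!: subgrp.ssum[OF S] t)
 moreover have "ssum (\<lambda>y z. \<tau> [] y z) v - \<tau> [] v [] \<in> S"
  by (rule ssum_last[OF S]) (auto intro!: t)
 moreover have "\<tau> [] v [] = Fs f v (\<lambda>u. \<phi> (f [a] # u))" by (simp add: \<tau>_def)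
 moreover have "Fs f v (\<lambda>u. \<phi> (f [a] # u)) - \<phi> (f [a] # map (\<lambda>l. f [l]) v) \<in> S"
 proof (rule Fs_len1[OF S fV av(2)])
  fix x y z assume "x \<in> lists V'" "z \<in> lists V'" "y \<in> lists V" "length y \<ge> 2"
   "length x + length y + length z \<le> length v" "wd x + wd y + wd z = wd v"
  then show "\<phi> (f [a] # x @ f y # z) \<in> S"
   using \<phi>[of "f [a] # x" z y] fa aw by simp
 qed
 ultimately show ?thesis
  using subgrp.add[OF S, OF subgrp.add[OF S]] by (fastforce simp: aw)
qed

end

definition Ph :: "('k, 'r) ring_scheme \<Rightarrow> ('k, 'a) ainf \<Rightarrow> ('k, 'b) ainf \<Rightarrow> ('k, 'a, 'b) ainf_maps \<Rightarrow>
  nat \<times> 'a word \<Rightarrow> (nat \<times> 'b word) \<Rightarrow>\<^sub>0 int" where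
 "Ph K A B f = (\<lambda>(m, w). if even m then Fcs (flet K A B f) w (\<lambda>u. frag_of (m, u)) else Fs (flet K A B f) w (\<lambda>u. frag_of (m, u)))"

lemma frag_extend_Fs:
 "frag_extend \<psi> (Fs f w \<phi>) = Fs f w (\<lambda>u. frag_extend \<psi> (\<phi> u))"
 "frag_extend \<psi> (Fcs f w \<phi>) = Fcs f w (\<lambda>u. frag_extend \<psi> (\<phi> u))"
 by (rule Fs_hom[OF additive_frag_extend] Fcs_hom[OF additive_frag_extend])+

lemma Fcs_add: "Fcs f w (\<lambda>u. \<phi> u + \<psi> u) = Fcs f w \<phi> + Fcs f w \<psi>"
 by (cases w) (simp_all add: Fcs_Cons Fs_add sgx_add ssum3_add)

lemma frag_extend_diff_fun: "frag_extend f x - frag_extend g x = frag_extend (\<lambda>s. f s - g s) x"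
proof (rule frag_induction[of x UNIV])
 fix a b assume ab: "frag_extend f a - frag_extend g a = frag_extend (\<lambda>s. f s - g s) a" "frag_extend f b - frag_extend g b = frag_extend (\<lambda>s. f s - g s) b"
 show "frag_extend f (a - b) - frag_extend g (a - b) = frag_extend (\<lambda>s. f s - g s) (a - b)"
  unfolding frag_extend_diff ab[symmetric] by (simp add: algebra_simps)
qed simp_all

context
 fixes K :: "('k, 'r) ring_scheme" and A :: "('k, 'a) ainf" and B :: "('k, 'b) ainf" and f :: "('k, 'a, 'b) ainf_maps"
 assumes K: "cring K" and A: "is_ainf K A" and B: "is_ainf K B"
  and fV: "\<And>y. y \<in> lists (Vl (amod A)) \<Longrightarrow> y \<noteq> [] \<Longrightarrow> flet K A B f y \<in> Vl (amod B)"
begin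

lemma Ph_FN: "x \<in> FN (amod A) N \<Longrightarrow> frag_extend (Ph K A B f) x \<in> FN (amod B) N"
proof (rule FN_extend_mem[OF FN_subgrp])
 interpret f_degree "flet K A B f" by (rule slet_f_degree)
 fix m w assume w: "w \<in> lists (Vl (amod A))" "int m + wd w - 1 = N"
 have "Fcs (flet K A B f) w (\<lambda>u. frag_of (m, u)) \<in> FN (amod B) N" "Fs (flet K A B f) w (\<lambda>u. frag_of (m, u)) \<in> FN (amod B) N"
  using w by (auto intro!: Fcs_mem[OF FN_subgrp fV w(1)] Fs_mem[OF FN_subgrp fV w(1)] simp: FN_of)
 then show "Ph K A B f (m, w) \<in> FN (amod B) N" by (simp add: Ph_def)
qed

lemma frag_Nil_Ker: "frag_of (m, []) \<in> Ker K (amod B)"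
 by (simp add: Ker_def EVof0[OF K B] words_iff)

text \<open>A block of two or more letters is sent to a zero letter, and a word with a zero letter
  evaluates to zero by linearity.\<close>

lemma Ph_strict:
 assumes z: "\<And>y. y \<in> lists (Vl (amod A)) \<Longrightarrow> length y \<ge> 2 \<Longrightarrow> snd (flet K A B f y) = \<zero>\<^bsub>amod B (fst (flet K A B f y))\<^esub>"
  and w: "w \<in> lists (Vl (amod A))"
 shows "Ph K A B f (m, w) - frag_of (m, map (\<lambda>l. flet K A B f [l]) w) \<in> Ker K (amod B)"
proof -
 let ?ff = "flet K A B f" and ?B = "amod B"
 note mB = is_ainfD(1)[OF B]
 note S = Ker_S[OF K B]
 interpret f_degree "?ff" by (rule slet_f_degree)
 have *: "frag_of (m, x @ ?ff y # z) \<in> Ker K ?B"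
  if "x \<in> lists (Vl ?B)" "z \<in> lists (Vl ?B)" "y \<in> lists (Vl (amod A))" "length y \<ge> 2" for x y z
 proof -
  obtain q c where fy: "?ff y = (q, c)" by (cases "?ff y")
  have c: "c = \<zero>\<^bsub>?B q\<^esub>" using assms(1)[OF that(3,4)] fy by simp
  have "EV K ?B m' n p (frag_of (m, x @ (q, c) # z)) = \<zero>\<^bsub>tpow K ?B n p\<^esub>" for m' n p
   unfolding c by (rule lin_on_zero[OF mB tpow_module[OF K mB] EV_letter_lin[where A = "?B", OF K mB that(1,2)]])
  then show ?thesis by (simp add: fy Ker_def)
 qed
 show ?thesis
 \<comment> \<open>\<open>Fcs\<close> is zero on the empty word while \<open>map\<close> returns the
   empty word; the difference lies in \<open>Ker\<close>.\<close>
 proof (cases "even m \<and> w = []")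
  case True
  then show ?thesis using subgrp.minus[OF S frag_Nil_Ker] by (simp add: Ph_def)
 next
  case False
  have "Fcs ?ff w (\<lambda>u. frag_of (m, u)) - frag_of (m, map (\<lambda>l. ?ff [l]) w) \<in> Ker K ?B" if "even m"
  proof -
   have "w \<noteq> []" using False that by blast
   show ?thesis by (rule Fcs_len1[where \<phi> = "\<lambda>u. frag_of (m, u)", OF S fV w \<open>w \<noteq> []\<close> *])
  qed
  moreover have "Fs ?ff w (\<lambda>u. frag_of (m, u)) - frag_of (m, map (\<lambda>l. ?ff [l]) w) \<in> Ker K ?B"
   by (rule Fs_len1[where \<phi> = "\<lambda>u. frag_of (m, u)", OF S fV w *])
  ultimately show ?thesis by (simp add: Ph_def)
 qed
qed

end

context
 fixes K :: "('k, 'r) ring_scheme" and A :: "('k, 'a) ainf" and B :: "('k, 'b) ainf" and f :: "('k, 'a, 'b) ainf_maps"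
 assumes K: "cring K" and A: "is_ainf K A" and B: "is_ainf K B" and f: "is_ainf_mor K A B f"
begin

lemma flet_V: "y \<in> lists (Vl (amod A)) \<Longrightarrow> y \<noteq> [] \<Longrightarrow> flet K A B f y \<in> Vl (amod B)"
 using slet_closed[where A = "amod A" and B = "amod B", OF K is_ainfD(1)[OF A] is_ainfD(1)[OF B] mor_ops_lin[OF f]] .

lemma Ph_lwl: "lwl K (amod A) (tpow K (amod B) n p) (EV K (amod B) m n p) (\<lambda>w. Ph K A B f (m', w))"
proof -
 let ?B = "amod B"
 note mA = is_ainfD(1)[OF A] and mB = is_ainfD(1)[OF B]
 have \<phi>: "lwl K ?B (tpow K ?B n p) (EV K ?B m n p) (\<lambda>u. frag_of (m', u))"
  unfolding lwl_def by (intro ballI allI EV_letter_lin[where A = "?B", OF K mB])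
 note fl = slet_lin_let[where A = "amod A" and B = "?B", OF K mA mB mor_ops_lin[OF f]]
 have "lwl K (amod A) (tpow K ?B n p) (EV K ?B m n p) (\<lambda>w. Fcs (flet K A B f) w (\<lambda>u. frag_of (m', u)))"
  by (rule lwl_Fcs[where A = "amod A" and B = "?B", OF mA tpow_module[OF K mB] EVh[OF K B] flet_V fl \<phi>])
 moreover have "lwl K (amod A) (tpow K ?B n p) (EV K ?B m n p) (\<lambda>w. Fs (flet K A B f) w (\<lambda>u. frag_of (m', u)))"
  by (rule lwl_Fs[where A = "amod A" and B = "?B", OF mA tpow_module[OF K mB] EVh[OF K B] flet_V fl \<phi>])
 ultimately show ?thesis by (cases "even m'") (simp_all add: Ph_def)
qed

lemma Ph_Nil: "n > 0 \<Longrightarrow> EV K (amod B) m n p (Ph K A B f (m', [])) = \<zero>\<^bsub>tpow K (amod B) n p\<^esub>"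
 using frag_Nil_Ker[OF K A B flet_V, of m'] fhom_zero[OF tpow_module[OF K is_ainfD(1)[OF B]] EVh[OF K B]]
 by (simp add: Ph_def Ker_def)

lemma mor_rel: "ainf_mor_rel (mlet K A) (Vl (amod A)) (Zl (amod A)) (mlet K B) (Vl (amod B)) (Zl (amod B)) (flet K A B f)"
 by (intro ainf_mor_rel.intro[OF m_rel[OF K A] m_rel[OF K B] slet_f_degree] ainf_mor_rel_axioms.intro flet_V rel_f_Zl[OF K A B f])

text \<open>The vertical maps commute modulo \<open>Ker\<close>. The horizontal ones commute
  exactly, except on the empty word in odd columns, where the defect is up to sign the empty word
  and lies in \<open>Ker\<close>.\<close>

lemma Ph_Dk:
 assumes "x \<in> FN (amod A) N"
 shows "frag_extend (Ph K A B f) (frag_extend (Dk K A) x) - frag_extend (Dk K B) (frag_extend (Ph K A B f) x) \<in> Ker K (amod B)"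
 unfolding frag_extend_comp frag_extend_diff_fun
proof (rule FN_extend_mem[OF Ker_S[OF K B] assms])
 let ?DB = "frag_extend (Dk K B)"
 note S = Ker_S[OF K B]
 note mm = mult_mod_of[where A = "amod B", OF K is_ainfD(1)[OF B]]
 fix m w assume w: "w \<in> lists (Vl (amod A))"
 let ?f = "flet K A B f" and ?mA = "mlet K A" and ?mB = "mlet K B"
 interpret ainf_mor_rel ?mA "Vl (amod A)" "Zl (amod A)" ?mB "Vl (amod B)" "Zl (amod B)" ?f by (rule mor_rel)
 let ?\<phi> = "\<lambda>m u. frag_of (m, u)" and ?P = "frag_extend (Ph K A B f)"
 have Pe: "even m \<Longrightarrow> Ph K A B f (m, u) = Fcs ?f u (?\<phi> m)" and Po: "odd m \<Longrightarrow> Ph K A B f (m, u) = Fs ?f u (?\<phi> m)" for m u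
  by (simp_all add: Ph_def)
 show "(?P \<circ> Dk K A) (m, w) - (?DB \<circ> Ph K A B f) (m, w) \<in> Ker K (amod B)"
 proof (cases "even m")
  case True
  show ?thesis
  proof (cases "m = 0")
   case True
   then show ?thesis
    using bs_Fcs[OF S mm w] by (simp add: Dk_even[OF K A] Dk_even[OF K B] Pe frag_extend_hom[OF K A] frag_extend_Fs)
  next
   case False
   then have o: "odd (m - 1)" using True by simp
   have "(?P \<circ> Dk K A) (m, w) = bs ?mA w (\<lambda>u. Fcs ?f u (?\<phi> m)) + Ns w (\<lambda>u. Fs ?f u (?\<phi> (m - 1)))"
    unfolding o_def Dk_even[OF K A True, of w] if_not_P[OF False] frag_extend_add frag_extend_hom[OF K A] frag_extend_of Pe[OF True] Po[OF o] ..
   moreover have "(?DB \<circ> Ph K A B f) (m, w) = Fcs ?f w (\<lambda>u. bs ?mB u (?\<phi> m)) + Fcs ?f w (\<lambda>u. Ns u (?\<phi> (m - 1)))"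
    unfolding o_def Pe[OF True] frag_extend_Fs frag_extend_of Dk_even[OF K B True] if_not_P[OF False] Fcs_add ..
   ultimately show ?thesis using bs_Fcs[OF S mm w, of m] unfolding Fcs_N by simp
  qed
 next
  case False
  then have e: "even (m - 1)" by (cases m) auto
  have 1: "(?P \<circ> Dk K A) (m, w) = Fcs ?f w (?\<phi> (m - 1)) - Ts w (\<lambda>u. Fcs ?f u (?\<phi> (m - 1))) - Bs ?mA w (\<lambda>u. Fs ?f u (?\<phi> m))"
   unfolding o_def Dk_odd[OF K A False, of w] frag_extend_diff frag_extend_hom[OF K A] frag_extend_of Pe[OF e] Po[OF False] ..
  have 2: "(?DB \<circ> Ph K A B f) (m, w) = Fs ?f w (?\<phi> (m - 1)) - Fs ?f w (\<lambda>u. Ts u (?\<phi> (m - 1))) - Fs ?f w (\<lambda>u. Bs ?mB u (?\<phi> m))"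
   unfolding o_def Po[OF False] frag_extend_Fs frag_extend_of Dk_odd[OF K B False] Fs_diff ..
  have "Fcs ?f w (?\<phi> (m - 1)) - Ts w (\<lambda>u. Fcs ?f u (?\<phi> (m - 1))) - (Fs ?f w (?\<phi> (m - 1)) - Fs ?f w (\<lambda>u. Ts u (?\<phi> (m - 1)))) \<in> Ker K (amod B)"
  proof (cases "w = []")
   case True
   then show ?thesis using subgrp.minus[OF S frag_Nil_Ker[OF K A B flet_V]] by simp
  next
   case False
   then show ?thesis using Fcs_T[OF False, of "?\<phi> (m - 1)"] subgrp.zero[OF S] by simp
  qed
  from subgrp.diff[OF S this Bs_Fs[OF S mm w, of m]] show ?thesis
   unfolding 1 2 by (simp add: algebra_simps)
 qed
qed

lemma Ph_hcx_map: "hcx_map K (FN (amod A)) (Ker K (amod A)) (frag_extend (Dk K A)) (\<lambda>c. frag_extend (sck A c)) (cl K A) (HC K A)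
  (FN (amod B)) (Ker K (amod B)) (frag_extend (Dk K B)) (\<lambda>c. frag_extend (sck B c)) (cl K B) (HC K B) (frag_extend (Ph K A B f))"
proof (intro hcx_map.intro HC_hcx K A B hcx_map_axioms.intro)
 let ?TB = "tpow K (amod B)" and ?EB = "EV K (amod B)" and ?Pf = "frag_extend (Ph K A B f)"
 note mA = is_ainfD(1)[OF A] and mB = is_ainfD(1)[OF B]
 show "additive_fun ?Pf" by (rule additive_frag_extend)
 fix x N assume x: "x \<in> FN (amod A) N"
 show "?Pf x \<in> FN (amod B) N" by (rule Ph_FN[OF K A B flet_V x])
 show "?Pf (frag_extend (Dk K A) x) - frag_extend (Dk K B) (?Pf x) \<in> Ker K (amod B)"
  by (rule Ph_Dk[OF x])
 show "?Pf x \<in> Ker K (amod B)" if "x \<in> Ker K (amod A)"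
  unfolding Ker_def
  using lwl_Ker[where A = "amod A", OF K mA tpow_module[OF K mB] EVh[OF K B] Ph_lwl Ph_Nil x that] by blast
 fix e assume e: "e \<in> carrier K"
 have "?EB m n p (?Pf (frag_extend (sck A e) x) - frag_extend (sck B e) (?Pf x)) = \<zero>\<^bsub>?TB n p\<^esub>"
  if n: "n > 0" for m n p
 proof -
  interpret T: module K "?TB n p" by (rule tpow_module[OF K mB])
  have "?EB m n p (?Pf (frag_extend (sck A e) x)) = e \<odot>\<^bsub>?TB n p\<^esub> ?EB m n p (?Pf x)"
   by (rule lwl_sc[where A = "amod A", OF K mA tpow_module[OF K mB] EVh[OF K B] Ph_lwl Ph_Nil[OF n] x e A refl])
  moreover have "?EB m n p (frag_extend (sck B e) (?Pf x)) = e \<odot>\<^bsub>?TB n p\<^esub> ?EB m n p (?Pf x)"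
   by (rule EV_sck[OF K B e Ph_FN[OF K A B flet_V x] n])
  moreover have "?EB m n p (?Pf x) \<in> carrier (?TB n p)"
   by (rule fhomD(1)[OF EVh[OF K B]])
  ultimately show ?thesis
   using e by (simp add: fhom_diff[OF tpow_module[OF K mB] EVh[OF K B]] T.minus_eq T.r_neg)
 qed
 then show "?Pf (frag_extend (sck A e) x) - frag_extend (sck B e) (?Pf x) \<in> Ker K (amod B)"
  by (simp add: Ker_def)
qed

end

section \<open>The induced maps of composites, identities and strict morphisms\<close>

lemma ainf_comp_closed:
 assumes K: "cring K" and A: "\<And>q. module K (amod A q)" and B: "\<And>q. module K (amod B q)" and C: "\<And>q. module K (amod C q)"
  and f: "ops_lin K (amod A) (amod B) 0 f" and g: "ops_lin K (amod B) (amod C) 0 g"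
  and X: "X \<in> carrier (tpow K (amod A) (Suc N) p)"
 shows "ainf_comp K A B C g f N p X \<in> carrier (amod C (p + int N))"
proof -
 interpret Cq: module K "amod C (p + int N)" by (rule C)
 have "g r (p + int (N - r)) (tmap K (amod A) (amod B) (map (mor_gmap f) ns) p X) \<in> carrier (amod C (p + int N))"
  if "r \<le> N" "ns \<in> J_tuples (Suc r) (N - r)" for r ns
 proof -
  have "lin_on K (tpow K (amod B) (Suc r) (p + int (N - r))) (amod C (p + int (N - r) + int r - 0)) (g r (p + int (N - r)))"
   using g unfolding ops_lin_def by blast
  from lin_onD(1)[OF this tmap_mor_closed[OF K A B f X that(2,1)]]
  have "g r (p + int (N - r)) (tmap K (amod A) (amod B) (map (mor_gmap f) ns) p X) \<in> carrier (amod C (p + int (N - r) + int r - 0))" .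
  moreover have "p + int (N - r) + int r - 0 = p + int N" using that by simp
  ultimately show ?thesis by (simp only:)
 qed
 then show ?thesis
  using X by (auto simp: ainf_comp_def Let_def intro!: Cq.finsum_closed sgn_mult_closed[OF C])
qed

context
 fixes K :: "('k, 'r) ring_scheme" and A :: "('k, 'a) ainf" and B :: "('k, 'b) ainf" and C :: "('k, 'c) ainf"
  and f :: "('k, 'a, 'b) ainf_maps" and g :: "('k, 'b, 'c) ainf_maps"
 assumes K: "cring K" and A: "is_ainf K A" and B: "is_ainf K B" and C: "is_ainf K C"
  and f: "is_ainf_mor K A B f" and g: "is_ainf_mor K B C g"
begin

lemma comp_V:
 assumes y: "y \<in> lists (Vl (amod A))" "y \<noteq> []"
 shows "flet K A C (ainf_comp K A B C g f) y \<in> Vl (amod C)"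
proof -
 obtain N where N: "length y = Suc N" using y by (cases y) auto
 have "pure K (amod A) y \<in> carrier (tpow K (amod A) (Suc N) (wdeg y))"
  using y N by (intro pure_closed[OF K is_ainfD(1)[OF A]]) (simp add: words_iff)
 from ainf_comp_closed[where A = A and B = B and C = C, OF K is_ainfD(1)[OF A] is_ainfD(1)[OF B] is_ainfD(1)[OF C] mor_ops_lin[OF f] mor_ops_lin[OF g] this]
 show ?thesis
  using N sgn_mult_closed[OF is_ainfD(1)[OF C]] by (simp add: slet_def Let_def)
qed

lemma Ph_comp:
 assumes x: "x \<in> FN (amod A) N"
 shows "frag_extend (Ph K A C (ainf_comp K A B C g f)) x - frag_extend (Ph K B C g) (frag_extend (Ph K A B f) x) \<in> Ker K (amod C)"
 unfolding frag_extend_comp frag_extend_diff_fun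
proof (rule FN_extend_mem[OF Ker_S[OF K C] x])
 note mA = is_ainfD(1)[OF A] and mB = is_ainfD(1)[OF B] and mC = is_ainfD(1)[OF C]
 note S = Ker_S[OF K C]
 note mm = mult_mod_of[where A = "amod C", OF K mC]
 interpret comp_rel "flet K A B f" "flet K B C g" "flet K A C (ainf_comp K A B C g f)" "Vl (amod A)" "Vl (amod B)" "Vl (amod C)" "Zl (amod C)"
  by (intro comp_rel.intro slet_f_degree comp_rel_axioms.intro flet_V[OF K A B f] flet_V[OF K B C g] comp_V
    rel_k_Zl[where A = A and B = B and C = C, OF K mA mB mC mor_ops_lin[OF f] mor_ops_lin[OF g]])
 fix m w assume w: "w \<in> lists (Vl (amod A))"
 show "Ph K A C (ainf_comp K A B C g f) (m, w) - (frag_extend (Ph K B C g) \<circ> Ph K A B f) (m, w) \<in> Ker K (amod C)"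
  using Fs_comp[OF S mm w, of m] Fcs_comp[OF S mm w, of m] by (cases "even m") (simp_all add: Ph_def frag_extend_Fs)
qed

end

text \<open>Written with an explicit choice of a cycle, so that it is a global constant; for a
  morphism \<open>HCm_imap\<close> identifies it with \<open>imap\<close>.\<close>

definition HCm :: "('k, 'r) ring_scheme \<Rightarrow> ('k, 'a) ainf \<Rightarrow> ('k, 'b) ainf \<Rightarrow> ('k, 'a, 'b) ainf_maps \<Rightarrow> int \<Rightarrow> ('k, 'a) hc \<Rightarrow> ('k, 'b) hc" where
 "HCm K A B f N = (\<lambda>X\<in>carrier (HC K A N). cl K B N (frag_extend (Ph K A B f) (SOME x. x \<in> cyc K A N \<and> cl K A N x = X)))"

lemma HC_repr:
 assumes "cring K" "is_ainf K A" "X \<in> carrier (HC K A N)"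
 shows "(SOME x. x \<in> cyc K A N \<and> cl K A N x = X) \<in> cyc K A N" "cl K A N (SOME x. x \<in> cyc K A N \<and> cl K A N x = X) = X"
proof -
 have "\<exists>x. x \<in> cyc K A N \<and> cl K A N x = X" using HC_carrier[OF assms(1,2), of X N] assms(3) by auto
 from someI_ex[OF this] show "(SOME x. x \<in> cyc K A N \<and> cl K A N x = X) \<in> cyc K A N" "cl K A N (SOME x. x \<in> cyc K A N \<and> cl K A N x = X) = X"
  by blast+
qed

lemma cyc_Z: "cring K \<Longrightarrow> is_ainf K A \<Longrightarrow> cyc K A N = hcx.Z (FN (amod A)) (Ker K (amod A)) (frag_extend (Dk K A)) N"
 by (simp add: cyc_def hcx.Z_def[OF HC_hcx])

lemma cl_cong:
 assumes K: "cring K" and A: "is_ainf K A" and "x \<in> cyc K A N" "y \<in> FN (amod A) N" "y - x \<in> Ker K (amod A)"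
 shows "y \<in> cyc K A N" "cl K A N y = cl K A N x"
proof -
 interpret hcx K "FN (amod A)" "Ker K (amod A)" "frag_extend (Dk K A)" "\<lambda>c. frag_extend (sck A c)" "cl K A" "HC K A"
  by (rule HC_hcx[OF K A])
 have x: "x \<in> Z N" using assms(3) by (simp add: cyc_Z[OF K A])
 have "y - x \<in> Z N" using assms x by (intro Z_Kr subgrp.diff[OF F]) (auto simp: Z_def)
 then have y: "y \<in> Z N" using Z_add[OF x, of "y - x"] by simp
 then show "y \<in> cyc K A N" by (simp add: cyc_Z[OF K A])
 show "cl K A N y = cl K A N x" by (rule c_eq_Kr[OF y x assms(5)])
qed

context
 fixes K :: "('k, 'r) ring_scheme" and A :: "('k, 'a) ainf" and B :: "('k, 'b) ainf" and f :: "('k, 'a, 'b) ainf_maps"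
 assumes K: "cring K" and A: "is_ainf K A" and B: "is_ainf K B" and f: "is_ainf_mor K A B f"
begin

interpretation hcx_map K "FN (amod A)" "Ker K (amod A)" "frag_extend (Dk K A)" "\<lambda>c. frag_extend (sck A c)" "cl K A" "HC K A"
  "FN (amod B)" "Ker K (amod B)" "frag_extend (Dk K B)" "\<lambda>c. frag_extend (sck B c)" "cl K B" "HC K B" "frag_extend (Ph K A B f)"
 by (rule Ph_hcx_map[OF K A B f])

lemma HCm_imap: "HCm K A B f N = imap N"
 unfolding HCm_def imap_def cyc_Z[OF K A] ..

lemma HCm_lin: "HCm K A B f N \<in> lin_maps K (HC K A N) (HC K B N)"
 unfolding HCm_imap by (rule imap_lin)

lemma HCm_cl: "x \<in> cyc K A N \<Longrightarrow> HCm K A B f N (cl K A N x) = cl K B N (frag_extend (Ph K A B f) x)"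
 unfolding HCm_imap cyc_Z[OF K A] by (rule imap_c)

lemma Ph_cyc: "x \<in> cyc K A N \<Longrightarrow> frag_extend (Ph K A B f) x \<in> cyc K B N"
 unfolding cyc_Z[OF K A] cyc_Z[OF K B] by (rule op_Z)

end

lemma HCm_comp:
 assumes K: "cring K" and A: "is_ainf K A" and B: "is_ainf K B" and C: "is_ainf K C"
  and f: "is_ainf_mor K A B f" and g: "is_ainf_mor K B C g"
 shows "HCm K A C (ainf_comp K A B C g f) N = compose (carrier (HC K A N)) (HCm K B C g N) (HCm K A B f N)"
proof (rule extensionalityI)
 let ?u = "ainf_comp K A B C g f"
 show "HCm K A C ?u N \<in> extensional (carrier (HC K A N))" by (simp add: HCm_def)
 fix X assume X: "X \<in> carrier (HC K A N)"
 define x where "x = (SOME x. x \<in> cyc K A N \<and> cl K A N x = X)"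
 have x: "x \<in> cyc K A N" "cl K A N x = X" unfolding x_def by (rule HC_repr[OF K A X])+
 have xF: "x \<in> FN (amod A) N" using x by (simp add: cyc_def[OF K A])
 note fx = Ph_cyc[OF K A B f x(1)]
 have "HCm K A C ?u N X = cl K C N (frag_extend (Ph K A C ?u) x)"
  using X by (simp add: HCm_def x_def)
 also have "\<dots> = cl K C N (frag_extend (Ph K B C g) (frag_extend (Ph K A B f) x))"
  by (rule cl_cong(2)[OF K C Ph_cyc[OF K B C g fx] Ph_FN[OF K A C comp_V[OF K A B C f g] xF] Ph_comp[OF K A B C f g xF]])
 also have "\<dots> = HCm K B C g N (HCm K A B f N X)"
  using HCm_cl[OF K A B f x(1)] HCm_cl[OF K B C g fx] x(2) by simp
 finally show "HCm K A C ?u N X = compose (carrier (HC K A N)) (HCm K B C g N) (HCm K A B f N) X"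
  using X by (simp add: compose_def)
qed simp

lemma flet_single: "flet K A B f [(q, a)] = (q, f 0 q (pure K (amod A) [(q, a)]))"
 by (simp add: slet_def Let_def)

lemma ainf_id_ops: 
 assumes K: "cring K" and A: "is_ainf K A"
 shows "ops_lin K (amod A) (amod A) 0 (ainf_id K A)"
 unfolding ops_lin_def
proof (intro allI)
 note mA = is_ainfD(1)[OF A]
 fix r p
 interpret T: module K "tpow K (amod A) (Suc r) p" by (rule tpow_module[OF K mA])
 show "lin_on K (tpow K (amod A) (Suc r) p) (amod A (p + int r - 0)) (ainf_id K A r p)"
 proof (cases "r = 0")
  case True
  have "fst (id_gmap K (amod A)) = 1" "fst (snd (id_gmap K (amod A))) = 0" by (simp_all add: id_gmap_def)
  then show ?thesis using True id_gmap_lin[where A = "amod A", OF K mA] by (simp add: ainf_id_def[abs_def] gm_lin_def)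
 next
  case False
  show ?thesis
   by (rule lin_on_congI[OF T.module_axioms lin_on_zero_fun[OF T.module_axioms mA]]) (use False in \<open>simp add: ainf_id_def\<close>)
 qed
qed

lemma flet_strict:
 assumes K: "cring K" and A: "is_ainf K A" and B: "is_ainf K B"
  and z: "\<And>n p X. n \<ge> 1 \<Longrightarrow> X \<in> carrier (tpow K (amod A) (n + 1) p) \<Longrightarrow> f n p X = \<zero>\<^bsub>amod B (p + int n)\<^esub>"
  and y: "y \<in> lists (Vl (amod A))" "length y \<ge> 2"
 shows "snd (flet K A B f y) = \<zero>\<^bsub>amod B (fst (flet K A B f y))\<^esub>"
proof -
 obtain n where n: "length y = Suc n" "n \<ge> 1" using y by (cases "length y") auto
 have "pure K (amod A) y \<in> carrier (tpow K (amod A) (n + 1) (wdeg y))"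
  using y n by (intro pure_closed[OF K is_ainfD(1)[OF A]]) (simp add: words_iff)
 from z[OF n(2) this] show ?thesis
  using n sgn_mult_zero[OF is_ainfD(1)[OF B]] by (simp add: slet_def Let_def)
qed

text \<open>The identity has zero higher components and fixes single letters, so by
  \<open>Ph_strict\<close> it fixes every word up to \<open>Ker\<close>.\<close>

lemma HCm_id:
 assumes K: "cring K" and A: "is_ainf K A"
 shows "HCm K A A (ainf_id K A) N = (\<lambda>X\<in>carrier (HC K A N). X)"
proof (rule extensionalityI)
 note mA = is_ainfD(1)[OF A]
 note V = slet_closed[where A = "amod A" and B = "amod A", OF K mA mA ainf_id_ops[OF K A]]
 show "HCm K A A (ainf_id K A) N \<in> extensional (carrier (HC K A N))" by (simp add: HCm_def)
 fix X assume X: "X \<in> carrier (HC K A N)"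
 define x where "x = (SOME x. x \<in> cyc K A N \<and> cl K A N x = X)"
 have x: "x \<in> cyc K A N" "cl K A N x = X" unfolding x_def by (rule HC_repr[OF K A X])+
 have xF: "x \<in> FN (amod A) N" using x by (simp add: cyc_def[OF K A])
 have "frag_extend (Ph K A A (ainf_id K A)) x - frag_extend frag_of x \<in> Ker K (amod A)"
  unfolding frag_extend_diff_fun
 proof (rule FN_extend_mem[OF Ker_S[OF K A] xF])
  fix m w assume w: "w \<in> lists (Vl (amod A))"
  have "flet K A A (ainf_id K A) [l] = l" if "l \<in> set w" for l
   using w that id_gmap_pure[where A = "amod A", OF K mA] by (cases l) (auto simp: flet_single ainf_id_def in_lists_conv_set)
  then have "map (\<lambda>l. flet K A A (ainf_id K A) [l]) w = w" by (simp add: map_idI)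
  with Ph_strict[OF K A A V flet_strict[OF K A A] w, of m]
  show "Ph K A A (ainf_id K A) (m, w) - frag_of (m, w) \<in> Ker K (amod A)" by (simp add: ainf_id_def)
 qed
 then have "frag_extend (Ph K A A (ainf_id K A)) x - x \<in> Ker K (amod A)" by (simp add: frag_expansion[symmetric])
 from cl_cong(2)[OF K A x(1) Ph_FN[OF K A A V xF] this]
 show "HCm K A A (ainf_id K A) N X = (\<lambda>X\<in>carrier (HC K A N). X) X"
  using X x by (simp add: HCm_def x_def[symmetric])
qed simp

text \<open>On a word both chain maps apply f_0 letter by letter: components of degree 0 produce no
  Koszul signs and leave the twist \<open>th\<close> unchanged.\<close>

lemma HCm_strict:
 assumes K: "cring K" and A: "is_ainf K A" and B: "is_ainf K B" and f: "strict_mor K A B f"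
  and z: "z \<in> cycles (cyc_module K A) N"
 shows "HCm K A B f N (hclass (cyc_module K A) N z) = hclass (cyc_module K B) N (strict_chain_map K A B f N z)"
proof -
 let ?EA = "EV K (amod A)" and ?EB = "EV K (amod B)" and ?Pf = "frag_extend (Ph K A B f)" and ?tm = "tmap K (amod A) (amod B)" and ?A = "amod A" and ?B = "amod B"
 note mA = is_ainfD(1)[OF A] and mB = is_ainfD(1)[OF B]
 have fm: "is_ainf_mor K A B f" and f0: "\<And>n p X. n \<ge> 1 \<Longrightarrow> X \<in> carrier (tpow K ?A (n + 1) p) \<Longrightarrow> f n p X = \<zero>\<^bsub>?B (p + int n)\<^esub>"
  using f by (auto simp: strict_mor_def)
 note V = flet_V[OF K A B fm]
 have "z \<in> carrier (Tot (cyc_module K A) N)" using z by (simp add: cycles_def)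
 then obtain x where x: "x \<in> FN ?A N" "tot K A N x = z" using tot_surj[OF K A] by blast
 have xc: "x \<in> cyc K A N" using cycles_iff[OF K A x(1)] z x(2) by simp
 let ?f = "\<lambda>l. flet K A B f [l]"
 have comp: "?EB m (Suc k) p (?Pf x)
   = ?tm (replicate (Suc k) (mor_gmap f 0)) p (?EA m (Suc k) p x)" for m k p
 proof -
  let ?\<Phi> = "replicate (Suc k) (mor_gmap f 0)" and ?TB = "tpow K ?B (Suc k) p"
  have gl: "list_all (gm_lin K ?A ?B) ?\<Phi>"
   using is_ainf_morD(1)[OF fm, of 0] by (auto simp: list_all_iff gm_lin_def mor_gmap_def)
  have s: "sum_list (map fst (replicate n (mor_gmap f 0))) = n" "sum_list (map (fst \<circ> snd) (replicate n (mor_gmap f 0))) = 0" for n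
   by (induction n) (auto simp: mor_gmap_def)
  have tl: "lin_on K (tpow K ?A (Suc k) p) ?TB (?tm ?\<Phi> p)"
   using tmap_lin[where A = "?A" and B = "?B", OF K mA mB gl, of p] unfolding s by simp
  have tw: "tmap_word K ?A (replicate (length w) (mor_gmap f 0)) w = map ?f w" "koszul_exp (replicate (length w) (mor_gmap f 0)) w = 0" for w
  proof -
   have "tmap_word K ?A (mor_gmap f 0 # \<Phi>) (l # v) = ?f l # tmap_word K ?A \<Phi> v" for \<Phi> l v
    by (cases l) (simp add: mor_gmap_def flet_single)
   then show "tmap_word K ?A (replicate (length w) (mor_gmap f 0)) w = map ?f w"
    by (induction w) auto
   have "koszul_exp (mor_gmap f 0 # replicate n (mor_gmap f 0)) (l # v) = koszul_exp (replicate n (mor_gmap f 0)) v" for n l v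
    using s(2)[of n] by (simp add: mor_gmap_def)
   then show "koszul_exp (replicate (length w) (mor_gmap f 0)) w = 0"
    by (induction w) auto
  qed
  show ?thesis
  proof (rule fhom_ext[where h = "\<lambda>x. ?EB m (Suc k) p (?Pf x)"
     and h' = "\<lambda>x. ?tm ?\<Phi> p (?EA m (Suc k) p x)", OF tpow_module[OF K mB]])
   show "fhom ?TB (\<lambda>x. ?EB m (Suc k) p (?Pf x))"
    by (rule fhom_frag_extend[OF tpow_module[OF K mB] EVh[OF K B]])
   show "fhom ?TB (\<lambda>x. ?tm ?\<Phi> p (?EA m (Suc k) p x))"
    by (rule fhom_lin[OF EVh[OF K A] tl])
   show "Poly_Mapping.keys x \<subseteq> vk ?A N" using x by (simp add: FN_def)
   fix s assume sv: "s \<in> vk ?A N"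
   obtain m' w where mw: "s = (m', w)" by (cases s)
   have w: "w \<in> lists (Vl ?A)" using sv by (simp add: mw vk_def)
   have fw: "map ?f w \<in> lists (Vl ?B)" using w V by (auto simp: in_lists_conv_set)
   have fd: "fst (?f l) = fst l" for l by (cases l) (simp add: flet_single)
   have wd: "wdeg (map ?f v) = wdeg v" for v by (induction v) (auto simp: fd)
   have thf: "th (map ?f v) = th v" for v by (induction v) (auto simp: wd)
   have TBm: "module K ?TB" by (rule tpow_module[OF K mB])
   interpret TB: module K ?TB by (rule TBm)
   have "Ph K A B f (m', w) - frag_of (m', map ?f w) \<in> Ker K ?B"
    by (rule Ph_strict[OF K A B V flet_strict[OF K A B f0] w])
   then have "?EB m (Suc k) p (Ph K A B f (m', w)) \<ominus>\<^bsub>?TB\<^esub> ?EB m (Suc k) p (frag_of (m', map ?f w)) = \<zero>\<^bsub>?TB\<^esub>"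
    unfolding fhom_diff[OF TBm EVh[OF K B], symmetric] by (simp add: Ker_def)
   then have e: "?EB m (Suc k) p (Ph K A B f (m', w)) = ?EB m (Suc k) p (frag_of (m', map ?f w))"
    using minus_zero_iff[OF TBm fhomD(1)[OF EVh[OF K B]] fhomD(1)[OF EVh[OF K B]]] by simp
   show "?EB m (Suc k) p (?Pf (frag_of s)) = ?tm ?\<Phi> p (?EA m (Suc k) p (frag_of s))"
   proof (cases "m' = m \<and> w \<in> words ?A (Suc k) p")
    case True
    then have lw: "length w = Suc k" "wdeg w = p" by (auto simp: words_iff)
    have fww: "map ?f w \<in> words ?B (Suc k) p" using fw lw wd by (simp add: words_iff)
    have ww: "w \<in> words ?A (Suc k) p" using True by blast
    have "?tm ?\<Phi> p (pure K ?A w) = pure K ?B (map ?f w)"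
     using tmap_pure[where A = "?A" and B = "?B" and p = p and w = w, OF K mA mB gl] ww lw tw[of w] s[of "Suc k"]
     by simp
    moreover have "m' = m" using True by blast
    ultimately show ?thesis
     using lin_on_sgn_mult[OF tpow_module[OF K mA] TBm tl pure_closed[where A = "?A", OF K mA ww]] fww
     by (simp add: mw e[unfolded \<open>m' = m\<close>] EVof[OF K A ww] EVof[OF K B fww] thf)
   next
    case False
    then have "?EA m (Suc k) p (frag_of s) = \<zero>\<^bsub>tpow K ?A (Suc k) p\<^esub>"
     unfolding mw by (intro EVof0[OF K A]) auto
    moreover have "?EB m (Suc k) p (frag_of (m', map ?f w)) = \<zero>\<^bsub>?TB\<^esub>"
     using False w by (intro EVof0[OF K B]) (auto simp: words_iff wd)
    ultimately show ?thesis
     using lin_on_zero[OF tpow_module[OF K mA] TBm tl] by (simp add: mw e)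
   qed
  qed
 qed
 have "tot K B N (?Pf x) = strict_chain_map K A B f N z"
  unfolding tot_def strict_chain_map_def x(2)[symmetric] by (intro restrict_ext) (simp add: comp)
 then show ?thesis
  using HCm_cl[OF K A B fm xc] x(2) by (simp add: cl_def[OF K A] cl_def[OF K B])
qed

section \<open>Homotopies on words\<close>

lemma lsum_hom: "additive_fun h \<Longrightarrow> h (lsum \<psi> w) = lsum (\<lambda>x l z. h (\<psi> x l z)) w"
 by (induction w arbitrary: \<psi>) (auto simp: additive_fun.zero additive_fun.add)

lemma lsum_add: "lsum (\<lambda>x l z. \<psi> x l z + \<psi>' x l z) w = lsum \<psi> w + lsum \<psi>' w"
 by (induction w arbitrary: \<psi> \<psi>') (auto simp: algebra_simps)

lemma lsum_append: "lsum \<psi> (Z @ X) = lsum (\<lambda>x l z. \<psi> x l (z @ X)) Z + lsum (\<lambda>x l z. \<psi> (Z @ x) l z) X"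
 by (induction Z arbitrary: \<psi>) (auto simp: algebra_simps)

lemma lsum_mem: "subgrp S \<Longrightarrow> (\<And>x l z. x @ l # z = w \<Longrightarrow> \<psi> x l z \<in> S) \<Longrightarrow> lsum \<psi> w \<in> S"
 by (induction w arbitrary: \<psi>) (auto simp: subgrp.zero intro!: subgrp.add)

text \<open>The tensor differential in suspended degrees: \<open>Bs\<close> with blocks of one
  letter only.\<close>

definition dsw :: "(int \<times> 'a \<Rightarrow> int \<times> 'a) \<Rightarrow> 'a word \<Rightarrow> ('a word \<Rightarrow> 'g::ab_group_add) \<Rightarrow> 'g" where
 "dsw d w \<phi> = lsum (\<lambda>x l z. sgx (wd x) (\<phi> (x @ d l # z))) w"

text \<open>The usual homotopy on a tensor power between the identity and the tensor power of
  \<open>u\<close>: identities in front of \<open>h\<close>, copies of \<open>u\<close> behind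
  it.\<close>

definition Hs :: "(int \<times> 'a \<Rightarrow> int \<times> 'a) \<Rightarrow> (int \<times> 'a \<Rightarrow> int \<times> 'a) \<Rightarrow> 'a word \<Rightarrow> ('a word \<Rightarrow> 'g::ab_group_add) \<Rightarrow> 'g" where
 "Hs h u w \<phi> = lsum (\<lambda>x l z. sgx (wd x) (\<phi> (x @ h l # map u z))) w"

lemma lsum_sgx_Cons: "lsum (\<lambda>x l z. sgx (wd (a # x)) (\<psi> x l z)) v = sgx (fst a + 1) (lsum (\<lambda>x l z. sgx (wd x) (\<psi> x l z)) v)"
 by (simp add: lsum_hom[OF additive_sgx'])

lemma dsw_simps:
 "dsw d [] \<phi> = 0" "dsw d (a # v) \<phi> = \<phi> (d a # v) + sgx (fst a + 1) (dsw d v (\<lambda>t. \<phi> (a # t)))"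
 unfolding dsw_def using lsum_sgx_Cons[of a "\<lambda>x l z. \<phi> (a # x @ d l # z)" v] by simp_all

lemma Hs_simps:
 "Hs h u [] \<phi> = 0" "Hs h u (a # v) \<phi> = \<phi> (h a # map u v) + sgx (fst a + 1) (Hs h u v (\<lambda>t. \<phi> (a # t)))"
 unfolding Hs_def using lsum_sgx_Cons[of a "\<lambda>x l z. \<phi> (a # x @ h l # map u z)" v] by simp_all

lemma dsw_hom: "additive_fun k \<Longrightarrow> k (dsw d w \<phi>) = dsw d w (\<lambda>t. k (\<phi> t))"
 by (simp add: dsw_def lsum_hom additive_sgx)

lemma Hs_hom: "additive_fun k \<Longrightarrow> k (Hs h u w \<phi>) = Hs h u w (\<lambda>t. k (\<phi> t))"
 by (simp add: Hs_def lsum_hom additive_sgx)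

lemma dsw_add: "dsw d w (\<lambda>t. \<phi> t + \<psi> t) = dsw d w \<phi> + dsw d w \<psi>"
 by (simp add: dsw_def sgx_add lsum_add)

lemma Hs_add: "Hs h u w (\<lambda>t. \<phi> t + \<psi> t) = Hs h u w \<phi> + Hs h u w \<psi>"
 by (simp add: Hs_def sgx_add lsum_add)

lemma Hs_diff: "Hs h u w (\<lambda>t. \<phi> t - \<psi> t) = Hs h u w \<phi> - Hs h u w \<psi>"
 using Hs_add[of h u w \<phi> "\<lambda>t. - \<psi> t"] Hs_hom[OF additive_uminus, of h u w \<psi>] by simp

lemma dsw_map:
 assumes "\<And>l. l \<in> V \<Longrightarrow> fst (u l) = fst l" "\<And>l. l \<in> V \<Longrightarrow> u (d l) = d (u l)"
 shows "w \<in> lists V \<Longrightarrow> dsw d (map u w) \<phi> = dsw d w (\<lambda>t. \<phi> (map u t))"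
proof (induction w arbitrary: \<phi>)
 case (Cons a v)
 then have "a \<in> V" "v \<in> lists V" by auto
 then show ?case using Cons.IH[of "\<lambda>t. \<phi> (u a # t)"] assms[of a] by (simp add: dsw_simps)
qed (simp add: dsw_simps)

locale htpy_rel =
 fixes V :: "(int \<times> 'a) set" and Z :: "((int \<times> 'a) \<Rightarrow>\<^sub>0 int) set" and d u h :: "int \<times> 'a \<Rightarrow> int \<times> 'a"
 assumes deg: "l \<in> V \<Longrightarrow> fst (d l) = fst l - 1" "l \<in> V \<Longrightarrow> fst (u l) = fst l" "l \<in> V \<Longrightarrow> fst (h l) = fst l + 1"
  and V: "l \<in> V \<Longrightarrow> d l \<in> V" "l \<in> V \<Longrightarrow> u l \<in> V" "l \<in> V \<Longrightarrow> h l \<in> V"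
  and ud: "l \<in> V \<Longrightarrow> u (d l) = d (u l)"
  and hd: "l \<in> V \<Longrightarrow> frag_of (d (h l)) + frag_of (h (d l)) - frag_of (u l) + frag_of l \<in> Z"
begin

lemma Hs_mem:
 assumes "subgrp S" "w \<in> lists V" "\<And>t. t \<in> lists V \<Longrightarrow> length t = length w \<Longrightarrow> wd t = wd w + 1 \<Longrightarrow> \<phi> t \<in> S"
 shows "Hs h u w \<phi> \<in> S"
 unfolding Hs_def
proof (rule lsum_mem[OF assms(1)], rule subgrp.sgx[OF assms(1)])
 fix x l z assume w: "x @ l # z = w"
 then have v: "x \<in> lists V" "l \<in> V" "z \<in> lists V" using assms(2) by auto
 have "wd (map u z) = wd z" using v(3) by (induction z) (auto simp: deg)
 moreover have "map u z \<in> lists V" using v(3) V by (induction z) auto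
 ultimately show "\<phi> (x @ h l # map u z) \<in> S"
  using v w V deg by (intro assms(3)) auto
qed

text \<open>Both \<open>d\<close> and \<open>h\<close> are odd, so the terms where they act on
  different letters cancel, for letters behind \<open>h\<close> because \<open>d\<close> commutes
  with \<open>u\<close>. What remains is u - 1 on one letter, and these differences
  telescope.\<close>

lemma Hs_homotopy:
 assumes S: "subgrp S"
 shows "mult_mod V Z S \<phi> \<Longrightarrow> w \<in> lists V \<Longrightarrow>
  dsw d w (\<lambda>t. Hs h u t \<phi>) + Hs h u w (\<lambda>t. dsw d t \<phi>) - (\<phi> (map u w) - \<phi> w) \<in> S"
proof (induction w arbitrary: \<phi>)
 case Nil
 then show ?case by (simp add: dsw_simps Hs_simps subgrp.zero[OF S])
next
 case (Cons a v)
 have a: "a \<in> V" "v \<in> lists V" using Cons.prems by auto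
 have uv: "map u v \<in> lists V" using a(2) V by (induction v) auto
 let ?s = "sgx (fst a + 1)" and ?H = "Hs h u" and ?\<phi>a = "\<lambda>t. \<phi> (a # t)" and ?t = "map u v"
 have s2: "?s (?s x) = x" for x :: "'b \<Rightarrow>\<^sub>0 int" by (simp add: sgx_def)
 have s1: "sgx (fst (d a) + 1) x = - ?s x" "sgx (fst (h a) + 1) x = - ?s x" for x :: "'b \<Rightarrow>\<^sub>0 int"
  using deg[OF a(1)] by (auto simp: sgx_def)
 have 1: "dsw d (a # v) (\<lambda>t. ?H t \<phi>) = \<phi> (h (d a) # ?t) - ?s (?H v (\<lambda>t. \<phi> (d a # t)))
   + ?s (dsw d v (\<lambda>t. \<phi> (h a # map u t))) + dsw d v (\<lambda>t. ?H t ?\<phi>a)"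
  unfolding dsw_simps Hs_simps dsw_add sgx_add s1 dsw_hom[OF additive_sgx', symmetric] s2 by (simp add: add.assoc)
 have 2: "?H (a # v) (\<lambda>t. dsw d t \<phi>) = \<phi> (d (h a) # ?t) - ?s (dsw d ?t (\<lambda>t. \<phi> (h a # t)))
   + ?s (?H v (\<lambda>t. \<phi> (d a # t))) + ?H v (\<lambda>t. dsw d t ?\<phi>a)"
  unfolding dsw_simps Hs_simps Hs_add sgx_add s1 Hs_hom[OF additive_sgx', symmetric] s2 by (simp add: add.assoc)
 have 3: "dsw d ?t (\<lambda>t. \<phi> (h a # t)) = dsw d v (\<lambda>t. \<phi> (h a # map u t))"
  by (rule dsw_map[where V = V and u = u and d = d, OF deg(2) ud a(2)])
 have IH: "dsw d v (\<lambda>t. ?H t ?\<phi>a) + ?H v (\<lambda>t. dsw d t ?\<phi>a) - (\<phi> (a # ?t) - \<phi> (a # v)) \<in> S"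
  using Cons.IH[OF mult_mod_Cons[OF Cons.prems(1) a(1)] a(2)] .
 have "frag_extend (\<lambda>l. \<phi> ([] @ l # ?t)) (frag_of (d (h a)) + frag_of (h (d a)) - frag_of (u a) + frag_of a) \<in> S"
  by (rule mult_modD[OF Cons.prems(1) _ uv hd[OF a(1)]]) simp
 then have "\<phi> (d (h a) # ?t) + \<phi> (h (d a) # ?t) - \<phi> (u a # ?t) + \<phi> (a # ?t) \<in> S"
  by (simp add: frag_extend_add frag_extend_diff)
 from subgrp.add[OF S this IH] show ?case
  unfolding 1 2 3 by (simp add: algebra_simps)
qed

end

text \<open>Blocks of one letter give the internal differential; every longer block shortens the
  word.\<close>

lemma (in m_degree) Bs_low:
 assumes S: "subgrp S" and mV: "\<And>y. y \<in> lists V \<Longrightarrow> y \<noteq> [] \<Longrightarrow> m y \<in> V"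
 shows "w \<in> lists V \<Longrightarrow> (\<And>t. t \<in> lists V \<Longrightarrow> length t < length w \<Longrightarrow> wd t = wd w - 1 \<Longrightarrow> \<phi> t \<in> S) \<Longrightarrow>
  Bs m w \<phi> - dsw (\<lambda>l. m [l]) w \<phi> \<in> S"
proof (induction w arbitrary: \<phi>)
 case Nil
 then show ?case by (simp add: dsw_simps subgrp.zero[OF S])
next
 case (Cons a v)
 have a: "a \<in> V" "v \<in> lists V" using Cons.prems by auto
 have "ssum (\<lambda>x z. \<phi> (m (a # x) # z)) v - \<phi> (m [a] # v) \<in> S"
 proof (rule ssum_first[OF S])
  fix x y assume xy: "x @ y = v" "x \<noteq> []"
  then have "x \<in> lists V" "y \<in> lists V" "Suc 0 \<le> length x" using a by (auto simp: Suc_le_eq)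
  then show "\<phi> (m (a # x) # y) \<in> S"
   using xy a mV[of "a # x"] by (intro Cons.prems(2)) (auto simp: m_deg)
 qed
 moreover have "sgx (fst a + 1) (Bs m v (\<lambda>t. \<phi> (a # t)) - dsw (\<lambda>l. m [l]) v (\<lambda>t. \<phi> (a # t))) \<in> S"
  using a by (intro subgrp.sgx[OF S] Cons.IH Cons.prems(2)) auto
 ultimately have "(ssum (\<lambda>x z. \<phi> (m (a # x) # z)) v - \<phi> (m [a] # v)) + sgx (fst a + 1) (Bs m v (\<lambda>t. \<phi> (a # t)) - dsw (\<lambda>l. m [l]) v (\<lambda>t. \<phi> (a # t))) \<in> S"
  by (rule subgrp.add[OF S])
 then show ?case by (simp add: dsw_simps sgx_diff algebra_simps)
qed

lemma (in m_degree) bs_low: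
 assumes S: "subgrp S" and mV: "\<And>y. y \<in> lists V \<Longrightarrow> y \<noteq> [] \<Longrightarrow> m y \<in> V"
  and w: "w \<in> lists V" and \<phi>: "\<And>t. t \<in> lists V \<Longrightarrow> length t < length w \<Longrightarrow> wd t = wd w - 1 \<Longrightarrow> \<phi> t \<in> S"
 shows "bs m w \<phi> - dsw (\<lambda>l. m [l]) w \<phi> \<in> S"
proof (cases w)
 case Nil
 then show ?thesis by (simp add: dsw_simps subgrp.zero[OF S])
next
 case (Cons a v)
 have a: "a \<in> V" "v \<in> lists V" using w Cons by auto
 define \<tau> where "\<tau> x y z = sgx (wd z * (fst a + 1 + wd x + wd y)) (\<phi> (m (z @ a # x) # y))" for x y z
 have t: "\<tau> x y z \<in> S" if xyz: "x @ y @ z = v" "x \<noteq> [] \<or> z \<noteq> []" for x y z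
 proof -
  have l: "x \<in> lists V" "y \<in> lists V" "z \<in> lists V" using xyz a by auto
  have "Suc 0 \<le> length x + length z" using xyz(2) by (cases x; cases z) auto
  then show ?thesis
   unfolding \<tau>_def using l a xyz Cons mV[of "z @ a # x"] by (intro subgrp.sgx[OF S] \<phi>) (auto simp: m_deg)
 qed
 have "ssum3 \<tau> v - ssum (\<lambda>y z. \<tau> [] y z) v \<in> S"
  unfolding ssum3_def by (rule ssum_first[OF S, where \<phi> = "\<lambda>x u. ssum (\<tau> x) u"]) (auto intro!: subgrp.ssum[OF S] t)
 moreover have "ssum (\<lambda>y z. \<tau> [] y z) v - \<tau> [] v [] \<in> S"
  by (rule ssum_last[OF S]) (auto intro!: t)
 ultimately have 1: "ssum3 \<tau> v - \<tau> [] v [] \<in> S"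
  using subgrp.add[OF S] by fastforce
 have 2: "sgx (fst a + 1) (Bs m v (\<lambda>t. \<phi> (a # t)) - dsw (\<lambda>l. m [l]) v (\<lambda>t. \<phi> (a # t))) \<in> S"
  using a Cons by (intro subgrp.sgx[OF S] Bs_low[OF S mV] \<phi>) auto
 have "bs m w \<phi> - dsw (\<lambda>l. m [l]) w \<phi> = (ssum3 \<tau> v - \<tau> [] v []) + sgx (fst a + 1) (Bs m v (\<lambda>t. \<phi> (a # t)) - dsw (\<lambda>l. m [l]) v (\<lambda>t. \<phi> (a # t)))"
  unfolding Cons bs_Cons dsw_simps by (simp add: \<tau>_def[abs_def] sgx_diff)
 then show ?thesis using subgrp.add[OF S 1 2] by simp
qed

text \<open>For the filtration by \<open>m + length w\<close> the leading part of the differential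
  is the tensor differential. The sign (-1)^m comes from the -b' in odd columns, and the horizontal
  maps lower the column.\<close>

lemma Dk_low:
 assumes K: "cring K" and A: "is_ainf K A" and S: "subgrp S" and w: "w \<in> lists (Vl (amod A))"
  and low: "\<And>m' t. t \<in> lists (Vl (amod A)) \<Longrightarrow> int m' + wd t = int m + wd w - 1 \<Longrightarrow> m' + length t < m + length w \<Longrightarrow> frag_of (m', t) \<in> S"
 shows "Dk K A (m, w) - sgx (int m) (dsw (\<lambda>l. mlet K A [l]) w (\<lambda>t. frag_of (m, t))) \<in> S"
proof -
 interpret m_degree "mlet K A" by (rule slet_m_degree)
 note V = mlet_V[OF K A]
 have l1: "frag_of (m, t) \<in> S" if "t \<in> lists (Vl (amod A))" "length t < length w" "wd t = wd w - 1" for t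
  using that by (intro low) auto
 have l2: "frag_of (m - 1, t) \<in> S" if "t \<in> lists (Vl (amod A))" "length t = length w" "wdeg t = wdeg w" "m \<noteq> 0" for t
  using that by (intro low) (auto simp: wd_def of_nat_diff)
 show ?thesis
 proof (cases "even m")
  case True
  have "(if m = 0 then 0 else Ns w (\<lambda>u. frag_of (m - 1, u))) \<in> S"
   using l2 subgrp.zero[OF S] by (auto intro!: Ns_mem[OF S w] simp del: One_nat_def)
  from subgrp.add[OF S bs_low[OF S V w l1] this] show ?thesis
   unfolding Dk_even[OF K A True] using True by (simp add: sgx_def algebra_simps)
 next
  case False
  then have m: "m \<noteq> 0" by (cases m) auto
  have "frag_of (m - 1, w) - Ts w (\<lambda>u. frag_of (m - 1, u)) \<in> S"
   using w by (intro subgrp.diff[OF S] Ts_mem[OF S w] l2 m refl)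
  from subgrp.diff[OF S this Bs_low[OF S V w l1]] show ?thesis
   unfolding Dk_odd[OF K A False] using False by (simp add: sgx_def algebra_simps)
 qed
qed

text \<open>Makes the composite of the chain maps of f and g a chain map; \<open>Ph\<close> of the
  composed morphism agrees with it modulo \<open>Ker\<close>.\<close>

lemma hcx_map_comp:
 assumes "hcx_map K FA KA DA sA cA MA FB KB DB sB cB MB f" "hcx_map K FB KB DB sB cB MB FC KC DC sC cC MC g"
 shows "hcx_map K FA KA DA sA cA MA FC KC DC sC cC MC (\<lambda>x. g (f x))"
proof -
 interpret f: hcx_map K FA KA DA sA cA MA FB KB DB sB cB MB f by fact
 interpret g: hcx_map K FB KB DB sB cB MB FC KC DC sC cC MC g by fact
 show ?thesis
 proof (intro hcx_map.intro f.A.hcx_axioms g.B.hcx_axioms hcx_map_axioms.intro)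
  show "additive_fun (\<lambda>x. g (f x))" using f.op g.op by (simp add: additive_fun_def)
  fix x N assume x: "x \<in> FA N"
  show "g (f x) \<in> FC N" by (intro g.op_F f.op_F x)
  show "g (f x) \<in> KC" if "x \<in> KA" by (rule g.op_K[OF f.op_F[OF x] f.op_K[OF x that]])
  have "g (f (DA x) - DB (f x)) \<in> KC"
   using f.op_F[OF f.A.D_F[OF x]] f.B.D_F[OF f.op_F[OF x]] by (intro g.op_K[OF _ f.op_D[OF x]] subgrp.diff[OF f.B.F])
  from subgrp.add[OF g.B.Kr this g.op_D[OF f.op_F[OF x]]]
  show "g (f (DA x)) - DC (g (f x)) \<in> KC" by (simp add: g.op_diff)
  fix e assume e: "e \<in> carrier K"
  have "g (f (sA e x) - sB e (f x)) \<in> KC"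
   using f.op_F[OF f.A.sc_F[OF e x]] f.B.sc_F[OF e f.op_F[OF x]] by (intro g.op_K[OF _ f.op_s[OF e x]] subgrp.diff[OF f.B.F])
  from subgrp.add[OF g.B.Kr this g.op_s[OF e f.op_F[OF x]]]
  show "g (f (sA e x)) - sC e (g (f x)) \<in> KC" by (simp add: g.op_diff)
 qed
qed

section \<open>The endomorphism of the complex given by gf\<close>

lemma htpyD:
 assumes "is_ainf_htpy K A B f g h" and B: "module K (amod B p)"
 shows "lin_on K (tpow K (amod A) (n + 1) p) (amod B (p + int n + 1)) (h n p)"
  and "X \<in> carrier (tpow K (amod A) 1 p) \<Longrightarrow> adiff B (p + 1) (h 0 p X) \<oplus>\<^bsub>amod B p\<^esub> h 0 (p - 1) (tdiff K A 1 p X)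
   = (f 0 p X \<ominus>\<^bsub>amod B p\<^esub> g 0 p X) \<oplus>\<^bsub>amod B p\<^esub> \<zero>\<^bsub>amod B p\<^esub> \<oplus>\<^bsub>amod B p\<^esub> \<zero>\<^bsub>amod B p\<^esub>"
proof -
 let ?B = "amod B"
 show "lin_on K (tpow K (amod A) (n + 1) p) (?B (p + int n + 1)) (h n p)"
  using assms unfolding is_ainf_htpy_def by (blast intro: lin_maps_lin_on)
 have "\<forall>N p. \<forall>X\<in>carrier (tpow K (amod A) (N + 1) p).
    let M = ?B (p + int N) in
    adiff B (p + int N + 1) (h N p X)
     \<oplus>\<^bsub>M\<^esub> sgn_mult M (int N) (h N (p - 1) (tdiff K A (N + 1) p X))
    = (f N p X \<ominus>\<^bsub>M\<^esub> g N p X)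
     \<oplus>\<^bsub>M\<^esub> finsum M (\<lambda>m. finsum M (\<lambda>t.
      sgn_mult M (int (t * (N - m)) + int N - 1)
       (h m (p + int (N - 1 - m))
        (insert_map K A (t - 1) (op_gmap A (N - 1 - m)) (m + 1 - t) p X)))
      {1..m + 1}) {..<N}
     \<oplus>\<^bsub>M\<^esub> finsum M (\<lambda>m. finsum M (\<lambda>ns. finsum M (\<lambda>i.
      sgn_mult M (int (m + eps ns + sum_list (take (i - 1) ns)))
       (aop B m (p + int (N - 1 - m) + 1)
        (tmap K (amod A) ?B
         (map (mor_gmap g) (take (i - 1) ns) @ [htpy_gmap h (ns ! (i - 1))]
          @ map (mor_gmap f) (drop i ns)) p X)))
      {1..m + 2}) (J_tuples (m + 2) (N - 1 - m))) {..<N}"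
  using assms unfolding is_ainf_htpy_def by blast
 \<comment> \<open>For N = 0 the sums over m < N are empty and leave two zero summands, so d h_0 +
   h_0 d is the difference of the components with index 0.\<close>
 from this[rule_format, of X 0 p]
 show "X \<in> carrier (tpow K (amod A) 1 p) \<Longrightarrow> adiff B (p + 1) (h 0 p X) \<oplus>\<^bsub>?B p\<^esub> h 0 (p - 1) (tdiff K A 1 p X)
   = (f 0 p X \<ominus>\<^bsub>?B p\<^esub> g 0 p X) \<oplus>\<^bsub>?B p\<^esub> \<zero>\<^bsub>?B p\<^esub> \<oplus>\<^bsub>?B p\<^esub> \<zero>\<^bsub>?B p\<^esub>"
  by (simp add: Let_def abelian_monoid.finsum_empty[OF abelian_group.axioms(1)[OF module.axioms(2)[OF B]]])
qed

context
 fixes K :: "('k, 'r) ring_scheme" and A :: "('k, 'a) ainf" and B :: "('k, 'b) ainf"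
  and f :: "('k, 'a, 'b) ainf_maps" and g :: "('k, 'b, 'a) ainf_maps" and h :: "('k, 'a, 'a) ainf_maps"
 assumes K: "cring K" and A: "is_ainf K A" and B: "is_ainf K B"
  and f: "is_ainf_mor K A B f" and g: "is_ainf_mor K B A g"
  and h: "is_ainf_htpy K A A (ainf_comp K A B A g f) (ainf_id K A) h"
begin

lemmas mA' = is_ainfD(1)[OF A]

text \<open>On a single letter the suspension sign is trivial, so \<open>dl\<close>,
  \<open>ul\<close> and \<open>hl\<close> are given by d, (gf)_0 and h_0 themselves.\<close>

definition dl where "dl l = mlet K A [l]"
definition ul where "ul l = flet K A A (ainf_comp K A B A g f) [l]"
definition hl where "hl l = (fst l + 1, h 0 (fst l) (pure K (amod A) [l]))"

lemma pure1: "a \<in> carrier (amod A q) \<Longrightarrow> pure K (amod A) [(q, a)] \<in> carrier (tpow K (amod A) 1 q)"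
 by (rule pure_closed[where A = "amod A", OF K mA']) (simp add: words_iff)

lemma dl_eq: "a \<in> carrier (amod A q) \<Longrightarrow> dl (q, a) = (q - 1, adiff A q a)"
 by (simp add: dl_def slet_def Let_def mO_def diff_pure[OF K A])

lemma hl_lin: "lin_on K (amod A q) (amod A (q + 1)) (\<lambda>a. h 0 q (pure K (amod A) [(q, a)]))"
proof -
 have "lin_on K (amod A q) (tpow K (amod A) 1 q) (\<lambda>a. pure K (amod A) ([] @ (q, a) # []))"
  by (intro mlinD[OF pure_mlin[OF K mA']]) auto
 from lin_on_comp[OF this, of "amod A (q + 1)" "h 0 q"] htpyD(1)[OF h mA', of 0 q] show ?thesis by simp
qed

lemma tdiff1:
 assumes a: "a \<in> carrier (amod A q)"
 shows "tdiff K A 1 q (pure K (amod A) [(q, a)]) = pure K (amod A) [(q - 1, adiff A q a)]"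
proof -
 let ?A = "amod A"
 let ?T = "tpow K ?A (Suc 0) (q - 1)"
 interpret T: module K ?T by (rule tpow_module[OF K mA'])
 have "insert_map K A 0 (Suc 0, - 1, mO K A 0) 0 q (pure K ?A ([] @ [(q, a)] @ [])) =
   sgn_mult (tpow K ?A (Suc (0 + 0)) (q + - 1)) (- 1 * wdeg []) (pure K ?A ([] @ (q + - 1, mO K A 0 q (pure K ?A [(q, a)])) # []))"
  using insert_map_pure[where A = "?A" and AA = A and x = "[]" and y = "[(q, a)]" and z = "[]" and i = 0 and j = 0 and p = q, OF K mA' gm_mO_lin[OF K A, of 0] refl]
  using a by simp
 then have 1: "insert_map K A 0 (Suc 0, - 1, mO K A 0) 0 q (pure K ?A [(q, a)]) = pure K ?A [(q - 1, adiff A q a)]"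
  using a by (simp add: mO_def diff_pure[OF K A])
 have "pure K ?A [(q - 1, adiff A q a)] \<in> carrier ?T"
  using pure1[OF lin_onD(1)[OF is_ainfD(3)[OF A] a]] by simp
 moreover have "tdiff K A (Suc 0) q (pure K ?A [(q, a)]) = finsum (tpow K ?A (Suc 0) (q - 1)) (\<lambda>i. insert_map K A i (Suc 0, - 1, mO K A 0) (0 - i) q (pure K ?A [(q, a)])) {..0}"
  using pure1[OF a] by (intro tdiff_eq[OF K A]) simp
 ultimately show ?thesis
  by (simp add: 1)
qed

text \<open>The homotopy relation with index 0 solved for (gf)_0 = 1 + d h_0 + h_0 d; from this form
  linearity and commutation with d are read off.\<close>

lemma u0:
 assumes a: "a \<in> carrier (amod A q)"
 shows "ainf_comp K A B A g f 0 q (pure K (amod A) [(q, a)]) \<in> carrier (amod A q)"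
  "ainf_comp K A B A g f 0 q (pure K (amod A) [(q, a)]) = a \<oplus>\<^bsub>amod A q\<^esub>
   (adiff A (q + 1) (h 0 q (pure K (amod A) [(q, a)])) \<oplus>\<^bsub>amod A q\<^esub> h 0 (q - 1) (pure K (amod A) [(q - 1, adiff A q a)]))"
proof -
 let ?X = "pure K (amod A) [(q, a)]"
 interpret M: module K "amod A q" by (rule mA')
 show c: "ainf_comp K A B A g f 0 q ?X \<in> carrier (amod A q)"
  using ainf_comp_closed[where A = A and B = B and C = A and N = 0 and p = q and X = ?X, OF K mA' is_ainfD(1)[OF B] mA' mor_ops_lin[OF f] mor_ops_lin[OF g]] pure1[OF a]
  by simp
 have i: "ainf_id K A 0 q ?X = a" using id_gmap_pure[where A = "amod A", OF K mA' a] by (simp add: ainf_id_def)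
 from htpyD(2)[OF h mA' pure1[OF a]] show "ainf_comp K A B A g f 0 q ?X = a \<oplus>\<^bsub>amod A q\<^esub>
   (adiff A (q + 1) (h 0 q ?X) \<oplus>\<^bsub>amod A q\<^esub> h 0 (q - 1) (pure K (amod A) [(q - 1, adiff A q a)]))"
  using a c by (simp add: tdiff1[OF a, simplified] i M.minus_eq M.a_ac M.r_neg1 M.r_neg2)
qed

lemma ul_eq: "ul (q, a) = (q, ainf_comp K A B A g f 0 q (pure K (amod A) [(q, a)]))"
 by (simp add: ul_def flet_single)

lemma ul_lin: "lin_on K (amod A q) (amod A q) (\<lambda>a. ainf_comp K A B A g f 0 q (pure K (amod A) [(q, a)]))"
proof (rule lin_on_congI[OF mA'])
 let ?A = "amod A"
 have i: "lin_on K (?A q) (?A q) (\<lambda>a. a)" by (auto simp: lin_on_def)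
 have d: "lin_on K (?A (q + 1)) (?A q) (adiff A (q + 1))" using is_ainfD(3)[OF A, of "q + 1"] by simp
 have h': "lin_on K (?A (q - 1)) (?A q) (\<lambda>a. h 0 (q - 1) (pure K ?A [(q - 1, a)]))" using hl_lin[of "q - 1"] by simp
 show "lin_on K (?A q) (?A q) (\<lambda>a. a \<oplus>\<^bsub>?A q\<^esub> (adiff A (q + 1) (h 0 q (pure K ?A [(q, a)])) \<oplus>\<^bsub>?A q\<^esub> h 0 (q - 1) (pure K ?A [(q - 1, adiff A q a)])))"
  by (intro lin_on_add_fun[OF mA' mA'] i lin_on_comp[OF hl_lin d] lin_on_comp[OF is_ainfD(3)[OF A] h'])
qed (rule u0(2))

lemma htpy_rel: "htpy_rel (Vl (amod A)) (Zl (amod A)) dl ul hl"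
proof
 let ?A = "amod A"
 note LEh = LE_fhom[where A = "?A", OF K mA'] and LEo = LE_of[where A = "?A", OF K mA']
 note dc = lin_onD(1)[OF is_ainfD(3)[OF A]] and hc = lin_onD(1)[OF hl_lin]
 fix l assume "l \<in> Vl ?A"
 then obtain q a where l: "l = (q, a)" and a: "a \<in> carrier (?A q)" by (cases l) auto
 let ?d = "adiff A" and ?h = "\<lambda>q a. h 0 q (pure K ?A [(q, a)])" and ?u = "\<lambda>q a. ainf_comp K A B A g f 0 q (pure K ?A [(q, a)])"
 interpret M: module K "?A q" by (rule mA')
 interpret M1: module K "?A (q - 1)" by (rule mA')
 have hl: "hl (q, a) = (q + 1, ?h q a)" for q a by (simp add: hl_def)
 show "fst (dl l) = fst l - 1" "fst (ul l) = fst l" "fst (hl l) = fst l + 1" "dl l \<in> Vl ?A" "ul l \<in> Vl ?A" "hl l \<in> Vl ?A"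
  using a dc[OF a] hc[OF a] u0(1)[OF a] by (simp_all add: l dl_eq ul_eq hl)
 have dh: "?d (q + 1) (?h q a) \<in> carrier (?A q)" using dc[OF hc[OF a]] by simp
 have hd: "?h (q - 1) (?d q a) \<in> carrier (?A q)" using hc[OF dc[OF a]] by simp
 \<comment> \<open>With u = 1 + dh + hd both sides are d + dhd, because dd = 0.\<close>
 show "ul (dl l) = dl (ul l)"
 proof -
  have dd: "?d q (?d (q + 1) (?h q a)) = \<zero>\<^bsub>?A (q - 1)\<^esub>" using is_ainfD(5)[OF A hc[OF a]] by simp
  have dda: "?d (q - 1) (?d q a) = \<zero>\<^bsub>?A (q - 2)\<^esub>" by (rule is_ainfD(5)[OF A a])
  have h0: "h 0 (q - 2) (pure K ?A [(q - 2, \<zero>\<^bsub>?A (q - 2)\<^esub>)]) = \<zero>\<^bsub>?A (q - 1)\<^esub>"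
   using lin_on_zero[OF mA' mA' hl_lin[of "q - 2"]] by simp
  have dhd: "?d q (?h (q - 1) (?d q a)) \<in> carrier (?A (q - 1))" by (rule dc[OF hd])
  have q2: "q - 1 - 1 = q - 2" "q - 1 + 1 = q" by simp_all
  have "?u (q - 1) (?d q a) = ?d q a \<oplus>\<^bsub>?A (q - 1)\<^esub> ?d q (?h (q - 1) (?d q a))"
   unfolding u0(2)[OF dc[OF a]] q2 dda h0 using dhd by simp
  moreover have "?d q (?u q a) = ?d q a \<oplus>\<^bsub>?A (q - 1)\<^esub> ?d q (?h (q - 1) (?d q a))"
   unfolding u0(2)[OF a] using a dh hd dhd dc[OF a] by (simp add: lin_onD(2)[OF is_ainfD(3)[OF A]] dd)
  ultimately show ?thesis
   using a dc[OF a] u0(1)[OF a] by (simp add: l dl_eq ul_eq)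
 qed
 have "LE ?A q' (frag_of (dl (hl l)) + frag_of (hl (dl l)) - frag_of (ul l) + frag_of l) = \<zero>\<^bsub>?A q'\<^esub>" for q'
 proof -
  interpret M': module K "?A q'" by (rule mA')
  have e: "dl (hl l) = (q, ?d (q + 1) (?h q a))" "hl (dl l) = (q, ?h (q - 1) (?d q a))" "ul l = (q, ?u q a)"
   using a hc[OF a] by (simp_all add: l hl dl_eq ul_eq)
  show ?thesis
  proof (cases "q' = q")
   case True
   have "LE ?A q (frag_of (dl (hl l)) + frag_of (hl (dl l)) - frag_of (ul l) + frag_of l)
    = (?d (q + 1) (?h q a) \<oplus>\<^bsub>?A q\<^esub> ?h (q - 1) (?d q a)) \<ominus>\<^bsub>?A q\<^esub> ?u q a \<oplus>\<^bsub>?A q\<^esub> a"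
    unfolding e using a dh hd u0(1)[OF a] by (simp add: fhomD(2)[OF LEh] fhom_diff[OF mA' LEh] LEo l)
   also have "\<dots> = \<zero>\<^bsub>?A q\<^esub>"
   proof -
    define s where "s = ?d (q + 1) (?h q a) \<oplus>\<^bsub>?A q\<^esub> ?h (q - 1) (?d q a)"
    have s: "s \<in> carrier (?A q)" using dh hd by (simp add: s_def)
    have "s \<ominus>\<^bsub>?A q\<^esub> (a \<oplus>\<^bsub>?A q\<^esub> s) \<oplus>\<^bsub>?A q\<^esub> a = (s \<oplus>\<^bsub>?A q\<^esub> \<ominus>\<^bsub>?A q\<^esub> s) \<oplus>\<^bsub>?A q\<^esub> (\<ominus>\<^bsub>?A q\<^esub> a \<oplus>\<^bsub>?A q\<^esub> a)"
     using a s by (simp only: M.minus_eq M.minus_add M.a_ac M.a_closed M.a_inv_closed)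
    then show ?thesis
     unfolding u0(2)[OF a] s_def[symmetric] using a s by (simp add: M.r_neg M.l_neg)
   qed
   finally show ?thesis unfolding True .
  next
   case False
   then show ?thesis
    unfolding e by (simp add: fhomD(2)[OF LEh] fhom_diff[OF mA' LEh] LEo l M'.minus_eq)
  qed
 qed
 then show "frag_of (dl (hl l)) + frag_of (hl (dl l)) - frag_of (ul l) + frag_of l \<in> Zl ?A"
  by (simp add: Zl_def)
qed

text \<open>The factor (-1)^m compensates the sign of the tensor differential in column
  \<open>m\<close>, so that in every column the leading part of DH + HD is the tensor power of u
  minus the identity.\<close>

definition Hk :: "nat \<times> 'a word \<Rightarrow> (nat \<times> 'a word) \<Rightarrow>\<^sub>0 int" where
 "Hk = (\<lambda>(m, w). sgx (int m) (Hs hl ul w (\<lambda>t. frag_of (m, t))))"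

lemma Hk_FN: "x \<in> FN (amod A) N \<Longrightarrow> frag_extend Hk x \<in> FN (amod A) (N + 1)"
proof (rule FN_extend_mem[OF FN_subgrp])
 interpret htpy_rel "Vl (amod A)" "Zl (amod A)" dl ul hl by (rule htpy_rel)
 fix m w assume w: "w \<in> lists (Vl (amod A))" "int m + wd w - 1 = N"
 then show "Hk (m, w) \<in> FN (amod A) (N + 1)"
  by (auto simp: Hk_def FN_of intro!: subgrp.sgx[OF FN_subgrp] Hs_mem[OF FN_subgrp w(1)])
qed

text \<open>The three terms in \<open>eq\<close> distinguish whether h acts before the varying
  letter, on it or behind it; accordingly the letter undergoes u, undergoes h or is kept.\<close>

lemma Hk_lwl: "lwl K (amod A) (tpow K (amod A) n p) (EV K (amod A) m n p) (\<lambda>w. Hk (m', w))"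
 unfolding lwl_def
proof (intro ballI allI)
 let ?WA = "lists (Vl (amod A))" and ?TA = "tpow K (amod A)" and ?A = "amod A"
 interpret htpy_rel "Vl ?A" "Zl ?A" dl ul hl by (rule htpy_rel)
 fix Z X q assume ZX: "Z \<in> ?WA" "X \<in> ?WA"
 note T = tpow_module[OF K mA', where n = n and p = p] and Eh = EV_fhom[where A = "?A" and n = n and p = p and m = m, OF K mA']
 note EL = EV_letter_lin[where A = "?A", OF K mA']
 have uX: "map ul w \<in> ?WA" if "w \<in> ?WA" for w
  using that V(2) by (induction w) auto
 have eq: "Hk (m', Z @ (q, a) # X) = sgx (int m')
   (lsum (\<lambda>x l z. sgx (wd x) (frag_of (m', (x @ hl l # map ul z) @ (q, ainf_comp K A B A g f 0 q (pure K ?A [(q, a)])) # map ul X))) Z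
    + (sgx (wd Z) (frag_of (m', Z @ (q + 1, h 0 q (pure K ?A [(q, a)])) # map ul X))
    + lsum (\<lambda>x l z. sgx (wd (Z @ (q, undefined) # x)) (frag_of (m', Z @ (q, a) # (x @ hl l # map ul z)))) X))" for a
  by (simp add: Hk_def Hs_def lsum_append ul_eq hl_def)
 show "lin_on K (?A q) (?TA n p) (\<lambda>a. EV K ?A m n p (Hk (m', Z @ (q, a) # X)))"
  unfolding eq
 proof (intro lf_sgx[OF mA' T Eh] lf_add[OF mA' T Eh] lf_lsum[OF mA' T Eh])
  fix x l z assume "x @ l # z = Z"
  then have v: "x \<in> ?WA" "l \<in> Vl ?A" "z \<in> ?WA" using ZX by auto
  show "lin_on K (?A q) (?TA n p) (\<lambda>a. EV K ?A m n p (frag_of (m', (x @ hl l # map ul z) @ (q, ainf_comp K A B A g f 0 q (pure K ?A [(q, a)])) # map ul X)))"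
   using v V(3) uX ZX by (intro lin_on_comp[OF ul_lin EL]) auto
 next
  show "lin_on K (?A q) (?TA n p) (\<lambda>a. EV K ?A m n p (frag_of (m', Z @ (q + 1, h 0 q (pure K ?A [(q, a)])) # map ul X)))"
   using uX ZX by (intro lin_on_comp[OF hl_lin EL]) auto
 next
  fix x l z assume "x @ l # z = X"
  then have v: "x \<in> ?WA" "l \<in> Vl ?A" "z \<in> ?WA" using ZX by auto
  show "lin_on K (?A q) (?TA n p) (\<lambda>a. EV K ?A m n p (frag_of (m', Z @ (q, a) # (x @ hl l # map ul z))))"
   using v V(3) uX ZX by (intro EL) auto
 qed
qed

lemma Hk_Ker:
 assumes x: "x \<in> FN (amod A) N" "x \<in> Ker K (amod A)"
 shows "frag_extend Hk x \<in> Ker K (amod A)"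
proof -
 have "EV K (amod A) m n p (Hk (m', [])) = \<zero>\<^bsub>tpow K (amod A) n p\<^esub>" for m n p m'
  by (simp add: Hk_def Hs_simps fhom_zero[OF tpow_module[OF K mA'] EVh[OF K A]])
 then show ?thesis
  unfolding Ker_def using lwl_Ker[where A = "amod A", OF K mA' tpow_module[OF K mA'] EVh[OF K A] Hk_lwl _ x] by blast
qed

text \<open>The strict inequality makes \<open>Lev 0\<close> consist of 0 alone, which starts the
  induction on the level.\<close>

definition Lev :: "nat \<Rightarrow> ((nat \<times> 'a word) \<Rightarrow>\<^sub>0 int) set" where
 "Lev s = {x. Poly_Mapping.keys x \<subseteq> {(m, w). m + length w < s}}"

abbreviation (input) "PP x \<equiv> frag_extend (Ph K B A g) (frag_extend (Ph K A B f) x)"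

text \<open>On a word, \<open>P\<close>, \<open>DH\<close> and \<open>HD\<close> replace the map of
  gf and the composites DH and HD by their leading parts, which \<open>HH\<close> relates to each
  other by the tensor homotopy.\<close>

lemma PP_low:
 assumes x: "x \<in> FN (amod A) N" "x \<in> Lev (Suc s)"
 shows "\<exists>y\<in>FN (amod A) N \<inter> Lev s. PP x - x - frag_extend (Dk K A) (frag_extend Hk x) - frag_extend Hk (frag_extend (Dk K A) x) - y \<in> Ker K (amod A)"
proof -
 let ?KA = "Ker K (amod A)" and ?A = "amod A"
 interpret htpy_rel "Vl ?A" "Zl ?A" dl ul hl by (rule htpy_rel)
 interpret f_degree "flet K A A (ainf_comp K A B A g f)" by (rule slet_f_degree)
 let ?u = "ainf_comp K A B A g f" and ?D = "frag_extend (Dk K A)" and ?H = "frag_extend Hk" and ?V = "Vl ?A"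
 note Kr = Ker_S[OF K A]
 \<comment> \<open>\<open>S\<close> absorbs both the kernel and the lower level, so the lemmas on
   leading parts, stated for arbitrary subgroups, apply to it directly.\<close>
 define S where "S = {v. \<exists>y\<in>FN ?A N \<inter> Lev s. v - y \<in> ?KA}"
 have FL: "subgrp (FN ?A N \<inter> Lev s)"
 proof -
  have "subgrp (Lev s)" unfolding Lev_def by (rule keys_subgrp)
  then show ?thesis using FN_subgrp[of "?A" N] by (auto simp: subgrp_def)
 qed
 have S: "subgrp S"
 proof
  show "0 \<in> S" using subgrp.zero[OF FL] subgrp.zero[OF Kr] by (force simp: S_def)
  fix v v' assume "v \<in> S" "v' \<in> S"
  then obtain y y' where "y \<in> FN ?A N \<inter> Lev s" "v - y \<in> ?KA" "y' \<in> FN ?A N \<inter> Lev s" "v' - y' \<in> ?KA"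
   by (auto simp: S_def)
  then have "y - y' \<in> FN ?A N \<inter> Lev s" "(v - v') - (y - y') \<in> ?KA"
   using subgrp.diff[OF FL, of y y'] subgrp.diff[OF Kr, of "v - y" "v' - y'"] by (auto simp: algebra_simps)
  then show "v - v' \<in> S" unfolding S_def by blast
 qed
 have KS: "v \<in> S" if "v \<in> ?KA" for v
  using that subgrp.zero[OF FL] unfolding S_def by force
 have low: "frag_of (m, t) \<in> S" if "t \<in> lists ?V" "int m + wd t - 1 = N" "m + length t < s" for m t
 proof -
  have "frag_of (m, t) \<in> FN ?A N \<inter> Lev s" using that by (simp add: FN_of Lev_def)
  then show ?thesis using subgrp.zero[OF Kr] unfolding S_def by force
 qed
 define \<chi> where "\<chi> k = Ph K A A ?u k - frag_of k - ?D (Hk k) - ?H (Dk K A k)" for k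
 have chi: "\<chi> (m, w) \<in> S" if w: "w \<in> lists ?V" "int m + wd w - 1 = N" "m + length w \<le> s" for m w
 proof -
  let ?\<phi> = "\<lambda>t. frag_of (m, t)" and ?s = "sgx (int m)"
  have s2: "?s (?s v) = v" for v :: "(nat \<times> 'a word) \<Rightarrow>\<^sub>0 int" by (simp add: sgx_def)
  have P: "Ph K A A ?u (m, w) - ?\<phi> (map ul w) \<in> S"
  proof -
   note V' = comp_V[OF K A B A f g]
   have l: "?\<phi> (x @ flet K A A ?u y # z) \<in> S" if "x \<in> lists ?V" "z \<in> lists ?V" "y \<in> lists ?V" "2 \<le> length y"
    "length x + length y + length z \<le> length w" "wd x + wd y + wd z = wd w" for x y z
   proof -
    have "y \<noteq> []" using that by auto
    then show ?thesis using that w V'[of y] by (intro low) (auto simp: f_deg)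
   qed
   show ?thesis
   proof (cases "even m \<and> w = []")
    case True
    then show ?thesis
     using KS subgrp.minus[OF Kr frag_Nil_Ker[OF K A A V']] by (simp add: Ph_def)
   next
    case False
    show ?thesis
    proof (cases "even m")
     case True
     then have "w \<noteq> []" using False by blast
     have "Fcs (flet K A A ?u) w ?\<phi> - ?\<phi> (map (\<lambda>l. flet K A A ?u [l]) w) \<in> S"
      by (rule Fcs_len1[where \<phi> = ?\<phi>, OF S V' w(1) \<open>w \<noteq> []\<close> l])
     then show ?thesis using True by (simp add: Ph_def ul_def[abs_def])
    next
     case False
     have "Fs (flet K A A ?u) w ?\<phi> - ?\<phi> (map (\<lambda>l. flet K A A ?u [l]) w) \<in> S"
      by (rule Fs_len1[where \<phi> = ?\<phi>, OF S V' w(1) l])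
     then show ?thesis using False by (simp add: Ph_def ul_def[abs_def])
    qed
   qed
  qed
  have DH: "?D (Hk (m, w)) - Hs hl ul w (\<lambda>t. dsw dl t ?\<phi>) \<in> S"
  proof -
   have "Hs hl ul w (\<lambda>t. Dk K A (m, t) - ?s (dsw dl t ?\<phi>)) \<in> S"
   proof (rule Hs_mem[OF S w(1)])
    fix t assume t: "t \<in> lists ?V" "length t = length w" "wd t = wd w + 1"
    show "Dk K A (m, t) - ?s (dsw dl t ?\<phi>) \<in> S"
     unfolding dl_def[abs_def] using t w by (intro Dk_low[OF K A S t(1)] low) auto
   qed
   from subgrp.sgx[OF S this, of "int m"] show ?thesis
    by (simp add: Hk_def additive_sgx[OF additive_frag_extend] Hs_hom[OF additive_frag_extend] Hs_diff sgx_diff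
      Hs_hom[OF additive_sgx', symmetric] s2 del: sgx_simps(3))
  qed
  have HD: "?H (Dk K A (m, w)) - dsw dl w (\<lambda>t. Hs hl ul t ?\<phi>) \<in> S"
  proof -
   \<comment> \<open>In HD the leading part of D is taken before H is applied, so
     \<open>Dk_low\<close> is used for the preimage of \<open>S\<close> under H.\<close>
   define S' where "S' = {v. ?H v \<in> S}"
   have S': "subgrp S'"
    by unfold_locales (auto simp: S'_def subgrp.zero[OF S] frag_extend_diff intro: subgrp.diff[OF S])
   have "Dk K A (m, w) - ?s (dsw dl w ?\<phi>) \<in> S'"
    unfolding dl_def[abs_def]
   proof (rule Dk_low[OF K A S' w(1)])
    fix m' t assume t: "t \<in> lists ?V" "int m' + wd t = int m + wd w - 1" "m' + length t < m + length w"
    have "Hs hl ul t (\<lambda>t. frag_of (m', t)) \<in> S"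
     using t w by (intro Hs_mem[OF S t(1)] low) auto
    then show "frag_of (m', t) \<in> S'" by (simp add: S'_def Hk_def subgrp.sgx[OF S])
   qed
   then have "?H (Dk K A (m, w)) - ?H (?s (dsw dl w ?\<phi>)) \<in> S" by (simp add: S'_def frag_extend_diff)
   moreover have "?H (?s (dsw dl w ?\<phi>)) = dsw dl w (\<lambda>t. Hs hl ul t ?\<phi>)"
    by (simp add: additive_sgx[OF additive_frag_extend] dsw_hom[OF additive_frag_extend] Hk_def dsw_hom[OF additive_sgx', symmetric] s2 del: sgx_simps(3))
   ultimately show ?thesis by simp
  qed
  have HH: "dsw dl w (\<lambda>t. Hs hl ul t ?\<phi>) + Hs hl ul w (\<lambda>t. dsw dl t ?\<phi>) - (?\<phi> (map ul w) - ?\<phi> w) \<in> S"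
   by (intro KS Hs_homotopy[OF Kr mult_mod_of[where A = "?A", OF K mA'] w(1)])
  from subgrp.diff[OF S subgrp.diff[OF S subgrp.diff[OF S P DH] HD] HH]
  show ?thesis by (simp add: \<chi>_def algebra_simps)
 qed
 have c1: "frag_extend \<chi> x \<in> S"
 proof (rule frag_extend_mem[OF S, where V = "vk ?A N \<inter> {(m, w). m + length w < Suc s}"])
  show "Poly_Mapping.keys x \<subseteq> vk ?A N \<inter> {(m, w). m + length w < Suc s}"
   using x by (auto simp: FN_def Lev_def)
  fix k assume "k \<in> vk ?A N \<inter> {(m, w). m + length w < Suc s}"
  then show "\<chi> k \<in> S" by (cases k) (auto simp: vk_def intro!: chi)
 qed
 have c2: "frag_extend \<chi> x = frag_extend (Ph K A A ?u) x - x - ?D (?H x) - ?H (?D x)"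
 proof -
  have "frag_extend (Ph K A A ?u) x - frag_extend frag_of x - ?D (?H x) - ?H (?D x) = frag_extend \<chi> x"
   unfolding frag_extend_comp frag_extend_diff_fun by (simp add: \<chi>_def[abs_def])
  then show ?thesis by (simp add: frag_expansion[symmetric])
 qed
 have c3: "frag_extend (Ph K A A ?u) x - PP x \<in> S"
  by (intro KS Ph_comp[OF K A B A f g x(1)])
 have "PP x - x - ?D (?H x) - ?H (?D x) = frag_extend \<chi> x - (frag_extend (Ph K A A ?u) x - PP x)"
  unfolding c2 by simp
 then have "PP x - x - ?D (?H x) - ?H (?D x) \<in> S"
  using subgrp.diff[OF S c1 c3] by (simp only:)
 then show ?thesis unfolding S_def by blast
qed

lemma HCm_bij: "bij_betw (\<lambda>X. HCm K B A g N (HCm K A B f N X)) (carrier (HC K A N)) (carrier (HC K A N))"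
proof -
 interpret hcx_endo K "FN (amod A)" "Ker K (amod A)" "frag_extend (Dk K A)" "\<lambda>c. frag_extend (sck A c)" "cl K A" "HC K A" "\<lambda>x. PP x" "frag_extend Hk" Lev
 proof (intro hcx_endo.intro hcx_endo_axioms.intro hcx_map_comp[OF Ph_hcx_map[OF K A B f] Ph_hcx_map[OF K B A g]])
  show "x = 0" if "x \<in> Lev 0" for x using that by (simp add: Lev_def)
  show "\<exists>s. x \<in> Lev s" for x
  proof -
   have "finite ((\<lambda>(m, w). m + length w) ` Poly_Mapping.keys x)" by simp
   then obtain s where "\<forall>n\<in>(\<lambda>(m, w). m + length w) ` Poly_Mapping.keys x. n < s"
    using finite_nat_set_iff_bounded by auto
   then show ?thesis by (auto simp: Lev_def)
  qed
 qed (use Hk_FN Hk_Ker PP_low in blast)+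
 have "HCm K B A g N (HCm K A B f N X) = imap N X" if X: "X \<in> carrier (HC K A N)" for X
 proof -
  obtain x where x: "x \<in> A.Z N" "X = cl K A N x" by (rule A.carrierE[OF X])
  then have xc: "x \<in> cyc K A N" by (simp add: cyc_Z[OF K A])
  show ?thesis
   unfolding x(2) imap_c[OF x(1)] HCm_cl[OF K A B f xc] HCm_cl[OF K B A g Ph_cyc[OF K A B f xc]] ..
 qed
 then show ?thesis using imap_bij[of N] by (simp cong: bij_betw_cong)
qed

end

theorem theorem3p1:
  fixes K :: "('k, 'r) ring_scheme"
  assumes "cring K"
  shows "\<exists>HC_map :: ('k, 'a) ainf \<Rightarrow> ('k, 'a) ainf \<Rightarrow> ('k, 'a, 'a) ainf_maps \<Rightarrow>
            int \<Rightarrow> ('k, 'a) hc \<Rightarrow> ('k, 'a) hc.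
          is_functor (Ainf_cat K) (GrM_cat K) (HC K) HC_map \<and>
          induced_on_strict K HC_map \<and>
          (\<forall>A\<in>Obj (Ainf_cat K). \<forall>B\<in>Obj (Ainf_cat K). \<forall>f.
             ainf_homotopy_equiv K A B f \<longrightarrow>
             is_isomorphism (GrM_cat K) (HC K A) (HC K B) (HC_map A B f))"
proof (intro exI[of _ "HCm K"] conjI ballI allI impI)
 show "is_functor (Ainf_cat K) (GrM_cat K) (HC K) (HCm K)"
  unfolding is_functor_def Ainf_cat_def GrM_cat_def cat.simps mem_Collect_eq
  by (intro conjI ballI allI ext HC_graded[OF assms] HCm_lin[OF assms] HCm_id[OF assms] HCm_comp[OF assms]) (simp_all only: mem_Collect_eq)
 show "induced_on_strict K (HCm K)"
  unfolding induced_on_strict_def using HCm_strict[OF assms] by blast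
 fix A B :: "('k, 'a) ainf" and f :: "('k, 'a, 'a) ainf_maps"
 assume "A \<in> Obj (Ainf_cat K)" "B \<in> Obj (Ainf_cat K)" "ainf_homotopy_equiv K A B f"
 then obtain g h h' where A: "is_ainf K A" and B: "is_ainf K B" and f: "is_ainf_mor K A B f" and g: "is_ainf_mor K B A g"
  and h: "is_ainf_htpy K A A (ainf_comp K A B A g f) (ainf_id K A) h" "is_ainf_htpy K B B (ainf_comp K B A B f g) (ainf_id K B) h'"
  by (auto simp: Ainf_cat_def ainf_homotopy_equiv_def ainf_homotopic_def)
 \<comment> \<open>Injectivity comes from gf, surjectivity from fg, each being bijective on
   homology.\<close>
 have bij: "bij_betw (HCm K A B f N) (carrier (HC K A N)) (carrier (HC K B N))" for N
 proof -
  note b1 = HCm_bij[OF assms A B f g h(1), of N] and b2 = HCm_bij[OF assms B A g f h(2), of N]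
  note c1 = lin_onD(1)[OF lin_maps_lin_on[OF HCm_lin[OF assms A B f]], of _ N] and c2 = lin_onD(1)[OF lin_maps_lin_on[OF HCm_lin[OF assms B A g]], of _ N]
  show ?thesis
   unfolding bij_betw_def
  proof
   show "inj_on (HCm K A B f N) (carrier (HC K A N))"
    using b1 unfolding bij_betw_def inj_on_def by metis
   show "HCm K A B f N ` carrier (HC K A N) = carrier (HC K B N)"
    using b2 c1 c2 unfolding bij_betw_def by blast
  qed
 qed
 \<comment> \<open>The restriction makes the inverse function extensional, as maps in the target
   category must be.\<close>
 define G where "G N = (\<lambda>Y\<in>carrier (HC K B N). inv_into (carrier (HC K A N)) (HCm K A B f N) Y)" for N
 have Gc: "G N Y \<in> carrier (HC K A N)" "HCm K A B f N (G N Y) = Y" if "Y \<in> carrier (HC K B N)" for N Y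
  using that bij_betw_inv_into_right[OF bij that] bij_betw_apply[OF bij_betw_inv_into[OF bij] that] by (simp_all add: G_def)
 have GX: "G N (HCm K A B f N X) = X" if "X \<in> carrier (HC K A N)" for N X
  using that bij_betw_inv_into_left[OF bij that] bij_betw_apply[OF bij that] by (simp add: G_def)
 have lin: "lin_on K (HC K A N) (HC K B N) (HCm K A B f N)" for N
  by (rule lin_maps_lin_on[OF HCm_lin[OF assms A B f]])
 have Gl: "G N \<in> lin_maps K (HC K B N) (HC K A N)" for N
 proof -
  interpret MA: module K "HC K A N" by (rule HC_module[OF assms A])
  have "lin_on K (HC K B N) (HC K A N) (G N)"
  proof (rule lin_onI)
   fix X Y c assume X: "X \<in> carrier (HC K B N)"
   show "G N X \<in> carrier (HC K A N)" by (rule Gc(1)[OF X])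
   show "G N (X \<oplus>\<^bsub>HC K B N\<^esub> Y) = G N X \<oplus>\<^bsub>HC K A N\<^esub> G N Y" if "Y \<in> carrier (HC K B N)"
    using GX[of "G N X \<oplus>\<^bsub>HC K A N\<^esub> G N Y" N] lin_onD(2)[OF lin Gc(1)[OF X] Gc(1)[OF that]] Gc[OF X] Gc[OF that] by simp
   show "G N (c \<odot>\<^bsub>HC K B N\<^esub> X) = c \<odot>\<^bsub>HC K A N\<^esub> G N X" if "c \<in> carrier K"
    using GX[of "c \<odot>\<^bsub>HC K A N\<^esub> G N X" N] lin_onD(3)[OF lin that Gc(1)[OF X]] Gc[OF X] that by simp
  qed
  then show ?thesis by (simp add: lin_maps_iff G_def)
 qed
 show "is_isomorphism (GrM_cat K) (HC K A) (HC K B) (HCm K A B f)"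
  unfolding is_isomorphism_def GrM_cat_def cat.simps mem_Collect_eq
 proof (intro conjI allI bexI[of _ G] CollectI HCm_lin[OF assms A B f] Gl ext)
  show "compose (carrier (HC K A N)) (G N) (HCm K A B f N) X = (\<lambda>x\<in>carrier (HC K A N). x) X" for N X
   using GX[of X N] by (simp add: compose_def restrict_def)
  show "compose (carrier (HC K B N)) (HCm K A B f N) (G N) Y = (\<lambda>x\<in>carrier (HC K B N). x) Y" for N Y
   using Gc(2)[of Y N] by (simp add: compose_def restrict_def)
 qed
qed

end
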